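(* Assume that the group $G$ is countable. Let $\chi\in\widehat{\mathcal{B}}^+$ and let $H=\mathrm{St}\,\chi$ be its stabilizer group. Then the map $\rho\mapsto\mathrm{Ind}_{\mathcal{A}_H\uparrow\mathcal{A}}(\rho)=\pi$ is a bijection from the set of unitary equivalence classes of inducible $*$-representations $\rho$ of $\mathcal{A}_H$ such that ( * ) $\mathrm{Res}_{\mathcal{B}}\rho$ is a multiple of the character $\chi$, onto the set of unitary equivalence classes of well-behaved $*$-representations $\pi$ of $\mathcal{A}$ associated with $\mathrm{Orb}\,\chi$. A $*$-representation $\rho$ of $\mathcal{A}_H$ satisfying ( * ) is bounded and inducible. Moreover, the von Neumann algebras $\rho(\mathcal{A}_H)'$ and $\pi(\mathcal{A})'$ are isomorphic. In particular, $\pi$ is irreducible if and only if $\rho$ is irreducible.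
   Context: A $*$-representation $\pi$ of a $*$-algebra $\mathcal{A}$ on a dense linear subspace $\mathcal{D}(\pi)$ of a Hilbert space $\mathcal{H}_\pi$ is an algebra homomorphism of $\mathcal{A}$ into the linear operators on $\mathcal{D}(\pi)$ with $\langle\pi(a)\varphi,\psi\rangle=\langle\varphi,\pi(a^* )\psi\rangle$. Unitary equivalence: an isometric linear map of $\mathcal{D}(\pi_1)$ onto $\mathcal{D}(\pi_2)$ intertwining the representations. $\pi$ is irreducible if $\pi=\pi_1\oplus\pi_2$ (with $\mathcal{D}(\pi)=\mathcal{D}(\pi_1)\oplus\mathcal{D}(\pi_2)$) is only possible with $\mathcal{D}(\pi_1)=\{0\}$ or $\mathcal{D}(\pi_2)=\{0\}$. The (strong) commutant $\pi(\mathcal{A})'$ is the set of bounded operators $T$ on $\mathcal{H}_\pi$ with $T\mathcal{D}(\pi)\subseteq\mathcal{D}(\pi)$ and $\pi(a)T\varphi=T\pi(a)\varphi$ for $a\in\mathcal{A}$, $\varphi\in\mathcal{D}(\pi)$. The graph topology of $\pi$ is given by the norms $\varphi\mapsto\|\varphi\|+\|\pi(a)\varphi\|$; $\pi$ is closed if $\mathcal{D}(\pi)$ is complete in it; the closure of $\pi$ is its extension by continuity to the completion. A closed $*$-representation $\pi$ of a commutative $*$-algebra $\mathcal{B}$ is integrable if $\overline{\pi(b^* )}=\pi(b)^*$ for all $b\in\mathcal{B}$. $\mathrm{Res}_{\mathcal{B}}$ denotes restriction to $\mathcal{B}$. $\sum\mathcal{A}^2$ is the set of finite sums of elements $a^*a$.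 Standing assumptions. $G$ is a discrete group and $\mathcal{A}=\bigoplus_{g\in G}\mathcal{A}_g$ is a unital $G$-graded $*$-algebra ($\mathcal{A}_g\mathcal{A}_h\subseteq\mathcal{A}_{gh}$, $\mathcal{A}_g^*\subseteq\mathcal{A}_{g^{-1}}$) such that $\mathcal{B}:=\mathcal{A}_e$ is commutative and countably generated. $\widehat{\mathcal{B}}^+$ is the set of characters (nontrivial $*$-homomorphisms $\mathcal{B}\to\mathbb{C}$) that are nonnegative on $\sum\mathcal{A}^2\cap\mathcal{B}$. It is assumed that $\chi(c^*d)\chi(d^*c)=\chi(c^*c)\chi(d^*d)$ for all $\chi\in\widehat{\mathcal{B}}^+$, $g\in G$, $c,d\in\mathcal{A}_g$, and that $\widehat{\mathcal{B}}^+$ is locally compact in the weakest topology making all functions $f_b(\chi)=\chi(b)$, $b\in\mathcal{B}$, continuous. Partial action: $\chi^g$ is defined if $\chi(a_g^*a_g)\neq0$ for some $a_g\in\mathcal{A}_g$ (write $\chi\in\mathcal{D}_g$); then $\chi^g(b)=\chi(a_g^*ba_g)/\chi(a_g^*a_g)$, $b\in\mathcal{B}$ (independent of $a_g$, again in $\widehat{\mathcal{B}}^+$). $\mathrm{Orb}\,\chi=\{\chi^g:\chi^g\text{ is defined}\}$ and $\mathrm{St}\,\chi=\{g\in G:\chi^g\text{ is defined and equals }\chi\}$, which is a subgroup of $G$. For $\Delta\subseteq\widehat{\mathcal{B}}^+$, $\Delta^g=\{\chi^g:\chi\in\Delta\cap\mathcal{D}_g\}$. A $*$-representation $\pi$ of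 $\mathcal{A}$ is well-behaved if (a) $\mathrm{Res}_{\mathcal{B}}\pi$ is integrable and there is a spectral measure $E_\pi$ on $\widehat{\mathcal{B}}^+$ with $\overline{\pi(b)}=\int f_b\,dE_\pi$ for $b\in\mathcal{B}$, and (b) $E_\pi(\Delta^g)\pi(a_g)\subseteq\pi(a_g)E_\pi(\Delta)$ for all $g\in G$, $a_g\in\mathcal{A}_g$ and Borel sets $\Delta\subseteq\widehat{\mathcal{B}}^+$. It is associated with $\mathrm{Orb}\,\chi$ if $E_\pi$ is supported on $\mathrm{Orb}\,\chi$. $\mathcal{A}_H=\bigoplus_{h\in H}\mathcal{A}_h$. "$\mathrm{Res}_{\mathcal{B}}\rho$ is a multiple of $\chi$" means that $\mathrm{Res}_{\mathcal B}\rho$ is a direct sum of copies of the one-dimensional representation $\chi$, i.e. $\rho$ acts on $\mathcal{D}(\rho)=\mathcal{H}_\rho$ and $\rho(b)=\chi(b)I$ for $b\in\mathcal{B}$. Induction: $p_H:\mathcal{A}\to\mathcal{A}_H$ is the canonical projection. A $*$-representation $\rho$ of $\mathcal{A}_H$ is inducible if the form $\langle a_1\otimes v_1,a_2\otimes v_2\rangle_0=\langle\rho(p_H(a_2^*a_1))v_1,v_2\rangle$ on $\mathcal{A}\otimes_{\mathcal{A}_H}\mathcal{D}(\rho)$ is nonnegative; then $\mathrm{Ind}_{\mathcal{A}_H\uparrow\mathcal{A}}\rho$ is the closure of the representation $a\mapsto([b\otimes v]\mapsto[ab\otimes v])$ on the quotient by the kernel $\{\eta:\langle\eta,\eta\rangle_0=0\}$.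 *)

theory Defs
  imports "HOL-Analysis.Analysis" "HOL-Library.Poly_Mapping" "HOL-Library.FuncSet"
begin

class star_algebra = ring_1 +
  fixes scaleC :: "complex \<Rightarrow> 'a \<Rightarrow> 'a" (infixr \<open>*\<^sub>C\<close> 75)
    and star :: "'a \<Rightarrow> 'a"
  assumes scaleC_add_right: "c *\<^sub>C (x + y) = c *\<^sub>C x + c *\<^sub>C y"
    and scaleC_add_left: "(c + d) *\<^sub>C x = c *\<^sub>C x + d *\<^sub>C x"
    and scaleC_scaleC: "c *\<^sub>C d *\<^sub>C x = (c * d) *\<^sub>C x"
    and scaleC_one: "1 *\<^sub>C x = x"
    and mult_scaleC_left: "(c *\<^sub>C x) * y = c *\<^sub>C (x * y)"
    and mult_scaleC_right: "x * (c *\<^sub>C y) = c *\<^sub>C (x * y)"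
    and star_star: "star (star x) = x"
    and star_add: "star (x + y) = star x + star y"
    and star_scaleC: "star (c *\<^sub>C x) = cnj c *\<^sub>C star x"
    and star_mult: "star (x * y) = star y * star x"

abbreviation csubspace :: "'a::star_algebra set \<Rightarrow> bool" where
  "csubspace \<equiv> module.subspace scaleC"

lemma vector_space_scaleC: "vector_space (scaleC :: complex \<Rightarrow> 'a \<Rightarrow> 'a::star_algebra)"
  by unfold_locales
    (simp_all add: scaleC_add_right scaleC_add_left scaleC_scaleC scaleC_one)

definition star_subalgebra :: "'a::star_algebra set \<Rightarrow> bool" where
  "star_subalgebra C \<longleftrightarrow> csubspace C \<and> 1 \<in> C \<and>
     (\<forall>x\<in>C. \<forall>y\<in>C. x * y \<in> C) \<and> (\<forall>x\<in>C. star x \<in> C)"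

definition countably_generated :: "'a::star_algebra set \<Rightarrow> bool" where
  "countably_generated B \<longleftrightarrow>
     (\<exists>S. countable S \<and> B = \<Inter>{C. star_subalgebra C \<and> S \<subseteq> C})"

definition sums_of_squares :: "'a::star_algebra set" where
  "sums_of_squares = {\<Sum>x\<leftarrow>xs. star x * x | xs. True}"

text \<open>The grading group is written additively, but class \<^class>\<open>group_add\<close> does not
  assume commutativity; its unit is \<open>0\<close>, so that the commutative subalgebra is \<open>A 0\<close>.\<close>

definition is_decomposition :: "('g::group_add \<Rightarrow> 'a::star_algebra set) \<Rightarrow> 'a \<Rightarrow> ('g \<Rightarrow> 'a) \<Rightarrow> bool"
  where "is_decomposition A a f \<longleftrightarrow>
     finite {g. f g \<noteq> 0} \<and> (\<forall>g. f g \<in> A g) \<and> a = (\<Sum>g | f g \<noteq> 0. f g)"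

definition graded_star_algebra :: "('g::group_add \<Rightarrow> 'a::star_algebra set) \<Rightarrow> bool" where
  "graded_star_algebra A \<longleftrightarrow>
     (\<forall>g. csubspace (A g)) \<and>
     (\<forall>a. \<exists>!f. is_decomposition A a f) \<and>
     (\<forall>g h. \<forall>x\<in>A g. \<forall>y\<in>A h. x * y \<in> A (g + h)) \<and>
     (\<forall>g. \<forall>x\<in>A g. star x \<in> A (- g))"

definition component :: "('g::group_add \<Rightarrow> 'a::star_algebra set) \<Rightarrow> 'a \<Rightarrow> 'g \<Rightarrow> 'a" where
  "component A a = (THE f. is_decomposition A a f)"

definition subgrading :: "('g::group_add \<Rightarrow> 'a::star_algebra set) \<Rightarrow> 'g set \<Rightarrow> 'a set" where
  "subgrading A H = {a. \<forall>g. component A a g \<noteq> 0 \<longrightarrow> g \<in> H}"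

definition grade_proj :: "('g::group_add \<Rightarrow> 'a::star_algebra set) \<Rightarrow> 'g set \<Rightarrow> 'a \<Rightarrow> 'a" where
  "grade_proj A H a = (\<Sum>g\<in>{g \<in> H. component A a g \<noteq> 0}. component A a g)"

text \<open>Functions on \<open>A 0\<close> are represented by elements of \<^term>\<open>extensional (A 0)\<close>, so
  that equality of characters is equality of HOL functions.\<close>

definition characters :: "('g::group_add \<Rightarrow> 'a::star_algebra set) \<Rightarrow> ('a \<Rightarrow> complex) set" where
  "characters A = {\<xi> \<in> extensional (A 0).
     (\<forall>x\<in>A 0. \<forall>y\<in>A 0. \<xi> (x + y) = \<xi> x + \<xi> y) \<and>
     (\<forall>c. \<forall>x\<in>A 0. \<xi> (c *\<^sub>C x) = c * \<xi> x) \<and>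
     (\<forall>x\<in>A 0. \<forall>y\<in>A 0. \<xi> (x * y) = \<xi> x * \<xi> y) \<and>
     (\<forall>x\<in>A 0. \<xi> (star x) = cnj (\<xi> x)) \<and>
     (\<exists>x\<in>A 0. \<xi> x \<noteq> 0)}"

definition pos_characters :: "('g::group_add \<Rightarrow> 'a::star_algebra set) \<Rightarrow> ('a \<Rightarrow> complex) set" where
  "pos_characters A =
     {\<xi> \<in> characters A. \<forall>b \<in> sums_of_squares \<inter> A 0. \<xi> b \<in> \<real>\<^sub>\<ge>\<^sub>0}"

definition char_topology :: "('g::group_add \<Rightarrow> 'a::star_algebra set) \<Rightarrow> ('a \<Rightarrow> complex) topology"
  where "char_topology A =
     topology_generated_by {{\<xi> \<in> pos_characters A. \<xi> b \<in> U} | b U. b \<in> A 0 \<and> open U}"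

definition char_borel :: "('g::group_add \<Rightarrow> 'a::star_algebra set) \<Rightarrow> ('a \<Rightarrow> complex) set set" where
  "char_borel A = sigma_sets (pos_characters A) {U. openin (char_topology A) U}"

definition act_defined :: "('g::group_add \<Rightarrow> 'a::star_algebra set) \<Rightarrow> 'g \<Rightarrow> ('a \<Rightarrow> complex) \<Rightarrow> bool"
  where "act_defined A g \<xi> \<longleftrightarrow> (\<exists>a\<in>A g. \<xi> (star a * a) \<noteq> 0)"

text \<open>The value does not depend on the chosen \<open>a\<close> if
  \<open>\<xi>(c\<^sup>*d)\<xi>(d\<^sup>*c) = \<xi>(c\<^sup>*c)\<xi>(d\<^sup>*d)\<close> for homogeneous \<open>c, d\<close> of equal degree.\<close>

definition char_act :: "('g::group_add \<Rightarrow> 'a::star_algebra set) \<Rightarrow> 'g \<Rightarrow> ('a \<Rightarrow> complex) \<Rightarrow> 'a \<Rightarrow> complex"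
  where "char_act A g \<xi> =
     (let a = (SOME a. a \<in> A g \<and> \<xi> (star a * a) \<noteq> 0)
      in (\<lambda>b\<in>A 0. \<xi> (star a * b * a) / \<xi> (star a * a)))"

definition char_act_set ::
    "('g::group_add \<Rightarrow> 'a::star_algebra set) \<Rightarrow> 'g \<Rightarrow> ('a \<Rightarrow> complex) set \<Rightarrow> ('a \<Rightarrow> complex) set"
  where "char_act_set A g \<Delta> = {char_act A g \<xi> | \<xi>. \<xi> \<in> \<Delta> \<and> act_defined A g \<xi>}"

definition char_orbit :: "('g::group_add \<Rightarrow> 'a::star_algebra set) \<Rightarrow> ('a \<Rightarrow> complex) \<Rightarrow> ('a \<Rightarrow> complex) set"
  where "char_orbit A \<xi> = {char_act A g \<xi> | g. act_defined A g \<xi>}"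

definition char_stab :: "('g::group_add \<Rightarrow> 'a::star_algebra set) \<Rightarrow> ('a \<Rightarrow> complex) \<Rightarrow> 'g set" where
  "char_stab A \<xi> = {g. act_defined A g \<xi> \<and> char_act A g \<xi> = \<xi>}"

text \<open>Explicit carriers allow a Hilbert space to be a subspace of another one, or a
  completion of a quotient depending on a representation. Inner products are linear in the
  first argument. The record is also used for spaces with a degenerate Hermitian form.\<close>

record 'v hspace =
  hcarrier :: "'v set"
  hzero :: 'v
  hadd :: "'v \<Rightarrow> 'v \<Rightarrow> 'v"
  hscale :: "complex \<Rightarrow> 'v \<Rightarrow> 'v"
  hinner :: "'v \<Rightarrow> 'v \<Rightarrow> complex"

definition hdiff :: "'v hspace \<Rightarrow> 'v \<Rightarrow> 'v \<Rightarrow> 'v" where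
  "hdiff V x y = hadd V x (hscale V (-1) y)"

definition hnorm :: "'v hspace \<Rightarrow> 'v \<Rightarrow> real" where
  "hnorm V x = sqrt (Re (hinner V x x))"

definition hsum :: "'v hspace \<Rightarrow> 'v list \<Rightarrow> 'v" where
  "hsum V xs = foldr (hadd V) xs (hzero V)"

definition htendsto :: "'v hspace \<Rightarrow> ('x \<Rightarrow> 'v) \<Rightarrow> 'v \<Rightarrow> 'x filter \<Rightarrow> bool" where
  "htendsto V f l F \<longleftrightarrow> ((\<lambda>x. hnorm V (hdiff V (f x) l)) \<longlongrightarrow> 0) F"

definition hCauchy :: "'v hspace \<Rightarrow> (nat \<Rightarrow> 'v) \<Rightarrow> bool" where
  "hCauchy V s \<longleftrightarrow> (\<forall>e>0. \<exists>N. \<forall>m\<ge>N. \<forall>n\<ge>N. hnorm V (hdiff V (s m) (s n)) < e)"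

definition inner_product_space :: "'v hspace \<Rightarrow> bool" where
  "inner_product_space V \<longleftrightarrow>
     hzero V \<in> hcarrier V \<and>
     (\<forall>x\<in>hcarrier V. \<forall>y\<in>hcarrier V. hadd V x y \<in> hcarrier V) \<and>
     (\<forall>c. \<forall>x\<in>hcarrier V. hscale V c x \<in> hcarrier V) \<and>
     (\<forall>x\<in>hcarrier V. \<forall>y\<in>hcarrier V. \<forall>z\<in>hcarrier V.
        hadd V (hadd V x y) z = hadd V x (hadd V y z)) \<and>
     (\<forall>x\<in>hcarrier V. \<forall>y\<in>hcarrier V. hadd V x y = hadd V y x) \<and>
     (\<forall>x\<in>hcarrier V. hadd V (hzero V) x = x) \<and>
     (\<forall>x\<in>hcarrier V. hadd V x (hscale V (-1) x) = hzero V) \<and>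
     (\<forall>c. \<forall>x\<in>hcarrier V. \<forall>y\<in>hcarrier V.
        hscale V c (hadd V x y) = hadd V (hscale V c x) (hscale V c y)) \<and>
     (\<forall>c d. \<forall>x\<in>hcarrier V. hscale V (c + d) x = hadd V (hscale V c x) (hscale V d x)) \<and>
     (\<forall>c d. \<forall>x\<in>hcarrier V. hscale V c (hscale V d x) = hscale V (c * d) x) \<and>
     (\<forall>x\<in>hcarrier V. hscale V 1 x = x) \<and>
     (\<forall>x\<in>hcarrier V. \<forall>y\<in>hcarrier V. \<forall>z\<in>hcarrier V.
        hinner V (hadd V x y) z = hinner V x z + hinner V y z) \<and>
     (\<forall>c. \<forall>x\<in>hcarrier V. \<forall>y\<in>hcarrier V. hinner V (hscale V c x) y = c * hinner V x y) \<and>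
     (\<forall>x\<in>hcarrier V. \<forall>y\<in>hcarrier V. hinner V y x = cnj (hinner V x y)) \<and>
     (\<forall>x\<in>hcarrier V. hinner V x x \<in> \<real>\<^sub>\<ge>\<^sub>0) \<and>
     (\<forall>x\<in>hcarrier V. hinner V x x = 0 \<longrightarrow> x = hzero V)"

definition hilbert_space :: "'v hspace \<Rightarrow> bool" where
  "hilbert_space V \<longleftrightarrow> inner_product_space V \<and>
     (\<forall>s. range s \<subseteq> hcarrier V \<and> hCauchy V s \<longrightarrow>
        (\<exists>l\<in>hcarrier V. htendsto V s l sequentially))"

definition hsubspace :: "'v hspace \<Rightarrow> 'v set \<Rightarrow> bool" where
  "hsubspace V D \<longleftrightarrow> D \<subseteq> hcarrier V \<and> hzero V \<in> D \<and>
     (\<forall>x\<in>D. \<forall>y\<in>D. hadd V x y \<in> D) \<and> (\<forall>c. \<forall>x\<in>D. hscale V c x \<in> D)"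

definition hdense :: "'v hspace \<Rightarrow> 'v set \<Rightarrow> bool" where
  "hdense V D \<longleftrightarrow> (\<forall>x\<in>hcarrier V. \<forall>e>0. \<exists>y\<in>D. hnorm V (hdiff V x y) < e)"

definition hlinear :: "'v hspace \<Rightarrow> 'v set \<Rightarrow> 'w hspace \<Rightarrow> ('v \<Rightarrow> 'w) \<Rightarrow> bool" where
  "hlinear V D W T \<longleftrightarrow>
     (\<forall>x\<in>D. \<forall>y\<in>D. T (hadd V x y) = hadd W (T x) (T y)) \<and>
     (\<forall>c. \<forall>x\<in>D. T (hscale V c x) = hscale W c (T x))"

definition coset :: "'v hspace \<Rightarrow> 'v set \<Rightarrow> 'v \<Rightarrow> 'v set" where
  "coset V N x = (\<lambda>n. hadd V x n) ` N"

definition rep_of :: "'v set \<Rightarrow> 'v" where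
  "rep_of X = (SOME x. x \<in> X)"

definition hquotient :: "'v hspace \<Rightarrow> 'v set \<Rightarrow> 'v set hspace" where
  "hquotient V N =
     \<lparr>hcarrier = coset V N ` hcarrier V,
      hzero = coset V N (hzero V),
      hadd = (\<lambda>X Y. coset V N (hadd V (rep_of X) (rep_of Y))),
      hscale = (\<lambda>c X. coset V N (hscale V c (rep_of X))),
      hinner = (\<lambda>X Y. hinner V (rep_of X) (rep_of Y))\<rparr>"

definition quotient_map :: "'v hspace \<Rightarrow> 'v set \<Rightarrow> ('v \<Rightarrow> 'v) \<Rightarrow> 'v set \<Rightarrow> 'v set" where
  "quotient_map V N T X = coset V N (T (rep_of X))"

definition null_vectors :: "'v hspace \<Rightarrow> 'v set" where
  "null_vectors V = {x \<in> hcarrier V. hinner V x x = 0}"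

definition cauchy_seqs :: "'v hspace \<Rightarrow> (nat \<Rightarrow> 'v) set" where
  "cauchy_seqs V = {s. range s \<subseteq> hcarrier V \<and> hCauchy V s}"

definition cauchy_class :: "'v hspace \<Rightarrow> (nat \<Rightarrow> 'v) \<Rightarrow> (nat \<Rightarrow> 'v) set" where
  "cauchy_class V s =
     {t \<in> cauchy_seqs V. (\<lambda>n. hnorm V (hdiff V (s n) (t n))) \<longlonglongrightarrow> 0}"

definition hcompletion :: "'v hspace \<Rightarrow> (nat \<Rightarrow> 'v) set hspace" where
  "hcompletion V =
     \<lparr>hcarrier = cauchy_class V ` cauchy_seqs V,
      hzero = cauchy_class V (\<lambda>_. hzero V),
      hadd = (\<lambda>X Y. cauchy_class V (\<lambda>n. hadd V (rep_of X n) (rep_of Y n))),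
      hscale = (\<lambda>c X. cauchy_class V (\<lambda>n. hscale V c (rep_of X n))),
      hinner = (\<lambda>X Y. lim (\<lambda>n. hinner V (rep_of X n) (rep_of Y n)))\<rparr>"

definition hembed :: "'v hspace \<Rightarrow> 'v \<Rightarrow> (nat \<Rightarrow> 'v) set" where
  "hembed V x = cauchy_class V (\<lambda>_. x)"

text \<open>Extensionality makes equality of operators on the carrier equality of functions.\<close>

definition bounded_ops :: "'v hspace \<Rightarrow> ('v \<Rightarrow> 'v) set" where
  "bounded_ops V = {T \<in> hcarrier V \<rightarrow>\<^sub>E hcarrier V. hlinear V (hcarrier V) V T \<and>
     (\<exists>C. \<forall>x\<in>hcarrier V. hnorm V (T x) \<le> C * hnorm V x)}"

definition adjoint_pair :: "'v hspace \<Rightarrow> ('v \<Rightarrow> 'v) \<Rightarrow> ('v \<Rightarrow> 'v) \<Rightarrow> bool" where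
  "adjoint_pair V S T \<longleftrightarrow>
     (\<forall>x\<in>hcarrier V. \<forall>y\<in>hcarrier V. hinner V (S x) y = hinner V x (T y))"

definition projections :: "'v hspace \<Rightarrow> ('v \<Rightarrow> 'v) set" where
  "projections V = {P \<in> bounded_ops V. (\<forall>x\<in>hcarrier V. P (P x) = P x) \<and> adjoint_pair V P P}"

definition op_commutant :: "'v hspace \<Rightarrow> ('v \<Rightarrow> 'v) set \<Rightarrow> ('v \<Rightarrow> 'v) set" where
  "op_commutant V M =
     {T \<in> bounded_ops V. \<forall>S\<in>M. \<forall>x\<in>hcarrier V. T (S x) = S (T x)}"

text \<open>The bicommutant condition makes the set a unital algebra.\<close>

definition von_neumann_algebra :: "'v hspace \<Rightarrow> ('v \<Rightarrow> 'v) set \<Rightarrow> bool" where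
  "von_neumann_algebra V M \<longleftrightarrow> M \<subseteq> bounded_ops V \<and>
     (\<forall>S\<in>M. \<exists>T\<in>M. adjoint_pair V S T) \<and> op_commutant V (op_commutant V M) = M"

definition star_isomorphic ::
    "'v hspace \<Rightarrow> ('v \<Rightarrow> 'v) set \<Rightarrow> 'w hspace \<Rightarrow> ('w \<Rightarrow> 'w) set \<Rightarrow> bool" where
  "star_isomorphic V M W N \<longleftrightarrow> (\<exists>\<Phi>. bij_betw \<Phi> M N \<and>
     (\<forall>S\<in>M. \<forall>T\<in>M. \<Phi> (\<lambda>x\<in>hcarrier V. hadd V (S x) (T x)) =
        (\<lambda>x\<in>hcarrier W. hadd W (\<Phi> S x) (\<Phi> T x))) \<and>
     (\<forall>c. \<forall>S\<in>M. \<Phi> (\<lambda>x\<in>hcarrier V. hscale V c (S x)) =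
        (\<lambda>x\<in>hcarrier W. hscale W c (\<Phi> S x))) \<and>
     (\<forall>S\<in>M. \<forall>T\<in>M. \<Phi> (\<lambda>x\<in>hcarrier V. S (T x)) =
        (\<lambda>x\<in>hcarrier W. \<Phi> S (\<Phi> T x))) \<and>
     (\<forall>S\<in>M. \<forall>T\<in>M. adjoint_pair V S T \<longrightarrow> adjoint_pair W (\<Phi> S) (\<Phi> T)))"

text \<open>The closure and the adjoint of an operator \<open>T\<close> with domain \<open>D\<close>, as graphs.\<close>

definition op_closure :: "'v hspace \<Rightarrow> 'v set \<Rightarrow> ('v \<Rightarrow> 'v) \<Rightarrow> ('v \<times> 'v) set" where
  "op_closure V D T = {(\<phi>, \<psi>) \<in> hcarrier V \<times> hcarrier V.
     \<exists>s. range s \<subseteq> D \<and> htendsto V s \<phi> sequentially \<and> htendsto V (\<lambda>n. T (s n)) \<psi> sequentially}"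

definition op_adjoint :: "'v hspace \<Rightarrow> 'v set \<Rightarrow> ('v \<Rightarrow> 'v) \<Rightarrow> ('v \<times> 'v) set" where
  "op_adjoint V D T = {(\<psi>, \<eta>) \<in> hcarrier V \<times> hcarrier V.
     \<forall>\<phi>\<in>D. hinner V (T \<phi>) \<psi> = hinner V \<phi> \<eta>}"

definition spectral_measure ::
    "'v hspace \<Rightarrow> 'x set \<Rightarrow> 'x set set \<Rightarrow> ('x set \<Rightarrow> 'v \<Rightarrow> 'v) \<Rightarrow> bool" where
  "spectral_measure V X \<Sigma> E \<longleftrightarrow>
     (\<forall>\<Delta>\<in>\<Sigma>. E \<Delta> \<in> projections V) \<and>
     (\<forall>\<phi>\<in>hcarrier V. E X \<phi> = \<phi>) \<and>
     (\<forall>S :: nat \<Rightarrow> 'x set. range S \<subseteq> \<Sigma> \<and> disjoint_family S \<longrightarrow>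
        (\<forall>\<phi>\<in>hcarrier V. htendsto V (\<lambda>n. hsum V (map (\<lambda>k. E (S k) \<phi>) [0..<n]))
           (E (\<Union>k. S k) \<phi>) sequentially))"

definition vector_measure ::
    "'v hspace \<Rightarrow> 'x set \<Rightarrow> 'x set set \<Rightarrow> ('x set \<Rightarrow> 'v \<Rightarrow> 'v) \<Rightarrow> 'v \<Rightarrow> 'x measure" where
  "vector_measure V X \<Sigma> E \<phi> = measure_of X \<Sigma> (\<lambda>\<Delta>. ennreal (Re (hinner V (E \<Delta> \<phi>) \<phi>)))"

text \<open>The graph of the operator \<open>\<integral> f dE\<close>. Its domain consists of the vectors \<open>\<phi>\<close> with
  \<open>f \<in> L\<^sup>2(\<mu>)\<close>, where \<open>\<mu> = \<langle>E(\<cdot>)\<phi>,\<phi>\<rangle>\<close>, and its value at \<open>\<phi>\<close> is the image of \<open>f\<close> under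
  the continuous extension to \<open>L\<^sup>2(\<mu>)\<close> of the isometry taking a step function
  \<open>\<Sum>c\<^sub>k 1\<^bsub>\<Delta>\<^sub>k\<^esub>\<close> to \<open>\<Sum>c\<^sub>k E(\<Delta>\<^sub>k)\<phi>\<close>.\<close>

definition step_fun :: "(complex \<times> 'x set) list \<Rightarrow> 'x \<Rightarrow> complex" where
  "step_fun cs x = (\<Sum>(c, \<Delta>)\<leftarrow>cs. c * indicator \<Delta> x)"

definition step_integral ::
    "'v hspace \<Rightarrow> ('x set \<Rightarrow> 'v \<Rightarrow> 'v) \<Rightarrow> (complex \<times> 'x set) list \<Rightarrow> 'v \<Rightarrow> 'v" where
  "step_integral V E cs \<phi> = hsum V (map (\<lambda>(c, \<Delta>). hscale V c (E \<Delta> \<phi>)) cs)"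

definition spectral_integral ::
    "'v hspace \<Rightarrow> 'x set \<Rightarrow> 'x set set \<Rightarrow> ('x set \<Rightarrow> 'v \<Rightarrow> 'v) \<Rightarrow> ('x \<Rightarrow> complex) \<Rightarrow> ('v \<times> 'v) set"
  where "spectral_integral V X \<Sigma> E f = {(\<phi>, \<psi>) \<in> hcarrier V \<times> hcarrier V.
     (\<integral>\<^sup>+x. ennreal ((cmod (f x))\<^sup>2) \<partial>vector_measure V X \<Sigma> E \<phi>) < \<infinity> \<and>
     (\<exists>cs :: nat \<Rightarrow> (complex \<times> 'x set) list.
        (\<forall>n. snd ` set (cs n) \<subseteq> \<Sigma>) \<and>
        (\<lambda>n. \<integral>\<^sup>+x. ennreal ((cmod (f x - step_fun (cs n) x))\<^sup>2) \<partial>vector_measure V X \<Sigma> E \<phi>)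
          \<longlonglongrightarrow> 0 \<and>
        htendsto V (\<lambda>n. step_integral V E (cs n) \<phi>) \<psi> sequentially)}"

text \<open>In what follows \<open>S\<close> is the \<open>*\<close>-subalgebra that is represented; the action of other
  elements, and the action on vectors outside of the domain, is irrelevant. Restricting a
  representation means replacing \<open>S\<close> by a smaller subalgebra.\<close>

record ('a, 'v) representation =
  hsp :: "'v hspace"
  rdom :: "'v set"
  ract :: "'a \<Rightarrow> 'v \<Rightarrow> 'v"

definition star_rep :: "'a::star_algebra set \<Rightarrow> ('a, 'v) representation \<Rightarrow> bool" where
  "star_rep S \<pi> \<longleftrightarrow>
     hilbert_space (hsp \<pi>) \<and> hsubspace (hsp \<pi>) (rdom \<pi>) \<and> hdense (hsp \<pi>) (rdom \<pi>) \<and>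
     (\<forall>a\<in>S. ract \<pi> a ` rdom \<pi> \<subseteq> rdom \<pi> \<and> hlinear (hsp \<pi>) (rdom \<pi>) (hsp \<pi>) (ract \<pi> a)) \<and>
     (\<forall>a\<in>S. \<forall>b\<in>S. \<forall>\<phi>\<in>rdom \<pi>. ract \<pi> (a + b) \<phi> = hadd (hsp \<pi>) (ract \<pi> a \<phi>) (ract \<pi> b \<phi>)) \<and>
     (\<forall>c. \<forall>a\<in>S. \<forall>\<phi>\<in>rdom \<pi>. ract \<pi> (c *\<^sub>C a) \<phi> = hscale (hsp \<pi>) c (ract \<pi> a \<phi>)) \<and>
     (\<forall>a\<in>S. \<forall>b\<in>S. \<forall>\<phi>\<in>rdom \<pi>. ract \<pi> (a * b) \<phi> = ract \<pi> a (ract \<pi> b \<phi>)) \<and>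
     (\<forall>a\<in>S. \<forall>\<phi>\<in>rdom \<pi>. \<forall>\<psi>\<in>rdom \<pi>.
        hinner (hsp \<pi>) (ract \<pi> a \<phi>) \<psi> = hinner (hsp \<pi>) \<phi> (ract \<pi> (star a) \<psi>))"

definition bounded_rep :: "'a::star_algebra set \<Rightarrow> ('a, 'v) representation \<Rightarrow> bool" where
  "bounded_rep S \<pi> \<longleftrightarrow>
     (\<forall>a\<in>S. \<exists>C. \<forall>\<phi>\<in>rdom \<pi>. hnorm (hsp \<pi>) (ract \<pi> a \<phi>) \<le> C * hnorm (hsp \<pi>) \<phi>)"

definition unitarily_equivalent ::
    "'a::star_algebra set \<Rightarrow> ('a, 'v) representation \<Rightarrow> ('a, 'w) representation \<Rightarrow> bool" where
  "unitarily_equivalent S \<pi>\<^sub>1 \<pi>\<^sub>2 \<longleftrightarrow>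
     (\<exists>U. U ` rdom \<pi>\<^sub>1 = rdom \<pi>\<^sub>2 \<and> hlinear (hsp \<pi>\<^sub>1) (rdom \<pi>\<^sub>1) (hsp \<pi>\<^sub>2) U \<and>
        (\<forall>\<phi>\<in>rdom \<pi>\<^sub>1. hnorm (hsp \<pi>\<^sub>2) (U \<phi>) = hnorm (hsp \<pi>\<^sub>1) \<phi>) \<and>
        (\<forall>a\<in>S. \<forall>\<phi>\<in>rdom \<pi>\<^sub>1. U (ract \<pi>\<^sub>1 a \<phi>) = ract \<pi>\<^sub>2 a (U \<phi>)))"

text \<open>A decomposition \<open>\<pi> = \<pi>\<^sub>1 \<oplus> \<pi>\<^sub>2\<close> is given by its domains \<open>D\<^sub>1, D\<^sub>2\<close>; the summands act
  by restriction in the closures of their domains.\<close>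

definition irreducible_rep :: "'a::star_algebra set \<Rightarrow> ('a, 'v) representation \<Rightarrow> bool" where
  "irreducible_rep S \<pi> \<longleftrightarrow>
     (\<forall>D\<^sub>1 D\<^sub>2. hsubspace (hsp \<pi>) D\<^sub>1 \<and> hsubspace (hsp \<pi>) D\<^sub>2 \<and>
        (\<forall>x\<in>D\<^sub>1. \<forall>y\<in>D\<^sub>2. hinner (hsp \<pi>) x y = 0) \<and>
        rdom \<pi> = {hadd (hsp \<pi>) x y | x y. x \<in> D\<^sub>1 \<and> y \<in> D\<^sub>2} \<and>
        (\<forall>a\<in>S. ract \<pi> a ` D\<^sub>1 \<subseteq> D\<^sub>1 \<and> ract \<pi> a ` D\<^sub>2 \<subseteq> D\<^sub>2)
        \<longrightarrow> D\<^sub>1 = {hzero (hsp \<pi>)} \<or> D\<^sub>2 = {hzero (hsp \<pi>)})"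

definition rep_commutant :: "'a::star_algebra set \<Rightarrow> ('a, 'v) representation \<Rightarrow> ('v \<Rightarrow> 'v) set" where
  "rep_commutant S \<pi> = {T \<in> bounded_ops (hsp \<pi>). T ` rdom \<pi> \<subseteq> rdom \<pi> \<and>
     (\<forall>a\<in>S. \<forall>\<phi>\<in>rdom \<pi>. ract \<pi> a (T \<phi>) = T (ract \<pi> a \<phi>))}"

text \<open>The graph topology need not be metrizable, so completeness refers to Cauchy filters.\<close>

definition graph_norm :: "('a, 'v) representation \<Rightarrow> 'a \<Rightarrow> 'v \<Rightarrow> real" where
  "graph_norm \<pi> a \<phi> = hnorm (hsp \<pi>) \<phi> + hnorm (hsp \<pi>) (ract \<pi> a \<phi>)"

definition graph_cauchy :: "'a set \<Rightarrow> ('a, 'v) representation \<Rightarrow> 'v filter \<Rightarrow> bool" where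
  "graph_cauchy S \<pi> F \<longleftrightarrow> F \<noteq> bot \<and> (\<forall>\<^sub>F x in F. x \<in> rdom \<pi>) \<and>
     (\<forall>a\<in>S. \<forall>e>0. \<forall>\<^sub>F (x, y) in F \<times>\<^sub>F F. graph_norm \<pi> a (hdiff (hsp \<pi>) x y) < e)"

definition closed_rep :: "'a set \<Rightarrow> ('a, 'v) representation \<Rightarrow> bool" where
  "closed_rep S \<pi> \<longleftrightarrow> (\<forall>F. graph_cauchy S \<pi> F \<longrightarrow>
     (\<exists>\<phi>\<in>rdom \<pi>. \<forall>a\<in>S. ((\<lambda>x. graph_norm \<pi> a (hdiff (hsp \<pi>) x \<phi>)) \<longlongrightarrow> 0) F))"

text \<open>The completion of the domain in the graph topology is realized inside the Hilbert
  space as the set of norm limits of graph Cauchy filters.\<close>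

definition rep_closure :: "'a set \<Rightarrow> ('a, 'v) representation \<Rightarrow> ('a, 'v) representation" where
  "rep_closure S \<pi> =
     \<lparr>hsp = hsp \<pi>,
      rdom = {\<phi> \<in> hcarrier (hsp \<pi>). \<exists>F. graph_cauchy S \<pi> F \<and> htendsto (hsp \<pi>) (\<lambda>x. x) \<phi> F},
      ract = (\<lambda>a \<phi>. THE \<psi>. \<psi> \<in> hcarrier (hsp \<pi>) \<and>
        (\<exists>F. graph_cauchy S \<pi> F \<and> htendsto (hsp \<pi>) (\<lambda>x. x) \<phi> F \<and>
             htendsto (hsp \<pi>) (ract \<pi> a) \<psi> F))\<rparr>"

definition integrable_rep :: "'a::star_algebra set \<Rightarrow> ('a, 'v) representation \<Rightarrow> bool" where
  "integrable_rep S \<pi> \<longleftrightarrow> star_rep S \<pi> \<and> closed_rep S \<pi> \<and>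
     (\<forall>b\<in>S. op_closure (hsp \<pi>) (rdom \<pi>) (ract \<pi> (star b)) =
             op_adjoint (hsp \<pi>) (rdom \<pi>) (ract \<pi> b))"

definition well_behaved_via ::
    "('g::group_add \<Rightarrow> 'a::star_algebra set) \<Rightarrow> ('a, 'v) representation \<Rightarrow>
     (('a \<Rightarrow> complex) set \<Rightarrow> 'v \<Rightarrow> 'v) \<Rightarrow> bool" where
  "well_behaved_via A \<pi> E \<longleftrightarrow>
     star_rep UNIV \<pi> \<and> integrable_rep (A 0) \<pi> \<and>
     spectral_measure (hsp \<pi>) (pos_characters A) (char_borel A) E \<and>
     (\<forall>b\<in>A 0. op_closure (hsp \<pi>) (rdom \<pi>) (ract \<pi> b) =
        spectral_integral (hsp \<pi>) (pos_characters A) (char_borel A) E (\<lambda>\<xi>. \<xi> b)) \<and>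
     (\<forall>g. \<forall>a\<in>A g. \<forall>\<Delta>\<in>char_borel A. \<forall>\<phi>\<in>rdom \<pi>.
        E \<Delta> \<phi> \<in> rdom \<pi> \<and> E (char_act_set A g \<Delta>) (ract \<pi> a \<phi>) = ract \<pi> a (E \<Delta> \<phi>))"

definition well_behaved ::
    "('g::group_add \<Rightarrow> 'a::star_algebra set) \<Rightarrow> ('a, 'v) representation \<Rightarrow> bool" where
  "well_behaved A \<pi> \<longleftrightarrow> (\<exists>E. well_behaved_via A \<pi> E)"

text \<open>The spectral measure of a well-behaved representation is determined by it, so it does
  not matter which one is taken here.\<close>

definition associated_with ::
    "('g::group_add \<Rightarrow> 'a::star_algebra set) \<Rightarrow> ('a, 'v) representation \<Rightarrow>
     ('a \<Rightarrow> complex) set \<Rightarrow> bool" where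
  "associated_with A \<pi> \<O> \<longleftrightarrow> (\<exists>E. well_behaved_via A \<pi> E \<and>
     (\<forall>\<Delta>\<in>char_borel A. \<Delta> \<inter> \<O> = {} \<longrightarrow> (\<forall>\<phi>\<in>hcarrier (hsp \<pi>). E \<Delta> \<phi> = hzero (hsp \<pi>))))"

definition multiple_of_char ::
    "('g::group_add \<Rightarrow> 'a::star_algebra set) \<Rightarrow> ('a \<Rightarrow> complex) \<Rightarrow> ('a, 'v) representation \<Rightarrow> bool"
  where "multiple_of_char A \<xi> \<rho> \<longleftrightarrow> rdom \<rho> = hcarrier (hsp \<rho>) \<and>
     (\<forall>b\<in>A 0. \<forall>\<phi>\<in>rdom \<rho>. ract \<rho> b \<phi> = hscale (hsp \<rho>) (\<xi> b) \<phi>)"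

type_synonym ('a, 'v) formal_tensors = "('a \<times> 'v) \<Rightarrow>\<^sub>0 complex"

definition formal_scale :: "complex \<Rightarrow> ('a, 'v) formal_tensors \<Rightarrow> ('a, 'v) formal_tensors" where
  "formal_scale c = Poly_Mapping.map ((*) c)"

definition formal :: "'a \<Rightarrow> 'v \<Rightarrow> ('a, 'v) formal_tensors" where
  "formal a v = Poly_Mapping.single (a, v) 1"

text \<open>The free vector space on pairs \<open>(a, v)\<close>, with the sesquilinear form that has the value
  \<open>\<langle>\<rho>(p\<^sub>H(b\<^sup>* a))v, w\<rangle>\<close> on the generators \<open>(a, v)\<close> and \<open>(b, w)\<close>.\<close>

definition formal_space ::
    "('g::group_add \<Rightarrow> 'a::star_algebra set) \<Rightarrow> 'g set \<Rightarrow> ('a, 'v) representation \<Rightarrow>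
     ('a, 'v) formal_tensors hspace" where
  "formal_space A H \<rho> =
     \<lparr>hcarrier = {f. Poly_Mapping.keys f \<subseteq> UNIV \<times> rdom \<rho>},
      hzero = 0,
      hadd = (+),
      hscale = formal_scale,
      hinner = (\<lambda>f f'. \<Sum>(a, v)\<in>Poly_Mapping.keys f. \<Sum>(b, w)\<in>Poly_Mapping.keys f'.
         Poly_Mapping.lookup f (a, v) * cnj (Poly_Mapping.lookup f' (b, w)) *
         hinner (hsp \<rho>) (ract \<rho> (grade_proj A H (star b * a)) v) w)\<rparr>"

definition tensor_relations ::
    "('g::group_add \<Rightarrow> 'a::star_algebra set) \<Rightarrow> 'g set \<Rightarrow> ('a, 'v) representation \<Rightarrow>
     ('a, 'v) formal_tensors set" where
  "tensor_relations A H \<rho> = module.span formal_scale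
     ({formal (a + b) v - formal a v - formal b v | a b v. v \<in> rdom \<rho>} \<union>
      {formal a (hadd (hsp \<rho>) v w) - formal a v - formal a w | a v w. v \<in> rdom \<rho> \<and> w \<in> rdom \<rho>} \<union>
      {formal (c *\<^sub>C a) v - formal_scale c (formal a v) | c a v. v \<in> rdom \<rho>} \<union>
      {formal a (hscale (hsp \<rho>) c v) - formal_scale c (formal a v) | c a v. v \<in> rdom \<rho>} \<union>
      {formal (a * b) v - formal a (ract \<rho> b v) | a b v. b \<in> subgrading A H \<and> v \<in> rdom \<rho>})"

definition tensor_space ::
    "('g::group_add \<Rightarrow> 'a::star_algebra set) \<Rightarrow> 'g set \<Rightarrow> ('a, 'v) representation \<Rightarrow>
     ('a, 'v) formal_tensors set hspace" where
  "tensor_space A H \<rho> = hquotient (formal_space A H \<rho>) (tensor_relations A H \<rho>)"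

definition inducible ::
    "('g::group_add \<Rightarrow> 'a::star_algebra set) \<Rightarrow> 'g set \<Rightarrow> ('a, 'v) representation \<Rightarrow> bool" where
  "inducible A H \<rho> \<longleftrightarrow> star_rep (subgrading A H) \<rho> \<and>
     (\<forall>\<eta>\<in>hcarrier (tensor_space A H \<rho>). hinner (tensor_space A H \<rho>) \<eta> \<eta> \<in> \<real>\<^sub>\<ge>\<^sub>0)"

definition formal_act :: "'a::star_algebra \<Rightarrow> ('a, 'v) formal_tensors \<Rightarrow> ('a, 'v) formal_tensors" where
  "formal_act a f =
     (\<Sum>(b, v)\<in>Poly_Mapping.keys f. formal_scale (Poly_Mapping.lookup f (b, v)) (formal (a * b) v))"

definition induced_prehilbert ::
    "('g::group_add \<Rightarrow> 'a::star_algebra set) \<Rightarrow> 'g set \<Rightarrow> ('a, 'v) representation \<Rightarrow>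
     ('a, 'v) formal_tensors set set hspace" where
  "induced_prehilbert A H \<rho> =
     hquotient (tensor_space A H \<rho>) (null_vectors (tensor_space A H \<rho>))"

definition induced_act ::
    "('g::group_add \<Rightarrow> 'a::star_algebra set) \<Rightarrow> 'g set \<Rightarrow> ('a, 'v) representation \<Rightarrow>
     'a \<Rightarrow> ('a, 'v) formal_tensors set set \<Rightarrow> ('a, 'v) formal_tensors set set" where
  "induced_act A H \<rho> a =
     quotient_map (tensor_space A H \<rho>) (null_vectors (tensor_space A H \<rho>))
       (quotient_map (formal_space A H \<rho>) (tensor_relations A H \<rho>) (formal_act a))"

definition Ind ::
    "('g::group_add \<Rightarrow> 'a::star_algebra set) \<Rightarrow> 'g set \<Rightarrow> ('a, 'v) representation \<Rightarrow>
     ('a, (nat \<Rightarrow> ('a, 'v) formal_tensors set set) set) representation" where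
  "Ind A H \<rho> = (let K = induced_prehilbert A H \<rho> in
     rep_closure UNIV
       \<lparr>hsp = hcompletion K,
        rdom = hembed K ` hcarrier K,
        ract = (\<lambda>a \<phi>. hembed K (induced_act A H \<rho> a (inv_into (hcarrier K) (hembed K) \<phi>)))\<rparr>)"

end

theory Submission
  imports Defs
begin

text \<open>
  Let \<open>H\<close> be the stabilizer of \<open>\<xi>\<close> and \<open>V\<close> the space of \<open>\<rho>\<close>. Everything rests on one computation.
  For every point \<open>x\<close> of the orbit choose a homogeneous element \<open>e\<^sub>x\<close> of a degree moving \<open>\<xi>\<close> to \<open>x\<close>,
  normalized by \<open>\<xi>(e\<^sub>x\<^sup>* e\<^sub>x) = 1\<close>; then \<open>x(e\<^sub>x e\<^sub>x\<^sup>*) = 1\<close>. If \<open>d\<close> is homogeneous of degree \<open>g\<close> and \<open>\<xi>\<^sup>g = x\<close>,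
  then \<open>e\<^sub>x\<^sup>* d\<close> belongs to \<open>A\<^sub>H\<close>, and in the induced space the vectors \<open>d \<otimes> v\<close> and \<open>e\<^sub>x \<otimes> \<rho>(e\<^sub>x\<^sup>* d)v\<close>
  coincide; if \<open>\<xi>\<^sup>g\<close> is undefined, then \<open>d \<otimes> v\<close> vanishes (lemmas \<open>ten_frame\<close> and \<open>ten_undefined\<close>).
  The elements of degree \<open>0\<close> act on \<open>e\<^sub>x \<otimes> v\<close> by the character \<open>x\<close>, so different points give
  orthogonal vectors. Hence the induced space is the \<open>\<ell>\<^sup>2\<close>-sum of copies of \<open>V\<close>, one for each point of
  the orbit, and the orbit is countable because the group is. The same computation for formal tensors
  writes the form as a sum of Gram sums over the orbit (\<open>form_decomposition\<close>), so \<open>\<rho>\<close> is inducible. It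
  is bounded because \<open>c\<^sup>* c\<close> acts as a scalar for homogeneous \<open>c\<close>.

  Two kinds of representations \<open>\<pi>\<close> have to be compared: the induced ones, which contain \<open>\<rho>\<close> as
  \<open>1 \<otimes> V\<close>, and the well-behaved ones over the orbit, which contain it as the range of the projection
  \<open>E {\<xi>}\<close>. Both have an isometric copy \<open>J\<close> of \<open>\<rho>\<close> such that the vectors \<open>\<pi>(d)Jv\<close> span a dense
  subspace (locale \<open>generated_rep\<close>), and this is all that the above computation needs. For a closed
  \<open>\<pi>\<close> the domain is then determined as well: it consists of all \<open>\<phi>\<close> for which the functionals
  \<open>\<pi>(d)Jv \<mapsto> \<langle>\<phi>, \<pi>(a\<^sup>* d)Jv\<rangle>\<close> with homogeneous \<open>a\<close> are represented by vectors. Indeed the inequality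
  \<open>\<parallel>\<pi>(a)\<phi>\<parallel>\<^sup>2 \<le> \<parallel>\<pi>(a\<^sup>* a)\<phi>\<parallel> \<parallel>\<phi>\<parallel>\<close> reduces the graph topology to degree \<open>0\<close>, and elements of degree \<open>0\<close> act
  diagonally, so the partial sums of the orthogonal expansion of such a \<open>\<phi>\<close> converge in the graph
  topology (\<open>adj_dom_approx\<close>). Representations with this largest domain form the locale \<open>full_rep\<close>. The
  closure of a generated representation is full (\<open>closure_full\<close>), hence \<open>Ind \<rho>\<close> is (\<open>Ind_full\<close>), and
  every well-behaved representation over the orbit is full for \<open>\<rho>\<close> on the range of \<open>E {\<xi>}\<close>
  (\<open>well_behaved_full\<close>).

  The theorem now is a statement about full representations. They are well-behaved: the projections
  onto the coordinates in \<open>\<Delta>\<close> form a spectral measure carried by countably many points, and spectral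
  integrals with respect to such a measure are multiplication operators (\<open>spectral_integral_atomic\<close>).
  A unitary between two representations \<open>\<rho>\<close> acts diagonally on the coordinates and respects the domains,
  which are defined by testing against tensors; conversely \<open>V\<close> is recovered in \<open>\<pi>\<close> as the joint
  eigenspace for \<open>\<xi>\<close> (\<open>eigenvector_J\<close>). So \<open>\<pi>\<close> and \<open>\<rho>\<close> determine each other up to unitary equivalence
  (\<open>full_rep_equivalence\<close>), which gives the bijection. In the same way an operator in the commutant of
  \<open>\<pi>\<close> preserves this eigenspace and is the amplification of its restriction (\<open>commutant_amp\<close>); this
  gives the isomorphism of the commutants, and orthogonal decompositions of \<open>\<pi>\<close> and \<open>\<rho>\<close> correspond to
  each other.
\<close>

section \<open>Hilbert spaces with explicit carriers\<close>

lemma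
  assumes "inner_product_space V"
  shows hzero_in [simp]: "hzero V \<in> hcarrier V"
    and hadd_in [simp]: "x \<in> hcarrier V \<Longrightarrow> y \<in> hcarrier V \<Longrightarrow> hadd V x y \<in> hcarrier V"
    and hscale_in [simp]: "x \<in> hcarrier V \<Longrightarrow> hscale V c x \<in> hcarrier V"
    and hadd_assoc: "x \<in> hcarrier V \<Longrightarrow> y \<in> hcarrier V \<Longrightarrow> z \<in> hcarrier V \<Longrightarrow>
          hadd V (hadd V x y) z = hadd V x (hadd V y z)"
    and hadd_commute: "x \<in> hcarrier V \<Longrightarrow> y \<in> hcarrier V \<Longrightarrow> hadd V x y = hadd V y x"
    and hadd_hzero_left: "x \<in> hcarrier V \<Longrightarrow> hadd V (hzero V) x = x"
    and hadd_neg: "x \<in> hcarrier V \<Longrightarrow> hadd V x (hscale V (-1) x) = hzero V"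
    and hscale_one: "x \<in> hcarrier V \<Longrightarrow> hscale V 1 x = x"
    and hinner_add_left [simp]: "x \<in> hcarrier V \<Longrightarrow> y \<in> hcarrier V \<Longrightarrow> z \<in> hcarrier V \<Longrightarrow>
          hinner V (hadd V x y) z = hinner V x z + hinner V y z"
    and hinner_scale_left [simp]: "x \<in> hcarrier V \<Longrightarrow> y \<in> hcarrier V \<Longrightarrow>
          hinner V (hscale V c x) y = c * hinner V x y"
    and hinner_sym: "x \<in> hcarrier V \<Longrightarrow> y \<in> hcarrier V \<Longrightarrow> hinner V y x = cnj (hinner V x y)"
    and hinner_self_nonneg: "x \<in> hcarrier V \<Longrightarrow> hinner V x x \<in> \<real>\<^sub>\<ge>\<^sub>0"
    and hinner_self_eq0: "x \<in> hcarrier V \<Longrightarrow> hinner V x x = 0 \<Longrightarrow> x = hzero V"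
proof -
  note r1 = assms[unfolded inner_product_space_def]
  note r2 = r1[THEN conjunct2]
  note r3 = r2[THEN conjunct2]
  note r4 = r3[THEN conjunct2]
  note r5 = r4[THEN conjunct2]
  note r6 = r5[THEN conjunct2]
  note r7 = r6[THEN conjunct2]
  note r8 = r7[THEN conjunct2]
  note r9 = r8[THEN conjunct2]
  note r10 = r9[THEN conjunct2]
  note r11 = r10[THEN conjunct2]
  note r12 = r11[THEN conjunct2]
  note r13 = r12[THEN conjunct2]
  note r14 = r13[THEN conjunct2]
  note r15 = r14[THEN conjunct2]
  note r16 = r15[THEN conjunct2]
  show "hzero V \<in> hcarrier V" by (rule r1[THEN conjunct1])
  show "hadd V x y \<in> hcarrier V" if "x \<in> hcarrier V" "y \<in> hcarrier V"
    using that r2[THEN conjunct1] by blast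
  show "hscale V c x \<in> hcarrier V" if "x \<in> hcarrier V"
    using that r3[THEN conjunct1] by blast
  show "hadd V (hadd V x y) z = hadd V x (hadd V y z)" if "x \<in> hcarrier V" "y \<in> hcarrier V" "z \<in> hcarrier V"
    using that r4[THEN conjunct1] by blast
  show "hadd V x y = hadd V y x" if "x \<in> hcarrier V" "y \<in> hcarrier V"
    using that r5[THEN conjunct1] by blast
  show "hadd V (hzero V) x = x" if "x \<in> hcarrier V"
    using that r6[THEN conjunct1] by blast
  show "hadd V x (hscale V (-1) x) = hzero V" if "x \<in> hcarrier V"
    using that r7[THEN conjunct1] by blast
  show "hscale V 1 x = x" if "x \<in> hcarrier V"
    using that r11[THEN conjunct1] by blast
  show "hinner V (hadd V x y) z = hinner V x z + hinner V y z" if "x \<in> hcarrier V" "y \<in> hcarrier V" "z \<in> hcarrier V"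
    using that r12[THEN conjunct1] by blast
  show "hinner V (hscale V c x) y = c * hinner V x y" if "x \<in> hcarrier V" "y \<in> hcarrier V"
    using that r13[THEN conjunct1] by blast
  show "hinner V y x = cnj (hinner V x y)" if "x \<in> hcarrier V" "y \<in> hcarrier V"
    using that r14[THEN conjunct1] by blast
  show "hinner V x x \<in> \<real>\<^sub>\<ge>\<^sub>0" if "x \<in> hcarrier V"
    using that r15[THEN conjunct1] by blast
  show "x = hzero V" if "x \<in> hcarrier V" "hinner V x x = 0"
    using that r16 by blast
qed

lemma hdiff_in [simp]:
  "inner_product_space V \<Longrightarrow> x \<in> hcarrier V \<Longrightarrow> y \<in> hcarrier V \<Longrightarrow> hdiff V x y \<in> hcarrier V"
  by (simp add: hdiff_def)

lemma hinner_diff_left [simp]: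
  assumes "inner_product_space V" "x \<in> hcarrier V" "y \<in> hcarrier V" "z \<in> hcarrier V"
  shows "hinner V (hdiff V x y) z = hinner V x z - hinner V y z"
  using assms by (simp add: hdiff_def)

lemma
  assumes "inner_product_space V" "x \<in> hcarrier V" "y \<in> hcarrier V"
  shows hinner_add_right [simp]:
      "z \<in> hcarrier V \<Longrightarrow> hinner V z (hadd V x y) = hinner V z x + hinner V z y"
    and hinner_diff_right [simp]:
      "z \<in> hcarrier V \<Longrightarrow> hinner V z (hdiff V x y) = hinner V z x - hinner V z y"
    and hinner_scale_right [simp]: "hinner V y (hscale V c x) = cnj c * hinner V y x"
proof -
  show "hinner V z (hadd V x y) = hinner V z x + hinner V z y" if "z \<in> hcarrier V"
    using assms that hinner_sym[of V "hadd V x y" z] hinner_sym[of V x z] hinner_sym[of V y z]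
    by simp
  show "hinner V z (hdiff V x y) = hinner V z x - hinner V z y" if "z \<in> hcarrier V"
    using assms that hinner_sym[of V "hdiff V x y" z] hinner_sym[of V x z] hinner_sym[of V y z]
    by simp
  show "hinner V y (hscale V c x) = cnj c * hinner V y x"
    using assms hinner_sym[of V "hscale V c x" y] hinner_sym[of V x y] by simp
qed

lemma hinner_zero [simp]:
  assumes "inner_product_space V" "x \<in> hcarrier V"
  shows "hinner V (hzero V) x = 0" "hinner V x (hzero V) = 0"
proof -
  have "hinner V (hadd V (hzero V) (hzero V)) x = hinner V (hzero V) x"
    by (simp only: hadd_hzero_left[OF assms(1) hzero_in[OF assms(1)]])
  thus "hinner V (hzero V) x = 0" using assms by simp
  thus "hinner V x (hzero V) = 0" using hinner_sym[of V "hzero V" x] assms by simp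
qed

text \<open>Since the form separates points, vector identities reduce to identities of complex
  numbers, which the simplifier can decide.\<close>

lemma vector_eqI:
  assumes "inner_product_space V" "x \<in> hcarrier V" "y \<in> hcarrier V"
    and "\<And>z. z \<in> hcarrier V \<Longrightarrow> hinner V x z = hinner V y z"
  shows "x = y"
proof -
  let ?d = "hadd V x (hscale V (-1) y)"
  have "hinner V ?d ?d = 0" using assms by simp
  hence z: "?d = hzero V" using assms hinner_self_eq0 by fastforce
  have "x = hadd V x (hadd V (hscale V (-1) y) y)"
    using assms hadd_neg[of V y] hadd_commute[of V y "hscale V (-1) y"]
      hadd_commute[of V x "hzero V"] hadd_hzero_left[of V x] by simp
  also have "\<dots> = hadd V ?d y" using assms hadd_assoc[of V x "hscale V (-1) y" y] by simp
  also have "\<dots> = y" using z assms hadd_hzero_left[of V y] by simp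
  finally show ?thesis .
qed

lemma hdiff_eq_zero:
  assumes "inner_product_space V" "x \<in> hcarrier V" "y \<in> hcarrier V" "hdiff V x y = hzero V"
  shows "x = y"
proof (rule vector_eqI[OF assms(1-3)])
  fix z assume "z \<in> hcarrier V"
  then have "hinner V x z - hinner V y z = 0"
    using hinner_diff_left[OF assms(1-3), of z] assms(1) by (simp add: assms(4))
  thus "hinner V x z = hinner V y z" by simp
qed

subsection \<open>Norm\<close>

lemma hinner_self:
  assumes "inner_product_space V" "x \<in> hcarrier V"
  shows "hinner V x x = complex_of_real ((hnorm V x)\<^sup>2)"
  using hinner_self_nonneg[OF assms] by (auto simp: hnorm_def nonneg_Reals_def simp flip: of_real_power)

lemma hnorm_ge0 [simp]: "inner_product_space V \<Longrightarrow> x \<in> hcarrier V \<Longrightarrow> 0 \<le> hnorm V x"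
  using hinner_self_nonneg[of V x] by (auto simp: hnorm_def nonneg_Reals_def)

lemma hnorm_sq:
  assumes "inner_product_space V" "x \<in> hcarrier V"
  shows "(hnorm V x)\<^sup>2 = Re (hinner V x x)"
  using hinner_self[OF assms] by simp

lemma hnorm_eq0: "inner_product_space V \<Longrightarrow> x \<in> hcarrier V \<Longrightarrow> hnorm V x = 0 \<Longrightarrow> x = hzero V"
  using hinner_self[of V x] hinner_self_eq0[of V x] by simp

lemma hnorm_zero [simp]: "inner_product_space V \<Longrightarrow> hnorm V (hzero V) = 0"
  by (simp add: hnorm_def)

lemma hnorm_scale [simp]:
  assumes "inner_product_space V" "x \<in> hcarrier V"
  shows "hnorm V (hscale V c x) = cmod c * hnorm V x"
proof -
  have "hinner V (hscale V c x) (hscale V c x) = complex_of_real ((cmod c * hnorm V x)\<^sup>2)"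
    using assms hinner_self[OF assms] complex_norm_square[of c]
    by (simp add: power_mult_distrib mult.assoc[symmetric])
  thus ?thesis unfolding hnorm_def[of V "hscale V c x"]
    using assms by (simp add: real_sqrt_unique)
qed

lemma Cauchy_Schwarz:
  assumes V: "inner_product_space V" and x: "x \<in> hcarrier V" and y: "y \<in> hcarrier V"
  shows "cmod (hinner V x y) \<le> hnorm V x * hnorm V y"
proof (cases "hinner V y y = 0")
  case True
  then show ?thesis using hinner_self_eq0[OF V y True] V x by simp
next
  case False
  define n where "n = (hnorm V y)\<^sup>2"
  have yy: "hinner V y y = of_real n" using hinner_self[OF V y] by (simp add: n_def)
  have n: "n > 0" using False yy by (simp add: n_def)
  define c where "c = hinner V x y / of_real n"
  let ?z = "hdiff V x (hscale V c y)"
  have yx: "hinner V y x = cnj (hinner V x y)" by (rule hinner_sym[OF V x y])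
  have "hinner V ?z ?z = hinner V x x - cnj c * hinner V x y - c * (hinner V y x - cnj c * of_real n)"
    using V x y yy by (simp add: algebra_simps)
  also have "\<dots> = hinner V x x - hinner V x y * cnj (hinner V x y) / of_real n"
    using n by (simp add: c_def yx field_simps)
  also have "\<dots> = of_real ((hnorm V x)\<^sup>2 - (cmod (hinner V x y))\<^sup>2 / n)"
    using hinner_self[OF V x] by (simp add: complex_norm_square[symmetric])
  finally have "hinner V ?z ?z = of_real ((hnorm V x)\<^sup>2 - (cmod (hinner V x y))\<^sup>2 / n)" .
  moreover have "hinner V ?z ?z \<in> \<real>\<^sub>\<ge>\<^sub>0" using V x y by (intro hinner_self_nonneg) auto
  ultimately have "0 \<le> (hnorm V x)\<^sup>2 - (cmod (hinner V x y))\<^sup>2 / n"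
    by (simp only: nonneg_Reals_of_real_iff)
  hence "(cmod (hinner V x y))\<^sup>2 \<le> (hnorm V x)\<^sup>2 * (hnorm V y)\<^sup>2"
    using n by (simp add: field_simps n_def)
  thus ?thesis
    using V x y by (simp add: power_mult_distrib[symmetric] power2_le_iff_abs_le)
qed

lemma hnorm_triangle:
  assumes V: "inner_product_space V" and x: "x \<in> hcarrier V" and y: "y \<in> hcarrier V"
  shows "hnorm V (hadd V x y) \<le> hnorm V x + hnorm V y"
proof -
  have "(hnorm V (hadd V x y))\<^sup>2 = (hnorm V x)\<^sup>2 + (hnorm V y)\<^sup>2 + Re (hinner V x y) + Re (hinner V y x)"
    using V x y by (simp add: hnorm_sq)
  also have "\<dots> = (hnorm V x)\<^sup>2 + (hnorm V y)\<^sup>2 + 2 * Re (hinner V x y)"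
    using hinner_sym[OF V x y] by simp
  also have "\<dots> \<le> (hnorm V x)\<^sup>2 + (hnorm V y)\<^sup>2 + 2 * (hnorm V x * hnorm V y)"
    using Cauchy_Schwarz[OF assms] complex_Re_le_cmod[of "hinner V x y"] by linarith
  also have "\<dots> = (hnorm V x + hnorm V y)\<^sup>2" by (simp add: power2_sum)
  finally show ?thesis using V x y by (simp add: power2_le_iff_abs_le)
qed

lemma hnorm_diff_commute:
  assumes "inner_product_space V" "x \<in> hcarrier V" "y \<in> hcarrier V"
  shows "hnorm V (hdiff V x y) = hnorm V (hdiff V y x)"
  using assms by (simp add: hnorm_def)

lemma hnorm_diff_triangle:
  assumes V: "inner_product_space V" and x: "x \<in> hcarrier V" and y: "y \<in> hcarrier V"
    and z: "z \<in> hcarrier V"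
  shows "hnorm V (hdiff V x z) \<le> hnorm V (hdiff V x y) + hnorm V (hdiff V y z)"
proof -
  have "hdiff V x z = hadd V (hdiff V x y) (hdiff V y z)"
    by (rule vector_eqI[OF V]) (use assms in auto)
  thus ?thesis using hnorm_triangle[OF V, of "hdiff V x y" "hdiff V y z"] assms by simp
qed

lemma hnorm_le_diff:
  assumes V: "inner_product_space V" and x: "x \<in> hcarrier V" and y: "y \<in> hcarrier V"
  shows "hnorm V x \<le> hnorm V y + hnorm V (hdiff V x y)"
proof -
  have "x = hadd V y (hdiff V x y)" by (rule vector_eqI[OF V]) (use assms in auto)
  thus ?thesis using hnorm_triangle[OF V y, of "hdiff V x y"] assms by simp
qed

subsection \<open>Convergence\<close>

lemma htendsto_inner_left:
  assumes V: "inner_product_space V" and f: "\<forall>\<^sub>F x in F. f x \<in> hcarrier V"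
    and l: "l \<in> hcarrier V" and z: "z \<in> hcarrier V" and t: "htendsto V f l F"
  shows "((\<lambda>x. hinner V (f x) z) \<longlongrightarrow> hinner V l z) F"
proof (rule Lim_null[THEN iffD2], rule Lim_null_comparison)
  show "\<forall>\<^sub>F x in F. norm (hinner V (f x) z - hinner V l z) \<le> hnorm V (hdiff V (f x) l) * hnorm V z"
    using f
  proof eventually_elim
    case (elim x)
    then show ?case using Cauchy_Schwarz[OF V, of "hdiff V (f x) l" z] V l z by simp
  qed
  show "((\<lambda>x. hnorm V (hdiff V (f x) l) * hnorm V z) \<longlongrightarrow> 0) F"
    using tendsto_mult_left_zero[OF t[unfolded htendsto_def]] by simp
qed

lemma htendsto_inner_right:
  assumes V: "inner_product_space V" and f: "\<forall>\<^sub>F x in F. f x \<in> hcarrier V"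
    and l: "l \<in> hcarrier V" and z: "z \<in> hcarrier V" and t: "htendsto V f l F"
  shows "((\<lambda>x. hinner V z (f x)) \<longlongrightarrow> hinner V z l) F"
proof -
  have "((\<lambda>x. cnj (hinner V (f x) z)) \<longlongrightarrow> cnj (hinner V l z)) F"
    by (intro tendsto_intros htendsto_inner_left assms)
  moreover have "\<forall>\<^sub>F x in F. cnj (hinner V (f x) z) = hinner V z (f x)"
    using f by eventually_elim (use hinner_sym[OF V _ z] in metis)
  ultimately show ?thesis
    unfolding hinner_sym[OF V l z] by (rule Lim_transform_eventually)
qed

lemma htendsto_norm:
  assumes V: "inner_product_space V" and f: "\<forall>\<^sub>F x in F. f x \<in> hcarrier V"
    and l: "l \<in> hcarrier V" and t: "htendsto V f l F"
  shows "((\<lambda>x. hnorm V (f x)) \<longlongrightarrow> hnorm V l) F"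
proof (rule Lim_null[THEN iffD2], rule Lim_null_comparison)
  show "\<forall>\<^sub>F x in F. norm (hnorm V (f x) - hnorm V l) \<le> hnorm V (hdiff V (f x) l)"
    using f
  proof eventually_elim
    case (elim x)
    then show ?case using hnorm_le_diff[OF V l, of "f x"] hnorm_le_diff[OF V elim l]
        hnorm_diff_commute[OF V l elim] by simp
  qed
  show "((\<lambda>x. hnorm V (hdiff V (f x) l)) \<longlongrightarrow> 0) F"
    using t by (simp add: htendsto_def)
qed

lemma htendsto_unique:
  assumes V: "inner_product_space V" and F: "F \<noteq> bot" and f: "\<forall>\<^sub>F x in F. f x \<in> hcarrier V"
    and l: "l \<in> hcarrier V" "l' \<in> hcarrier V" and t: "htendsto V f l F" "htendsto V f l' F"
  shows "l = l'"
  by (rule vector_eqI[OF V l])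
     (use tendsto_unique[OF F htendsto_inner_left[OF V f l(1) _ t(1)] htendsto_inner_left[OF V f l(2) _ t(2)]] in auto)

lemma htendsto_const [simp]:
  assumes "inner_product_space V" "x \<in> hcarrier V" shows "htendsto V (\<lambda>_. x) x F"
proof -
  have "hnorm V (hdiff V x x) = 0" using assms by (simp add: hnorm_def)
  thus ?thesis by (simp add: htendsto_def)
qed

lemma htendsto_map_bounded:
  assumes "\<forall>\<^sub>F x in F. hnorm W (hdiff W (T (f x)) (T l)) \<le> K * hnorm V (hdiff V (f x) l)"
    and W: "inner_product_space W" "\<forall>\<^sub>F x in F. T (f x) \<in> hcarrier W" "T l \<in> hcarrier W"
    and t: "htendsto V f l F"
  shows "htendsto W (\<lambda>x. T (f x)) (T l) F"
  unfolding htendsto_def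
proof (rule Lim_null_comparison)
  show "\<forall>\<^sub>F x in F. norm (hnorm W (hdiff W (T (f x)) (T l))) \<le> K * hnorm V (hdiff V (f x) l)"
    using assms(1) W(2) by eventually_elim (use W in simp)
  show "((\<lambda>x. K * hnorm V (hdiff V (f x) l)) \<longlongrightarrow> 0) F"
    using tendsto_mult_right_zero[OF t[unfolded htendsto_def]] by simp
qed

lemma hilbert_ips [simp]: "hilbert_space V \<Longrightarrow> inner_product_space V"
  by (simp add: hilbert_space_def)

lemma hilbert_complete:
  "hilbert_space V \<Longrightarrow> (\<And>n. s n \<in> hcarrier V) \<Longrightarrow> hCauchy V s \<Longrightarrow>
    \<exists>l\<in>hcarrier V. htendsto V s l sequentially"
  unfolding hilbert_space_def by blast

lemma htendsto_hCauchy: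
  assumes V: "inner_product_space V" and s: "\<And>n. s n \<in> hcarrier V" and l: "l \<in> hcarrier V"
    and t: "htendsto V s l sequentially"
  shows "hCauchy V s"
  unfolding hCauchy_def
proof (intro allI impI)
  fix e :: real assume "e > 0"
  hence "e / 2 > 0" by simp
  then have "\<forall>\<^sub>F n in sequentially. hnorm V (hdiff V (s n) l) < e / 2"
    using order_tendstoD(2)[OF t[unfolded htendsto_def]] by blast
  then obtain N where N: "\<And>n. n \<ge> N \<Longrightarrow> hnorm V (hdiff V (s n) l) < e / 2"
    unfolding eventually_sequentially by blast
  show "\<exists>N. \<forall>m\<ge>N. \<forall>n\<ge>N. hnorm V (hdiff V (s m) (s n)) < e"
  proof (intro exI allI impI)
    fix m n assume "m \<ge> N" "n \<ge> N"
    then show "hnorm V (hdiff V (s m) (s n)) < e"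
      using N[of m] N[of n] hnorm_diff_triangle[OF V s l s, of m n] hnorm_diff_commute[OF V s l, of n]
      by simp
  qed
qed

text \<open>Completeness was required for sequences. It carries over to filters, because a Cauchy
  filter contains sets of diameter below any \<open>1/n\<close>, and points chosen in their decreasing
  intersections form a Cauchy sequence.\<close>

lemma filter_complete:
  assumes V: "hilbert_space V" and F: "F \<noteq> bot" and f: "\<forall>\<^sub>F x in F. f x \<in> hcarrier V"
    and c: "\<And>e. e > 0 \<Longrightarrow> \<forall>\<^sub>F (x, y) in F \<times>\<^sub>F F. hnorm V (hdiff V (f x) (f y)) < e"
  shows "\<exists>l\<in>hcarrier V. htendsto V f l F"
proof -
  note ips = hilbert_ips[OF V]
  have "\<forall>n. \<exists>P. eventually P F \<and> (\<forall>x y. P x \<longrightarrow> P y \<longrightarrow> hnorm V (hdiff V (f x) (f y)) < inverse (real (Suc n)))"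
    using c[THEN eventually_prod_same[THEN iffD1]] by fastforce
  then obtain P where P: "\<And>n. eventually (P n) F"
    and Pd: "\<And>n x y. P n x \<Longrightarrow> P n y \<Longrightarrow> hnorm V (hdiff V (f x) (f y)) < inverse (real (Suc n))"
    by metis
  define Q where "Q n x \<longleftrightarrow> f x \<in> hcarrier V \<and> (\<forall>k\<le>n. P k x)" for n x
  have Q: "eventually (Q n) F" for n
  proof -
    have "\<forall>\<^sub>F x in F. \<forall>k\<in>{..n}. P k x" by (rule eventually_ball_finite) (auto intro: P)
    thus ?thesis unfolding Q_def using f by eventually_elim auto
  qed
  have "\<forall>n. \<exists>x. Q n x" using Q F eventually_happens' by blast
  then obtain p where p: "\<And>n. Q n (p n)" by metis
  have pd: "hnorm V (hdiff V (f x) (f (p m))) < inverse (real (Suc n))" if "Q n x" "n \<le> m" for x n m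
    using that p[of m] Pd[of n x "p m"] by (auto simp: Q_def)
  have fp: "f (p n) \<in> hcarrier V" for n using p by (auto simp: Q_def)
  have small: "\<exists>N. inverse (real (Suc N)) < e" if "e > 0" for e :: real
    using reals_Archimedean[OF that] by blast
  have "hCauchy V (\<lambda>n. f (p n))"
    unfolding hCauchy_def
  proof (intro allI impI)
    fix e :: real assume "e > 0"
    then obtain N where N: "inverse (real (Suc N)) < e" using small by blast
    show "\<exists>N. \<forall>m\<ge>N. \<forall>n\<ge>N. hnorm V (hdiff V (f (p m)) (f (p n))) < e"
    proof (intro exI allI impI)
      fix m n assume "m \<ge> N" "n \<ge> N"
      moreover have "Q N (p m)" using p[of m] \<open>m \<ge> N\<close> by (auto simp: Q_def)
      ultimately show "hnorm V (hdiff V (f (p m)) (f (p n))) < e"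
        using pd[of N "p m" n] N by simp
    qed
  qed
  then obtain l where l: "l \<in> hcarrier V" and lt: "htendsto V (\<lambda>n. f (p n)) l sequentially"
    using hilbert_complete[OF V] fp by metis
  have "htendsto V f l F"
    unfolding htendsto_def
  proof (rule tendstoI)
    fix e :: real assume "e > 0"
    hence e2: "e / 2 > 0" by simp
    obtain N where N: "inverse (real (Suc N)) < e / 2" using small[OF e2] by blast
    have "\<forall>\<^sub>F n in sequentially. hnorm V (hdiff V (f (p n)) l) < e / 2"
      using order_tendstoD(2)[OF lt[unfolded htendsto_def] e2] .
    then obtain m where m: "m \<ge> N" "hnorm V (hdiff V (f (p m)) l) < e / 2"
      using eventually_conj[OF eventually_ge_at_top[of N]] eventually_happens'[OF sequentially_bot]
      by (smt (verit))
    show "\<forall>\<^sub>F x in F. dist (hnorm V (hdiff V (f x) l)) 0 < e"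
      using Q[of N]
    proof eventually_elim
      case (elim x)
      then have fx: "f x \<in> hcarrier V" by (simp add: Q_def)
      show ?case using pd[OF elim m(1)] N m(2) hnorm_diff_triangle[OF ips fx fp l, of m]
          ips fx l by simp
    qed
  qed
  thus ?thesis using l by blast
qed

subsection \<open>Finite sums and orthogonal series\<close>

lemma hsum_simps [simp]:
  "hsum V [] = hzero V" "hsum V (x # xs) = hadd V x (hsum V xs)"
  by (simp_all add: hsum_def)

lemma hsum_in [simp]:
  "inner_product_space V \<Longrightarrow> set xs \<subseteq> hcarrier V \<Longrightarrow> hsum V xs \<in> hcarrier V"
  by (induction xs) auto

lemma hinner_hsum_left:
  "inner_product_space V \<Longrightarrow> set xs \<subseteq> hcarrier V \<Longrightarrow> z \<in> hcarrier V \<Longrightarrow>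
    hinner V (hsum V xs) z = (\<Sum>x\<leftarrow>xs. hinner V x z)"
  by (induction xs) auto

lemma hinner_hsum_right:
  "inner_product_space V \<Longrightarrow> set xs \<subseteq> hcarrier V \<Longrightarrow> z \<in> hcarrier V \<Longrightarrow>
    hinner V z (hsum V xs) = (\<Sum>x\<leftarrow>xs. hinner V z x)"
  by (induction xs) auto

lemma hsum_in_subspace:
  "hsubspace V D \<Longrightarrow> set xs \<subseteq> D \<Longrightarrow> hsum V xs \<in> D"
  by (induction xs) (auto simp: hsubspace_def)

definition psum :: "'v hspace \<Rightarrow> (nat \<Rightarrow> 'v) \<Rightarrow> nat \<Rightarrow> 'v" where
  "psum V u n = hsum V (map u [0..<n])"

lemma psum_in [simp]:
  "inner_product_space V \<Longrightarrow> (\<And>k. u k \<in> hcarrier V) \<Longrightarrow> psum V u n \<in> hcarrier V"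
  unfolding psum_def by (rule hsum_in) auto

lemma psum_in_subspace: "hsubspace V D \<Longrightarrow> (\<And>k. u k \<in> D) \<Longrightarrow> psum V u n \<in> D"
  unfolding psum_def by (rule hsum_in_subspace) auto

lemma hinner_psum:
  assumes "inner_product_space V" "\<And>k. u k \<in> hcarrier V" "z \<in> hcarrier V"
  shows "hinner V (psum V u n) z = (\<Sum>k<n. hinner V (u k) z)"
    "hinner V z (psum V u n) = (\<Sum>k<n. hinner V z (u k))"
proof -
  have s: "set (map u [0..<n]) \<subseteq> hcarrier V" using assms by auto
  show "hinner V (psum V u n) z = (\<Sum>k<n. hinner V (u k) z)"
    unfolding psum_def using hinner_hsum_left[OF assms(1) s assms(3)]
    by (simp add: comp_def interv_sum_list_conv_sum_set_nat atLeast0LessThan)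
  show "hinner V z (psum V u n) = (\<Sum>k<n. hinner V z (u k))"
    unfolding psum_def using hinner_hsum_right[OF assms(1) s assms(3)]
    by (simp add: comp_def interv_sum_list_conv_sum_set_nat atLeast0LessThan)
qed

lemma psum_orthogonal_inner:
  assumes V: "inner_product_space V" and u: "\<And>k. u k \<in> hcarrier V"
    and o: "\<And>j k. j \<noteq> k \<Longrightarrow> hinner V (u j) (u k) = 0" and "m \<le> n"
  shows "hinner V (psum V u n) (psum V u m) = complex_of_real (\<Sum>k<m. (hnorm V (u k))\<^sup>2)"
    "hinner V (psum V u m) (psum V u n) = complex_of_real (\<Sum>k<m. (hnorm V (u k))\<^sup>2)"
proof -
  have "hinner V (psum V u n) (u k) = hinner V (u k) (u k)" if "k < n" for k
  proof -
    have "hinner V (psum V u n) (u k) = (\<Sum>j<n. if j = k then hinner V (u k) (u k) else 0)"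
      unfolding hinner_psum(1)[OF V u u] using o by (intro sum.cong) auto
    thus ?thesis using that by simp
  qed
  thus 1: "hinner V (psum V u n) (psum V u m) = complex_of_real (\<Sum>k<m. (hnorm V (u k))\<^sup>2)"
    using V u \<open>m \<le> n\<close> by (simp add: hinner_psum(2) hinner_self)
  show "hinner V (psum V u m) (psum V u n) = complex_of_real (\<Sum>k<m. (hnorm V (u k))\<^sup>2)"
    using hinner_sym[OF V, of "psum V u n" "psum V u m"] V u unfolding 1 by simp
qed

lemma psum_diff_norm:
  assumes V: "inner_product_space V" and u: "\<And>k. u k \<in> hcarrier V"
    and o: "\<And>j k. j \<noteq> k \<Longrightarrow> hinner V (u j) (u k) = 0" and "m \<le> n"
  shows "(hnorm V (hdiff V (psum V u n) (psum V u m)))\<^sup>2 = (\<Sum>k<n. (hnorm V (u k))\<^sup>2) - (\<Sum>k<m. (hnorm V (u k))\<^sup>2)"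
  using V u by (simp add: hnorm_sq psum_orthogonal_inner[OF V u o] \<open>m \<le> n\<close> del: of_real_sum)

text \<open>Orthogonality turns the distance of two partial sums into a difference of partial sums
  of the bounded series of squared norms, so the partial sums form a Cauchy sequence.\<close>

lemma Riesz_Fischer:
  assumes V: "hilbert_space V" and u: "\<And>k. u k \<in> hcarrier V"
    and o: "\<And>j k. j \<noteq> k \<Longrightarrow> hinner V (u j) (u k) = 0"
    and M: "\<And>n. (\<Sum>k<n. (hnorm V (u k))\<^sup>2) \<le> M"
  obtains \<psi> where "\<psi> \<in> hcarrier V" "htendsto V (psum V u) \<psi> sequentially"
    "\<And>z. z \<in> hcarrier V \<Longrightarrow> (\<lambda>n. \<Sum>k<n. hinner V (u k) z) \<longlonglongrightarrow> hinner V \<psi> z"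
    "(\<lambda>n. \<Sum>k<n. (hnorm V (u k))\<^sup>2) \<longlonglongrightarrow> (hnorm V \<psi>)\<^sup>2"
proof -
  note ips = hilbert_ips[OF V]
  define S where "S n = (\<Sum>k<n. (hnorm V (u k))\<^sup>2)" for n
  have "convergent S"
  proof (rule Bseq_mono_convergent)
    show "Bseq S"
      by (rule BseqI'[of _ M]) (use M in \<open>auto simp: S_def sum_nonneg\<close>)
    show "\<forall>m n. m \<le> n \<longrightarrow> S m \<le> S n" unfolding S_def by (auto intro!: sum_mono2)
  qed
  hence C: "Cauchy S" by (simp add: Cauchy_convergent_iff)
  have "hCauchy V (psum V u)"
    unfolding hCauchy_def
  proof (intro allI impI)
    fix e :: real assume e: "e > 0"
    hence "e\<^sup>2 > 0" by simp
    then obtain N where N: "\<And>m n. m \<ge> N \<Longrightarrow> n \<ge> N \<Longrightarrow> norm (S m - S n) < e\<^sup>2"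
      using C unfolding Cauchy_iff by blast
    have main: "hnorm V (hdiff V (psum V u n) (psum V u m)) < e" if "N \<le> m" "m \<le> n" for m n
    proof (rule power_less_imp_less_base)
      show "(hnorm V (hdiff V (psum V u n) (psum V u m)))\<^sup>2 < e\<^sup>2"
        using psum_diff_norm[OF ips u o \<open>m \<le> n\<close>] N[of n m] that unfolding S_def by simp
      show "0 \<le> e" using e by simp
    qed
    show "\<exists>N. \<forall>m\<ge>N. \<forall>n\<ge>N. hnorm V (hdiff V (psum V u m) (psum V u n)) < e"
    proof (intro exI allI impI)
      fix m n assume "m \<ge> N" "n \<ge> N"
      then show "hnorm V (hdiff V (psum V u m) (psum V u n)) < e"
        using main[of m n] main[of n m] hnorm_diff_commute[of V "psum V u m" "psum V u n"] u
        by (cases "m \<le> n") (auto simp: ips)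
    qed
  qed
  then obtain \<psi> where \<psi>: "\<psi> \<in> hcarrier V" and t: "htendsto V (psum V u) \<psi> sequentially"
    using hilbert_complete[OF V, of "psum V u"] ips u by auto
  have ev: "\<forall>\<^sub>F n in sequentially. psum V u n \<in> hcarrier V" using ips u by simp
  show ?thesis
  proof
    fix z assume z: "z \<in> hcarrier V"
    show "(\<lambda>n. \<Sum>k<n. hinner V (u k) z) \<longlonglongrightarrow> hinner V \<psi> z"
      using htendsto_inner_left[OF ips ev \<psi> z t] by (simp add: hinner_psum(1)[OF ips u z])
  next
    have "(\<lambda>n. (hnorm V (psum V u n))\<^sup>2) \<longlonglongrightarrow> (hnorm V \<psi>)\<^sup>2"
      by (intro tendsto_intros htendsto_norm[OF ips ev \<psi> t])
    moreover have "(hnorm V (psum V u n))\<^sup>2 = (\<Sum>k<n. (hnorm V (u k))\<^sup>2)" for n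
      using psum_orthogonal_inner(1)[OF ips, where u = u and m = n and n = n] o ips u
      by (simp add: hnorm_sq del: of_real_sum)
    ultimately show "(\<lambda>n. \<Sum>k<n. (hnorm V (u k))\<^sup>2) \<longlonglongrightarrow> (hnorm V \<psi>)\<^sup>2" by simp
  qed (use \<psi> t in auto)
qed

subsection \<open>Riesz representation and adjoints\<close>

text \<open>The representing vector minimises \<open>\<parallel>x\<parallel>\<^sup>2 - 2 Re f(x)\<close>; a minimising sequence is Cauchy
  by the parallelogram identity.\<close>

lemma Riesz_representation:
  assumes V: "hilbert_space V" and lin: "\<And>x y. x \<in> hcarrier V \<Longrightarrow> y \<in> hcarrier V \<Longrightarrow> f (hadd V x y) = f x + f y"
    and sc: "\<And>c x. x \<in> hcarrier V \<Longrightarrow> f (hscale V c x) = c * f x"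
    and bd: "\<And>x. x \<in> hcarrier V \<Longrightarrow> cmod (f x) \<le> C * hnorm V x"
  shows "\<exists>y\<in>hcarrier V. \<forall>x\<in>hcarrier V. f x = hinner V x y"
proof -
  note ips [simp] = hilbert_ips[OF V]
  define Q where "Q x = (hnorm V x)\<^sup>2 - 2 * Re (f x)" for x
  have lb: "- (C\<^sup>2) \<le> Q x" if x: "x \<in> hcarrier V" for x
  proof -
    have "Re (f x) \<le> C * hnorm V x" using bd[OF x] complex_Re_le_cmod[of "f x"] by linarith
    moreover have "0 \<le> (hnorm V x - C)\<^sup>2" by simp
    ultimately show ?thesis unfolding Q_def by (simp add: power2_diff algebra_simps)
  qed
  define I where "I = (INF x\<in>hcarrier V. Q x)"
  have bdd: "bdd_below (Q ` hcarrier V)" using lb by (auto intro!: bdd_belowI[of _ "- (C\<^sup>2)"])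
  have ne: "hcarrier V \<noteq> {}" using hzero_in[OF ips] by blast
  have I: "I \<le> Q x" if "x \<in> hcarrier V" for x unfolding I_def by (rule cINF_lower[OF bdd that])
  have "\<forall>n. \<exists>x\<in>hcarrier V. Q x < I + inverse (real (Suc n))"
  proof
    fix n :: nat
    have "I < I + inverse (real (Suc n))" by simp
    thus "\<exists>x\<in>hcarrier V. Q x < I + inverse (real (Suc n))"
      unfolding I_def using cINF_less_iff[OF ne bdd] by blast
  qed
  then obtain s where s: "\<And>n. s n \<in> hcarrier V" and sQ: "\<And>n. Q (s n) < I + inverse (real (Suc n))"
    by metis
  (* The parallelogram identity at the midpoint: vectors that nearly minimise Q are close. *)
  have par: "(hnorm V (hdiff V x y))\<^sup>2 \<le> 2 * (Q x - I) + 2 * (Q y - I)"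
    if x: "x \<in> hcarrier V" and y: "y \<in> hcarrier V" for x y
  proof -
    let ?m = "hscale V (1/2) (hadd V x y)"
    have "I \<le> Q ?m" using x y by (intro I) simp
    also have "Q ?m = Re (hinner V x x + hinner V y y + hinner V x y + hinner V y x) / 4 - Re (f x) - Re (f y)"
    proof -
      have 1: "f ?m = 1/2 * (f x + f y)" using x y lin sc by simp
      have 2: "(hnorm V ?m)\<^sup>2 = Re (hinner V ?m ?m)" using x y by (intro hnorm_sq) auto
      have 3: "hinner V ?m ?m = 1/4 * (hinner V x x + hinner V y y + hinner V x y + hinner V y x)"
        using x y by (simp add: field_simps)
      show ?thesis unfolding Q_def 1 2 3 by (simp add: add_divide_distrib)
    qed
    finally have "4 * I \<le> Re (hinner V x x + hinner V y y + hinner V x y + hinner V y x) - 4 * Re (f x) - 4 * Re (f y)"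
      by linarith
    moreover have "(hnorm V (hdiff V x y))\<^sup>2 = Re (hinner V x x + hinner V y y - hinner V x y - hinner V y x)"
      using x y by (simp add: hnorm_sq algebra_simps)
    ultimately show ?thesis unfolding Q_def using x y by (simp add: hnorm_sq)
  qed
  have "hCauchy V s"
    unfolding hCauchy_def
  proof (intro allI impI)
    fix e :: real assume e: "e > 0"
    hence "e\<^sup>2 / 4 > 0" by simp
    then obtain N where N: "inverse (real (Suc N)) < e\<^sup>2 / 4" using reals_Archimedean by blast
    show "\<exists>N. \<forall>m\<ge>N. \<forall>n\<ge>N. hnorm V (hdiff V (s m) (s n)) < e"
    proof (intro exI allI impI)
      fix m n assume mn: "m \<ge> N" "n \<ge> N"
      have sm: "Q (s k) - I < e\<^sup>2 / 4" if "k \<ge> N" for k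
      proof -
        have "inverse (real (Suc k)) \<le> inverse (real (Suc N))" using that by simp
        thus ?thesis using sQ[of k] N by linarith
      qed
      have "(hnorm V (hdiff V (s m) (s n)))\<^sup>2 < e\<^sup>2"
        using par[OF s s, of m n] sm[OF mn(1)] sm[OF mn(2)] by simp
      thus "hnorm V (hdiff V (s m) (s n)) < e" using e power_less_imp_less_base by fastforce
    qed
  qed
  then obtain y where y: "y \<in> hcarrier V" and t: "htendsto V s y sequentially"
    using hilbert_complete[OF V, of s] s by blast
  have ev: "\<forall>\<^sub>F n in sequentially. s n \<in> hcarrier V" using s by simp
  have fd: "f (hdiff V x z) = f x - f z" if "x \<in> hcarrier V" "z \<in> hcarrier V" for x z
    using that lin[of x "hscale V (-1) z"] sc[of z "-1"] by (simp add: hdiff_def)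
  have ft: "(\<lambda>n. f (s n)) \<longlonglongrightarrow> f y"
  proof (rule Lim_null[THEN iffD2], rule Lim_null_comparison)
    show "\<forall>\<^sub>F n in sequentially. norm (f (s n) - f y) \<le> C * hnorm V (hdiff V (s n) y)"
      using bd[of "hdiff V (s _) y"] fd[OF s y] s y by simp
    show "(\<lambda>n. C * hnorm V (hdiff V (s n) y)) \<longlonglongrightarrow> 0"
      using tendsto_mult_right_zero[OF t[unfolded htendsto_def]] by simp
  qed
  have Qt: "(\<lambda>n. Q (s n)) \<longlonglongrightarrow> Q y" unfolding Q_def
    by (intro tendsto_intros ft htendsto_norm[OF ips ev y t])
  have Qy: "Q y \<le> I"
  proof (rule LIMSEQ_le[OF Qt])
    show "(\<lambda>n. I + inverse (real (Suc n))) \<longlonglongrightarrow> I"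
      using LIMSEQ_inverse_real_of_nat_add by simp
    show "\<exists>N. \<forall>n\<ge>N. Q (s n) \<le> I + inverse (real (Suc n))" using sQ less_imp_le by blast
  qed
  (* The first variation of Q at its minimum y in direction x vanishes. *)
  have key: "Re (hinner V x y) = Re (f x)" if x: "x \<in> hcarrier V" for x
  proof -
    define a where "a = (hnorm V x)\<^sup>2"
    define b where "b = Re (hinner V x y) - Re (f x)"
    have "0 \<le> t\<^sup>2 * a + 2 * t * b" for t :: real
    proof -
      let ?z = "hadd V y (hscale V (of_real t) x)"
      have "I \<le> Q ?z" using x y by (intro I) simp
      moreover have "Q ?z = Q y + t\<^sup>2 * a + 2 * t * b"
      proof -
        have "(hnorm V ?z)\<^sup>2 = (hnorm V y)\<^sup>2 + t * Re (hinner V y x) + t * Re (hinner V x y) + t\<^sup>2 * a"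
          unfolding a_def using x y by (simp add: hnorm_sq algebra_simps) (simp add: power2_eq_square)
        moreover have "Re (hinner V y x) = Re (hinner V x y)" using hinner_sym[OF ips x y] by simp
        moreover have "f ?z = f y + of_real t * f x" using x y lin sc by simp
        ultimately show ?thesis unfolding Q_def b_def by (simp add: algebra_simps)
      qed
      ultimately show ?thesis using Qy by simp
    qed
    note quad = this
    have "b = 0"
    proof (rule ccontr)
      assume b: "b \<noteq> 0"
      (* The minimiser of the quadratic is - b / a; with a + 1 the case a = 0 is covered too. *)
      define t where "t = - b / (a + 1)"
      have a1: "a + 1 > 0" unfolding a_def by (simp add: add_nonneg_pos)
      have bt: "b = - t * (a + 1)" using a1 by (simp add: t_def)
      have "t\<^sup>2 * a + 2 * t * b = - (t\<^sup>2 * (a + 2))"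
        unfolding bt by (simp add: power2_eq_square algebra_simps)
      moreover have "t\<^sup>2 * (a + 2) > 0" using b a1 by (simp add: t_def)
      ultimately show False using quad[of t] by linarith
    qed
    thus ?thesis by (simp add: b_def)
  qed
  have "f x = hinner V x y" if x: "x \<in> hcarrier V" for x
  proof (rule complex_eqI)
    show "Re (f x) = Re (hinner V x y)" using key[OF x] by simp
    show "Im (f x) = Im (hinner V x y)"
      using key[of "hscale V (-\<i>) x"] sc[OF x, of "-\<i>"] x y by simp
  qed
  thus ?thesis using y by blast
qed

text \<open>The Riesz representation of the functionals \<open>x \<mapsto> \<langle>T x, y\<rangle>\<close>.\<close>

lemma adjoint_exists:
  assumes V: "hilbert_space V" and W: "inner_product_space W"
    and T: "\<And>x. x \<in> hcarrier V \<Longrightarrow> T x \<in> hcarrier W" "hlinear V (hcarrier V) W T"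
    and bd: "\<And>x. x \<in> hcarrier V \<Longrightarrow> hnorm W (T x) \<le> C * hnorm V x"
  shows "\<exists>S. \<forall>y\<in>hcarrier W. S y \<in> hcarrier V \<and> (\<forall>x\<in>hcarrier V. hinner W (T x) y = hinner V x (S y))"
proof -
  have "\<exists>s\<in>hcarrier V. \<forall>x\<in>hcarrier V. hinner W (T x) y = hinner V x s" if y: "y \<in> hcarrier W" for y
  proof (rule Riesz_representation[OF V, of "\<lambda>x. hinner W (T x) y" "C * hnorm W y"])
    fix x assume x: "x \<in> hcarrier V"
    have "cmod (hinner W (T x) y) \<le> hnorm W (T x) * hnorm W y"
      using Cauchy_Schwarz[OF W T(1) y] x by simp
    also have "\<dots> \<le> C * hnorm V x * hnorm W y"
      by (rule mult_right_mono) (use bd[OF x] W y in auto)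
    finally show "cmod (hinner W (T x) y) \<le> C * hnorm W y * hnorm V x" by (simp add: mult_ac)
  qed (use T W y in \<open>auto simp: hlinear_def\<close>)
  thus ?thesis by metis
qed

text \<open>The defining identity of an adjoint determines its values, so it forces linearity, and
  testing it against the value itself bounds this value.\<close>

lemma adjoint_linear:
  assumes V: "inner_product_space V" and W: "inner_product_space W"
    and T: "\<And>x. x \<in> hcarrier V \<Longrightarrow> T x \<in> hcarrier W"
    and S: "\<And>y. y \<in> hcarrier W \<Longrightarrow> S y \<in> hcarrier V"
    and a: "\<And>x y. x \<in> hcarrier V \<Longrightarrow> y \<in> hcarrier W \<Longrightarrow> hinner W (T x) y = hinner V x (S y)"
  shows "hlinear W (hcarrier W) V S"
proof -
  have a': "hinner V (S y) x = hinner W y (T x)" if "x \<in> hcarrier V" "y \<in> hcarrier W" for x y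
    using a[OF that] hinner_sym[OF V that(1) S[OF that(2)]] hinner_sym[OF W T[OF that(1)] that(2)] by simp
  show ?thesis
    unfolding hlinear_def
  proof (intro conjI ballI allI)
    fix x y assume "x \<in> hcarrier W" "y \<in> hcarrier W"
    then show "S (hadd W x y) = hadd V (S x) (S y)"
      by (intro vector_eqI[OF V]) (use V W S T in \<open>auto simp: a'\<close>)
  next
    fix c x assume "x \<in> hcarrier W"
    then show "S (hscale W c x) = hscale V c (S x)"
      by (intro vector_eqI[OF V]) (use V W S T in \<open>auto simp: a'\<close>)
  qed
qed

lemma adjoint_bound:
  assumes V: "inner_product_space V" and W: "inner_product_space W"
    and T: "\<And>x. x \<in> hcarrier V \<Longrightarrow> T x \<in> hcarrier W" and y: "y \<in> hcarrier W" and s: "s \<in> hcarrier V"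
    and bd: "\<And>x. x \<in> hcarrier V \<Longrightarrow> hnorm W (T x) \<le> C * hnorm V x" and C: "C \<ge> 0"
    and a: "\<And>x. x \<in> hcarrier V \<Longrightarrow> hinner W (T x) y = hinner V x s"
  shows "hnorm V s \<le> C * hnorm W y"
proof (cases "hnorm V s = 0")
  case True
  then show ?thesis using C W y by simp
next
  case False
  hence pos: "hnorm V s > 0" using hnorm_ge0[OF V s] by linarith
  have "(hnorm V s)\<^sup>2 = Re (hinner W (T s) y)" using a[OF s] hnorm_sq[OF V s] by simp
  also have "\<dots> \<le> hnorm W (T s) * hnorm W y"
    using Cauchy_Schwarz[OF W T[OF s] y] complex_Re_le_cmod[of "hinner W (T s) y"] by linarith
  also have "\<dots> \<le> (C * hnorm V s) * hnorm W y"
    by (rule mult_right_mono) (use bd[OF s] W y in auto)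
  finally have "hnorm V s * hnorm V s \<le> hnorm V s * (C * hnorm W y)"
    by (simp add: power2_eq_square mult_ac)
  thus ?thesis using pos by simp
qed

section \<open>Graded star algebras and their positive characters\<close>

interpretation scaleC_vs: vector_space "scaleC :: complex \<Rightarrow> 'a \<Rightarrow> 'a::star_algebra"
  by (rule vector_space_scaleC)

lemma star_zero [simp]: "star (0::'a::star_algebra) = 0"
proof -
  have "star (0::'a) + star 0 = star 0 + 0" by (simp flip: star_add)
  thus ?thesis by (simp only: add_left_cancel)
qed

lemma star_one [simp]: "star (1::'a::star_algebra) = 1"
proof -
  have "star (star (1::'a) * 1) = star 1 * 1" by (simp only: star_mult star_star)
  thus ?thesis by (simp add: star_star)
qed

text \<open>The standing hypotheses on the algebra; a character, its orbit and the countability of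
  the group enter later.\<close>

locale graded =
  fixes A :: "'g::group_add \<Rightarrow> 'a::star_algebra set"
  assumes graded: "graded_star_algebra A"
    and comm: "\<And>x y. x \<in> A 0 \<Longrightarrow> y \<in> A 0 \<Longrightarrow> x * y = y * x"
    and Cauchy_eq: "\<And>\<psi> g c d. \<psi> \<in> pos_characters A \<Longrightarrow> c \<in> A g \<Longrightarrow> d \<in> A g \<Longrightarrow>
           \<psi> (star c * d) * \<psi> (star d * c) = \<psi> (star c * c) * \<psi> (star d * d)"
begin

lemma
  shows subspace_A: "csubspace (A g)"
    and A_mult: "x \<in> A g \<Longrightarrow> y \<in> A h \<Longrightarrow> x * y \<in> A (g + h)"
    and A_star: "x \<in> A g \<Longrightarrow> star x \<in> A (- g)"
    and ex_decomposition: "\<exists>!f. is_decomposition A a f"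
  using graded unfolding graded_star_algebra_def by blast+

lemma
  shows A_zero [simp]: "0 \<in> A g"
    and A_add: "x \<in> A g \<Longrightarrow> y \<in> A g \<Longrightarrow> x + y \<in> A g"
    and A_scale: "x \<in> A g \<Longrightarrow> c *\<^sub>C x \<in> A g"
    and A_diff: "x \<in> A g \<Longrightarrow> y \<in> A g \<Longrightarrow> x - y \<in> A g"
  using subspace_A[of g]
  by (simp_all add: scaleC_vs.subspace_0 scaleC_vs.subspace_add scaleC_vs.subspace_scale
      scaleC_vs.subspace_diff)

lemma decomposition: "is_decomposition A a (component A a)"
  unfolding component_def by (rule theI'[OF ex_decomposition])

lemma component_eqI:
  assumes "finite S" "\<And>g. f g \<in> A g" "\<And>g. g \<notin> S \<Longrightarrow> f g = 0" "a = (\<Sum>g\<in>S. f g)"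
  shows "component A a = f"
proof -
  have sub: "{g. f g \<noteq> 0} \<subseteq> S" using assms(3) by auto
  have "a = (\<Sum>g | f g \<noteq> 0. f g)"
    unfolding assms(4) by (rule sum.mono_neutral_right[OF assms(1) sub]) auto
  hence "is_decomposition A a f"
    using assms(2) finite_subset[OF sub assms(1)] by (simp add: is_decomposition_def)
  thus ?thesis using decomposition ex_decomposition by blast
qed

lemma component_in: "component A a g \<in> A g"
  and component_finite: "finite {g. component A a g \<noteq> 0}"
  and component_sum: "a = (\<Sum>g | component A a g \<noteq> 0. component A a g)"
  using decomposition[of a] by (simp_all add: is_decomposition_def)

lemma component_sum_superset:
  "finite S \<Longrightarrow> {g. component A a g \<noteq> 0} \<subseteq> S \<Longrightarrow> a = (\<Sum>g\<in>S. component A a g)"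
  by (subst component_sum) (rule sum.mono_neutral_left, auto)

lemma component_homogeneous: "a \<in> A g \<Longrightarrow> component A a = (\<lambda>k. if k = g then a else 0)"
  by (rule component_eqI[of "{g}"]) auto

lemma component_add: "component A (a + b) = (\<lambda>g. component A a g + component A b g)"
proof (rule component_eqI)
  let ?S = "{g. component A a g \<noteq> 0} \<union> {g. component A b g \<noteq> 0}"
  show fin: "finite ?S" using component_finite by simp
  show "a + b = (\<Sum>g\<in>?S. component A a g + component A b g)"
    using component_sum_superset[OF fin, of a] component_sum_superset[OF fin, of b]
    by (simp add: sum.distrib)
qed (auto intro: A_add component_in)

lemma component_scale: "component A (c *\<^sub>C a) = (\<lambda>g. c *\<^sub>C component A a g)"
  by (rule component_eqI[OF component_finite[of a]])
    (auto intro: A_scale component_in simp flip: scaleC_vs.scale_sum_right component_sum)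

lemma graded_induct [case_names homogeneous add]:
  assumes "\<And>g a. a \<in> A g \<Longrightarrow> P a" "\<And>a b. P a \<Longrightarrow> P b \<Longrightarrow> P (a + b)"
  shows "P a"
proof -
  have "P (\<Sum>g\<in>S. component A a g)" if "finite S" for S
    using that by induction (auto intro: assms component_in assms(1)[OF A_zero[of 0]])
  thus ?thesis using component_finite component_sum[of a] by metis
qed

lemma grade_proj_superset:
  "finite S \<Longrightarrow> {g. component A a g \<noteq> 0} \<subseteq> S \<Longrightarrow>
    grade_proj A H a = (\<Sum>g\<in>S. if g \<in> H then component A a g else 0)"
  unfolding grade_proj_def
  by (rule sum.mono_neutral_cong_left) auto

lemma grade_proj_add: "grade_proj A H (a + b) = grade_proj A H a + grade_proj A H b"
proof -
  let ?S = "{g. component A a g \<noteq> 0} \<union> {g. component A b g \<noteq> 0}"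
  have fin: "finite ?S" using component_finite by simp
  have "{g. component A (a + b) g \<noteq> 0} \<subseteq> ?S" by (auto simp: component_add)
  from grade_proj_superset[OF fin this, of H] show ?thesis
    unfolding grade_proj_superset[OF fin Un_upper1, of H] grade_proj_superset[OF fin Un_upper2, of H]
    by (auto simp: component_add sum.distrib[symmetric] intro!: sum.cong)
qed

lemma grade_proj_scale: "grade_proj A H (c *\<^sub>C a) = c *\<^sub>C grade_proj A H a"
proof -
  have "{g. component A (c *\<^sub>C a) g \<noteq> 0} \<subseteq> {g. component A a g \<noteq> 0}"
    by (auto simp: component_scale)
  from grade_proj_superset[OF component_finite this]
  show ?thesis unfolding grade_proj_superset[OF component_finite order_refl, of H a]
    by (auto simp: component_scale scaleC_vs.scale_sum_right intro!: sum.cong)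
qed

lemma grade_proj_homogeneous: "a \<in> A g \<Longrightarrow> grade_proj A H a = (if g \<in> H then a else 0)"
  by (subst grade_proj_superset[of "{g}"]) (auto simp: component_homogeneous)

lemma subgrading_homogeneous: "a \<in> A g \<Longrightarrow> g \<in> H \<Longrightarrow> a \<in> subgrading A H"
  by (auto simp: subgrading_def component_homogeneous)

lemma subgrading_zero [simp]: "0 \<in> subgrading A H"
  using component_homogeneous[OF A_zero] by (auto simp: subgrading_def)

lemma subgrading_add: "a \<in> subgrading A H \<Longrightarrow> b \<in> subgrading A H \<Longrightarrow> a + b \<in> subgrading A H"
  by (auto simp: subgrading_def component_add) (metis add.right_neutral)

lemma subgrading_sum: "(\<And>i. i \<in> I \<Longrightarrow> f i \<in> subgrading A H) \<Longrightarrow> sum f I \<in> subgrading A H"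
  by (induction I rule: infinite_finite_induct) (auto intro: subgrading_add)

lemma grade_proj_in: "grade_proj A H a \<in> subgrading A H"
  unfolding grade_proj_def by (rule subgrading_sum) (auto intro: subgrading_homogeneous component_in)

lemma subgrading_induct [consumes 2, case_names homogeneous add]:
  assumes "a \<in> subgrading A H" "H \<noteq> {}" "\<And>g a. g \<in> H \<Longrightarrow> a \<in> A g \<Longrightarrow> P a"
    and "\<And>a b. a \<in> subgrading A H \<Longrightarrow> b \<in> subgrading A H \<Longrightarrow> P a \<Longrightarrow> P b \<Longrightarrow> P (a + b)"
  shows "P a"
proof -
  have "P (\<Sum>g\<in>S. component A a g) \<and> (\<Sum>g\<in>S. component A a g) \<in> subgrading A H"
    if "finite S" "S \<subseteq> {g. component A a g \<noteq> 0}" for S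
    using that
  proof induction
    case empty
    obtain h where "h \<in> H" using assms(2) by blast
    then show ?case using assms(3)[OF _ A_zero] by auto
  next
    case (insert g S)
    then have "g \<in> H" using assms(1) by (auto simp: subgrading_def)
    then show ?case using insert
      by (auto intro!: assms(4) assms(3)[OF _ component_in] subgrading_add
          subgrading_homogeneous[OF component_in])
  qed
  from this[OF component_finite order_refl] component_sum[of a] show ?thesis by simp
qed

text \<open>The degree \<open>0\<close> part of \<open>1\<close> is a right unit for homogeneous elements, hence equal to \<open>1\<close>.\<close>

lemma A_one [simp]: "1 \<in> A 0"
proof -
  define e where "e = component A 1"
  have e: "e g \<in> A g" for g unfolding e_def by (rule component_in)
  have fin: "finite {g. e g \<noteq> 0}" unfolding e_def by (rule component_finite)
  have one: "1 = (\<Sum>g | e g \<noteq> 0. e g)" unfolding e_def by (rule component_sum)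
  have "a * e 0 = a" for a
  proof (induction a rule: graded_induct)
    case (homogeneous h a)
    have "component A a = (\<lambda>g. a * e (- h + g))"
    proof (rule component_eqI)
      show "finite ((+) h ` {g. e g \<noteq> 0})" using fin by simp
      show "a * e (- h + g) \<in> A g" for g
        using A_mult[OF homogeneous e, of "- h + g"] by (simp add: add.assoc[symmetric])
      show "a * e (- h + g) = 0" if "g \<notin> (+) h ` {g. e g \<noteq> 0}" for g
      proof -
        have "g = h + (- h + g)" by (simp add: add.assoc[symmetric])
        hence "e (- h + g) = 0" using that by (metis (mono_tags, lifting) image_eqI mem_Collect_eq)
        thus ?thesis by simp
      qed
      have "a = a * (\<Sum>g | e g \<noteq> 0. e g)" using one by simp
      also have "\<dots> = (\<Sum>g\<in>(+) h ` {g. e g \<noteq> 0}. a * e (- h + g))"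
        by (subst sum.reindex) (auto simp: sum_distrib_left inj_on_def add.assoc[symmetric])
      finally show "a = (\<Sum>g\<in>(+) h ` {g. e g \<noteq> 0}. a * e (- h + g))" .
    qed
    from fun_cong[OF this, of h] show ?case using component_homogeneous[OF homogeneous] by simp
  qed (simp add: distrib_right)
  from this[of 1] e[of 0] show ?thesis by simp
qed

lemma A0_mult: "x \<in> A 0 \<Longrightarrow> y \<in> A g \<Longrightarrow> x * y \<in> A g"
  and A0_star: "x \<in> A 0 \<Longrightarrow> star x \<in> A 0"
  and A0_star_mult: "x \<in> A g \<Longrightarrow> y \<in> A g \<Longrightarrow> star x * y \<in> A 0"
  and A0_mult_star: "x \<in> A g \<Longrightarrow> y \<in> A g \<Longrightarrow> x * star y \<in> A 0"
  using A_mult[of x 0 y g] A_mult[of x g y 0] A_star[of x 0] A_mult[of "star x" "- g" y g]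
    A_mult[of x g "star y" "- g"] A_star[of x g] A_star[of y g] by auto

lemma subgrading_one [simp]: "0 \<in> H \<Longrightarrow> 1 \<in> subgrading A H"
  by (rule subgrading_homogeneous[OF A_one])

subsection \<open>Positive characters and the partial action\<close>

lemma
  assumes "\<psi> \<in> pos_characters A"
  shows char_add: "x \<in> A 0 \<Longrightarrow> y \<in> A 0 \<Longrightarrow> \<psi> (x + y) = \<psi> x + \<psi> y"
    and char_scale: "x \<in> A 0 \<Longrightarrow> \<psi> (c *\<^sub>C x) = c * \<psi> x"
    and char_mult: "x \<in> A 0 \<Longrightarrow> y \<in> A 0 \<Longrightarrow> \<psi> (x * y) = \<psi> x * \<psi> y"
    and char_star: "x \<in> A 0 \<Longrightarrow> \<psi> (star x) = cnj (\<psi> x)"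
    and char_extensional: "\<psi> \<in> extensional (A 0)"
    and char_nontrivial: "\<exists>x\<in>A 0. \<psi> x \<noteq> 0"
  using assms unfolding pos_characters_def characters_def by blast+

lemma char_one: "\<psi> \<in> pos_characters A \<Longrightarrow> \<psi> 1 = 1"
  using char_nontrivial[of \<psi>] char_mult[of \<psi> _ 1] by fastforce

lemma char_diff: "\<psi> \<in> pos_characters A \<Longrightarrow> x \<in> A 0 \<Longrightarrow> y \<in> A 0 \<Longrightarrow> \<psi> (x - y) = \<psi> x - \<psi> y"
  using char_add[of \<psi> "x - y" y] A_diff[of x 0 y] by simp

lemma char_zero: "\<psi> \<in> pos_characters A \<Longrightarrow> \<psi> 0 = 0"
  using char_diff[of \<psi> 0 0] by simp

lemma star_mult_self_squares: "star a * a \<in> sums_of_squares"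
  unfolding sums_of_squares_def by (rule CollectI, rule exI[of _ "[a]"]) simp

lemma char_square: "\<psi> \<in> pos_characters A \<Longrightarrow> a \<in> A g \<Longrightarrow> \<psi> (star a * a) \<in> \<real>\<^sub>\<ge>\<^sub>0"
  using star_mult_self_squares[of a] A0_star_mult[of a g a] unfolding pos_characters_def by blast

lemma char_null:
  assumes "\<psi> \<in> pos_characters A" "a \<in> A g" "c \<in> A g" "\<psi> (star a * a) = 0"
  shows "\<psi> (star a * c) = 0" "\<psi> (star c * a) = 0"
proof -
  have "\<psi> (star c * a) = cnj (\<psi> (star a * c))"
    using char_star[OF assms(1) A0_star_mult[OF assms(2,3)]] by (simp add: star_mult star_star)
  moreover have "\<psi> (star a * c) * \<psi> (star c * a) = 0" using Cauchy_eq[OF assms(1-3)] assms(4) by simp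
  ultimately show "\<psi> (star a * c) = 0" "\<psi> (star c * a) = 0" by auto
qed

lemma char_null_mult:
  assumes "\<psi> \<in> pos_characters A" "a \<in> A g" "b \<in> A 0" "\<psi> (star a * a) = 0"
  shows "\<psi> (star a * b * a) = 0"
  using char_null(1)[OF assms(1,2) A0_mult[OF assms(3,2)] assms(4)] by (simp add: mult.assoc)

text \<open>Commutativity of \<open>A 0\<close> moves \<open>b\<close> past \<open>c c\<^sup>*\<close> and \<open>a a\<^sup>*\<close>; this gives two identities
  relating both sides to \<open>\<psi>(c\<^sup>* b a)\<close>, and \<open>\<psi>(c\<^sup>* a)\<close> can be cancelled unless both sides vanish.\<close>

lemma char_conjugate_indep:
  assumes \<psi>: "\<psi> \<in> pos_characters A" and a: "a \<in> A g" and c: "c \<in> A g" and b: "b \<in> A 0"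
  shows "\<psi> (star a * b * a) * \<psi> (star c * c) = \<psi> (star c * b * c) * \<psi> (star a * a)"
proof -
  note mem = A0_star_mult A0_mult_star A0_mult
  have ba: "b * a \<in> A g" and bc: "b * c \<in> A g" using A0_mult a b c by auto
  have 1: "\<psi> (star c * (b * a)) * \<psi> (star c * c) = \<psi> (star c * (b * c)) * \<psi> (star c * a)"
  proof -
    have "star c * (b * c) * (star c * a) = star c * (b * (c * star c)) * a" by (simp add: mult.assoc)
    also have "\<dots> = star c * c * (star c * (b * a))"
      unfolding comm[OF b A0_mult_star[OF c c]] by (simp add: mult.assoc)
    finally have "star c * (b * c) * (star c * a) = star c * c * (star c * (b * a))" .
    thus ?thesis
      using char_mult[OF \<psi> A0_star_mult[OF c bc] A0_star_mult[OF c a]]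
        char_mult[OF \<psi> A0_star_mult[OF c c] A0_star_mult[OF c ba]] by (simp add: mult.commute)
  qed
  have 2: "\<psi> (star a * (b * a)) * \<psi> (star c * a) = \<psi> (star c * (b * a)) * \<psi> (star a * a)"
  proof -
    have "(star c * (b * a)) * (star a * a) = star c * (b * (a * star a)) * a" by (simp add: mult.assoc)
    also have "\<dots> = (star c * a) * (star a * (b * a))"
      unfolding comm[OF b A0_mult_star[OF a a]] by (simp add: mult.assoc)
    finally have "(star c * a) * (star a * (b * a)) = (star c * (b * a)) * (star a * a)" by simp
    thus ?thesis
      using char_mult[OF \<psi> A0_star_mult[OF c a] A0_star_mult[OF a ba]]
        char_mult[OF \<psi> A0_star_mult[OF c ba] A0_star_mult[OF a a]] by (simp add: mult.commute)
  qed
  show ?thesis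
  proof (cases "\<psi> (star c * a) = 0")
    case False
    have "\<psi> (star a * (b * a)) * \<psi> (star c * c) * \<psi> (star c * a) =
        \<psi> (star c * (b * c)) * \<psi> (star a * a) * \<psi> (star c * a)"
    proof -
      have "\<psi> (star a * (b * a)) * \<psi> (star c * c) * \<psi> (star c * a) =
          (\<psi> (star a * (b * a)) * \<psi> (star c * a)) * \<psi> (star c * c)" by (simp add: mult_ac)
      also have "\<dots> = (\<psi> (star c * (b * a)) * \<psi> (star c * c)) * \<psi> (star a * a)"
        unfolding 2 by (simp add: mult_ac)
      finally show ?thesis unfolding 1 by (simp add: mult_ac)
    qed
    with False show ?thesis by (simp add: mult.assoc)
  next
    case True
    hence "\<psi> (star c * c) * \<psi> (star a * a) = 0" using Cauchy_eq[OF \<psi> c a] by simp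
    thus ?thesis using char_null_mult[OF \<psi> a b] char_null_mult[OF \<psi> c b] by fastforce
  qed
qed

lemma char_act_eq:
  assumes \<psi>: "\<psi> \<in> pos_characters A" and d: "act_defined A g \<psi>" and a: "a \<in> A g" and b: "b \<in> A 0"
  shows "\<psi> (star a * b * a) = char_act A g \<psi> b * \<psi> (star a * a)"
proof -
  define c where "c = (SOME a. a \<in> A g \<and> \<psi> (star a * a) \<noteq> 0)"
  have c: "c \<in> A g" "\<psi> (star c * c) \<noteq> 0"
    using someI_ex[of "\<lambda>a. a \<in> A g \<and> \<psi> (star a * a) \<noteq> 0"] d unfolding c_def act_defined_def by auto
  have "char_act A g \<psi> b = \<psi> (star c * b * c) / \<psi> (star c * c)"
    using b unfolding char_act_def c_def[symmetric] by simp
  hence "char_act A g \<psi> b * \<psi> (star c * c) = \<psi> (star c * b * c)" using c(2) by simp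
  hence "\<psi> (star a * b * a) * \<psi> (star c * c) = (char_act A g \<psi> b * \<psi> (star a * a)) * \<psi> (star c * c)"
    using char_conjugate_indep[OF \<psi> a c(1) b] by (metis mult.assoc mult.commute)
  thus ?thesis using c(2) by simp
qed

lemma act_defined_normalized:
  assumes "\<psi> \<in> pos_characters A" "act_defined A g \<psi>"
  obtains a where "a \<in> A g" "\<psi> (star a * a) = 1"
proof -
  obtain c where c: "c \<in> A g" "\<psi> (star c * c) \<noteq> 0" using assms(2) by (auto simp: act_defined_def)
  obtain r where r: "\<psi> (star c * c) = of_real r" "r \<ge> 0"
    using char_square[OF assms(1) c(1)] by (auto simp: nonneg_Reals_def)
  let ?s = "of_real (1 / sqrt r) :: complex"
  have "\<psi> (star (?s *\<^sub>C c) * (?s *\<^sub>C c)) = ?s * ?s * of_real r"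
    using char_scale[OF assms(1) A0_star_mult[OF c(1,1)], of "?s * ?s"] r
    by (simp add: star_scaleC mult_scaleC_left mult_scaleC_right scaleC_scaleC)
  also have "\<dots> = 1" using r c(2) by (simp flip: of_real_mult add: field_simps)
  finally show ?thesis using that A_scale[OF c(1)] by blast
qed

lemma act_defined_ofI: "a \<in> A g \<Longrightarrow> \<psi> (star a * a) \<noteq> 0 \<Longrightarrow> act_defined A g \<psi>"
  by (auto simp: act_defined_def)

lemma pos_char_eqI:
  assumes "\<psi> \<in> extensional (A 0)" "\<phi> \<in> extensional (A 0)" "\<And>b. b \<in> A 0 \<Longrightarrow> \<psi> b = \<phi> b"
  shows "\<psi> = \<phi>"
  using assms by (rule extensionalityI)

lemma char_act_extensional: "char_act A g \<psi> \<in> extensional (A 0)"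
  by (simp add: char_act_def Let_def)

lemma char_act_pos:
  assumes \<psi>: "\<psi> \<in> pos_characters A" and d: "act_defined A g \<psi>"
  shows "char_act A g \<psi> \<in> pos_characters A"
proof -
  obtain a where a: "a \<in> A g" "\<psi> (star a * a) = 1" using act_defined_normalized[OF assms] .
  have act: "char_act A g \<psi> b = \<psi> (star a * b * a)" if "b \<in> A 0" for b
    using char_act_eq[OF \<psi> d a(1) that] a(2) by simp
  have mem: "star a * b * a \<in> A 0" if "b \<in> A 0" for b
    using A0_star_mult[OF a(1) A0_mult[OF that a(1)]] by (simp add: mult.assoc)
  have "\<psi> (star a * (x * y) * a) = \<psi> (star a * x * a) * \<psi> (star a * y * a)"
    if x: "x \<in> A 0" and y: "y \<in> A 0" for x y
  proof -
    have "(star a * x * a) * (star a * y * a) = star a * (x * (a * star a)) * (y * a)"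
      by (simp add: mult.assoc)
    also have "\<dots> = (star a * a) * (star a * (x * y) * a)"
      unfolding comm[OF x A0_mult_star[OF a(1,1)]] by (simp add: mult.assoc)
    finally have "(star a * x * a) * (star a * y * a) = (star a * a) * (star a * (x * y) * a)" .
    thus ?thesis
      using char_mult[OF \<psi> mem[OF x] mem[OF y]] char_mult[OF \<psi> A0_star_mult[OF a(1,1)] mem[OF A0_mult[OF x y]]] a(2)
      by simp
  qed
  moreover have "\<psi> (star a * b * a) \<in> \<real>\<^sub>\<ge>\<^sub>0" if b: "b \<in> A 0" "b \<in> sums_of_squares" for b
  proof -
    obtain xs where "b = (\<Sum>x\<leftarrow>xs. star x * x)" using b(2) by (auto simp: sums_of_squares_def)
    moreover have "star a * (\<Sum>x\<leftarrow>xs. star x * x) * a = (\<Sum>x\<leftarrow>map (\<lambda>x. x * a) xs. star x * x)"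
      by (induction xs) (auto simp: algebra_simps star_mult)
    ultimately have "star a * b * a = (\<Sum>x\<leftarrow>map (\<lambda>x. x * a) xs. star x * x)" by (simp only:)
    hence "star a * b * a \<in> sums_of_squares" unfolding sums_of_squares_def by blast
    thus ?thesis using \<psi> mem[OF b(1)] by (auto simp: pos_characters_def)
  qed
  moreover have "char_act A g \<psi> 1 \<noteq> 0" using act[OF A_one] a by simp
  moreover have "star a * star x * a = star (star a * x * a)" for x
    by (simp add: star_mult star_star mult.assoc)
  ultimately show ?thesis
    unfolding pos_characters_def characters_def
    using A_one A0_mult[where g = 0]
    by (auto simp: act A_add A_scale A0_star char_act_extensional distrib_left distrib_right
        char_add[OF \<psi>] char_scale[OF \<psi>] char_star[OF \<psi>] mem mult_scaleC_left mult_scaleC_right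
        intro!: bexI[of _ 1])
qed

text \<open>The partial action law, in the two directions in which domains can be compared. If \<open>c\<close>
  of degree \<open>m\<close> and \<open>d\<close> of degree \<open>k + m\<close> are normalized for \<open>\<psi>\<close>, then \<open>d c\<^sup>*\<close> has degree \<open>k\<close>, and conjugating
  \<open>\<psi>\<^sup>m\<close> with it is the same as conjugating \<open>\<psi>\<close> with \<open>d c\<^sup>* c\<close>, hence with \<open>d\<close> because \<open>\<psi>(c\<^sup>* c) = 1\<close>.\<close>

lemma
  assumes \<psi>: "\<psi> \<in> pos_characters A" and m: "act_defined A m \<psi>" and k: "act_defined A (k + m) \<psi>"
  shows act_compose_defined: "act_defined A k (char_act A m \<psi>)"
    and act_compose: "char_act A k (char_act A m \<psi>) = char_act A (k + m) \<psi>"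
proof -
  obtain c where c: "c \<in> A m" "\<psi> (star c * c) = 1" using act_defined_normalized[OF \<psi> m] .
  obtain d where d: "d \<in> A (k + m)" "\<psi> (star d * d) = 1" using act_defined_normalized[OF \<psi> k] .
  have e: "d * star c \<in> A k" using A_mult[OF d(1) A_star[OF c(1)]] by (simp add: add.assoc)
  have act: "char_act A m \<psi> b = \<psi> (star c * b * c)" if "b \<in> A 0" for b
    using char_act_eq[OF \<psi> m c(1) that] c(2) by simp
  have main: "char_act A m \<psi> (star (d * star c) * b * (d * star c)) = char_act A (k + m) \<psi> b"
    if b: "b \<in> A 0" for b
  proof -
    have b': "star d * b * d \<in> A 0" using A0_star_mult[OF d(1) A0_mult[OF b d(1)]] by (simp add: mult.assoc)
    have "char_act A m \<psi> (star (d * star c) * b * (d * star c)) =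
        \<psi> ((star c * c) * (star d * b * d) * (star c * c))"
      using act[OF A0_star_mult[OF e A0_mult[OF b e]]] by (simp add: star_mult star_star mult.assoc)
    also have "\<dots> = \<psi> (star d * b * d)"
      using char_mult[OF \<psi>] A0_star_mult[OF c(1) c(1)] b' A0_mult c(2) by simp
    finally show ?thesis using char_act_eq[OF \<psi> k d(1) b] d(2) by simp
  qed
  have one: "char_act A m \<psi> (star (d * star c) * (d * star c)) = 1"
    using main[OF A_one] char_one[OF char_act_pos[OF \<psi> k]] by simp
  thus def: "act_defined A k (char_act A m \<psi>)" using act_defined_ofI[OF e] by simp
  show "char_act A k (char_act A m \<psi>) = char_act A (k + m) \<psi>"
    using char_act_eq[OF char_act_pos[OF \<psi> m] def e] main one
    by (intro pos_char_eqI char_act_extensional) simp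
qed

lemma act_defined_add:
  assumes \<psi>: "\<psi> \<in> pos_characters A" and m: "act_defined A m \<psi>" and k: "act_defined A k (char_act A m \<psi>)"
  shows "act_defined A (k + m) \<psi>"
proof -
  obtain c where c: "c \<in> A m" "\<psi> (star c * c) = 1" using act_defined_normalized[OF \<psi> m] .
  obtain d where d: "d \<in> A k" "char_act A m \<psi> (star d * d) = 1"
    using act_defined_normalized[OF char_act_pos[OF \<psi> m] k] .
  have "\<psi> (star (d * c) * (d * c)) = 1"
    using char_act_eq[OF \<psi> m c(1) A0_star_mult[OF d(1,1)]] c d by (simp add: star_mult mult.assoc)
  thus ?thesis using act_defined_ofI[OF A_mult[OF d(1) c(1)]] by simp
qed

lemma
  assumes "\<psi> \<in> pos_characters A"
  shows act_zero_defined: "act_defined A 0 \<psi>" and act_zero_eq: "char_act A 0 \<psi> = \<psi>"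
proof -
  show def: "act_defined A 0 \<psi>" using act_defined_ofI[OF A_one, of \<psi>] char_one[OF assms] by simp
  show "char_act A 0 \<psi> = \<psi>"
    using char_act_eq[OF assms def A_one] char_one[OF assms]
    by (intro pos_char_eqI char_act_extensional char_extensional[OF assms]) simp
qed

lemma
  assumes "\<psi> \<in> pos_characters A" "act_defined A k \<psi>"
  shows act_inverse_defined: "act_defined A (- k) (char_act A k \<psi>)"
    and act_inverse: "char_act A (- k) (char_act A k \<psi>) = \<psi>"
  using act_compose_defined[OF assms, of "- k"] act_compose[OF assms, of "- k"]
    act_zero_defined[OF assms(1)] act_zero_eq[OF assms(1)] by auto

lemma act_inject:
  assumes "\<psi> \<in> pos_characters A" "act_defined A k \<psi>" "\<phi> \<in> pos_characters A" "act_defined A k \<phi>"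
    and "char_act A k \<psi> = char_act A k \<phi>"
  shows "\<psi> = \<phi>"
  using act_inverse[OF assms(1,2)] act_inverse[OF assms(3,4)] unfolding assms(5) by (rule trans[OF sym])

text \<open>The degrees that move \<open>\<psi>\<close> to a given point form one left coset of the stabilizer; this is
  what matches degrees modulo the stabilizer with points of the orbit.\<close>

lemma
  assumes \<psi>: "\<psi> \<in> pos_characters A" and g: "act_defined A g \<psi>"
  shows stab_coset: "h \<in> char_stab A \<psi> \<Longrightarrow> act_defined A (g + h) \<psi> \<and> char_act A (g + h) \<psi> = char_act A g \<psi>"
    and stab_coset_conv: "act_defined A k \<psi> \<Longrightarrow> char_act A k \<psi> = char_act A g \<psi> \<Longrightarrow> - g + k \<in> char_stab A \<psi>"
proof -
  assume "h \<in> char_stab A \<psi>"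
  hence h: "act_defined A h \<psi>" "char_act A h \<psi> = \<psi>" by (auto simp: char_stab_def)
  have "act_defined A (g + h) \<psi>" using act_defined_add[OF \<psi> h(1)] g h(2) by simp
  thus "act_defined A (g + h) \<psi> \<and> char_act A (g + h) \<psi> = char_act A g \<psi>"
    using act_compose[OF \<psi> h(1)] h(2) by simp
next
  assume k: "act_defined A k \<psi>" "char_act A k \<psi> = char_act A g \<psi>"
  have "act_defined A (- g) (char_act A k \<psi>)" using act_inverse_defined[OF \<psi> g] k(2) by simp
  hence d: "act_defined A (- g + k) \<psi>" by (rule act_defined_add[OF \<psi> k(1)])
  have "char_act A (- g + k) \<psi> = \<psi>"
    using act_compose[OF \<psi> k(1) d] k(2) act_inverse[OF \<psi> g] by simp
  thus "- g + k \<in> char_stab A \<psi>" using d by (simp add: char_stab_def)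
qed

lemma
  assumes \<psi>: "\<psi> \<in> pos_characters A"
  shows stab_zero: "0 \<in> char_stab A \<psi>"
    and stab_uminus: "h \<in> char_stab A \<psi> \<Longrightarrow> - h \<in> char_stab A \<psi>"
    and stab_add: "h \<in> char_stab A \<psi> \<Longrightarrow> k \<in> char_stab A \<psi> \<Longrightarrow> h + k \<in> char_stab A \<psi>"
proof -
  show z: "0 \<in> char_stab A \<psi>" using act_zero_defined[OF \<psi>] act_zero_eq[OF \<psi>] by (simp add: char_stab_def)
  have d: "- h + k \<in> char_stab A \<psi>" if "h \<in> char_stab A \<psi>" "k \<in> char_stab A \<psi>" for h k
    using that stab_coset_conv[OF \<psi>, of h k] by (simp add: char_stab_def)
  have u: "- h \<in> char_stab A \<psi>" if "h \<in> char_stab A \<psi>" for h using d[OF that z] by simp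
  thus "h \<in> char_stab A \<psi> \<Longrightarrow> - h \<in> char_stab A \<psi>" .
  show "h \<in> char_stab A \<psi> \<Longrightarrow> k \<in> char_stab A \<psi> \<Longrightarrow> h + k \<in> char_stab A \<psi>"
    using d[OF u, of h k] by simp
qed

subsection \<open>Borel sets of characters\<close>

lemma char_topology_open:
  assumes "b \<in> A 0" "open U"
  shows "openin (char_topology A) {\<psi> \<in> pos_characters A. \<psi> b \<in> U}"
  unfolding char_topology_def by (rule topology_generated_by_Basis) (use assms in blast)

lemma char_topology_topspace: "topspace (char_topology A) = pos_characters A"
proof -
  have "pos_characters A = {\<psi> \<in> pos_characters A. \<psi> 1 \<in> UNIV}" by simp
  hence "openin (char_topology A) (pos_characters A)" using char_topology_open[OF A_one open_UNIV] by simp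
  thus ?thesis unfolding char_topology_def topology_generated_by_topspace
    by (auto dest!: openin_subset simp: char_topology_def)
qed

lemma char_borel_sigma: "sigma_algebra (pos_characters A) (char_borel A)"
  unfolding char_borel_def
  by (rule sigma_algebra_sigma_sets) (use openin_subset[of "char_topology A"] char_topology_topspace in blast)

lemma char_borel_sub: "\<Delta> \<in> char_borel A \<Longrightarrow> \<Delta> \<subseteq> pos_characters A"
  unfolding char_borel_def
  by (rule sigma_sets_into_sp[where A = "{U. openin (char_topology A) U}"])
    (use openin_subset[of "char_topology A"] char_topology_topspace in blast)

text \<open>Points are closed since the topology separates them.\<close>

lemma char_borel_singleton:
  assumes "\<psi> \<in> pos_characters A" shows "{\<psi>} \<in> char_borel A"
proof -
  let ?U = "\<Union>b\<in>A 0. {\<phi> \<in> pos_characters A. \<phi> b \<in> - {\<psi> b}}"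
  have "openin (char_topology A) ?U" by (intro openin_clauses(3) openin_Union) (auto intro!: char_topology_open simp del: Compl_iff)
  hence "?U \<in> char_borel A" unfolding char_borel_def by (intro sigma_sets.Basic) simp
  hence "pos_characters A - ?U \<in> char_borel A" unfolding char_borel_def by (rule sigma_sets.Compl)
  moreover have "pos_characters A - ?U = {\<psi>}"
    using assms by (auto intro!: pos_char_eqI char_extensional)
  ultimately show ?thesis by simp
qed

end

section \<open>Orthogonal decompositions into copies of one Hilbert space\<close>

text \<open>An inner product preserving map is linear, since the defect of linearity has norm \<open>0\<close>.\<close>

lemma isometry_linear:
  assumes V: "inner_product_space V" and W: "inner_product_space W"
    and J: "\<And>v. v \<in> hcarrier V \<Longrightarrow> J v \<in> hcarrier W"
    and i: "\<And>v w. v \<in> hcarrier V \<Longrightarrow> w \<in> hcarrier V \<Longrightarrow> hinner W (J v) (J w) = hinner V v w"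
  shows "hlinear V (hcarrier V) W J"
  unfolding hlinear_def
proof (intro conjI ballI allI)
  fix x y assume xy: "x \<in> hcarrier V" "y \<in> hcarrier V"
  let ?d = "hdiff W (J (hadd V x y)) (hadd W (J x) (J y))"
  have "hinner W ?d ?d = 0" using V W J xy by (simp add: i algebra_simps)
  hence d: "?d = hzero W" using V W J xy by (intro hinner_self_eq0) auto
  show "J (hadd V x y) = hadd W (J x) (J y)"
    by (rule hdiff_eq_zero[OF W _ _ d]) (use V W J xy in auto)
next
  fix c x assume x: "x \<in> hcarrier V"
  let ?d = "hdiff W (J (hscale V c x)) (hscale W c (J x))"
  have "hinner W ?d ?d = 0" using V W J x by (simp add: i algebra_simps)
  hence d: "?d = hzero W" using V W J x by (intro hinner_self_eq0) auto
  show "J (hscale V c x) = hscale W c (J x)"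
    by (rule hdiff_eq_zero[OF W _ _ d]) (use V W J x in auto)
qed

lemma
  assumes "hlinear V (hcarrier V) W T"
  shows hlinear_add: "x \<in> hcarrier V \<Longrightarrow> y \<in> hcarrier V \<Longrightarrow> T (hadd V x y) = hadd W (T x) (T y)"
    and hlinear_scale: "x \<in> hcarrier V \<Longrightarrow> T (hscale V c x) = hscale W c (T x)"
  using assms by (auto simp: hlinear_def)

lemma hlinear_diff:
  "inner_product_space V \<Longrightarrow> hlinear V (hcarrier V) W T \<Longrightarrow> x \<in> hcarrier V \<Longrightarrow> y \<in> hcarrier V \<Longrightarrow>
    T (hdiff V x y) = hdiff W (T x) (T y)"
  by (simp add: hdiff_def hlinear_add hlinear_scale)

lemma hscale_zero_eq:
  "inner_product_space V \<Longrightarrow> x \<in> hcarrier V \<Longrightarrow> hscale V 0 x = hzero V"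
  by (rule vector_eqI) auto

lemma hscale_hzero [simp]: "inner_product_space V \<Longrightarrow> hscale V c (hzero V) = hzero V"
  by (rule vector_eqI) auto

lemma hadd_zero_left [simp]: "inner_product_space V \<Longrightarrow> x \<in> hcarrier V \<Longrightarrow> hadd V (hzero V) x = x"
  by (rule hadd_hzero_left)

lemma hadd_zero_right [simp]: "inner_product_space V \<Longrightarrow> x \<in> hcarrier V \<Longrightarrow> hadd V x (hzero V) = x"
  by (rule vector_eqI) auto

lemma hlinear_zero:
  assumes "inner_product_space V" "inner_product_space W" "hlinear V (hcarrier V) W T"
    "\<And>x. x \<in> hcarrier V \<Longrightarrow> T x \<in> hcarrier W"
  shows "T (hzero V) = hzero W"
  using hlinear_scale[OF assms(3) hzero_in[OF assms(1)], of 0] assms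
  by (simp add: hscale_zero_eq)

text \<open>The last hypothesis says that \<open>\<phi> - u k\<close> is orthogonal to \<open>u k\<close>, so \<open>\<phi>\<close> minus the partial sum
  is orthogonal to the partial sum.\<close>

lemma Bessel_inequality:
  assumes V: "inner_product_space V" and u: "\<And>k::nat. u k \<in> hcarrier V"
    and orth: "\<And>j k. j \<noteq> k \<Longrightarrow> hinner V (u j) (u k) = 0"
    and \<phi>: "\<phi> \<in> hcarrier V" and p: "\<And>k. hinner V (u k) \<phi> = hinner V (u k) (u k)"
  shows "(\<Sum>k<n. (hnorm V (u k))\<^sup>2) \<le> (hnorm V \<phi>)\<^sup>2"
proof -
  let ?s = "psum V u n"
  have s: "?s \<in> hcarrier V" using V u by simp
  have ss: "hinner V ?s ?s = of_real (\<Sum>k<n. (hnorm V (u k))\<^sup>2)"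
    by (rule psum_orthogonal_inner(1)[OF V u orth]) auto
  have s\<phi>: "hinner V ?s \<phi> = of_real (\<Sum>k<n. (hnorm V (u k))\<^sup>2)"
    using V u \<phi> by (simp add: hinner_psum(1) p hinner_self)
  have "hinner V \<phi> ?s = of_real (\<Sum>k<n. (hnorm V (u k))\<^sup>2)"
    using hinner_sym[OF V s \<phi>] unfolding s\<phi> by simp
  hence "(hnorm V (hdiff V \<phi> ?s))\<^sup>2 = (hnorm V \<phi>)\<^sup>2 - (\<Sum>k<n. (hnorm V (u k))\<^sup>2)"
    using V \<phi> s ss s\<phi> by (simp add: hnorm_sq del: of_real_sum)
  thus ?thesis using zero_le_power2[of "hnorm V (hdiff V \<phi> ?s)"] by linarith
qed

locale countable_index =
  fixes X :: "'x set"
  assumes countable_X: "countable X"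
begin

text \<open>Families indexed by the countable set \<open>X\<close> are turned into sequences, with \<open>z\<close> at the
  indices that do not enumerate an element of \<open>X\<close>.\<close>

definition seq_of :: "'b \<Rightarrow> ('x \<Rightarrow> 'b) \<Rightarrow> nat \<Rightarrow> 'b" where
  "seq_of z f k = (if k \<in> to_nat_on X ` X then f (from_nat_into X k) else z)"

lemma seq_of_cases [case_names index none]:
  assumes "\<And>x. x \<in> X \<Longrightarrow> k = to_nat_on X x \<Longrightarrow> P" and "k \<notin> to_nat_on X ` X \<Longrightarrow> P"
  shows P
  using assms by blast

lemma seq_of_to_nat_on [simp]: "x \<in> X \<Longrightarrow> seq_of z f (to_nat_on X x) = f x"
  by (simp add: seq_of_def countable_X)

lemma seq_of_none [simp]: "k \<notin> to_nat_on X ` X \<Longrightarrow> seq_of z f k = z"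
  by (simp add: seq_of_def)

lemma seq_of_single:
  assumes "x \<in> X" "\<And>y. y \<in> X \<Longrightarrow> y \<noteq> x \<Longrightarrow> f y = z"
  shows "seq_of z f = (\<lambda>k. if k = to_nat_on X x then f x else z)"
proof
  fix k show "seq_of z f k = (if k = to_nat_on X x then f x else z)"
    by (rule seq_of_cases[of k]) (use assms in \<open>auto simp: inj_on_eq_iff[OF inj_on_to_nat_on[OF countable_X]]\<close>)
qed

lemma seq_of_eq_iff: "x \<in> X \<Longrightarrow> y \<in> X \<Longrightarrow> to_nat_on X x = to_nat_on X y \<longleftrightarrow> x = y"
  by (simp add: inj_on_eq_iff[OF inj_on_to_nat_on[OF countable_X]])

end

text \<open>The maps \<open>C x\<close> embed \<open>V\<close> isometrically onto mutually orthogonal subspaces that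
  together span a dense subspace of \<open>K\<close>; thus \<open>K\<close> is the \<open>\<ell>\<^sup>2\<close>-sum of copies of \<open>V\<close>.\<close>

locale coordinates = countable_index X
  for K :: "'h hspace" and V :: "'v hspace" and X :: "'x set" and C :: "'x \<Rightarrow> 'v \<Rightarrow> 'h" +
  assumes K: "hilbert_space K" and V: "hilbert_space V"
    and C_in [simp]: "x \<in> X \<Longrightarrow> v \<in> hcarrier V \<Longrightarrow> C x v \<in> hcarrier K"
    and C_inner: "x \<in> X \<Longrightarrow> y \<in> X \<Longrightarrow> v \<in> hcarrier V \<Longrightarrow> w \<in> hcarrier V \<Longrightarrow>
      hinner K (C x v) (C y w) = (if x = y then hinner V v w else 0)"
    and C_total: "\<phi> \<in> hcarrier K \<Longrightarrow> (\<And>x v. x \<in> X \<Longrightarrow> v \<in> hcarrier V \<Longrightarrow> hinner K \<phi> (C x v) = 0) \<Longrightarrow>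
      \<phi> = hzero K"
begin

lemma ipsK [simp]: "inner_product_space K" and ipsV [simp]: "inner_product_space V"
  using K V by simp_all

lemma C_norm [simp]: "x \<in> X \<Longrightarrow> v \<in> hcarrier V \<Longrightarrow> hnorm K (C x v) = hnorm V v"
  by (simp add: hnorm_def C_inner)

lemma C_linear: "x \<in> X \<Longrightarrow> hlinear V (hcarrier V) K (C x)"
  by (rule isometry_linear) (auto simp: C_inner)

text \<open>The adjoint of the isometry \<open>C x\<close>.\<close>

definition coord :: "'x \<Rightarrow> 'h \<Rightarrow> 'v" where
  "coord x = (SOME S. \<forall>\<phi>\<in>hcarrier K. S \<phi> \<in> hcarrier V \<and> (\<forall>v\<in>hcarrier V. hinner K (C x v) \<phi> = hinner V v (S \<phi>)))"

lemma
  assumes "x \<in> X" "\<phi> \<in> hcarrier K"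
  shows coord_in [simp]: "coord x \<phi> \<in> hcarrier V"
    and inner_C_left: "v \<in> hcarrier V \<Longrightarrow> hinner K (C x v) \<phi> = hinner V v (coord x \<phi>)"
    and inner_C_right: "v \<in> hcarrier V \<Longrightarrow> hinner K \<phi> (C x v) = hinner V (coord x \<phi>) v"
proof -
  have "\<exists>S. \<forall>\<phi>\<in>hcarrier K. S \<phi> \<in> hcarrier V \<and> (\<forall>v\<in>hcarrier V. hinner K (C x v) \<phi> = hinner V v (S \<phi>))"
    by (rule adjoint_exists[OF V ipsK _ C_linear[OF assms(1)], of 1]) (use assms(1) in auto)
  hence *: "\<forall>\<phi>\<in>hcarrier K. coord x \<phi> \<in> hcarrier V \<and> (\<forall>v\<in>hcarrier V. hinner K (C x v) \<phi> = hinner V v (coord x \<phi>))"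
    unfolding coord_def by (rule someI_ex)
  thus 1: "coord x \<phi> \<in> hcarrier V" and 2: "v \<in> hcarrier V \<Longrightarrow> hinner K (C x v) \<phi> = hinner V v (coord x \<phi>)"
    using assms(2) by auto
  show "hinner K \<phi> (C x v) = hinner V (coord x \<phi>) v" if "v \<in> hcarrier V"
    using 2[OF that] hinner_sym[OF ipsK C_in[OF assms(1) that] assms(2)] hinner_sym[OF ipsV that 1] by simp
qed

lemma coord_linear: "x \<in> X \<Longrightarrow> hlinear K (hcarrier K) V (coord x)"
  by (rule adjoint_linear[of V K "C x"]) (auto simp: inner_C_left)

lemma coord_eqI: "x \<in> X \<Longrightarrow> \<phi> \<in> hcarrier K \<Longrightarrow> u \<in> hcarrier V \<Longrightarrow>
    (\<And>v. v \<in> hcarrier V \<Longrightarrow> hinner K \<phi> (C x v) = hinner V u v) \<Longrightarrow> coord x \<phi> = u"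
  by (rule vector_eqI[OF ipsV]) (auto simp: inner_C_right)

lemma coord_C: "x \<in> X \<Longrightarrow> y \<in> X \<Longrightarrow> v \<in> hcarrier V \<Longrightarrow> coord x (C y v) = (if x = y then v else hzero V)"
  by (rule coord_eqI) (auto simp: C_inner)

lemma coord_ext:
  assumes "\<phi> \<in> hcarrier K" "\<psi> \<in> hcarrier K" "\<And>x. x \<in> X \<Longrightarrow> coord x \<phi> = coord x \<psi>"
  shows "\<phi> = \<psi>"
proof (rule hdiff_eq_zero[OF ipsK assms(1,2)], rule C_total)
  fix x v assume "x \<in> X" "v \<in> hcarrier V"
  then show "hinner K (hdiff K \<phi> \<psi>) (C x v) = 0" using assms by (simp add: inner_C_right)
qed (use assms in simp)

lemma coord_bound: "x \<in> X \<Longrightarrow> \<phi> \<in> hcarrier K \<Longrightarrow> hnorm V (coord x \<phi>) \<le> hnorm K \<phi>"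
  using adjoint_bound[of V K "C x" \<phi> "coord x \<phi>" 1] by (auto simp: inner_C_left)

subsection \<open>Expansion and synthesis\<close>

text \<open>Every square summable family consists of the coordinates of a vector, the orthogonal sum
  of the vectors \<open>C x (u x)\<close>.\<close>

lemma synthesis:
  assumes u: "\<And>x. x \<in> X \<Longrightarrow> u x \<in> hcarrier V"
    and M: "\<And>n. (\<Sum>k<n. seq_of 0 (\<lambda>x. (hnorm V (u x))\<^sup>2) k) \<le> M"
  obtains \<phi> where "\<phi> \<in> hcarrier K" "\<And>x. x \<in> X \<Longrightarrow> coord x \<phi> = u x"
    "htendsto K (psum K (seq_of (hzero K) (\<lambda>x. C x (u x)))) \<phi> sequentially"
    "(\<lambda>n. \<Sum>k<n. seq_of 0 (\<lambda>x. (hnorm V (u x))\<^sup>2) k) \<longlonglongrightarrow> (hnorm K \<phi>)\<^sup>2"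
proof -
  let ?p = "seq_of (hzero K) (\<lambda>x. C x (u x))"
  have p: "?p k \<in> hcarrier K" for k
    by (rule seq_of_cases[of k]) (use u in auto)
  have inner: "hinner K (?p j) z = seq_of 0 (\<lambda>x. hinner K (C x (u x)) z) j" if "z \<in> hcarrier K" for j z
    by (rule seq_of_cases[of j]) (use that in auto)
  have orth: "hinner K (?p j) (?p k) = 0" if "j \<noteq> k" for j k
    by (rule seq_of_cases[of j]; rule seq_of_cases[of k])
      (use u that in \<open>auto simp: C_inner seq_of_eq_iff\<close>)
  have nrm: "(hnorm K (?p k))\<^sup>2 = seq_of 0 (\<lambda>x. (hnorm V (u x))\<^sup>2) k" for k
    by (rule seq_of_cases[of k]) (use u in auto)
  obtain \<phi> where \<phi>: "\<phi> \<in> hcarrier K" "htendsto K (psum K ?p) \<phi> sequentially"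
    "\<And>z. z \<in> hcarrier K \<Longrightarrow> (\<lambda>n. \<Sum>k<n. hinner K (?p k) z) \<longlonglongrightarrow> hinner K \<phi> z"
    "(\<lambda>n. \<Sum>k<n. (hnorm K (?p k))\<^sup>2) \<longlonglongrightarrow> (hnorm K \<phi>)\<^sup>2"
    by (rule Riesz_Fischer[OF K, of ?p M]) (use p orth M in \<open>simp_all add: nrm\<close>)
  have "coord x \<phi> = u x" if x: "x \<in> X" for x
  proof (rule coord_eqI[OF x \<phi>(1) u[OF x]])
    fix v assume v: "v \<in> hcarrier V"
    have "(\<lambda>k. hinner K (?p k) (C x v)) = (\<lambda>k. if k = to_nat_on X x then hinner V (u x) v else 0)"
    proof -
      have "(\<lambda>k. hinner K (?p k) (C x v)) = seq_of 0 (\<lambda>y. hinner K (C y (u y)) (C x v))"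
        using inner x v by auto
      also have "\<dots> = (\<lambda>k. if k = to_nat_on X x then hinner K (C x (u x)) (C x v) else 0)"
        by (rule seq_of_single[OF x]) (use u x v in \<open>auto simp: C_inner\<close>)
      finally show ?thesis unfolding C_inner[OF x x u[OF x] v] by simp
    qed
    hence *: "(\<lambda>n. \<Sum>k<n. hinner K (?p k) (C x v)) = (\<lambda>n. if to_nat_on X x < n then hinner V (u x) v else 0)"
      by (simp add: fun_eq_iff)
    have "(\<lambda>n. \<Sum>k<n. hinner K (?p k) (C x v)) \<longlonglongrightarrow> hinner V (u x) v"
      unfolding * by (rule tendsto_eventually) (use eventually_gt_at_top in eventually_elim, auto)
    thus "hinner K \<phi> (C x v) = hinner V (u x) v" using LIMSEQ_unique \<phi>(3) x v by (metis C_in)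
  qed
  thus ?thesis using that \<phi> unfolding nrm by blast
qed

definition component_of :: "'h \<Rightarrow> nat \<Rightarrow> 'h" where
  "component_of \<phi> = seq_of (hzero K) (\<lambda>x. C x (coord x \<phi>))"

lemma component_of_in [simp]: "\<phi> \<in> hcarrier K \<Longrightarrow> component_of \<phi> k \<in> hcarrier K"
  unfolding component_of_def by (rule seq_of_cases[of k]) auto

lemma Bessel:
  assumes "\<phi> \<in> hcarrier K"
  shows "(\<Sum>k<n. seq_of 0 (\<lambda>x. (hnorm V (coord x \<phi>))\<^sup>2) k) \<le> (hnorm K \<phi>)\<^sup>2"
proof -
  let ?p = "component_of \<phi>"
  have orth: "hinner K (?p j) (?p k) = 0" if "j \<noteq> k" for j k
    unfolding component_of_def
    by (rule seq_of_cases[of j]; rule seq_of_cases[of k])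
      (use assms that in \<open>auto simp: C_inner seq_of_eq_iff\<close>)
  have nrm: "(hnorm K (?p k))\<^sup>2 = seq_of 0 (\<lambda>x. (hnorm V (coord x \<phi>))\<^sup>2) k" for k
    unfolding component_of_def by (rule seq_of_cases[of k]) (use assms in auto)
  have pin: "hinner K (?p k) \<phi> = hinner K (?p k) (?p k)" for k
    unfolding component_of_def
    by (rule seq_of_cases[of k]) (use assms in \<open>auto simp: C_inner inner_C_left coord_C\<close>)
  show ?thesis
    using Bessel_inequality[OF ipsK component_of_in[OF assms] orth assms pin] unfolding nrm .
qed

text \<open>The vector synthesised from the coordinates of \<open>\<phi>\<close> has the coordinates of \<open>\<phi>\<close>, so it is \<open>\<phi>\<close>.\<close>

lemma
  assumes "\<phi> \<in> hcarrier K"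
  shows expansion: "htendsto K (psum K (component_of \<phi>)) \<phi> sequentially"
    and Parseval: "(\<lambda>n. \<Sum>k<n. seq_of 0 (\<lambda>x. (hnorm V (coord x \<phi>))\<^sup>2) k) \<longlonglongrightarrow> (hnorm K \<phi>)\<^sup>2"
proof -
  obtain \<psi> where \<psi>: "\<psi> \<in> hcarrier K" "\<And>x. x \<in> X \<Longrightarrow> coord x \<psi> = coord x \<phi>"
    "htendsto K (psum K (component_of \<phi>)) \<psi> sequentially"
    "(\<lambda>n. \<Sum>k<n. seq_of 0 (\<lambda>x. (hnorm V (coord x \<phi>))\<^sup>2) k) \<longlonglongrightarrow> (hnorm K \<psi>)\<^sup>2"
    unfolding component_of_def
    by (rule synthesis[of "\<lambda>x. coord x \<phi>" "(hnorm K \<phi>)\<^sup>2"]) (use assms Bessel in auto)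
  moreover have "\<psi> = \<phi>" using coord_ext \<psi> assms by blast
  ultimately show "htendsto K (psum K (component_of \<phi>)) \<phi> sequentially"
    "(\<lambda>n. \<Sum>k<n. seq_of 0 (\<lambda>x. (hnorm V (coord x \<phi>))\<^sup>2) k) \<longlonglongrightarrow> (hnorm K \<phi>)\<^sup>2" by auto
qed

end

text \<open>The image of a vector is synthesised from its transformed coordinates, which stay square
  summable because the operators are uniformly bounded.\<close>

lemma diagonal_operator:
  assumes "coordinates K1 V1 X C1" "coordinates K2 V2 X C2"
    and T: "\<And>x v. x \<in> X \<Longrightarrow> v \<in> hcarrier V1 \<Longrightarrow> T x v \<in> hcarrier V2"
    and lin: "\<And>x. x \<in> X \<Longrightarrow> hlinear V1 (hcarrier V1) V2 (T x)"
    and bd: "\<And>x v. x \<in> X \<Longrightarrow> v \<in> hcarrier V1 \<Longrightarrow> hnorm V2 (T x v) \<le> M * hnorm V1 v" and M: "M \<ge> 0"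
  obtains D where "D \<in> hcarrier K1 \<rightarrow>\<^sub>E hcarrier K2" "hlinear K1 (hcarrier K1) K2 D"
    "\<And>\<phi>. \<phi> \<in> hcarrier K1 \<Longrightarrow> hnorm K2 (D \<phi>) \<le> M * hnorm K1 \<phi>"
    "\<And>x \<phi>. x \<in> X \<Longrightarrow> \<phi> \<in> hcarrier K1 \<Longrightarrow>
        coordinates.coord K2 V2 C2 x (D \<phi>) = T x (coordinates.coord K1 V1 C1 x \<phi>)"
    "\<And>x v. x \<in> X \<Longrightarrow> v \<in> hcarrier V1 \<Longrightarrow> D (C1 x v) = C2 x (T x v)"
proof -
  interpret one: coordinates K1 V1 X C1 by fact
  interpret two: coordinates K2 V2 X C2 by fact
  have "\<exists>\<psi>\<in>hcarrier K2. (\<forall>x\<in>X. two.coord x \<psi> = T x (one.coord x \<phi>)) \<and> hnorm K2 \<psi> \<le> M * hnorm K1 \<phi>"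
    if \<phi>: "\<phi> \<in> hcarrier K1" for \<phi>
  proof -
    have le: "(\<Sum>k<n. one.seq_of 0 (\<lambda>x. (hnorm V2 (T x (one.coord x \<phi>)))\<^sup>2) k) \<le> (M * hnorm K1 \<phi>)\<^sup>2" for n
    proof -
      have "(\<Sum>k<n. one.seq_of 0 (\<lambda>x. (hnorm V2 (T x (one.coord x \<phi>)))\<^sup>2) k)
          \<le> (\<Sum>k<n. M\<^sup>2 * one.seq_of 0 (\<lambda>x. (hnorm V1 (one.coord x \<phi>))\<^sup>2) k)"
      proof (rule sum_mono)
        fix k
        show "one.seq_of 0 (\<lambda>x. (hnorm V2 (T x (one.coord x \<phi>)))\<^sup>2) k
          \<le> M\<^sup>2 * one.seq_of 0 (\<lambda>x. (hnorm V1 (one.coord x \<phi>))\<^sup>2) k"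
          by (rule one.seq_of_cases[of k])
            (use \<phi> T bd in \<open>auto simp flip: power_mult_distrib intro!: power_mono\<close>)
      qed
      also have "\<dots> \<le> M\<^sup>2 * (hnorm K1 \<phi>)\<^sup>2"
        using one.Bessel[OF \<phi>] by (simp add: mult_left_mono flip: sum_distrib_left)
      finally show ?thesis by (simp add: power_mult_distrib)
    qed
    obtain \<psi> where \<psi>: "\<psi> \<in> hcarrier K2" "\<And>x. x \<in> X \<Longrightarrow> two.coord x \<psi> = T x (one.coord x \<phi>)"
      "(\<lambda>n. \<Sum>k<n. one.seq_of 0 (\<lambda>x. (hnorm V2 (T x (one.coord x \<phi>)))\<^sup>2) k) \<longlonglongrightarrow> (hnorm K2 \<psi>)\<^sup>2"
      by (rule two.synthesis[of "\<lambda>x. T x (one.coord x \<phi>)", OF _ le]) (use T \<phi> in auto)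
    have "(hnorm K2 \<psi>)\<^sup>2 \<le> (M * hnorm K1 \<phi>)\<^sup>2"
      by (rule LIMSEQ_le_const2[OF \<psi>(3)]) (use le in auto)
    hence "hnorm K2 \<psi> \<le> M * hnorm K1 \<phi>"
      by (rule power2_le_imp_le) (use M \<phi> in simp)
    thus ?thesis using \<psi> by auto
  qed
  then obtain D0 where D0: "\<And>\<phi>. \<phi> \<in> hcarrier K1 \<Longrightarrow> D0 \<phi> \<in> hcarrier K2"
    "\<And>\<phi> x. \<phi> \<in> hcarrier K1 \<Longrightarrow> x \<in> X \<Longrightarrow> two.coord x (D0 \<phi>) = T x (one.coord x \<phi>)"
    "\<And>\<phi>. \<phi> \<in> hcarrier K1 \<Longrightarrow> hnorm K2 (D0 \<phi>) \<le> M * hnorm K1 \<phi>" by metis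
  define D where "D = restrict D0 (hcarrier K1)"
  have D: "D \<phi> = D0 \<phi>" if "\<phi> \<in> hcarrier K1" for \<phi> using that by (simp add: D_def)
  note tl = hlinear_add[OF two.coord_linear] hlinear_add[OF one.coord_linear]
    hlinear_scale[OF two.coord_linear] hlinear_scale[OF one.coord_linear]
    hlinear_add[OF lin] hlinear_scale[OF lin]
  show ?thesis
  proof (rule that[of D])
    show "D \<in> hcarrier K1 \<rightarrow>\<^sub>E hcarrier K2" using D0(1) by (auto simp: D_def)
    show "hlinear K1 (hcarrier K1) K2 D"
      unfolding hlinear_def
    proof (intro conjI ballI allI)
      fix x y assume "x \<in> hcarrier K1" "y \<in> hcarrier K1"
      then show "D (hadd K1 x y) = hadd K2 (D x) (D y)"
        by (intro two.coord_ext) (auto simp: D D0 tl)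
    next
      fix c x assume "x \<in> hcarrier K1"
      then show "D (hscale K1 c x) = hscale K2 c (D x)"
        by (intro two.coord_ext) (auto simp: D D0 tl)
    qed
    show "D (C1 x v) = C2 x (T x v)" if "x \<in> X" "v \<in> hcarrier V1" for x v
      using that T hlinear_zero[OF one.ipsV two.ipsV lin T]
      by (intro two.coord_ext) (auto simp: D D0 one.coord_C two.coord_C)
  qed (auto simp: D D0)
qed

section \<open>Representations of the stabilizer algebra\<close>

lemma
  assumes "star_rep S \<pi>"
  shows star_rep_hilbert: "hilbert_space (hsp \<pi>)"
    and star_rep_subspace: "hsubspace (hsp \<pi>) (rdom \<pi>)"
    and star_rep_dense: "hdense (hsp \<pi>) (rdom \<pi>)"
    and act_in: "a \<in> S \<Longrightarrow> \<phi> \<in> rdom \<pi> \<Longrightarrow> ract \<pi> a \<phi> \<in> rdom \<pi>"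
    and act_hadd: "a \<in> S \<Longrightarrow> \<phi> \<in> rdom \<pi> \<Longrightarrow> \<psi> \<in> rdom \<pi> \<Longrightarrow>
      ract \<pi> a (hadd (hsp \<pi>) \<phi> \<psi>) = hadd (hsp \<pi>) (ract \<pi> a \<phi>) (ract \<pi> a \<psi>)"
    and act_hscale: "a \<in> S \<Longrightarrow> \<phi> \<in> rdom \<pi> \<Longrightarrow>
      ract \<pi> a (hscale (hsp \<pi>) c \<phi>) = hscale (hsp \<pi>) c (ract \<pi> a \<phi>)"
    and act_add: "a \<in> S \<Longrightarrow> b \<in> S \<Longrightarrow> \<phi> \<in> rdom \<pi> \<Longrightarrow>
      ract \<pi> (a + b) \<phi> = hadd (hsp \<pi>) (ract \<pi> a \<phi>) (ract \<pi> b \<phi>)"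
    and act_scaleC: "a \<in> S \<Longrightarrow> \<phi> \<in> rdom \<pi> \<Longrightarrow> ract \<pi> (c *\<^sub>C a) \<phi> = hscale (hsp \<pi>) c (ract \<pi> a \<phi>)"
    and act_mult: "a \<in> S \<Longrightarrow> b \<in> S \<Longrightarrow> \<phi> \<in> rdom \<pi> \<Longrightarrow> ract \<pi> (a * b) \<phi> = ract \<pi> a (ract \<pi> b \<phi>)"
    and act_adjoint: "a \<in> S \<Longrightarrow> \<phi> \<in> rdom \<pi> \<Longrightarrow> \<psi> \<in> rdom \<pi> \<Longrightarrow>
      hinner (hsp \<pi>) (ract \<pi> a \<phi>) \<psi> = hinner (hsp \<pi>) \<phi> (ract \<pi> (star a) \<psi>)"
  using assms unfolding star_rep_def hlinear_def by (simp_all add: image_subset_iff)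

lemma
  assumes "hsubspace V D"
  shows subspace_carrier: "x \<in> D \<Longrightarrow> x \<in> hcarrier V"
    and subspace_zero: "hzero V \<in> D"
    and subspace_add: "x \<in> D \<Longrightarrow> y \<in> D \<Longrightarrow> hadd V x y \<in> D"
    and subspace_scale: "x \<in> D \<Longrightarrow> hscale V c x \<in> D"
  using assms by (auto simp: hsubspace_def)

lemma subspace_diff: "hsubspace V D \<Longrightarrow> x \<in> D \<Longrightarrow> y \<in> D \<Longrightarrow> hdiff V x y \<in> D"
  by (simp add: hdiff_def subspace_add subspace_scale)

lemma star_rep_mono:
  assumes "star_rep S \<pi>" "S' \<subseteq> S" shows "star_rep S' \<pi>"
  using assms unfolding star_rep_def by (meson subsetD)

text \<open>For each point \<open>x\<close> of the orbit a degree \<open>deg x\<close> moving \<open>\<xi>\<close> to \<open>x\<close> and a normalized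
  element \<open>el x\<close> of this degree are chosen.\<close>

locale orbit = graded A for A :: "'g::group_add \<Rightarrow> 'a::star_algebra set" +
  fixes \<xi> :: "'a \<Rightarrow> complex" and H :: "'g set"
  assumes countable_group: "countable (UNIV :: 'g set)"
    and \<xi>: "\<xi> \<in> pos_characters A"
    and H: "H = char_stab A \<xi>"
begin

abbreviation orb where "orb \<equiv> char_orbit A \<xi>"

definition deg :: "('a \<Rightarrow> complex) \<Rightarrow> 'g" where
  "deg x = (SOME g. act_defined A g \<xi> \<and> char_act A g \<xi> = x)"

definition el :: "('a \<Rightarrow> complex) \<Rightarrow> 'a" where
  "el x = (SOME a. a \<in> A (deg x) \<and> \<xi> (star a * a) = 1)"

lemma countable_orb: "countable orb"
proof -
  have "orb \<subseteq> (\<lambda>g. char_act A g \<xi>) ` UNIV" by (auto simp: char_orbit_def)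
  thus ?thesis using countable_group countable_image countable_subset by metis
qed

lemma
  assumes "x \<in> orb"
  shows deg_defined: "act_defined A (deg x) \<xi>" and deg_act: "char_act A (deg x) \<xi> = x"
    and el_in: "el x \<in> A (deg x)" and el_norm: "\<xi> (star (el x) * el x) = 1"
proof -
  have "\<exists>g. act_defined A g \<xi> \<and> char_act A g \<xi> = x" using assms by (auto simp: char_orbit_def)
  from someI_ex[OF this] show d: "act_defined A (deg x) \<xi>" and "char_act A (deg x) \<xi> = x"
    unfolding deg_def by auto
  have "\<exists>a. a \<in> A (deg x) \<and> \<xi> (star a * a) = 1" using act_defined_normalized[OF \<xi> d] by blast
  from someI_ex[OF this] show "el x \<in> A (deg x)" "\<xi> (star (el x) * el x) = 1"
    unfolding el_def by auto
qed

lemma act_in_orb: "act_defined A g \<xi> \<Longrightarrow> char_act A g \<xi> \<in> orb"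
  by (auto simp: char_orbit_def)

lemma orb_pos: "x \<in> orb \<Longrightarrow> x \<in> pos_characters A"
  using char_act_pos[OF \<xi>] by (auto simp: char_orbit_def)

lemma \<xi>_orb: "\<xi> \<in> orb"
  using act_in_orb[OF act_zero_defined[OF \<xi>]] act_zero_eq[OF \<xi>] by simp

lemma H_zero [simp]: "0 \<in> H" and H_uminus: "h \<in> H \<Longrightarrow> - h \<in> H"
  and H_add: "h \<in> H \<Longrightarrow> k \<in> H \<Longrightarrow> h + k \<in> H"
  using stab_zero[OF \<xi>] stab_uminus[OF \<xi>] stab_add[OF \<xi>] by (auto simp: H)

lemma H_nonempty: "H \<noteq> {}"
  using H_zero by blast

lemma H_add_iff: "h \<in> H \<Longrightarrow> g + h \<in> H \<longleftrightarrow> g \<in> H"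
  using H_add[of g h] H_add[OF _ H_uminus[of h], of "g + h"] by (auto simp: add.assoc)

lemma deg_\<xi>: "deg \<xi> \<in> H"
  using deg_defined[OF \<xi>_orb] deg_act[OF \<xi>_orb] by (simp add: H char_stab_def)

lemma deg_coset:
  assumes "act_defined A g \<xi>" "x = char_act A g \<xi>" shows "- deg x + g \<in> H"
proof -
  have x: "x \<in> orb" using assms act_in_orb by simp
  show ?thesis unfolding H
    by (rule stab_coset_conv[OF \<xi> deg_defined[OF x] assms(1)]) (use deg_act[OF x] assms in simp)
qed

lemma coset_defined:
  assumes "- k + g \<in> H" "act_defined A k \<xi>"
  shows "act_defined A g \<xi>" "char_act A g \<xi> = char_act A k \<xi>"
  using stab_coset[OF \<xi> assms(2) assms(1)[unfolded H]] by (simp_all add: add.assoc[symmetric])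

text \<open>In degree \<open>0\<close> the element \<open>el x (el x)\<^sup>*\<close> is a unit as far as the point \<open>x\<close> is concerned.\<close>

lemma el_unit:
  assumes x: "x \<in> orb" shows "x (el x * star (el x)) = 1"
proof -
  note e = el_in[OF x]
  have "x (el x * star (el x)) = \<xi> (star (el x) * (el x * star (el x)) * el x)"
    using char_act_eq[OF \<xi> deg_defined[OF x] e A0_mult_star[OF e e]] deg_act[OF x] el_norm[OF x] by simp
  also have "\<dots> = \<xi> ((star (el x) * el x) * (star (el x) * el x))" by (simp add: mult.assoc)
  also have "\<dots> = 1" using char_mult[OF \<xi> A0_star_mult[OF e e] A0_star_mult[OF e e]] el_norm[OF x] by simp
  finally show ?thesis .
qed

lemma conjugate_unit:
  assumes g: "act_defined A g \<xi>" and x: "x = char_act A g \<xi>" and d: "d \<in> A g"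
  shows "\<xi> (star d * (el x * star (el x)) * d) = \<xi> (star d * d)"
proof -
  have xo: "x \<in> orb" using g x act_in_orb by simp
  show ?thesis
    using char_act_eq[OF \<xi> g d A0_mult_star[OF el_in[OF xo] el_in[OF xo]]] el_unit[OF xo] x by simp
qed

lemma subgrading_star: "a \<in> subgrading A H \<Longrightarrow> star a \<in> subgrading A H"
proof (induction rule: subgrading_induct[OF _ H_nonempty, consumes 1, case_names homogeneous add])
  case (homogeneous g a)
  then show ?case using A_star H_uminus subgrading_homogeneous by metis
qed (simp add: star_add subgrading_add)

lemma el_star_mult_in:
  assumes "act_defined A g \<xi>" "x = char_act A g \<xi>" "d \<in> A g"
  shows "star (el x) * d \<in> A (- deg x + g)" "star (el x) * d \<in> subgrading A H"
proof -
  have "x \<in> orb" using assms act_in_orb by simp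
  from A_mult[OF A_star[OF el_in[OF this]] assms(3)]
  show 1: "star (el x) * d \<in> A (- deg x + g)" .
  show "star (el x) * d \<in> subgrading A H" by (rule subgrading_homogeneous[OF 1 deg_coset[OF assms(1,2)]])
qed

end

locale stabilizer_rep = orbit A \<xi> H
  for A :: "'g::group_add \<Rightarrow> 'a::star_algebra set" and \<xi> H +
  fixes \<rho> :: "('a, 'v) representation"
  assumes rep: "star_rep (subgrading A H) \<rho>" and multiple: "multiple_of_char A \<xi> \<rho>"
begin

abbreviation V where "V \<equiv> hsp \<rho>"

lemma \<rho>_dom: "rdom \<rho> = hcarrier V"
  using multiple by (simp add: multiple_of_char_def)

lemma V_hilbert: "hilbert_space V" and V_ips [simp]: "inner_product_space V"
  using star_rep_hilbert[OF rep] by simp_all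

lemmas \<rho>_in [simp] = act_in[OF rep, unfolded \<rho>_dom]
  and \<rho>_hadd = act_hadd[OF rep, unfolded \<rho>_dom]
  and \<rho>_hscale = act_hscale[OF rep, unfolded \<rho>_dom]
  and \<rho>_add = act_add[OF rep, unfolded \<rho>_dom]
  and \<rho>_scaleC = act_scaleC[OF rep, unfolded \<rho>_dom]
  and \<rho>_mult = act_mult[OF rep, unfolded \<rho>_dom]
  and \<rho>_adjoint = act_adjoint[OF rep, unfolded \<rho>_dom]

lemma \<rho>_char: "b \<in> A 0 \<Longrightarrow> v \<in> hcarrier V \<Longrightarrow> ract \<rho> b v = hscale V (\<xi> b) v"
  using multiple by (simp add: multiple_of_char_def)

lemma \<rho>_one [simp]: "v \<in> hcarrier V \<Longrightarrow> ract \<rho> 1 v = v"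
  using \<rho>_char[OF A_one] char_one[OF \<xi>] hscale_one[OF V_ips] by simp

lemma \<rho>_zero [simp]: "v \<in> hcarrier V \<Longrightarrow> ract \<rho> 0 v = hzero V"
  using \<rho>_char[OF A_zero] char_zero[OF \<xi>] hscale_zero_eq[OF V_ips] by simp

text \<open>Homogeneous elements act as multiples of isometries, because \<open>c\<^sup>* c\<close> acts as a scalar.\<close>

lemma \<rho>_inner:
  assumes "c \<in> A g" "d \<in> A g" "g \<in> H" "v \<in> hcarrier V" "w \<in> hcarrier V"
  shows "hinner V (ract \<rho> c v) (ract \<rho> d w) = \<xi> (star d * c) * hinner V v w"
proof -
  have s: "c \<in> subgrading A H" "d \<in> subgrading A H" "star d \<in> subgrading A H"
    using subgrading_homogeneous subgrading_star assms by auto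
  have "hinner V (ract \<rho> c v) (ract \<rho> d w) = hinner V (ract \<rho> (star d * c) v) w"
    using s assms \<rho>_adjoint[OF s(3), of "ract \<rho> c v" w] \<rho>_mult[OF s(3,1)] by (simp add: star_star)
  thus ?thesis using \<rho>_char[OF A0_star_mult[OF assms(2,1)]] assms by simp
qed

lemma \<rho>_null:
  assumes "c \<in> A g" "g \<in> H" "\<xi> (star c * c) = 0" "v \<in> hcarrier V"
  shows "ract \<rho> c v = hzero V"
  using \<rho>_inner[OF assms(1,1,2,4,4)] assms subgrading_homogeneous
  by (intro hinner_self_eq0) auto

lemma \<rho>_bounded: "bounded_rep (subgrading A H) \<rho>"
  unfolding bounded_rep_def \<rho>_dom
proof
  fix a assume "a \<in> subgrading A H"
  then show "\<exists>C. \<forall>v\<in>hcarrier V. hnorm V (ract \<rho> a v) \<le> C * hnorm V v"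
    using H_nonempty
  proof (induction rule: subgrading_induct)
    case (homogeneous g a)
    obtain r where r: "\<xi> (star a * a) = of_real r" "r \<ge> 0"
      using char_square[OF \<xi> homogeneous(2)] by (auto simp: nonneg_Reals_def)
    have "hnorm V (ract \<rho> a v) \<le> sqrt r * hnorm V v" if v: "v \<in> hcarrier V" for v
    proof -
      have "Re (hinner V (ract \<rho> a v) (ract \<rho> a v)) = r * Re (hinner V v v)"
        using \<rho>_inner[OF homogeneous(2,2,1) v v] r by simp
      thus ?thesis by (simp add: hnorm_def real_sqrt_mult)
    qed
    then show ?case by blast
  next
    case (add a b)
    then obtain C D where C: "\<And>v. v \<in> hcarrier V \<Longrightarrow> hnorm V (ract \<rho> a v) \<le> C * hnorm V v"
      and D: "\<And>v. v \<in> hcarrier V \<Longrightarrow> hnorm V (ract \<rho> b v) \<le> D * hnorm V v" by blast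
    have "hnorm V (ract \<rho> (a + b) v) \<le> (C + D) * hnorm V v" if v: "v \<in> hcarrier V" for v
      using hnorm_triangle[OF V_ips, of "ract \<rho> a v" "ract \<rho> b v"] C[OF v] D[OF v] v add.hyps
      by (simp add: \<rho>_add algebra_simps)
    then show ?case by blast
  qed
qed

text \<open>Inserting \<open>el x (el x)\<^sup>*\<close> between \<open>b\<^sup>*\<close> and \<open>a\<close> does not change the action, if \<open>a\<close> moves
  \<open>\<xi>\<close> to \<open>x\<close>: the difference \<open>b\<^sup>*(1 - el x (el x)\<^sup>*)a\<close> is null for \<open>\<xi>\<close>.\<close>

lemma \<rho>_insert_unit:
  assumes g: "act_defined A g \<xi>" and x: "x = char_act A g \<xi>" and a: "a \<in> A g" and b: "b \<in> A k"
    and h: "- k + g \<in> H" and v: "v \<in> hcarrier V"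
  shows "ract \<rho> (star b * (el x * star (el x)) * a) v = ract \<rho> (star b * a) v"
proof -
  let ?z = "el x * star (el x)"
  have xo: "x \<in> orb" using g x act_in_orb by simp
  have z: "?z \<in> A 0" by (rule A0_mult_star[OF el_in[OF xo] el_in[OF xo]])
  define y where "y = ?z - 1"
  have y: "y \<in> A 0" using z by (simp add: y_def A_diff)
  have ya: "y * a \<in> A g" by (rule A0_mult[OF y a])
  have xy: "x y = 0"
    using el_unit[OF xo] char_diff[OF orb_pos[OF xo] z A_one] char_one[OF orb_pos[OF xo]] by (simp add: y_def)
  have c: "star b * (y * a) \<in> A (- k + g)" by (rule A_mult[OF A_star[OF b] ya])
  have bb: "b * star b \<in> A 0" by (rule A0_mult_star[OF b b])
  have sy: "star y \<in> A 0" by (rule A0_star[OF y])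
  have "\<xi> (star (star b * (y * a)) * (star b * (y * a))) = \<xi> (star a * (star y * ((b * star b) * y)) * a)"
    by (simp add: star_mult star_star mult.assoc)
  also have "\<dots> = x (star y * ((b * star b) * y)) * \<xi> (star a * a)"
    using char_act_eq[OF \<xi> g a A0_mult[OF sy A0_mult[OF bb y]]] x by simp
  also have "\<dots> = 0"
    using char_mult[OF orb_pos[OF xo] sy A0_mult[OF bb y]] char_mult[OF orb_pos[OF xo] bb y] xy by simp
  finally have "ract \<rho> (star b * (y * a)) v = hzero V" by (rule \<rho>_null[OF c h _ v])
  moreover have "star b * ?z * a = star b * (y * a) + star b * a"
    by (simp add: y_def algebra_simps)
  moreover have "star b * (y * a) \<in> subgrading A H" "star b * a \<in> subgrading A H"
    using subgrading_homogeneous[OF c h] subgrading_homogeneous[OF A_mult[OF A_star[OF b] a] h] by auto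
  ultimately show ?thesis using v by (simp add: \<rho>_add)
qed

lemma \<rho>_undefined_null:
  assumes g: "\<not> act_defined A g \<xi>" and a: "a \<in> A g" and b: "b \<in> A k"
    and h: "- k + g \<in> H" and v: "v \<in> hcarrier V"
  shows "ract \<rho> (star b * a) v = hzero V"
proof (rule \<rho>_null[OF A_mult[OF A_star[OF b] a] h _ v])
  have "\<xi> (star a * a) = 0" using g a by (auto simp: act_defined_def)
  from char_null_mult[OF \<xi> a A0_mult_star[OF b b] this]
  show "\<xi> (star (star b * a) * (star b * a)) = 0" by (simp add: star_mult star_star mult.assoc)
qed

subsection \<open>Every such representation is inducible\<close>

text \<open>The map \<open>a \<otimes> v \<mapsto> part x a v\<close> is the projection of the induced space onto the subspace
  belonging to the point \<open>x\<close>, in the coordinates given by \<open>el x\<close>.\<close>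

definition part :: "('a \<Rightarrow> complex) \<Rightarrow> 'a \<Rightarrow> 'v \<Rightarrow> 'v" where
  "part x a v = ract \<rho> (grade_proj A H (star (el x) * a)) v"

lemma part_in [simp]: "v \<in> hcarrier V \<Longrightarrow> part x a v \<in> hcarrier V"
  by (simp add: part_def grade_proj_in)

lemma part_add: "v \<in> hcarrier V \<Longrightarrow> part x (a + b) v = hadd V (part x a v) (part x b v)"
  by (simp add: part_def distrib_left grade_proj_add \<rho>_add grade_proj_in)

lemma part_homogeneous:
  assumes "a \<in> A g" "x \<in> orb" "v \<in> hcarrier V"
  shows "part x a v = (if act_defined A g \<xi> \<and> char_act A g \<xi> = x then ract \<rho> (star (el x) * a) v else hzero V)"
proof -
  have m: "star (el x) * a \<in> A (- deg x + g)" by (rule A_mult[OF A_star[OF el_in[OF assms(2)]] assms(1)])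
  have "- deg x + g \<in> H \<longleftrightarrow> act_defined A g \<xi> \<and> char_act A g \<xi> = x"
    using deg_coset[of g x] coset_defined[of "deg x" g] deg_defined[OF assms(2)] deg_act[OF assms(2)] by auto
  thus ?thesis using assms by (simp add: part_def grade_proj_homogeneous[OF m])
qed

text \<open>The form is the orthogonal sum of its parts over the points of the orbit. A tensor has
  parts over finitely many points only. The set \<open>F\<close> of these points depends on \<open>a\<close> alone and may be
  enlarged, so that one finite set serves all terms of a formal tensor at once.\<close>

lemma form_decomposition:
  "\<exists>F. finite F \<and> F \<subseteq> orb \<and> (\<forall>F' b v w. finite F' \<longrightarrow> F \<subseteq> F' \<longrightarrow> F' \<subseteq> orb \<longrightarrow>
     v \<in> hcarrier V \<longrightarrow> w \<in> hcarrier V \<longrightarrow>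
     hinner V (ract \<rho> (grade_proj A H (star b * a)) v) w = (\<Sum>x\<in>F'. hinner V (part x a v) (part x b w)))"
proof (induction a rule: graded_induct)
  case (homogeneous g a)
  define F where "F = (if act_defined A g \<xi> then {char_act A g \<xi>} else {})"
  show ?case
  proof (intro exI conjI allI impI)
    show "finite F" "F \<subseteq> orb" by (auto simp: F_def act_in_orb)
    fix F' b v w
    assume F': "finite F'" "F \<subseteq> F'" "F' \<subseteq> orb" and v: "v \<in> hcarrier V" and w: "w \<in> hcarrier V"
    show "hinner V (ract \<rho> (grade_proj A H (star b * a)) v) w = (\<Sum>x\<in>F'. hinner V (part x a v) (part x b w))"
    proof (induction b rule: graded_induct)
      case (homogeneous k b)
      have ba: "star b * a \<in> A (- k + g)" by (rule A_mult[OF A_star[OF homogeneous] \<open>a \<in> A g\<close>])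
      have px: "part x a v = hzero V" if "x \<in> F'" "x \<notin> F" for x
        using part_homogeneous[OF \<open>a \<in> A g\<close> _ v, of x] that F' by (auto simp: F_def split: if_splits)
      have "(\<Sum>x\<in>F'. hinner V (part x a v) (part x b w)) = (\<Sum>x\<in>F. hinner V (part x a v) (part x b w))"
        by (rule sum.mono_neutral_right) (use F' px w in auto)
      also have "\<dots> = hinner V (ract \<rho> (grade_proj A H (star b * a)) v) w"
      proof (cases "act_defined A g \<xi>")
        case False
        have "ract \<rho> (grade_proj A H (star b * a)) v = hzero V"
          using \<rho>_undefined_null[OF False \<open>a \<in> A g\<close> homogeneous _ v] v
          by (simp add: grade_proj_homogeneous[OF ba])
        then show ?thesis using False w by (simp add: F_def)
      next
        case True
        define x where "x = char_act A g \<xi>"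
        have xo: "x \<in> orb" using True act_in_orb by (simp add: x_def)
        have F: "F = {x}" using True by (simp add: F_def x_def)
        have pa: "part x a v = ract \<rho> (star (el x) * a) v"
          using part_homogeneous[OF \<open>a \<in> A g\<close> xo v] True by (simp add: x_def)
        show ?thesis
        proof (cases "- k + g \<in> H")
          case h: True
          have kg: "act_defined A k \<xi> \<and> char_act A k \<xi> = x"
            using coset_defined[of g k] H_uminus[OF h] True by (simp add: x_def minus_add)
          have pb: "part x b w = ract \<rho> (star (el x) * b) w"
            using part_homogeneous[OF homogeneous xo w] kg by simp
          have sa: "star (el x) * a \<in> subgrading A H" using el_star_mult_in(2)[OF True x_def \<open>a \<in> A g\<close>] .
          have sb: "star (el x) * b \<in> subgrading A H" using el_star_mult_in(2)[of k x b] kg homogeneous by simp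
          have "hinner V (part x a v) (part x b w) = hinner V (ract \<rho> (star (star (el x) * b) * (star (el x) * a)) v) w"
            unfolding pa pb using \<rho>_adjoint[OF subgrading_star[OF sb], of "ract \<rho> (star (el x) * a) v" w]
              \<rho>_mult[OF subgrading_star[OF sb] sa v] sa v w by (simp add: star_star)
          also have "star (star (el x) * b) * (star (el x) * a) = star b * (el x * star (el x)) * a"
            by (simp add: star_mult star_star mult.assoc)
          finally show ?thesis
            unfolding \<rho>_insert_unit[OF True x_def \<open>a \<in> A g\<close> homogeneous h v]
            using h by (simp add: F grade_proj_homogeneous[OF ba])
        next
          case h: False
          have "\<not> (act_defined A k \<xi> \<and> char_act A k \<xi> = x)"
            using stab_coset_conv[OF \<xi> _ True, of k] h by (auto simp: x_def H)
          hence "part x b w = hzero V" using part_homogeneous[OF homogeneous xo w] by auto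
          then show ?thesis using h v w by (simp add: F grade_proj_homogeneous[OF ba])
        qed
      qed
      finally show ?case by simp
    next
      case (add b c)
      then show ?case using v w
        by (simp add: star_add distrib_right grade_proj_add \<rho>_add grade_proj_in part_add sum.distrib)
    qed
  qed
next
  case (add a b)
  obtain F1 where F1: "finite F1" "F1 \<subseteq> orb"
    and F1_sum: "\<And>F' c v w. finite F' \<Longrightarrow> F1 \<subseteq> F' \<Longrightarrow> F' \<subseteq> orb \<Longrightarrow> v \<in> hcarrier V \<Longrightarrow> w \<in> hcarrier V \<Longrightarrow>
     hinner V (ract \<rho> (grade_proj A H (star c * a)) v) w = (\<Sum>x\<in>F'. hinner V (part x a v) (part x c w))"
    by (rule exE[OF add(1)]) (elim conjE, blast)
  obtain F2 where F2: "finite F2" "F2 \<subseteq> orb"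
    and F2_sum: "\<And>F' c v w. finite F' \<Longrightarrow> F2 \<subseteq> F' \<Longrightarrow> F' \<subseteq> orb \<Longrightarrow> v \<in> hcarrier V \<Longrightarrow> w \<in> hcarrier V \<Longrightarrow>
     hinner V (ract \<rho> (grade_proj A H (star c * b)) v) w = (\<Sum>x\<in>F'. hinner V (part x b v) (part x c w))"
    by (rule exE[OF add(2)]) (elim conjE, blast)
  show ?case
  proof (intro exI[of _ "F1 \<union> F2"] conjI allI impI)
    fix F' c v w
    assume F': "finite F'" "F1 \<union> F2 \<subseteq> F'" "F' \<subseteq> orb" and v: "v \<in> hcarrier V" and w: "w \<in> hcarrier V"
    have "hinner V (ract \<rho> (grade_proj A H (star c * (a + b))) v) w =
      hinner V (ract \<rho> (grade_proj A H (star c * a)) v) w + hinner V (ract \<rho> (grade_proj A H (star c * b)) v) w"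
      using v w by (simp add: distrib_left grade_proj_add \<rho>_add grade_proj_in)
    also have "\<dots> = (\<Sum>x\<in>F'. hinner V (part x (a + b) v) (part x c w))"
      using F1_sum[of F' v w c] F2_sum[of F' v w c] F' v w by (simp add: part_add sum.distrib)
    finally show "hinner V (ract \<rho> (grade_proj A H (star c * (a + b))) v) w =
      (\<Sum>x\<in>F'. hinner V (part x (a + b) v) (part x c w))" .
  qed (use F1 F2 in auto)
qed

end

lemma sum_in_nonneg_Reals: "(\<And>i. i \<in> I \<Longrightarrow> f i \<in> \<real>\<^sub>\<ge>\<^sub>0) \<Longrightarrow> sum f I \<in> (\<real>\<^sub>\<ge>\<^sub>0 :: complex set)"
  by (induction I rule: infinite_finite_induct) auto

text \<open>A Gram sum is the squared norm of the corresponding linear combination.\<close>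

lemma Gram_nonneg:
  assumes V: "inner_product_space V" and I: "finite I" and u: "\<And>i. i \<in> I \<Longrightarrow> u i \<in> hcarrier V"
  shows "(\<Sum>i\<in>I. \<Sum>j\<in>I. c i * cnj (c j) * hinner V (u i) (u j)) \<in> \<real>\<^sub>\<ge>\<^sub>0"
proof -
  obtain ps where ps: "set ps = I" "distinct ps" using finite_distinct_list[OF I] by blast
  let ?s = "hsum V (map (\<lambda>i. hscale V (c i) (u i)) ps)"
  have s: "set (map (\<lambda>i. hscale V (c i) (u i)) ps) \<subseteq> hcarrier V" using V u ps by auto
  have 1: "hinner V z ?s = (\<Sum>j\<in>I. cnj (c j) * hinner V z (u j))" if "z \<in> hcarrier V" for z
    using hinner_hsum_right[OF V s that] u that V ps
    by (simp add: comp_def sum_list_distinct_conv_sum_set cong: sum.cong)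
  have "hinner V ?s ?s = (\<Sum>i\<in>I. c i * hinner V (u i) ?s)"
    using hinner_hsum_left[OF V s hsum_in[OF V s]] u V ps hsum_in[OF V s]
    by (simp add: comp_def sum_list_distinct_conv_sum_set cong: sum.cong)
  also have "\<dots> = (\<Sum>i\<in>I. \<Sum>j\<in>I. c i * cnj (c j) * hinner V (u i) (u j))"
    using u by (simp add: 1 sum_distrib_left mult.assoc cong: sum.cong)
  finally show ?thesis using hinner_self_nonneg[OF V hsum_in[OF V s]] by simp
qed

context stabilizer_rep
begin

text \<open>Over each point of the orbit the form restricts to the Gram sum of the parts.\<close>

lemma formal_form_nonneg:
  assumes "f \<in> hcarrier (formal_space A H \<rho>)"
  shows "hinner (formal_space A H \<rho>) f f \<in> \<real>\<^sub>\<ge>\<^sub>0"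
proof -
  let ?k = "Poly_Mapping.keys f" and ?c = "Poly_Mapping.lookup f"
  have k: "snd p \<in> hcarrier V" if "p \<in> ?k" for p
    using assms that by (auto simp: formal_space_def \<rho>_dom)
  have "\<exists>F. \<forall>a. finite (F a) \<and> F a \<subseteq> orb \<and> (\<forall>F' b v w. finite F' \<longrightarrow> F a \<subseteq> F' \<longrightarrow> F' \<subseteq> orb \<longrightarrow>
     v \<in> hcarrier V \<longrightarrow> w \<in> hcarrier V \<longrightarrow>
     hinner V (ract \<rho> (grade_proj A H (star b * a)) v) w = (\<Sum>x\<in>F'. hinner V (part x a v) (part x b w)))"
    by (rule choice) (rule allI, rule form_decomposition)
  then obtain F where F: "\<forall>a. finite (F a) \<and> F a \<subseteq> orb \<and> (\<forall>F' b v w. finite F' \<longrightarrow> F a \<subseteq> F' \<longrightarrow> F' \<subseteq> orb \<longrightarrow>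
     v \<in> hcarrier V \<longrightarrow> w \<in> hcarrier V \<longrightarrow>
     hinner V (ract \<rho> (grade_proj A H (star b * a)) v) w = (\<Sum>x\<in>F'. hinner V (part x a v) (part x b w)))" ..
  define F' where "F' = (\<Union>p\<in>?k. F (fst p))"
  have F': "finite F'" "F' \<subseteq> orb" using F[THEN spec, THEN conjunct1] F[THEN spec, THEN conjunct2, THEN conjunct1]
    unfolding F'_def by auto
  have "hinner (formal_space A H \<rho>) f f =
      (\<Sum>p\<in>?k. \<Sum>q\<in>?k. ?c p * cnj (?c q) * hinner V (ract \<rho> (grade_proj A H (star (fst q) * fst p)) (snd p)) (snd q))"
    by (simp add: formal_space_def case_prod_unfold)
  also have "\<dots> = (\<Sum>p\<in>?k. \<Sum>q\<in>?k. \<Sum>x\<in>F'. ?c p * cnj (?c q) * hinner V (part x (fst p) (snd p)) (part x (fst q) (snd q)))"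
  proof (intro sum.cong refl)
    fix p q assume p: "p \<in> ?k" and q: "q \<in> ?k"
    have "hinner V (ract \<rho> (grade_proj A H (star (fst q) * fst p)) (snd p)) (snd q) =
        (\<Sum>x\<in>F'. hinner V (part x (fst p) (snd p)) (part x (fst q) (snd q)))"
      using F[THEN spec[of _ "fst p"], THEN conjunct2, THEN conjunct2, rule_format, OF F'(1) _ F'(2) k[OF p] k[OF q]] p
      unfolding F'_def by blast
    thus "?c p * cnj (?c q) * hinner V (ract \<rho> (grade_proj A H (star (fst q) * fst p)) (snd p)) (snd q) =
        (\<Sum>x\<in>F'. ?c p * cnj (?c q) * hinner V (part x (fst p) (snd p)) (part x (fst q) (snd q)))"
      by (simp add: sum_distrib_left)
  qed
  also have "\<dots> = (\<Sum>x\<in>F'. \<Sum>p\<in>?k. \<Sum>q\<in>?k. ?c p * cnj (?c q) * hinner V (part x (fst p) (snd p)) (part x (fst q) (snd q)))"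
    by (simp only: sum.swap[of _ F' ?k])
  also have "\<dots> \<in> \<real>\<^sub>\<ge>\<^sub>0"
  proof (rule sum_in_nonneg_Reals)
    fix x assume "x \<in> F'"
    show "(\<Sum>p\<in>?k. \<Sum>q\<in>?k. ?c p * cnj (?c q) * hinner V (part x (fst p) (snd p)) (part x (fst q) (snd q))) \<in> \<real>\<^sub>\<ge>\<^sub>0"
      by (rule Gram_nonneg[OF V_ips finite_keys]) (use k in simp)
  qed
  finally show ?thesis .
qed

end

section \<open>Representations generated from the stabilizer\<close>

text \<open>The common features of induced representations and of well-behaved representations over
  the orbit. The vector \<open>\<pi>(d)Jv\<close> plays the role of \<open>d \<otimes> v\<close>.\<close>

locale generated_rep = stabilizer_rep A \<xi> H \<rho>
  for A :: "'g::group_add \<Rightarrow> 'a::star_algebra set" and \<xi> H and \<rho> :: "('a, 'v) representation" +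
  fixes \<pi> :: "('a, 'h) representation" and J :: "'v \<Rightarrow> 'h"
  assumes star_rep_\<pi>: "star_rep UNIV \<pi>"
    and J_in: "v \<in> hcarrier V \<Longrightarrow> J v \<in> rdom \<pi>"
    and J_inner: "v \<in> hcarrier V \<Longrightarrow> w \<in> hcarrier V \<Longrightarrow> hinner (hsp \<pi>) (J v) (J w) = hinner V v w"
    and J_act: "a \<in> subgrading A H \<Longrightarrow> v \<in> hcarrier V \<Longrightarrow> ract \<pi> a (J v) = J (ract \<rho> a v)"
    and total: "\<phi> \<in> hcarrier (hsp \<pi>) \<Longrightarrow>
      (\<And>d v. v \<in> hcarrier V \<Longrightarrow> hinner (hsp \<pi>) \<phi> (ract \<pi> d (J v)) = 0) \<Longrightarrow> \<phi> = hzero (hsp \<pi>)"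
begin

abbreviation K where "K \<equiv> hsp \<pi>"

lemma K_hilbert: "hilbert_space K" and K_ips [simp]: "inner_product_space K"
  using star_rep_hilbert[OF star_rep_\<pi>] by simp_all

lemmas dom_subspace = star_rep_subspace[OF star_rep_\<pi>]
lemmas dom_carrier [simp] = subspace_carrier[OF dom_subspace]
lemmas \<pi>_in [simp] = act_in[OF star_rep_\<pi> UNIV_I]
  and \<pi>_hadd = act_hadd[OF star_rep_\<pi> UNIV_I]
  and \<pi>_hscale = act_hscale[OF star_rep_\<pi> UNIV_I]
  and \<pi>_add = act_add[OF star_rep_\<pi> UNIV_I UNIV_I]
  and \<pi>_scaleC = act_scaleC[OF star_rep_\<pi> UNIV_I]
  and \<pi>_mult = act_mult[OF star_rep_\<pi> UNIV_I UNIV_I]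
  and \<pi>_adjoint = act_adjoint[OF star_rep_\<pi> UNIV_I]

lemma \<pi>_diff: "x \<in> rdom \<pi> \<Longrightarrow> y \<in> rdom \<pi> \<Longrightarrow> ract \<pi> a (hdiff K x y) = hdiff K (ract \<pi> a x) (ract \<pi> a y)"
  by (simp add: hdiff_def \<pi>_hadd \<pi>_hscale subspace_scale[OF dom_subspace])

lemma J_linear: "hlinear V (hcarrier V) K J"
  by (rule isometry_linear) (auto simp: J_in J_inner)

definition ten :: "'a \<Rightarrow> 'v \<Rightarrow> 'h" where
  "ten d v = ract \<pi> d (J v)"

lemma ten_dom [simp]: "v \<in> hcarrier V \<Longrightarrow> ten d v \<in> rdom \<pi>"
  by (simp add: ten_def J_in)

lemma ten_in [simp]: "v \<in> hcarrier V \<Longrightarrow> ten d v \<in> hcarrier K"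
  by simp

lemma ten_add: "v \<in> hcarrier V \<Longrightarrow> ten (c + d) v = hadd K (ten c v) (ten d v)"
  by (simp add: ten_def \<pi>_add J_in)

lemma act_ten: "v \<in> hcarrier V \<Longrightarrow> ract \<pi> a (ten d v) = ten (a * d) v"
  by (simp add: ten_def \<pi>_mult J_in)

lemma ten_sub: "h \<in> subgrading A H \<Longrightarrow> v \<in> hcarrier V \<Longrightarrow> ten h v = J (ract \<rho> h v)"
  by (simp add: ten_def J_act)

lemma ten_one: "v \<in> hcarrier V \<Longrightarrow> ten 1 v = J v"
  using ten_sub[of 1 v] by simp

lemma ten_inner:
  assumes "c \<in> A g" "d \<in> A k" "- k + g \<in> H" "v \<in> hcarrier V" "w \<in> hcarrier V"
  shows "hinner K (ten c v) (ten d w) = hinner V (ract \<rho> (star d * c) v) w"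
proof -
  have s: "star d * c \<in> subgrading A H"
    by (rule subgrading_homogeneous[OF A_mult[OF A_star[OF assms(2)] assms(1)] assms(3)])
  have "hinner K (ten c v) (ten d w) = hinner K (ten (star d * c) v) (J w)"
    using \<pi>_adjoint[of "ten c v" "J w" "star d"] assms
    by (simp add: ten_def[of d] act_ten[symmetric] star_star J_in \<pi>_adjoint[of "ten c v" "J w"])
  thus ?thesis using s assms by (simp add: ten_sub J_inner)
qed

text \<open>Up to a vector of norm \<open>0\<close>, a tensor \<open>d \<otimes> v\<close> of degree \<open>g\<close> only depends on the point
  \<open>x\<close> to which \<open>g\<close> moves \<open>\<xi>\<close>, and vanishes if there is no such point.\<close>

lemma ten_undefined:
  assumes "d \<in> A g" "\<not> act_defined A g \<xi>" "v \<in> hcarrier V"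
  shows "ten d v = hzero K"
proof (rule hinner_self_eq0[OF K_ips])
  have "ract \<rho> (star d * d) v = hzero V"
    using \<rho>_undefined_null[OF assms(2,1,1) _ assms(3)] by simp
  thus "hinner K (ten d v) (ten d v) = 0" using assms by (simp add: ten_inner[where g = g and k = g])
qed (use assms in simp)

definition frame :: "('a \<Rightarrow> complex) \<Rightarrow> 'v \<Rightarrow> 'h" where
  "frame x v = ten (el x) v"

lemma frame_dom [simp]: "v \<in> hcarrier V \<Longrightarrow> frame x v \<in> rdom \<pi>"
  by (simp add: frame_def)

lemma ten_frame:
  assumes d: "d \<in> A g" and g: "act_defined A g \<xi>" and x: "x = char_act A g \<xi>" and v: "v \<in> hcarrier V"
  shows "ten d v = frame x (ract \<rho> (star (el x) * d) v)"
proof -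
  have xo: "x \<in> orb" using g x act_in_orb by simp
  note e = el_in[OF xo]
  let ?u = "ract \<rho> (star (el x) * d) v"
  have sd: "star (el x) * d \<in> A (- deg x + g)" and s: "star (el x) * d \<in> subgrading A H"
    using el_star_mult_in[OF g x d] .
  have h: "- deg x + g \<in> H" by (rule deg_coset[OF g x])
  have h': "- g + deg x \<in> H" using H_uminus[OF h] by (simp add: minus_add)
  have u: "?u \<in> hcarrier V" using s v by simp
  have uu: "hinner V ?u ?u = \<xi> (star d * d) * hinner V v v"
    using \<rho>_inner[OF sd sd h v v] conjugate_unit[OF g x d] by (simp add: star_mult star_star mult.assoc)
  (* All inner products among the two vectors are equal, so their difference has norm 0. *)
  have 1: "hinner K (ten d v) (ten d v) = hinner V ?u ?u"
    using v \<rho>_char[OF A0_star_mult[OF d d] v] uu by (simp add: ten_inner[OF d d])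
  have 2: "hinner K (frame x ?u) (frame x ?u) = hinner V ?u ?u"
    unfolding frame_def using u \<rho>_char[OF A0_star_mult[OF e e] u] el_norm[OF xo] ten_inner[OF e e _ u u]
    by (simp add: hscale_one)
  have 3: "hinner K (ten d v) (frame x ?u) = hinner V ?u ?u"
    unfolding frame_def using ten_inner[OF d e h v u] .
  have 4: "hinner K (frame x ?u) (ten d v) = hinner V ?u ?u"
    using hinner_sym[OF K_ips, of "ten d v" "frame x ?u"] 3 hinner_sym[OF V_ips u u] u v by simp
  have d0: "hdiff K (ten d v) (frame x ?u) = hzero K"
    by (rule hinner_self_eq0[OF K_ips]) (use u v 1 2 3 4 in simp_all)
  show ?thesis by (rule hdiff_eq_zero[OF K_ips _ _ d0]) (use u v in simp_all)
qed

text \<open>Conjugation with \<open>el x\<close> turns \<open>\<xi>\<close> into \<open>x\<close>.\<close>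

lemma act_frame_char:
  assumes "b \<in> A 0" "x \<in> orb" "v \<in> hcarrier V"
  shows "ract \<pi> b (frame x v) = hscale K (x b) (frame x v)"
proof -
  note e = el_in[OF assms(2)]
  have "star (el x) * (b * el x) \<in> A 0" by (rule A0_star_mult[OF e A0_mult[OF assms(1) e]])
  moreover have "\<xi> (star (el x) * (b * el x)) = x b"
    using char_act_eq[OF \<xi> deg_defined[OF assms(2)] e assms(1)] deg_act[OF assms(2)] el_norm[OF assms(2)]
    by (simp add: mult.assoc)
  ultimately have "ract \<rho> (star (el x) * (b * el x)) v = hscale V (x b) v"
    using \<rho>_char assms(3) by simp
  hence "ract \<pi> b (frame x v) = frame x (hscale V (x b) v)"
    using ten_frame[OF A0_mult[OF assms(1) e] deg_defined[OF assms(2)] deg_act[OF assms(2), symmetric] assms(3)]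
    by (simp add: frame_def act_ten assms(3))
  also have "\<dots> = hscale K (x b) (frame x v)"
    using assms(3) by (simp add: frame_def ten_def hlinear_scale[OF J_linear] \<pi>_hscale J_in)
  finally show ?thesis .
qed

text \<open>Frames at different points are orthogonal because they are joint eigenvectors for
  different characters.\<close>

lemma frame_inner:
  assumes x: "x \<in> orb" and y: "y \<in> orb" and v: "v \<in> hcarrier V" and w: "w \<in> hcarrier V"
  shows "hinner K (frame x v) (frame y w) = (if x = y then hinner V v w else 0)"
proof (cases "x = y")
  case True
  then show ?thesis
    unfolding frame_def using ten_inner[OF el_in[OF x] el_in[OF x] _ v w] \<rho>_char[OF A0_star_mult[OF el_in[OF x] el_in[OF x]] v] el_norm[OF x] v
    by (simp add: hscale_one)
next
  case False
  obtain b where b: "b \<in> A 0" "x b \<noteq> y b"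
    using False pos_char_eqI[of x y] char_extensional orb_pos x y by metis
  have "x b * hinner K (frame x v) (frame y w) = hinner K (ract \<pi> b (frame x v)) (frame y w)"
    using act_frame_char[OF b(1) x v] v w by simp
  also have "\<dots> = hinner K (frame x v) (ract \<pi> (star b) (frame y w))"
    using v w by (simp add: \<pi>_adjoint)
  also have "\<dots> = y b * hinner K (frame x v) (frame y w)"
    using act_frame_char[OF A0_star[OF b(1)] y w] v w char_star[OF orb_pos[OF y] b(1)] by simp
  finally show ?thesis using b(2) False by simp
qed

lemma ten_induct:
  assumes v: "v \<in> hcarrier V" and "\<And>x u. x \<in> orb \<Longrightarrow> u \<in> hcarrier V \<Longrightarrow> P (frame x u)" "P (hzero K)"
    and "\<And>\<phi> \<psi>. \<phi> \<in> rdom \<pi> \<Longrightarrow> \<psi> \<in> rdom \<pi> \<Longrightarrow> P \<phi> \<Longrightarrow> P \<psi> \<Longrightarrow> P (hadd K \<phi> \<psi>)"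
  shows "P (ten d v)"
proof (induction d rule: graded_induct)
  case (homogeneous g d)
  show ?case
  proof (cases "act_defined A g \<xi>")
    case True
    then show ?thesis
      using ten_frame[OF homogeneous True refl v] assms(2) act_in_orb el_star_mult_in(2)[OF True refl homogeneous] v
      by simp
  qed (use ten_undefined[OF homogeneous _ v] assms(3) in simp)
qed (use v assms(4) in \<open>simp add: ten_add\<close>)

text \<open>Totality of the frame vectors is totality of the tensors, each of which is a finite sum
  of frame vectors.\<close>

sublocale coordinates K V orb frame
proof
  fix \<phi> assume \<phi>: "\<phi> \<in> hcarrier K" and 0: "\<And>x v. x \<in> orb \<Longrightarrow> v \<in> hcarrier V \<Longrightarrow> hinner K \<phi> (frame x v) = 0"
  have "hinner K \<phi> (ten d v) = 0" if "v \<in> hcarrier V" for d v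
    by (rule ten_induct[OF that]) (use \<phi> 0 in auto)
  thus "\<phi> = hzero K" using total[OF \<phi>] by (simp add: ten_def)
qed (auto simp: K_hilbert V_hilbert countable_orb frame_inner)

lemma ten_ext:
  assumes "\<phi> \<in> hcarrier K" "\<psi> \<in> hcarrier K"
    and "\<And>g d v. d \<in> A g \<Longrightarrow> v \<in> hcarrier V \<Longrightarrow> hinner K \<phi> (ten d v) = hinner K \<psi> (ten d v)"
  shows "\<phi> = \<psi>"
proof (rule coord_ext[OF assms(1,2)])
  fix x assume x: "x \<in> orb"
  show "coord x \<phi> = coord x \<psi>"
  proof (rule coord_eqI[OF x assms(1)])
    fix v assume v: "v \<in> hcarrier V"
    show "hinner K \<phi> (frame x v) = hinner V (coord x \<psi>) v"
      using assms(3)[OF el_in[OF x] v] inner_C_right[OF x assms(2) v] by (simp add: frame_def)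
  qed (use assms x in simp)
qed

text \<open>\<open>adj a \<phi> \<psi>\<close> says that \<open>\<psi>\<close> is the value at \<open>\<phi>\<close> of the adjoint of \<open>\<pi>(a\<^sup>*)\<close> restricted to the
  span of the tensors.\<close>

definition adj :: "'a \<Rightarrow> 'h \<Rightarrow> 'h \<Rightarrow> bool" where
  "adj a \<phi> \<psi> \<longleftrightarrow> \<psi> \<in> hcarrier K \<and>
     (\<forall>g. \<forall>d\<in>A g. \<forall>v\<in>hcarrier V. hinner K \<psi> (ten d v) = hinner K \<phi> (ten (star a * d) v))"

definition adj_dom :: "'h set" where
  "adj_dom = {\<phi> \<in> hcarrier K. \<forall>g. \<forall>a\<in>A g. \<exists>\<psi>. adj a \<phi> \<psi>}"

lemma adj_ract: "\<phi> \<in> rdom \<pi> \<Longrightarrow> adj a \<phi> (ract \<pi> a \<phi>)"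
  by (simp add: adj_def \<pi>_adjoint act_ten)

lemma adj_unique: "adj a \<phi> \<psi> \<Longrightarrow> adj a \<phi> \<psi>' \<Longrightarrow> \<psi> = \<psi>'"
  by (rule ten_ext) (auto simp: adj_def)

lemma adj_add:
  assumes "\<phi> \<in> hcarrier K" "adj a \<phi> \<psi>" "adj b \<phi> \<psi>'" shows "adj (a + b) \<phi> (hadd K \<psi> \<psi>')"
  using assms by (auto simp: adj_def star_add distrib_right ten_add)

lemma adj_dom_ex: "\<phi> \<in> adj_dom \<Longrightarrow> \<exists>\<psi>. adj a \<phi> \<psi>"
  by (induction a rule: graded_induct) (auto simp: adj_dom_def dest: adj_add)

lemma adj_coord:
  assumes b: "b \<in> A 0" and x: "x \<in> orb" and \<phi>: "\<phi> \<in> hcarrier K" and a: "adj b \<phi> \<psi>"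
  shows "coord x \<psi> = hscale V (x b) (coord x \<phi>)"
proof (rule coord_eqI[OF x])
  fix v assume v: "v \<in> hcarrier V"
  have "hinner K \<psi> (frame x v) = hinner K \<phi> (ract \<pi> (star b) (frame x v))"
    using a el_in[OF x] v by (simp add: adj_def frame_def act_ten)
  also have "\<dots> = x b * hinner K \<phi> (frame x v)"
    using act_frame_char[OF A0_star[OF b] x v] char_star[OF orb_pos[OF x] b] v \<phi> by simp
  finally show "hinner K \<psi> (frame x v) = hinner V (hscale V (x b) (coord x \<phi>)) v"
    using x v \<phi> by (simp add: inner_C_right)
qed (use a x \<phi> in \<open>auto simp: adj_def\<close>)

lemmas act_coord = adj_coord[OF _ _ dom_carrier adj_ract]

lemma component_of_dom [simp]: "\<phi> \<in> hcarrier K \<Longrightarrow> component_of \<phi> k \<in> rdom \<pi>"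
  unfolding component_of_def by (rule seq_of_cases[of k]) (auto simp: subspace_zero[OF dom_subspace])

lemma psum_dom [simp]: "\<phi> \<in> hcarrier K \<Longrightarrow> psum K (component_of \<phi>) n \<in> rdom \<pi>"
  by (rule psum_in_subspace[OF dom_subspace]) simp

lemma coord_psum:
  assumes "\<phi> \<in> hcarrier K" "x \<in> orb"
  shows "coord x (psum K (component_of \<phi>) n) = (if to_nat_on orb x < n then coord x \<phi> else hzero V)"
proof (rule coord_eqI[OF assms(2)])
  fix v assume v: "v \<in> hcarrier V"
  have "hinner K (component_of \<phi> k) (frame x v) = (if k = to_nat_on orb x then hinner V (coord x \<phi>) v else 0)" for k
    unfolding component_of_def
    by (rule seq_of_cases[of k]) (use assms v in \<open>auto simp: frame_inner seq_of_eq_iff\<close>)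
  thus "hinner K (psum K (component_of \<phi>) n) (frame x v) =
      hinner V (if to_nat_on orb x < n then coord x \<phi> else hzero V) v"
    using assms v by (simp add: hinner_psum(1))
qed (use assms in auto)

text \<open>Elements of degree \<open>0\<close> commute with the expansion, so the partial sums converge in their
  graph norms.\<close>

lemma act_psum:
  assumes "b \<in> A 0" "\<phi> \<in> hcarrier K" "adj b \<phi> \<psi>"
  shows "ract \<pi> b (psum K (component_of \<phi>) n) = psum K (component_of \<psi>) n"
proof (rule coord_ext)
  have \<psi>: "\<psi> \<in> hcarrier K" using assms(3) by (simp add: adj_def)
  show "psum K (component_of \<psi>) n \<in> hcarrier K" using \<psi> by simp
  show "coord x (ract \<pi> b (psum K (component_of \<phi>) n)) = coord x (psum K (component_of \<psi>) n)" if x: "x \<in> orb" for x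
    using x assms \<psi> adj_coord[OF assms(1) x assms(2,3)] by (simp add: act_coord coord_psum)
qed (use assms in simp)

lemma graph_bound:
  assumes "\<phi> \<in> rdom \<pi>"
  shows "(hnorm K (ract \<pi> a \<phi>))\<^sup>2 \<le> hnorm K (ract \<pi> (star a * a) \<phi>) * hnorm K \<phi>"
proof -
  have "(hnorm K (ract \<pi> a \<phi>))\<^sup>2 = Re (hinner K (ract \<pi> (star a * a) \<phi>) \<phi>)"
    using assms \<pi>_adjoint[of "ract \<pi> a \<phi>" \<phi> "star a"] by (simp add: hnorm_sq \<pi>_mult star_star)
  also have "\<dots> \<le> hnorm K (ract \<pi> (star a * a) \<phi>) * hnorm K \<phi>"
    using Cauchy_Schwarz[OF K_ips, of "ract \<pi> (star a * a) \<phi>" \<phi>] assms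
      complex_Re_le_cmod[of "hinner K (ract \<pi> (star a * a) \<phi>) \<phi>"] by simp
  finally show ?thesis .
qed

text \<open>The graph topology is determined by the elements of degree \<open>0\<close>: for homogeneous \<open>a\<close> the
  element \<open>a\<^sup>* a\<close> has degree \<open>0\<close>, and \<open>graph_bound\<close> applies.\<close>

lemma graph_Cauchy_all:
  assumes F: "F \<noteq> bot" and dom: "\<forall>\<^sub>F x in F. x \<in> rdom \<pi>"
    and id: "\<And>e. e > 0 \<Longrightarrow> \<forall>\<^sub>F (x, y) in F \<times>\<^sub>F F. hnorm K (hdiff K x y) < e"
    and b: "\<And>b e. b \<in> A 0 \<Longrightarrow> e > 0 \<Longrightarrow> \<forall>\<^sub>F (x, y) in F \<times>\<^sub>F F. hnorm K (hdiff K (ract \<pi> b x) (ract \<pi> b y)) < e"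
    and e: "e > 0"
  shows "\<forall>\<^sub>F (x, y) in F \<times>\<^sub>F F. hnorm K (hdiff K (ract \<pi> a x) (ract \<pi> a y)) < e"
  using e
proof (induction a arbitrary: e rule: graded_induct)
  have dd: "\<forall>\<^sub>F (x, y) in F \<times>\<^sub>F F. x \<in> rdom \<pi> \<and> y \<in> rdom \<pi>"
    using dom unfolding eventually_prod_same by blast
  {
    case (homogeneous g a)
    have "\<forall>\<^sub>F (x, y) in F \<times>\<^sub>F F. hnorm K (hdiff K (ract \<pi> (star a * a) x) (ract \<pi> (star a * a) y)) < e"
      using b[OF A0_star_mult[OF homogeneous(1,1)] homogeneous(2)] .
    with dd id[OF homogeneous(2)] show ?case
    proof eventually_elim
      case (elim p)
      obtain x y where p: "p = (x, y)" by (cases p)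
      from elim have xy: "x \<in> rdom \<pi>" "y \<in> rdom \<pi>" by (auto simp: p)
      have z: "hdiff K x y \<in> rdom \<pi>" using subspace_diff[OF dom_subspace xy] .
      have "(hnorm K (ract \<pi> a (hdiff K x y)))\<^sup>2 \<le> hnorm K (ract \<pi> (star a * a) (hdiff K x y)) * hnorm K (hdiff K x y)"
        by (rule graph_bound[OF z])
      also have "\<dots> < e * e"
        using elim z xy by (intro mult_strict_mono') (auto simp: p \<pi>_diff)
      finally have "hnorm K (ract \<pi> a (hdiff K x y)) < e"
        using homogeneous(2) by (simp add: power2_eq_square[symmetric] power_less_imp_less_base)
      then show ?case using xy by (simp add: p \<pi>_diff)
    qed
  next
    case (add a a')
    from add.prems have e2: "e / 2 > 0" by simp
    from dd add.IH(1)[OF e2] add.IH(2)[OF e2] show ?case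
    proof eventually_elim
      case (elim p)
      obtain x y where p: "p = (x, y)" by (cases p)
      from elim have xy: "x \<in> rdom \<pi>" "y \<in> rdom \<pi>" by (auto simp: p)
      have "hdiff K (ract \<pi> (a + a') x) (ract \<pi> (a + a') y) =
          hadd K (hdiff K (ract \<pi> a x) (ract \<pi> a y)) (hdiff K (ract \<pi> a' x) (ract \<pi> a' y))"
        by (rule vector_eqI[OF K_ips]) (use xy in \<open>auto simp: \<pi>_add\<close>)
      then show ?case
        using hnorm_triangle[OF K_ips, of "hdiff K (ract \<pi> a x) (ract \<pi> a y)" "hdiff K (ract \<pi> a' x) (ract \<pi> a' y)"] elim xy
        by (simp add: p)
    qed
  }
qed

text \<open>Limits of graph Cauchy filters lie in the adjoint domain, with the limit of the images as
  value of the adjoint.\<close>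

lemma graph_cauchy_limit:
  assumes "graph_cauchy S \<pi> F" "A 0 \<subseteq> S"
  obtains \<phi> L where "\<phi> \<in> adj_dom" "htendsto K (\<lambda>x. x) \<phi> F"
    "\<And>a. adj a \<phi> (L a)" "\<And>a. htendsto K (ract \<pi> a) (L a) F"
proof -
  have F: "F \<noteq> bot" and dom: "\<forall>\<^sub>F x in F. x \<in> rdom \<pi>"
    and gr: "\<And>a e. a \<in> S \<Longrightarrow> e > 0 \<Longrightarrow> \<forall>\<^sub>F (x, y) in F \<times>\<^sub>F F. graph_norm \<pi> a (hdiff K x y) < e"
    using assms(1) by (auto simp: graph_cauchy_def)
  have dd: "\<forall>\<^sub>F (x, y) in F \<times>\<^sub>F F. x \<in> rdom \<pi> \<and> y \<in> rdom \<pi>"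
    using dom unfolding eventually_prod_same by blast
  have b: "\<forall>\<^sub>F (x, y) in F \<times>\<^sub>F F. hnorm K (hdiff K (ract \<pi> b x) (ract \<pi> b y)) < e \<and> hnorm K (hdiff K x y) < e"
    if "b \<in> A 0" "e > 0" for b e
    using dd gr[OF subsetD[OF assms(2) that(1)] that(2)]
  proof eventually_elim
    case (elim p)
    obtain x y where p: "p = (x, y)" by (cases p)
    from elim have xy: "x \<in> rdom \<pi>" "y \<in> rdom \<pi>" by (auto simp: p)
    have "0 \<le> hnorm K (hdiff K x y)" "0 \<le> hnorm K (hdiff K (ract \<pi> b x) (ract \<pi> b y))" using xy by auto
    moreover have "hnorm K (hdiff K x y) + hnorm K (hdiff K (ract \<pi> b x) (ract \<pi> b y)) < e"
      using elim xy by (simp add: p graph_norm_def \<pi>_diff)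
    ultimately show ?case unfolding p prod.case by linarith
  qed
  have id: "\<forall>\<^sub>F (x, y) in F \<times>\<^sub>F F. hnorm K (hdiff K x y) < e" if "e > 0" for e
    using b[OF A_one that] by eventually_elim auto
  have b': "\<forall>\<^sub>F (x, y) in F \<times>\<^sub>F F. hnorm K (hdiff K (ract \<pi> b x) (ract \<pi> b y)) < e" if "b \<in> A 0" "e > 0" for b e
    using b[OF that] by eventually_elim auto
  have carr: "\<forall>\<^sub>F x in F. x \<in> hcarrier K" using dom by eventually_elim simp
  obtain \<phi> where \<phi>: "\<phi> \<in> hcarrier K" "htendsto K (\<lambda>x. x) \<phi> F"
    using filter_complete[OF K_hilbert F carr id] by blast
  have acarr: "\<forall>\<^sub>F x in F. ract \<pi> a x \<in> hcarrier K" for a using dom by eventually_elim simp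
  have "\<exists>l\<in>hcarrier K. htendsto K (ract \<pi> a) l F" for a
    by (rule filter_complete[OF K_hilbert F acarr graph_Cauchy_all[OF F dom id b']])
  then obtain L where L: "\<And>a. L a \<in> hcarrier K" "\<And>a. htendsto K (ract \<pi> a) (L a) F" by metis
  have adj: "adj a \<phi> (L a)" for a
    unfolding adj_def
  proof (intro conjI allI ballI)
    fix g d v assume v: "v \<in> hcarrier V"
    have t1: "((\<lambda>x. hinner K (ract \<pi> a x) (ten d v)) \<longlongrightarrow> hinner K (L a) (ten d v)) F"
      using htendsto_inner_left[OF K_ips acarr L(1) _ L(2)] v by simp
    have t2: "((\<lambda>x. hinner K x (ten (star a * d) v)) \<longlongrightarrow> hinner K \<phi> (ten (star a * d) v)) F"
      using htendsto_inner_left[OF K_ips carr \<phi>(1) _ \<phi>(2)] v by simp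
    have ev: "\<forall>\<^sub>F x in F. hinner K x (ten (star a * d) v) = hinner K (ract \<pi> a x) (ten d v)"
      using dom by eventually_elim (use v in \<open>simp add: \<pi>_adjoint act_ten\<close>)
    show "hinner K (L a) (ten d v) = hinner K \<phi> (ten (star a * d) v)"
      by (rule tendsto_unique[OF F t1 Lim_transform_eventually[OF t2 ev]])
  qed (rule L)
  thus ?thesis using that[of \<phi> L] \<phi> L by (auto simp: adj_dom_def)
qed

text \<open>Conversely every vector of the adjoint domain is a limit of graph Cauchy partial sums: by
  \<open>act_psum\<close> the images under an element of degree \<open>0\<close> are partial sums of a convergent expansion too,
  and degree \<open>0\<close> suffices.\<close>

lemma adj_dom_approx:
  assumes "\<phi> \<in> adj_dom"
  defines "F \<equiv> filtermap (psum K (component_of \<phi>)) sequentially"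
  shows "graph_cauchy S \<pi> F" "htendsto K (\<lambda>x. x) \<phi> F"
proof -
  let ?s = "psum K (component_of \<phi>)"
  have \<phi>: "\<phi> \<in> hcarrier K" using assms by (simp add: adj_dom_def)
  show "htendsto K (\<lambda>x. x) \<phi> F"
    using expansion[OF \<phi>] by (simp add: htendsto_def F_def filterlim_filtermap)
  have F: "F \<noteq> bot" by (simp add: F_def filtermap_bot_iff)
  have dom: "\<forall>\<^sub>F x in F. x \<in> rdom \<pi>" using \<phi> by (simp add: F_def eventually_filtermap)
  have cauchy: "\<forall>\<^sub>F (x, y) in F \<times>\<^sub>F F. hnorm K (hdiff K (T x) (T y)) < e"
    if T: "\<And>n. T (?s n) = psum K (component_of \<psi>) n" "\<psi> \<in> hcarrier K" and e: "e > 0" for T \<psi> e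
  proof -
    have "hCauchy K (\<lambda>n. T (?s n))"
      by (rule htendsto_hCauchy[OF K_ips _ T(2)]) (use T expansion[OF T(2)] in simp_all)
    then obtain N where N: "\<forall>m\<ge>N. \<forall>n\<ge>N. hnorm K (hdiff K (T (?s m)) (T (?s n))) < e"
      using e unfolding hCauchy_def by blast
    show ?thesis
      unfolding eventually_prod_same
    proof (intro exI conjI)
      show "\<forall>\<^sub>F z in F. \<exists>n\<ge>N. z = ?s n"
        unfolding F_def eventually_filtermap using eventually_ge_at_top[of N] by eventually_elim auto
    qed (use N in auto)
  qed
  have id: "\<forall>\<^sub>F (x, y) in F \<times>\<^sub>F F. hnorm K (hdiff K x y) < e" if "e > 0" for e
    by (rule cauchy[of "\<lambda>x. x" \<phi>]) (use \<phi> that in auto)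
  have b: "\<forall>\<^sub>F (x, y) in F \<times>\<^sub>F F. hnorm K (hdiff K (ract \<pi> b x) (ract \<pi> b y)) < e" if b: "b \<in> A 0" "e > 0" for b e
  proof -
    obtain \<psi> where \<psi>: "adj b \<phi> \<psi>" using adj_dom_ex[OF assms(1)] by blast
    show ?thesis
      by (rule cauchy[of "ract \<pi> b" \<psi>]) (use act_psum[OF b(1) \<phi> \<psi>] \<psi> b in \<open>auto simp: adj_def\<close>)
  qed
  have "\<forall>\<^sub>F (x, y) in F \<times>\<^sub>F F. graph_norm \<pi> a (hdiff K x y) < e" if "e > 0" for a e
  proof -
    from that have e2: "e / 2 > 0" by simp
    have dd: "\<forall>\<^sub>F (x, y) in F \<times>\<^sub>F F. x \<in> rdom \<pi> \<and> y \<in> rdom \<pi>"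
      using dom unfolding eventually_prod_same by blast
    have "\<forall>\<^sub>F (x, y) in F \<times>\<^sub>F F. hnorm K (hdiff K (ract \<pi> a x) (ract \<pi> a y)) < e / 2"
      by (rule graph_Cauchy_all[OF F dom id b e2])
    with dd id[OF e2] show ?thesis
      by eventually_elim (auto simp: graph_norm_def \<pi>_diff)
  qed
  thus "graph_cauchy S \<pi> F" using F dom by (auto simp: graph_cauchy_def)
qed

lemma dom_sub_adj_dom: "rdom \<pi> \<subseteq> adj_dom"
  using adj_ract by (auto simp: adj_dom_def)

end

section \<open>The closure of a generated representation\<close>

text \<open>A generated representation whose domain is the whole adjoint domain; these are the
  closed ones.\<close>

locale full_rep = generated_rep +
  assumes adj_dom_sub: "adj_dom \<subseteq> rdom \<pi>"
begin

lemma ract_eqI: "\<phi> \<in> rdom \<pi> \<Longrightarrow> adj a \<phi> \<psi> \<Longrightarrow> ract \<pi> a \<phi> = \<psi>"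
  using adj_unique adj_ract by blast

lemma domI: "\<phi> \<in> hcarrier K \<Longrightarrow> (\<And>g a. a \<in> A g \<Longrightarrow> \<exists>\<psi>. adj a \<phi> \<psi>) \<Longrightarrow> \<phi> \<in> rdom \<pi>"
  using adj_dom_sub by (auto simp: adj_dom_def)

lemma closed:
  assumes "A 0 \<subseteq> S" shows "closed_rep S \<pi>"
  unfolding closed_rep_def
proof (intro allI impI)
  fix F assume F: "graph_cauchy S \<pi> F"
  obtain \<phi> L where \<phi>: "\<phi> \<in> adj_dom" "htendsto K (\<lambda>x. x) \<phi> F"
    and L: "\<And>a. adj a \<phi> (L a)" "\<And>a. htendsto K (ract \<pi> a) (L a) F"
    by (rule graph_cauchy_limit[OF F assms]) (rule that)
  have \<phi>d: "\<phi> \<in> rdom \<pi>" using \<phi> adj_dom_sub by blast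
  have dom: "\<forall>\<^sub>F x in F. x \<in> rdom \<pi>" using F by (simp add: graph_cauchy_def)
  show "\<exists>\<phi>\<in>rdom \<pi>. \<forall>a\<in>S. ((\<lambda>x. graph_norm \<pi> a (hdiff (hsp \<pi>) x \<phi>)) \<longlongrightarrow> 0) F"
  proof (intro bexI ballI)
    fix a
    have "((\<lambda>x. hnorm K (hdiff K x \<phi>) + hnorm K (hdiff K (ract \<pi> a x) (ract \<pi> a \<phi>))) \<longlongrightarrow> 0 + 0) F"
      using \<phi>(2) L(2)[of a] unfolding ract_eqI[OF \<phi>d L(1)] htendsto_def by (intro tendsto_add)
    moreover have "\<forall>\<^sub>F x in F. hnorm K (hdiff K x \<phi>) + hnorm K (hdiff K (ract \<pi> a x) (ract \<pi> a \<phi>)) =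
        graph_norm \<pi> a (hdiff K x \<phi>)"
      using dom by eventually_elim (simp add: graph_norm_def \<pi>_diff \<phi>d)
    ultimately show "((\<lambda>x. graph_norm \<pi> a (hdiff (hsp \<pi>) x \<phi>)) \<longlongrightarrow> 0) F"
      by (auto intro: Lim_transform_eventually)
  qed (rule \<phi>d)
qed

end

context generated_rep
begin

lemma adj_all:
  assumes "adj a \<phi> \<psi>" "\<phi> \<in> hcarrier K" "v \<in> hcarrier V"
  shows "hinner K \<psi> (ten d v) = hinner K \<phi> (ten (star a * d) v)"
  by (induction d rule: graded_induct) (use assms in \<open>auto simp: adj_def ten_add distrib_left\<close>)

lemma \<pi>_zero: "ract \<pi> a (hzero K) = hzero K"
proof -
  have z: "hzero K \<in> rdom \<pi>" by (rule subspace_zero[OF dom_subspace])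
  from \<pi>_hscale[OF z, where c = 0 and a = a] show ?thesis using z by (simp add: hscale_zero_eq)
qed

definition closure :: "('a, 'h) representation" where
  "closure = rep_closure UNIV \<pi>"

lemma closure_hsp [simp]: "hsp closure = K"
  by (simp add: closure_def rep_closure_def)

lemma closure_dom: "rdom closure = adj_dom"
proof -
  have 1: "\<phi> \<in> adj_dom" if F: "\<phi> \<in> hcarrier K" "graph_cauchy UNIV \<pi> F" "htendsto K (\<lambda>x. x) \<phi> F" for \<phi> F
  proof -
    obtain \<phi>' L where \<phi>': "\<phi>' \<in> adj_dom" "htendsto K (\<lambda>x. x) \<phi>' F"
      and "\<And>a. adj a \<phi>' (L a)" "\<And>a. htendsto K (ract \<pi> a) (L a) F"
      by (rule graph_cauchy_limit[OF F(2) subset_UNIV]) (rule that)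
    have \<phi>'K: "\<phi>' \<in> hcarrier K" using \<phi>'(1) by (simp add: adj_dom_def)
    have "\<phi> = \<phi>'"
      by (rule htendsto_unique[OF K_ips _ _ F(1) \<phi>'K F(3) \<phi>'(2)])
        (use F(2) in \<open>auto simp: graph_cauchy_def elim: eventually_mono\<close>)
    thus ?thesis using \<phi>'(1) by simp
  qed
  have 2: "\<exists>F. graph_cauchy UNIV \<pi> F \<and> htendsto K (\<lambda>x. x) \<phi> F" if "\<phi> \<in> adj_dom" for \<phi>
    using adj_dom_approx(1)[OF that, of UNIV] adj_dom_approx(2)[OF that] by blast
  have 3: "\<phi> \<in> hcarrier K" if "\<phi> \<in> adj_dom" for \<phi> using that by (simp add: adj_dom_def)
  have "rdom closure = {\<phi> \<in> hcarrier K. \<exists>F. graph_cauchy UNIV \<pi> F \<and> htendsto K (\<lambda>x. x) \<phi> F}"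
    by (simp add: closure_def rep_closure_def)
  also have "\<dots> = adj_dom" using 1 2 3 by blast
  finally show ?thesis .
qed

lemma closure_act:
  assumes \<phi>: "\<phi> \<in> adj_dom" shows "adj a \<phi> (ract closure a \<phi>)"
proof -
  have \<phi>K: "\<phi> \<in> hcarrier K" using \<phi> by (simp add: adj_dom_def)
  let ?P = "\<lambda>\<psi>. \<psi> \<in> hcarrier K \<and> (\<exists>F. graph_cauchy UNIV \<pi> F \<and> htendsto K (\<lambda>x. x) \<phi> F \<and> htendsto K (ract \<pi> a) \<psi> F)"
  have P: "adj a \<phi> \<psi>" if "?P \<psi>" for \<psi>
  proof -
    from that have \<psi>: "\<psi> \<in> hcarrier K" by blast
    from that obtain F where F: "graph_cauchy UNIV \<pi> F" "htendsto K (\<lambda>x. x) \<phi> F" "htendsto K (ract \<pi> a) \<psi> F"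
      by blast
    obtain \<phi>' L where \<phi>': "\<phi>' \<in> adj_dom" "htendsto K (\<lambda>x. x) \<phi>' F"
      and L: "\<And>a. adj a \<phi>' (L a)" "\<And>a. htendsto K (ract \<pi> a) (L a) F"
      by (rule graph_cauchy_limit[OF F(1) subset_UNIV]) (rule that)
    have ne: "F \<noteq> bot" and ev: "\<forall>\<^sub>F x in F. x \<in> hcarrier K" "\<forall>\<^sub>F x in F. ract \<pi> a x \<in> hcarrier K"
      using F(1) by (auto simp: graph_cauchy_def elim: eventually_mono)
    have "\<phi> = \<phi>'" using htendsto_unique[OF K_ips ne ev(1) \<phi>K _ F(2) \<phi>'(2)] \<phi>'(1) by (simp add: adj_dom_def)
    moreover have "\<psi> = L a"
      using htendsto_unique[OF K_ips ne ev(2) \<psi> _ F(3) L(2)] L(1)[of a] by (simp add: adj_def)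
    ultimately show ?thesis using L(1) by simp
  qed
  have ex: "\<exists>\<psi>. ?P \<psi>"
  proof -
    let ?F = "filtermap (psum K (component_of \<phi>)) sequentially"
    note F = adj_dom_approx(1)[OF \<phi>, of UNIV] adj_dom_approx(2)[OF \<phi>]
    obtain \<phi>' L where "\<phi>' \<in> adj_dom" "htendsto K (\<lambda>x. x) \<phi>' ?F"
      and L: "\<And>a. adj a \<phi>' (L a)" "\<And>a. htendsto K (ract \<pi> a) (L a) ?F"
      by (rule graph_cauchy_limit[OF F(1) subset_UNIV]) (rule that)
    have "?P (L a)" using F L(1)[of a] L(2)[of a] by (auto simp: adj_def intro!: exI[of _ ?F])
    thus ?thesis by blast
  qed
  then obtain \<psi> where \<psi>: "?P \<psi>" by blast
  have "ract closure a \<phi> = (THE \<psi>. ?P \<psi>)" by (simp add: closure_def rep_closure_def)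
  also have "\<dots> = \<psi>" using \<psi> P adj_unique by (intro the_equality) blast+
  finally show ?thesis using P[OF \<psi>] by simp
qed

lemma closure_act_eqI: "\<phi> \<in> adj_dom \<Longrightarrow> adj a \<phi> \<psi> \<Longrightarrow> ract closure a \<phi> = \<psi>"
  using closure_act adj_unique by blast

lemma closure_extends: "\<phi> \<in> rdom \<pi> \<Longrightarrow> ract closure a \<phi> = ract \<pi> a \<phi>"
  using dom_sub_adj_dom adj_ract by (intro closure_act_eqI) auto

lemma adj_hadd: "\<phi> \<in> hcarrier K \<Longrightarrow> \<psi> \<in> hcarrier K \<Longrightarrow> adj a \<phi> \<phi>' \<Longrightarrow> adj a \<psi> \<psi>' \<Longrightarrow>
    adj a (hadd K \<phi> \<psi>) (hadd K \<phi>' \<psi>')"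
  by (simp add: adj_def)

lemma adj_hscale: "\<phi> \<in> hcarrier K \<Longrightarrow> adj a \<phi> \<phi>' \<Longrightarrow> adj a (hscale K c \<phi>) (hscale K c \<phi>')"
  by (simp add: adj_def)

lemma adj_dom_subspace: "hsubspace K adj_dom"
  unfolding hsubspace_def
proof (intro conjI ballI allI)
  have K: "\<phi> \<in> hcarrier K" if "\<phi> \<in> adj_dom" for \<phi> using that by (simp add: adj_dom_def)
  show "adj_dom \<subseteq> hcarrier K" using K by blast
  show "hzero K \<in> adj_dom" using dom_sub_adj_dom subspace_zero[OF dom_subspace] by blast
  fix \<phi> assume \<phi>: "\<phi> \<in> adj_dom"
  show "hadd K \<phi> \<psi> \<in> adj_dom" if \<psi>: "\<psi> \<in> adj_dom" for \<psi>
    unfolding adj_dom_def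
  proof (intro CollectI conjI allI ballI)
    fix a
    show "\<exists>\<eta>. adj a (hadd K \<phi> \<psi>) \<eta>"
      using adj_dom_ex[OF \<phi>, of a] adj_dom_ex[OF \<psi>, of a] adj_hadd[OF K[OF \<phi>] K[OF \<psi>]] by blast
  qed (use K \<phi> \<psi> in simp)
  show "hscale K c \<phi> \<in> adj_dom" for c
    unfolding adj_dom_def
  proof (intro CollectI conjI allI ballI)
    fix a
    show "\<exists>\<eta>. adj a (hscale K c \<phi>) \<eta>" using adj_dom_ex[OF \<phi>, of a] adj_hscale[OF K[OF \<phi>]] by blast
  qed (use K \<phi> in simp)
qed

text \<open>Symmetry passes from the tensors to the closure along the partial sums.\<close>

lemma adj_symmetric:
  assumes \<phi>: "\<phi> \<in> adj_dom" "\<psi> \<in> adj_dom" and a: "adj a \<phi> \<phi>'" "adj (star a) \<psi> \<psi>'"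
  shows "hinner K \<phi>' \<psi> = hinner K \<phi> \<psi>'"
proof -
  have in': "\<phi> \<in> hcarrier K" "\<psi> \<in> hcarrier K" "\<phi>' \<in> hcarrier K" "\<psi>' \<in> hcarrier K"
    using assms by (auto simp: adj_dom_def adj_def)
  let ?s = "psum K (component_of \<psi>)"
  let ?F = "filtermap ?s sequentially"
  note F = adj_dom_approx(1)[OF \<phi>(2), of UNIV] adj_dom_approx(2)[OF \<phi>(2)]
  obtain \<psi>2 L where \<psi>2: "\<psi>2 \<in> adj_dom" "htendsto K (\<lambda>x. x) \<psi>2 ?F" and L: "\<And>a. adj a \<psi>2 (L a)" "\<And>a. htendsto K (ract \<pi> a) (L a) ?F"
    by (rule graph_cauchy_limit[OF F(1) subset_UNIV]) (rule that)
  have ne: "?F \<noteq> bot" by (simp add: filtermap_bot_iff)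
  have ev: "\<forall>\<^sub>F x in ?F. x \<in> hcarrier K" using in' by (simp add: eventually_filtermap)
  have "\<psi> = \<psi>2" using htendsto_unique[OF K_ips ne ev in'(2) _ F(2) \<psi>2(2)] \<psi>2(1) by (simp add: adj_dom_def)
  hence "L (star a) = \<psi>'" using L(1) a(2) adj_unique by blast
  hence t: "htendsto K (\<lambda>n. ract \<pi> (star a) (?s n)) \<psi>' sequentially"
    using L(2)[of "star a"] by (simp add: htendsto_def filterlim_filtermap)
  have eq: "hinner K \<phi>' (?s n) = hinner K \<phi> (ract \<pi> (star a) (?s n))" for n
  proof (induction n)
    case 0
    then show ?case using in' by (simp add: psum_def \<pi>_zero)
  next
    case (Suc n)
    have eq1: "hinner K \<phi>' (component_of \<psi> k) = hinner K \<phi> (ract \<pi> (star a) (component_of \<psi> k))" for k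
      unfolding component_of_def
      by (rule seq_of_cases[of k]) (use in' adj_all[OF a(1) in'(1)] in \<open>auto simp: frame_def act_ten \<pi>_zero\<close>)
    have s: "?s (Suc n) = hadd K (?s n) (component_of \<psi> n)"
      by (rule vector_eqI[OF K_ips]) (use in' in \<open>simp_all add: hinner_psum\<close>)
    show ?case unfolding s using Suc eq1 in' by (simp add: \<pi>_hadd)
  qed
  have "(\<lambda>n. hinner K \<phi>' (?s n)) \<longlonglongrightarrow> hinner K \<phi>' \<psi>"
    using htendsto_inner_right[OF K_ips _ in'(2,3) expansion[OF in'(2)]] in' by simp
  moreover have "(\<lambda>n. hinner K \<phi> (ract \<pi> (star a) (?s n))) \<longlonglongrightarrow> hinner K \<phi> \<psi>'"
    using htendsto_inner_right[OF K_ips _ in'(4,1) t] in' by simp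
  ultimately show ?thesis using LIMSEQ_unique unfolding eq by blast
qed

lemma closure_star_rep: "star_rep UNIV closure"
proof -
  note adj = closure_act
  have cK: "ract closure a \<phi> \<in> hcarrier K" if "\<phi> \<in> adj_dom" for a \<phi>
    using adj[OF that] by (simp add: adj_def)
  have dK: "\<phi> \<in> hcarrier K" if "\<phi> \<in> adj_dom" for \<phi> using that by (simp add: adj_dom_def)
  have mult: "adj b (ract closure a \<phi>) (ract closure (b * a) \<phi>)" if \<phi>: "\<phi> \<in> adj_dom" for a b \<phi>
    using adj_all[OF adj[OF \<phi>] dK[OF \<phi>]] cK[OF \<phi>] by (simp add: adj_def star_mult mult.assoc)
  have in': "ract closure a \<phi> \<in> adj_dom" if "\<phi> \<in> adj_dom" for a \<phi>
    using mult[OF that] cK[OF that] by (auto simp: adj_dom_def)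
  note sub = adj_dom_subspace
  show ?thesis
    unfolding star_rep_def closure_hsp closure_dom hlinear_def
  proof (intro conjI ballI allI)
    show "hilbert_space K" by (rule K_hilbert)
    show "hsubspace K adj_dom" by (rule sub)
    show "hdense K adj_dom"
      using star_rep_dense[OF star_rep_\<pi>] dom_sub_adj_dom unfolding hdense_def by blast
    fix a
    show "ract closure a ` adj_dom \<subseteq> adj_dom" using in' by blast
    fix \<phi> assume \<phi>: "\<phi> \<in> adj_dom"
    show "ract closure a (hadd K \<phi> \<psi>) = hadd K (ract closure a \<phi>) (ract closure a \<psi>)" if \<psi>: "\<psi> \<in> adj_dom" for \<psi>
      by (rule closure_act_eqI[OF subspace_add[OF sub \<phi> \<psi>] adj_hadd[OF dK[OF \<phi>] dK[OF \<psi>] adj[OF \<phi>] adj[OF \<psi>]]])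
    show "ract closure a (hscale K c \<phi>) = hscale K c (ract closure a \<phi>)" for c
      by (rule closure_act_eqI[OF subspace_scale[OF sub \<phi>] adj_hscale[OF dK[OF \<phi>] adj[OF \<phi>]]])
    show "ract closure (a + b) \<phi> = hadd K (ract closure a \<phi>) (ract closure b \<phi>)" for b
      by (rule closure_act_eqI[OF \<phi> adj_add[OF dK[OF \<phi>] adj[OF \<phi>] adj[OF \<phi>]]])
    show "ract closure (c *\<^sub>C a) \<phi> = hscale K c (ract closure a \<phi>)" for c
    proof (rule closure_act_eqI[OF \<phi>])
      have "ten (star (c *\<^sub>C a) * d) v = hscale K (cnj c) (ten (star a * d) v)" if "v \<in> hcarrier V" for d v
        using that by (simp add: ten_def star_scaleC mult_scaleC_left \<pi>_scaleC J_in)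
      thus "adj (c *\<^sub>C a) \<phi> (hscale K c (ract closure a \<phi>))"
        using adj[OF \<phi>, of a] dK[OF \<phi>] by (simp add: adj_def)
    qed
    show "ract closure (a * b) \<phi> = ract closure a (ract closure b \<phi>)" for b
      by (rule closure_act_eqI[OF in'[OF \<phi>] mult[OF \<phi>], symmetric])
    show "hinner K (ract closure a \<phi>) \<psi> = hinner K \<phi> (ract closure (star a) \<psi>)" if \<psi>: "\<psi> \<in> adj_dom" for \<psi>
      by (rule adj_symmetric[OF \<phi> \<psi> adj[OF \<phi>] adj[OF \<psi>]])
  qed
qed

lemma closure_full: "full_rep A \<xi> H \<rho> closure J"
proof -
  interpret c: generated_rep A \<xi> H \<rho> closure J
  proof
    show "star_rep UNIV closure" by (rule closure_star_rep)
    show "J v \<in> rdom closure" if "v \<in> hcarrier V" for v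
      using J_in[OF that] dom_sub_adj_dom by (auto simp: closure_dom)
    show "\<phi> = hzero (hsp closure)" if "\<phi> \<in> hcarrier (hsp closure)"
      "\<And>d v. v \<in> hcarrier V \<Longrightarrow> hinner (hsp closure) \<phi> (ract closure d (J v)) = 0" for \<phi>
      using total[of \<phi>] that by (simp add: closure_extends J_in)
  qed (auto simp: J_inner closure_extends J_in J_act)
  have ten: "c.ten d v = ten d v" if "v \<in> hcarrier V" for d v
    using that by (simp add: c.ten_def ten_def closure_extends J_in)
  have adj: "c.adj a \<phi> \<psi> \<longleftrightarrow> adj a \<phi> \<psi>" for a \<phi> \<psi>
    by (simp add: c.adj_def adj_def ten cong: ball_cong)
  show ?thesis
    by unfold_locales (simp add: c.adj_dom_def adj_dom_def adj closure_dom)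
qed

end

section \<open>Spectral measures\<close>

locale spectral =
  fixes K :: "'h hspace" and \<Omega> :: "'x set" and \<Sigma> :: "'x set set" and E :: "'x set \<Rightarrow> 'h \<Rightarrow> 'h"
  assumes hilbert: "hilbert_space K" and sm: "spectral_measure K \<Omega> \<Sigma> E" and sa: "sigma_algebra \<Omega> \<Sigma>"
begin

lemma ips [simp]: "inner_product_space K"
  using hilbert by simp

lemma E_projection: "\<Delta> \<in> \<Sigma> \<Longrightarrow> E \<Delta> \<in> projections K"
  and E_space: "\<phi> \<in> hcarrier K \<Longrightarrow> E \<Omega> \<phi> = \<phi>"
  and E_sigma: "range S \<subseteq> \<Sigma> \<Longrightarrow> disjoint_family S \<Longrightarrow> \<phi> \<in> hcarrier K \<Longrightarrow>
    htendsto K (psum K (\<lambda>k. E (S k) \<phi>)) (E (\<Union>k. S k) \<phi>) sequentially" for S :: "nat \<Rightarrow> 'x set"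
  using sm unfolding spectral_measure_def psum_def by blast+

lemma
  assumes "\<Delta> \<in> \<Sigma>" "\<phi> \<in> hcarrier K"
  shows E_in [simp]: "E \<Delta> \<phi> \<in> hcarrier K" and E_idem: "E \<Delta> (E \<Delta> \<phi>) = E \<Delta> \<phi>"
    and E_scale: "E \<Delta> (hscale K c \<phi>) = hscale K c (E \<Delta> \<phi>)"
    and E_add: "\<psi> \<in> hcarrier K \<Longrightarrow> E \<Delta> (hadd K \<phi> \<psi>) = hadd K (E \<Delta> \<phi>) (E \<Delta> \<psi>)"
    and E_sym: "\<psi> \<in> hcarrier K \<Longrightarrow> hinner K (E \<Delta> \<phi>) \<psi> = hinner K \<phi> (E \<Delta> \<psi>)"
  using E_projection[OF assms(1)] assms(2)
  by (auto simp: projections_def bounded_ops_def adjoint_pair_def hlinear_def)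

lemma E_diff: "\<Delta> \<in> \<Sigma> \<Longrightarrow> \<phi> \<in> hcarrier K \<Longrightarrow> \<psi> \<in> hcarrier K \<Longrightarrow> E \<Delta> (hdiff K \<phi> \<psi>) = hdiff K (E \<Delta> \<phi>) (E \<Delta> \<psi>)"
  by (simp add: hdiff_def E_add E_scale)

lemma E_norm_sq: "\<Delta> \<in> \<Sigma> \<Longrightarrow> \<phi> \<in> hcarrier K \<Longrightarrow> (hnorm K (E \<Delta> \<phi>))\<^sup>2 = Re (hinner K (E \<Delta> \<phi>) \<phi>)"
  using E_sym[of \<Delta> "E \<Delta> \<phi>" \<phi>] by (simp add: hnorm_sq E_idem)

lemma E_norm_le:
  assumes "\<Delta> \<in> \<Sigma>" "\<phi> \<in> hcarrier K" shows "hnorm K (E \<Delta> \<phi>) \<le> hnorm K \<phi>"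
proof (cases "hnorm K (E \<Delta> \<phi>) = 0")
  case False
  hence pos: "hnorm K (E \<Delta> \<phi>) > 0" using hnorm_ge0[OF ips E_in[OF assms]] by linarith
  have "(hnorm K (E \<Delta> \<phi>))\<^sup>2 \<le> hnorm K (E \<Delta> \<phi>) * hnorm K \<phi>"
    unfolding E_norm_sq[OF assms]
    using Cauchy_Schwarz[OF ips E_in[OF assms] assms(2)] complex_Re_le_cmod[of "hinner K (E \<Delta> \<phi>) \<phi>"] by linarith
  thus ?thesis using pos by (simp add: power2_eq_square)
qed (use assms in simp)

lemma E_limit:
  assumes "\<Delta> \<in> \<Sigma>" "\<And>n. s n \<in> hcarrier K" "l \<in> hcarrier K" "htendsto K s l F"
  shows "htendsto K (\<lambda>n. E \<Delta> (s n)) (E \<Delta> l) F"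
proof (rule htendsto_map_bounded[where V = K and K = 1 and T = "E \<Delta>" and f = s and l = l])
  show "\<forall>\<^sub>F n in F. hnorm K (hdiff K (E \<Delta> (s n)) (E \<Delta> l)) \<le> 1 * hnorm K (hdiff K (s n) l)"
    using E_norm_le[OF assms(1), of "hdiff K (s _) l"] assms by (simp add: E_diff)
qed (use assms in auto)

interpretation sigma_algebra \<Omega> \<Sigma>
  by (rule sa)

lemmas empty_in [simp] = empty_sets and space_in [simp] = top and union_in [simp] = Un
  and inter_in [simp] = Int and diff_in [simp] = Diff

text \<open>The series with all terms equal to \<open>E {} \<phi>\<close> converges, so its terms vanish.\<close>

lemma E_empty [simp]:
  assumes \<phi>: "\<phi> \<in> hcarrier K" shows "E {} \<phi> = hzero K"
proof -
  let ?u = "E {} \<phi>"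
  have u: "?u \<in> hcarrier K" using \<phi> by simp
  have "htendsto K (psum K (\<lambda>k. E {} \<phi>)) (E {} \<phi>) sequentially"
    using E_sigma[of "\<lambda>_. {}" \<phi>] \<phi> by (simp add: disjoint_family_on_def)
  hence t: "(\<lambda>n. of_nat n * hinner K ?u ?u) \<longlonglongrightarrow> hinner K ?u ?u"
    using htendsto_inner_left[OF ips _ u u, of "psum K (\<lambda>k. E {} \<phi>)" sequentially] u
    by (simp add: hinner_psum(1))
  have "(\<lambda>n. of_nat (Suc n) * hinner K ?u ?u - of_nat n * hinner K ?u ?u) \<longlonglongrightarrow> 0"
    using tendsto_diff[OF LIMSEQ_Suc[OF t] t] by simp
  hence "(\<lambda>n::nat. hinner K ?u ?u) \<longlonglongrightarrow> 0" by (simp add: algebra_simps)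
  hence "hinner K ?u ?u = 0" by (simp add: LIMSEQ_const_iff)
  thus ?thesis using hinner_self_eq0[OF ips u] by blast
qed

lemma E_union:
  assumes "S \<in> \<Sigma>" "T \<in> \<Sigma>" "S \<inter> T = {}" "\<phi> \<in> hcarrier K"
  shows "E (S \<union> T) \<phi> = hadd K (E S \<phi>) (E T \<phi>)"
proof (rule vector_eqI[OF ips])
  fix z assume z: "z \<in> hcarrier K"
  let ?S = "binaryset S T"
  have in': "?S k \<in> \<Sigma>" for k using assms by (auto simp: binaryset_def)
  have t: "htendsto K (psum K (\<lambda>k. E (?S k) \<phi>)) (E (S \<union> T) \<phi>) sequentially"
  proof -
    have "disjoint_family ?S"
      unfolding disjoint_family_on_def
    proof (intro ballI impI)
      fix j k :: nat assume "j \<noteq> k"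
      then show "?S j \<inter> ?S k = {}" using assms(3) by (auto simp: binaryset_def)
    qed
    thus ?thesis using E_sigma[of ?S \<phi>] in' assms(4) by (auto simp: UN_binaryset_eq)
  qed
  have t1: "(\<lambda>n. \<Sum>k<n. hinner K (E (?S k) \<phi>) z) \<longlonglongrightarrow> hinner K (E (S \<union> T) \<phi>) z"
    using htendsto_inner_left[OF ips _ _ z t] in' assms z by (simp add: hinner_psum(1))
  have ev: "\<forall>\<^sub>F n in sequentially. (\<Sum>k<n. hinner K (E (?S k) \<phi>) z) = hinner K (E S \<phi>) z + hinner K (E T \<phi>) z"
    using eventually_ge_at_top[of 2]
  proof eventually_elim
    case (elim n)
    have "(\<Sum>k<n. hinner K (E (?S k) \<phi>) z) = (\<Sum>k<2. hinner K (E (?S k) \<phi>) z)"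
      by (rule sum.mono_neutral_right) (use elim assms z in \<open>auto simp: binaryset_def\<close>)
    then show ?case by (simp add: binaryset_def numeral_2_eq_2)
  qed
  have "hinner K (E S \<phi>) z + hinner K (E T \<phi>) z = hinner K (E (S \<union> T) \<phi>) z"
    by (rule LIMSEQ_unique[OF tendsto_eventually[OF ev] t1])
  thus "hinner K (E (S \<union> T) \<phi>) z = hinner K (hadd K (E S \<phi>) (E T \<phi>)) z" using assms z by simp
qed (use assms in auto)

text \<open>If \<open>y\<close> is in the range of \<open>E T\<close>, then \<open>E (S \<union> T) y = E S y + y\<close> has squared norm
  \<open>\<parallel>E S y\<parallel>\<^sup>2 + \<parallel>y\<parallel>\<^sup>2\<close>, which a projection cannot allow unless \<open>E S y\<close> is zero.\<close>

lemma E_disjoint: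
  assumes "S \<in> \<Sigma>" "T \<in> \<Sigma>" "S \<inter> T = {}" "\<phi> \<in> hcarrier K"
  shows "E S (E T \<phi>) = hzero K"
proof -
  let ?y = "E T \<phi>"
  have y: "?y \<in> hcarrier K" using assms by simp
  have "(hnorm K (E (S \<union> T) ?y))\<^sup>2 = Re (hinner K (E S ?y) ?y) + Re (hinner K ?y ?y)"
    using E_norm_sq[of "S \<union> T" ?y] E_union[OF assms(1-3) y] assms y by (simp add: E_idem)
  also have "\<dots> = (hnorm K (E S ?y))\<^sup>2 + (hnorm K ?y)\<^sup>2"
    using E_norm_sq[OF assms(1) y] y by (simp add: hnorm_sq)
  finally have "(hnorm K (E S ?y))\<^sup>2 + (hnorm K ?y)\<^sup>2 \<le> (hnorm K ?y)\<^sup>2"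
    using E_norm_le[of "S \<union> T" ?y] assms y power_mono[of "hnorm K (E (S \<union> T) ?y)" "hnorm K ?y" 2] by simp
  hence "hnorm K (E S ?y) = 0" by simp
  thus ?thesis using hnorm_eq0[OF ips E_in[OF assms(1) y]] by blast
qed

lemma E_inter:
  assumes "S \<in> \<Sigma>" "T \<in> \<Sigma>" "\<phi> \<in> hcarrier K"
  shows "E S (E T \<phi>) = E (S \<inter> T) \<phi>"
proof -
  have m: "S \<inter> T \<in> \<Sigma>" "S - T \<in> \<Sigma>" "T - S \<in> \<Sigma>" using assms by auto
  have T: "S \<inter> T \<union> (T - S) = T" and S: "S \<inter> T \<union> (S - T) = S" by auto
  have "E T \<phi> = hadd K (E (S \<inter> T) \<phi>) (E (T - S) \<phi>)"
    using E_union[OF m(1,3) _ assms(3)] unfolding T by blast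
  hence "E S (E T \<phi>) = hadd K (E S (E (S \<inter> T) \<phi>)) (E S (E (T - S) \<phi>))" using assms m by (simp add: E_add)
  also have "E S (E (T - S) \<phi>) = hzero K" by (rule E_disjoint) (use assms m in auto)
  also have "E S (E (S \<inter> T) \<phi>) = hadd K (E (S \<inter> T) (E (S \<inter> T) \<phi>)) (E (S - T) (E (S \<inter> T) \<phi>))"
    using E_union[OF m(1,2) _ E_in[OF m(1) assms(3)]] unfolding S by blast
  also have "E (S - T) (E (S \<inter> T) \<phi>) = hzero K" by (rule E_disjoint) (use assms m in auto)
  finally show ?thesis using assms m by (simp add: E_idem)
qed

lemma emeasure_vector_measure:
  assumes \<phi>: "\<phi> \<in> hcarrier K" and \<Delta>: "\<Delta> \<in> \<Sigma>"
  shows "emeasure (vector_measure K \<Omega> \<Sigma> E \<phi>) \<Delta> = ennreal ((hnorm K (E \<Delta> \<phi>))\<^sup>2)"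
proof -
  let ?m = "\<lambda>\<Delta>. ennreal (Re (hinner K (E \<Delta> \<phi>) \<phi>))"
  have "countably_additive \<Sigma> ?m"
  proof (rule countably_additiveI)
    fix S :: "nat \<Rightarrow> 'x set" assume S: "range S \<subseteq> \<Sigma>" "disjoint_family S" "(\<Union>i. S i) \<in> \<Sigma>"
    have S': "S k \<in> \<Sigma>" for k using S by auto
    have "(\<lambda>n. hinner K (psum K (\<lambda>k. E (S k) \<phi>) n) \<phi>) \<longlonglongrightarrow> hinner K (E (\<Union>k. S k) \<phi>) \<phi>"
      using htendsto_inner_left[OF ips _ _ \<phi> E_sigma[OF S(1,2) \<phi>]] S S' \<phi> by simp
    hence "(\<lambda>n. \<Sum>k<n. hinner K (E (S k) \<phi>) \<phi>) \<longlonglongrightarrow> hinner K (E (\<Union>k. S k) \<phi>) \<phi>"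
      using S' \<phi> by (simp add: hinner_psum(1))
    hence "(\<lambda>k. Re (hinner K (E (S k) \<phi>) \<phi>)) sums Re (hinner K (E (\<Union>k. S k) \<phi>) \<phi>)"
      unfolding sums_def using tendsto_Re by fastforce
    thus "suminf (\<lambda>i. ?m (S i)) = ?m (\<Union>i. S i)"
      by (rule suminf_ennreal_eq[rotated]) (use E_norm_sq[OF S' \<phi>, symmetric] in simp)
  qed
  moreover have "positive \<Sigma> ?m" using \<phi> by (simp add: positive_def)
  ultimately have "emeasure (vector_measure K \<Omega> \<Sigma> E \<phi>) \<Delta> = ?m \<Delta>"
    unfolding vector_measure_def using emeasure_measure_of_sigma[OF sa] \<Delta> by blast
  thus ?thesis using E_norm_sq[OF \<Delta> \<phi>] by simp
qed

lemma vector_measure_space: "space (vector_measure K \<Omega> \<Sigma> E \<phi>) = \<Omega>"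
  and vector_measure_sets: "sets (vector_measure K \<Omega> \<Sigma> E \<phi>) = \<Sigma>"
proof -
  have "\<Sigma> \<subseteq> Pow \<Omega>" using sa by (auto simp: sigma_algebra_def algebra_iff_Un)
  thus "space (vector_measure K \<Omega> \<Sigma> E \<phi>) = \<Omega>" "sets (vector_measure K \<Omega> \<Sigma> E \<phi>) = \<Sigma>"
    using sigma_algebra.sigma_sets_eq[OF sa] by (simp_all add: vector_measure_def)
qed

end

text \<open>A spectral measure carried by countably many points \<open>x\<close> is determined by the projections
  \<open>E {x}\<close>, and integrals with respect to it become sums. For such measures the spectral integral
  of \<open>f\<close> is the operator that multiplies the range of \<open>E {x}\<close> by \<open>f x\<close>.\<close>

locale atomic_spectral = spectral K \<Omega> \<Sigma> E + countable_index X
  for K :: "'h hspace" and \<Omega> :: "'x set" and \<Sigma> and E and X :: "'x set" +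
  assumes point_in [simp]: "x \<in> X \<Longrightarrow> {x} \<in> \<Sigma>"
    and support: "\<Delta> \<in> \<Sigma> \<Longrightarrow> \<Delta> \<inter> X = {} \<Longrightarrow> \<phi> \<in> hcarrier K \<Longrightarrow> E \<Delta> \<phi> = hzero K"
begin

lemma X_in [simp]: "X \<in> \<Sigma>"
proof -
  have "(\<Union>x\<in>X. {x}) \<in> \<Sigma>" by (rule sigma_algebra.countable_UN'[OF sa countable_X]) auto
  thus ?thesis by simp
qed

lemma X_sub: "X \<subseteq> \<Omega>"
proof -
  have "\<Sigma> \<subseteq> Pow \<Omega>" using sa by (auto simp: sigma_algebra_def algebra_iff_Un)
  thus ?thesis using X_in by blast
qed

lemma E_complement [simp]: "\<phi> \<in> hcarrier K \<Longrightarrow> E (\<Omega> - X) \<phi> = hzero K"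
  by (rule support) auto

lemma E_X:
  assumes "\<phi> \<in> hcarrier K" shows "E X \<phi> = \<phi>"
proof -
  have "E (X \<union> (\<Omega> - X)) \<phi> = hadd K (E X \<phi>) (E (\<Omega> - X) \<phi>)"
    by (rule E_union) (use assms in auto)
  thus ?thesis using assms X_sub E_space by (simp add: Un_absorb1)
qed

lemma E_points:
  assumes "\<phi> \<in> hcarrier K"
  shows "htendsto K (psum K (seq_of (hzero K) (\<lambda>x. E {x} \<phi>))) \<phi> sequentially"
proof -
  let ?S = "seq_of {} (\<lambda>x. {x})"
  have in': "?S k \<in> \<Sigma>" for k by (rule seq_of_cases[of k]) auto
  have "disjoint_family ?S"
    unfolding disjoint_family_on_def
  proof (intro ballI impI)
    fix j k :: nat assume "j \<noteq> k"
    then show "?S j \<inter> ?S k = {}"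
      by (rule_tac seq_of_cases[of j]; rule_tac seq_of_cases[of k]) auto
  qed
  moreover have "(\<Union>k. ?S k) = X"
  proof -
    have "?S k \<subseteq> X" for k by (rule seq_of_cases[of k]) auto
    moreover have "x \<in> ?S (to_nat_on X x)" if "x \<in> X" for x using that by simp
    ultimately show ?thesis by blast
  qed
  moreover have "(\<lambda>k. E (?S k) \<phi>) = seq_of (hzero K) (\<lambda>x. E {x} \<phi>)"
  proof
    fix k show "E (?S k) \<phi> = seq_of (hzero K) (\<lambda>x. E {x} \<phi>) k"
      by (rule seq_of_cases[of k]) (use assms in auto)
  qed
  ultimately show ?thesis using E_sigma[of ?S \<phi>] in' E_X[OF assms] assms by auto
qed

lemma points_ext:
  assumes "\<phi> \<in> hcarrier K" "\<psi> \<in> hcarrier K" "\<And>x. x \<in> X \<Longrightarrow> E {x} \<phi> = E {x} \<psi>"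
  shows "\<phi> = \<psi>"
proof (rule htendsto_unique[OF ips sequentially_bot _ assms(1,2)])
  have in': "seq_of (hzero K) (\<lambda>x. E {x} \<phi>) k \<in> hcarrier K" for k
    by (rule seq_of_cases[of k]) (use assms in auto)
  show "\<forall>\<^sub>F n in sequentially. psum K (seq_of (hzero K) (\<lambda>x. E {x} \<phi>)) n \<in> hcarrier K" using in' by simp
  have "seq_of (hzero K) (\<lambda>x. E {x} \<phi>) = seq_of (hzero K) (\<lambda>x. E {x} \<psi>)"
  proof
    fix k show "seq_of (hzero K) (\<lambda>x. E {x} \<phi>) k = seq_of (hzero K) (\<lambda>x. E {x} \<psi>) k"
      by (rule seq_of_cases[of k]) (use assms in auto)
  qed
  thus "htendsto K (psum K (seq_of (hzero K) (\<lambda>x. E {x} \<phi>))) \<psi> sequentially" using E_points[OF assms(2)] by simp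
qed (rule E_points[OF assms(1)])

lemma nn_integral_atomic:
  assumes \<phi>: "\<phi> \<in> hcarrier K"
  shows "(\<integral>\<^sup>+x. g x \<partial>vector_measure K \<Omega> \<Sigma> E \<phi>) = suminf (\<lambda>k. seq_of 0 (\<lambda>x. g x * ennreal ((hnorm K (E {x} \<phi>))\<^sup>2)) k)"
proof -
  let ?\<mu> = "vector_measure K \<Omega> \<Sigma> E \<phi>"
  let ?g = "\<lambda>k y. seq_of 0 (\<lambda>x. g x * indicator {x} y) k"
  have g: "g y = suminf (\<lambda>k. ?g k y)" if y: "y \<in> X" for y
  proof -
    have "(\<lambda>k. ?g k y) = (\<lambda>k. if k = to_nat_on X y then g y else 0)"
    proof
      fix k show "?g k y = (if k = to_nat_on X y then g y else 0)"
        by (rule seq_of_cases[of k]) (use y in \<open>auto simp: seq_of_eq_iff indicator_def\<close>)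
    qed
    thus ?thesis using sums_single[of "to_nat_on X y" "\<lambda>_. g y"] by (simp add: sums_iff)
  qed
  have "(\<integral>\<^sup>+y. g y \<partial>?\<mu>) = (\<integral>\<^sup>+y. (suminf (\<lambda>k. ?g k y)) \<partial>?\<mu>)"
  proof (rule nn_integral_cong_AE, rule AE_I)
    show "{y \<in> space ?\<mu>. g y \<noteq> suminf (\<lambda>k. ?g k y)} \<subseteq> \<Omega> - X" using g by (auto simp: vector_measure_space)
    show "emeasure ?\<mu> (\<Omega> - X) = 0"
      using \<phi> by (simp add: emeasure_vector_measure)
    show "\<Omega> - X \<in> sets ?\<mu>" by (simp add: vector_measure_sets)
  qed
  also have "\<dots> = (suminf (\<lambda>k. \<integral>\<^sup>+y. ?g k y \<partial>?\<mu>))"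
  proof (rule nn_integral_suminf)
    fix k show "?g k \<in> borel_measurable ?\<mu>"
      by (rule seq_of_cases[of k])
        (auto simp: vector_measure_sets intro!: borel_measurable_times_ennreal borel_measurable_indicator)
  qed
  also have "(\<lambda>k. \<integral>\<^sup>+y. ?g k y \<partial>?\<mu>) = seq_of 0 (\<lambda>x. g x * ennreal ((hnorm K (E {x} \<phi>))\<^sup>2))"
  proof
    fix k show "(\<integral>\<^sup>+y. ?g k y \<partial>?\<mu>) = seq_of 0 (\<lambda>x. g x * ennreal ((hnorm K (E {x} \<phi>))\<^sup>2)) k"
      by (rule seq_of_cases[of k])
        (use \<phi> in \<open>auto simp: nn_integral_cmult_indicator vector_measure_sets emeasure_vector_measure\<close>)
  qed
  finally show ?thesis .
qed

lemma norm_sq_atomic: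
  assumes \<phi>: "\<phi> \<in> hcarrier K"
  shows "suminf (\<lambda>k. seq_of 0 (\<lambda>x. ennreal ((hnorm K (E {x} \<phi>))\<^sup>2)) k) = ennreal ((hnorm K \<phi>)\<^sup>2)"
  using nn_integral_atomic[OF \<phi>, of "\<lambda>_. 1"] emeasure_vector_measure[OF \<phi> space_in] E_space[OF \<phi>]
  by (simp add: vector_measure_space)

lemma step_fun_Cons [simp]: "step_fun (p # ps) x = fst p * indicator (snd p) x + step_fun ps x"
  and step_fun_Nil [simp]: "step_fun [] x = 0"
  by (simp_all add: step_fun_def case_prod_unfold)

lemma step_integral_Cons: "step_integral K E (p # ps) \<phi> = hadd K (hscale K (fst p) (E (snd p) \<phi>)) (step_integral K E ps \<phi>)"
  and step_integral_Nil: "step_integral K E [] \<phi> = hzero K"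
  by (simp_all add: step_integral_def case_prod_unfold)

lemma step_integral_point:
  assumes "snd ` set cs \<subseteq> \<Sigma>" "\<phi> \<in> hcarrier K" "x \<in> X"
  shows "step_integral K E cs \<phi> \<in> hcarrier K \<and>
    E {x} (step_integral K E cs \<phi>) = hscale K (step_fun cs x) (E {x} \<phi>)"
  using assms(1)
proof (induction cs)
  case Nil
  have "E {x} (hzero K) = hzero K"
    using E_scale[of "{x}" \<phi> 0] assms by (simp add: hscale_zero_eq)
  then show ?case using assms by (simp add: step_integral_Nil hscale_zero_eq)
next
  case (Cons p cs)
  then have s: "step_integral K E cs \<phi> \<in> hcarrier K"
    and IH: "E {x} (step_integral K E cs \<phi>) = hscale K (step_fun cs x) (E {x} \<phi>)" and p: "snd p \<in> \<Sigma>" by auto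
  have "E {x} (E (snd p) \<phi>) = hscale K (indicator (snd p) x) (E {x} \<phi>)"
    using E_inter[of "{x}" "snd p" \<phi>] p assms
    by (cases "x \<in> snd p") (auto simp: hscale_zero_eq hscale_one)
  then show ?case
    using s IH p assms
    by (auto simp: step_integral_Cons E_add E_scale intro!: vector_eqI[OF ips] simp: algebra_simps)
qed

text \<open>Approximation of \<open>f\<close> by step functions in square mean forces convergence at each point with
  \<open>E {x} \<phi> \<noteq> 0\<close>. Conversely, the restrictions of \<open>f\<close> to the first \<open>n\<close> points of \<open>X\<close> are step functions whose
  integrals are the partial sums of the expansion of \<open>\<psi>\<close>, and their distance to \<open>f\<close> in square mean is the
  norm of the remainder of this expansion.\<close>

theorem spectral_integral_atomic:
  "spectral_integral K \<Omega> \<Sigma> E f =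
    {(\<phi>, \<psi>) \<in> hcarrier K \<times> hcarrier K. \<forall>x\<in>X. E {x} \<psi> = hscale K (f x) (E {x} \<phi>)}"
proof (intro set_eqI iffI)
  fix p assume "p \<in> spectral_integral K \<Omega> \<Sigma> E f"
  then obtain \<phi> \<psi> cs where p: "p = (\<phi>, \<psi>)" and in': "\<phi> \<in> hcarrier K" "\<psi> \<in> hcarrier K"
    and cs: "\<And>n. snd ` set (cs n) \<subseteq> \<Sigma>"
    and lim: "(\<lambda>n. \<integral>\<^sup>+x. ennreal ((cmod (f x - step_fun (cs n) x))\<^sup>2) \<partial>vector_measure K \<Omega> \<Sigma> E \<phi>) \<longlonglongrightarrow> 0"
    and t: "htendsto K (\<lambda>n. step_integral K E (cs n) \<phi>) \<psi> sequentially"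
    unfolding spectral_integral_def by auto
  have "E {x} \<psi> = hscale K (f x) (E {x} \<phi>)" if x: "x \<in> X" for x
  proof (rule htendsto_unique[OF ips sequentially_bot])
    let ?s = "\<lambda>n. hscale K (step_fun (cs n) x) (E {x} \<phi>)"
    note st = step_integral_point[OF cs in'(1) x]
    show "htendsto K ?s (E {x} \<psi>) sequentially"
      using E_limit[OF point_in[OF x] _ in'(2) t] st by simp
    have sq: "(hnorm K (hdiff K (?s n) (hscale K (f x) (E {x} \<phi>))))\<^sup>2 =
        (cmod (f x - step_fun (cs n) x))\<^sup>2 * (hnorm K (E {x} \<phi>))\<^sup>2" for n
    proof -
      have "hdiff K (?s n) (hscale K (f x) (E {x} \<phi>)) = hscale K (step_fun (cs n) x - f x) (E {x} \<phi>)"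
        by (rule vector_eqI[OF ips]) (use in' x in \<open>auto simp: algebra_simps\<close>)
      thus ?thesis using in' x by (simp add: power_mult_distrib norm_minus_commute)
    qed
    have "ennreal ((hnorm K (hdiff K (?s n) (hscale K (f x) (E {x} \<phi>))))\<^sup>2) \<le>
        (\<integral>\<^sup>+x. ennreal ((cmod (f x - step_fun (cs n) x))\<^sup>2) \<partial>vector_measure K \<Omega> \<Sigma> E \<phi>)" for n
    proof -
      let ?t = "seq_of 0 (\<lambda>x. ennreal ((cmod (f x - step_fun (cs n) x))\<^sup>2) * ennreal ((hnorm K (E {x} \<phi>))\<^sup>2))"
      have "?t (to_nat_on X x) \<le> suminf (\<lambda>k. ?t k)"
        using sum_le_suminf[of ?t "{to_nat_on X x}"] by simp
      thus ?thesis using x unfolding sq nn_integral_atomic[OF in'(1)] by (simp add: ennreal_mult)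
    qed
    hence "(\<lambda>n. ennreal ((hnorm K (hdiff K (?s n) (hscale K (f x) (E {x} \<phi>))))\<^sup>2)) \<longlonglongrightarrow> 0"
      by (intro tendsto_sandwich[OF _ _ tendsto_const lim]) auto
    hence "(\<lambda>n. (hnorm K (hdiff K (?s n) (hscale K (f x) (E {x} \<phi>))))\<^sup>2) \<longlonglongrightarrow> 0"
      by (simp add: tendsto_ennreal_iff[of _ _ 0, simplified])
    hence "(\<lambda>n. sqrt ((hnorm K (hdiff K (?s n) (hscale K (f x) (E {x} \<phi>))))\<^sup>2)) \<longlonglongrightarrow> 0"
      using tendsto_real_sqrt by fastforce
    thus "htendsto K ?s (hscale K (f x) (E {x} \<phi>)) sequentially"
      unfolding htendsto_def using in' x by simp
  qed (use in' x in auto)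
  thus "p \<in> {(\<phi>, \<psi>) \<in> hcarrier K \<times> hcarrier K. \<forall>x\<in>X. E {x} \<psi> = hscale K (f x) (E {x} \<phi>)}"
    using p in' by simp
next
  fix p assume "p \<in> {(\<phi>, \<psi>) \<in> hcarrier K \<times> hcarrier K. \<forall>x\<in>X. E {x} \<psi> = hscale K (f x) (E {x} \<phi>)}"
  then obtain \<phi> \<psi> where p: "p = (\<phi>, \<psi>)" and in': "\<phi> \<in> hcarrier K" "\<psi> \<in> hcarrier K"
    and eq: "\<And>x. x \<in> X \<Longrightarrow> E {x} \<psi> = hscale K (f x) (E {x} \<phi>)" by auto
  let ?\<mu> = "vector_measure K \<Omega> \<Sigma> E \<phi>"
  have nrm: "ennreal ((cmod (f x))\<^sup>2) * ennreal ((hnorm K (E {x} \<phi>))\<^sup>2) = ennreal ((hnorm K (E {x} \<psi>))\<^sup>2)" if "x \<in> X" for x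
    using that in' by (simp add: eq power_mult_distrib ennreal_mult)
  have fin: "(\<integral>\<^sup>+x. ennreal ((cmod (f x))\<^sup>2) \<partial>?\<mu>) < \<infinity>"
  proof -
    have "seq_of 0 (\<lambda>x. ennreal ((cmod (f x))\<^sup>2) * ennreal ((hnorm K (E {x} \<phi>))\<^sup>2)) =
      seq_of 0 (\<lambda>x. ennreal ((hnorm K (E {x} \<psi>))\<^sup>2))"
    proof
      fix k show "seq_of 0 (\<lambda>x. ennreal ((cmod (f x))\<^sup>2) * ennreal ((hnorm K (E {x} \<phi>))\<^sup>2)) k =
        seq_of 0 (\<lambda>x. ennreal ((hnorm K (E {x} \<psi>))\<^sup>2)) k"
        by (rule seq_of_cases[of k]) (auto simp: nrm)
    qed
    thus ?thesis unfolding nn_integral_atomic[OF in'(1)] using norm_sq_atomic[OF in'(2)] by simp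
  qed
  (* Indices that enumerate no point contribute the step function 0 on the empty set. *)
  define cs where "cs n = map (seq_of (0, {}) (\<lambda>x. (f x, {x}))) [0..<n]" for n
  have csin: "snd ` set (cs n) \<subseteq> \<Sigma>" for n
  proof -
    have "snd (seq_of (0, {}) (\<lambda>x. (f x, {x})) k) \<in> \<Sigma>" for k
      by (rule seq_of_cases[of k]) auto
    thus ?thesis by (auto simp: cs_def)
  qed
  let ?s = "psum K (seq_of (hzero K) (\<lambda>x. E {x} \<psi>))"
  have uin: "seq_of (hzero K) (\<lambda>x. E {x} \<psi>) k \<in> hcarrier K" for k
    by (rule seq_of_cases[of k]) (use in' in auto)
  have sin: "?s n \<in> hcarrier K" for n using uin by simp
  have int: "step_integral K E (cs n) \<phi> = ?s n" for n
  proof -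
    have "(\<lambda>(c, \<Delta>). hscale K c (E \<Delta> \<phi>)) (seq_of (0, {}) (\<lambda>x. (f x, {x})) k) = seq_of (hzero K) (\<lambda>x. E {x} \<psi>) k" for k
      by (rule seq_of_cases[of k]) (use in' in \<open>auto simp: eq\<close>)
    thus ?thesis by (simp add: step_integral_def cs_def psum_def comp_def)
  qed
  have step: "step_fun (cs n) x = (if to_nat_on X x < n then f x else 0)" if x: "x \<in> X" for n x
  proof -
    have "step_fun (cs n) x = (\<Sum>k<n. if k = to_nat_on X x then f x else 0)"
    proof -
      have "(case seq_of (0, {}) (\<lambda>x. (f x, {x})) k of (c, \<Delta>) \<Rightarrow> c * indicator \<Delta> x) = (if k = to_nat_on X x then f x else 0)" for k
        by (rule seq_of_cases[of k]) (use x in \<open>auto simp: seq_of_eq_iff\<close>)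
      thus ?thesis
        by (simp add: step_fun_def cs_def comp_def interv_sum_list_conv_sum_set_nat atLeast0LessThan)
    qed
    thus ?thesis by simp
  qed
  have rest: "(\<integral>\<^sup>+x. ennreal ((cmod (f x - step_fun (cs n) x))\<^sup>2) \<partial>?\<mu>) = ennreal ((hnorm K (hdiff K \<psi> (?s n)))\<^sup>2)" for n
  proof -
    have pt: "E {x} (hdiff K \<psi> (?s n)) = hscale K (f x - step_fun (cs n) x) (E {x} \<phi>)" if x: "x \<in> X" for x
    proof -
      have "E {x} (hdiff K \<psi> (?s n)) = hdiff K (hscale K (f x) (E {x} \<phi>)) (hscale K (step_fun (cs n) x) (E {x} \<phi>))"
        using step_integral_point[OF csin in'(1) x, of n] x in' sin by (simp add: int E_diff eq)
      also have "\<dots> = hscale K (f x - step_fun (cs n) x) (E {x} \<phi>)"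
        by (rule vector_eqI[OF ips]) (use in' x in \<open>auto simp: algebra_simps\<close>)
      finally show ?thesis .
    qed
    have "seq_of 0 (\<lambda>x. ennreal ((cmod (f x - step_fun (cs n) x))\<^sup>2) * ennreal ((hnorm K (E {x} \<phi>))\<^sup>2)) =
      seq_of 0 (\<lambda>x. ennreal ((hnorm K (E {x} (hdiff K \<psi> (?s n))))\<^sup>2))"
    proof
      fix k show "seq_of 0 (\<lambda>x. ennreal ((cmod (f x - step_fun (cs n) x))\<^sup>2) * ennreal ((hnorm K (E {x} \<phi>))\<^sup>2)) k =
        seq_of 0 (\<lambda>x. ennreal ((hnorm K (E {x} (hdiff K \<psi> (?s n))))\<^sup>2)) k"
        by (rule seq_of_cases[of k]) (use in' in \<open>auto simp: pt power_mult_distrib ennreal_mult\<close>)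
    qed
    thus ?thesis
      unfolding nn_integral_atomic[OF in'(1)] using norm_sq_atomic[of "hdiff K \<psi> (?s n)"] in' sin by simp
  qed
  have t: "htendsto K ?s \<psi> sequentially" by (rule E_points[OF in'(2)])
  have "(\<lambda>n. (hnorm K (hdiff K \<psi> (?s n)))\<^sup>2) \<longlonglongrightarrow> 0\<^sup>2"
    using t in' sin unfolding htendsto_def by (intro tendsto_power) (simp add: hnorm_diff_commute)
  hence "(\<lambda>n. ennreal ((hnorm K (hdiff K \<psi> (?s n)))\<^sup>2)) \<longlonglongrightarrow> ennreal (0\<^sup>2)" by (rule tendsto_ennrealI)
  hence "(\<lambda>n. \<integral>\<^sup>+x. ennreal ((cmod (f x - step_fun (cs n) x))\<^sup>2) \<partial>?\<mu>) \<longlonglongrightarrow> 0"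
    unfolding rest by simp
  thus "p \<in> spectral_integral K \<Omega> \<Sigma> E f"
    unfolding spectral_integral_def p using in' fin csin t int by (auto intro!: exI[of _ cs])
qed

end

section \<open>Closed generated representations are well-behaved\<close>

context coordinates
begin

lemma inner_expansion:
  assumes "\<phi> \<in> hcarrier K" "\<psi> \<in> hcarrier K"
  shows "(\<lambda>n. \<Sum>k<n. seq_of 0 (\<lambda>x. hinner V (coord x \<phi>) (coord x \<psi>)) k) \<longlonglongrightarrow> hinner K \<phi> \<psi>"
proof -
  have eq: "hinner K (component_of \<phi> k) \<psi> = seq_of 0 (\<lambda>x. hinner V (coord x \<phi>) (coord x \<psi>)) k" for k
    unfolding component_of_def by (rule seq_of_cases[of k]) (use assms in \<open>auto simp: inner_C_left\<close>)
  have "(\<lambda>n. hinner K (psum K (component_of \<phi>) n) \<psi>) \<longlonglongrightarrow> hinner K \<phi> \<psi>"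
    by (rule htendsto_inner_left[OF ipsK _ assms(1,2) expansion[OF assms(1)]]) (use assms in simp)
  thus ?thesis using assms by (simp add: hinner_psum(1) eq)
qed

lemma inner_coordI:
  assumes "\<phi> \<in> hcarrier K" "\<psi> \<in> hcarrier K" "\<phi>' \<in> hcarrier K" "\<psi>' \<in> hcarrier K"
    and eq: "\<And>x. x \<in> X \<Longrightarrow> hinner V (coord x \<phi>) (coord x \<psi>) = hinner V (coord x \<phi>') (coord x \<psi>')"
  shows "hinner K \<phi> \<psi> = hinner K \<phi>' \<psi>'"
proof -
  have "seq_of 0 (\<lambda>x. hinner V (coord x \<phi>) (coord x \<psi>)) k = seq_of 0 (\<lambda>x. hinner V (coord x \<phi>') (coord x \<psi>')) k" for k
    by (rule seq_of_cases[of k]) (use eq in auto)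
  hence "(\<lambda>n. \<Sum>k<n. seq_of 0 (\<lambda>x. hinner V (coord x \<phi>) (coord x \<psi>)) k) \<longlonglongrightarrow> hinner K \<phi>' \<psi>'"
    using inner_expansion[OF assms(3,4)] by simp
  from LIMSEQ_unique[OF inner_expansion[OF assms(1,2)] this] show ?thesis .
qed

lemma inner_coord_zero:
  assumes "\<phi> \<in> hcarrier K" "\<psi> \<in> hcarrier K" "\<And>x. x \<in> X \<Longrightarrow> hinner V (coord x \<phi>) (coord x \<psi>) = 0"
  shows "hinner K \<phi> \<psi> = 0"
proof -
  have "hinner K \<phi> \<psi> = hinner K (hzero K) \<psi>"
    by (rule inner_coordI) (use assms hlinear_zero[OF ipsK ipsV coord_linear] in auto)
  thus ?thesis using assms by simp
qed

text \<open>The projection onto the part over \<open>\<Delta>\<close>; it exists by \<open>diagonal_operator\<close>.\<close>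

definition proj :: "'x set \<Rightarrow> 'h \<Rightarrow> 'h" where
  "proj \<Delta> = (SOME D. D \<in> hcarrier K \<rightarrow>\<^sub>E hcarrier K \<and> hlinear K (hcarrier K) K D \<and>
     (\<forall>\<phi>\<in>hcarrier K. hnorm K (D \<phi>) \<le> 1 * hnorm K \<phi>) \<and>
     (\<forall>\<phi>\<in>hcarrier K. \<forall>x\<in>X. coord x (D \<phi>) = (if x \<in> \<Delta> then coord x \<phi> else hzero V)))"

lemma
  shows proj_bounded: "proj \<Delta> \<in> bounded_ops K"
    and proj_in [simp]: "\<phi> \<in> hcarrier K \<Longrightarrow> proj \<Delta> \<phi> \<in> hcarrier K"
    and coord_proj: "\<phi> \<in> hcarrier K \<Longrightarrow> x \<in> X \<Longrightarrow> coord x (proj \<Delta> \<phi>) = (if x \<in> \<Delta> then coord x \<phi> else hzero V)"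
proof -
  obtain D where "D \<in> hcarrier K \<rightarrow>\<^sub>E hcarrier K" "hlinear K (hcarrier K) K D"
    "\<And>\<phi>. \<phi> \<in> hcarrier K \<Longrightarrow> hnorm K (D \<phi>) \<le> 1 * hnorm K \<phi>"
    "\<And>x \<phi>. x \<in> X \<Longrightarrow> \<phi> \<in> hcarrier K \<Longrightarrow> coord x (D \<phi>) = (if x \<in> \<Delta> then coord x \<phi> else hzero V)"
    by (rule diagonal_operator[OF coordinates_axioms coordinates_axioms, of "\<lambda>x v. if x \<in> \<Delta> then v else hzero V" 1])
      (auto simp: hlinear_def)
  hence "\<exists>D. D \<in> hcarrier K \<rightarrow>\<^sub>E hcarrier K \<and> hlinear K (hcarrier K) K D \<and>
     (\<forall>\<phi>\<in>hcarrier K. hnorm K (D \<phi>) \<le> 1 * hnorm K \<phi>) \<and>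
     (\<forall>\<phi>\<in>hcarrier K. \<forall>x\<in>X. coord x (D \<phi>) = (if x \<in> \<Delta> then coord x \<phi> else hzero V))"
    by (intro exI[of _ D]) auto
  note * = someI_ex[OF this, folded proj_def]
  show "proj \<Delta> \<in> bounded_ops K"
    unfolding bounded_ops_def using * by (intro CollectI conjI exI[of _ 1]) auto
  show "\<phi> \<in> hcarrier K \<Longrightarrow> proj \<Delta> \<phi> \<in> hcarrier K"
    "\<phi> \<in> hcarrier K \<Longrightarrow> x \<in> X \<Longrightarrow> coord x (proj \<Delta> \<phi>) = (if x \<in> \<Delta> then coord x \<phi> else hzero V)"
    using * by auto
qed

lemma proj_projection: "proj \<Delta> \<in> projections K"
proof -
  have "proj \<Delta> (proj \<Delta> \<phi>) = proj \<Delta> \<phi>" if "\<phi> \<in> hcarrier K" for \<phi>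
    by (rule coord_ext) (use that in \<open>auto simp: coord_proj\<close>)
  moreover have "hinner K (proj \<Delta> \<phi>) \<psi> = hinner K \<phi> (proj \<Delta> \<psi>)" if "\<phi> \<in> hcarrier K" "\<psi> \<in> hcarrier K" for \<phi> \<psi>
    by (rule inner_coordI) (use that in \<open>auto simp: coord_proj\<close>)
  ultimately show ?thesis using proj_bounded by (simp add: projections_def adjoint_pair_def)
qed

lemma proj_spectral_measure:
  assumes "X \<subseteq> \<Omega>" shows "spectral_measure K \<Omega> \<Sigma> proj"
  unfolding spectral_measure_def
proof (intro conjI ballI allI impI)
  show "proj \<Delta> \<in> projections K" for \<Delta> by (rule proj_projection)
  show "proj \<Omega> \<phi> = \<phi>" if "\<phi> \<in> hcarrier K" for \<phi>
    by (rule coord_ext) (use that assms in \<open>auto simp: coord_proj\<close>)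
  fix S :: "nat \<Rightarrow> 'x set" and \<phi>
  assume S: "range S \<subseteq> \<Sigma> \<and> disjoint_family S" and \<phi>: "\<phi> \<in> hcarrier K"
  have dis: "j = k" if "x \<in> S j" "x \<in> S k" for x j k
    using S that by (auto simp: disjoint_family_on_def)
  let ?u = "\<lambda>k. proj (S k) \<phi>"
  have u: "?u k \<in> hcarrier K" for k using \<phi> by simp
  have orth: "hinner K (?u j) (?u k) = 0" if "j \<noteq> k" for j k
    by (rule inner_coord_zero) (use \<phi> that dis in \<open>auto simp: coord_proj\<close>)
  have self: "hinner K (?u k) \<phi> = hinner K (?u k) (?u k)" for k
    by (rule inner_coordI) (use \<phi> in \<open>auto simp: coord_proj\<close>)
  have bd: "(\<Sum>k<n. (hnorm K (?u k))\<^sup>2) \<le> (hnorm K \<phi>)\<^sup>2" for n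
    by (rule Bessel_inequality[where u = ?u, OF ipsK u orth \<phi> self])
  obtain \<psi> where \<psi>: "\<psi> \<in> hcarrier K" and t: "htendsto K (psum K ?u) \<psi> sequentially"
    and i: "\<And>z. z \<in> hcarrier K \<Longrightarrow> (\<lambda>n. \<Sum>k<n. hinner K (?u k) z) \<longlonglongrightarrow> hinner K \<psi> z"
    and "(\<lambda>n. \<Sum>k<n. (hnorm K (?u k))\<^sup>2) \<longlonglongrightarrow> (hnorm K \<psi>)\<^sup>2"
    by (rule Riesz_Fischer[where u = ?u, OF K u orth bd]) (assumption, rule that)
  have "\<psi> = proj (\<Union>k. S k) \<phi>"
  proof (rule coord_ext[OF \<psi>])
    fix x assume x: "x \<in> X"
    show "coord x \<psi> = coord x (proj (\<Union>k. S k) \<phi>)"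
    proof (rule coord_eqI[OF x \<psi>])
      fix v assume v: "v \<in> hcarrier V"
      have ip: "hinner K (?u k) (C x v) = (if x \<in> S k then hinner V (coord x \<phi>) v else 0)" for k
        using x v \<phi> by (auto simp: inner_C_right coord_proj)
      show "hinner K \<psi> (C x v) = hinner V (coord x (proj (\<Union>k. S k) \<phi>)) v"
      proof (cases "\<exists>m. x \<in> S m")
        case True
        then obtain m where m: "x \<in> S m" by blast
        have iff: "x \<in> S k \<longleftrightarrow> k = m" for k using dis[of x k m] m by blast
        have sum: "(\<Sum>k<n. hinner K (?u k) (C x v)) = (if m < n then hinner V (coord x \<phi>) v else 0)" for n
          unfolding ip iff by simp
        have ev: "\<forall>\<^sub>F n in sequentially. (\<Sum>k<n. hinner K (?u k) (C x v)) = hinner V (coord x \<phi>) v"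
          using eventually_gt_at_top[of m] by eventually_elim (simp only: sum if_True)
        have "hinner K \<psi> (C x v) = hinner V (coord x \<phi>) v"
          by (rule LIMSEQ_unique[OF i tendsto_eventually[OF ev]]) (use x v in simp)
        then show ?thesis using True x \<phi> by (simp add: coord_proj)
      next
        case False
        hence "(\<lambda>n. \<Sum>k<n. hinner K (?u k) (C x v)) = (\<lambda>_. 0)" by (simp add: ip)
        hence "hinner K \<psi> (C x v) = 0" using i[of "C x v"] x v by (simp add: LIMSEQ_const_iff)
        then show ?thesis using False x v \<phi> by (simp add: coord_proj)
      qed
    qed (use \<phi> x in auto)
  qed (use \<phi> in simp)
  thus "htendsto K (\<lambda>n. hsum K (map (\<lambda>k. proj (S k) \<phi>) [0..<n])) (proj (\<Union>k. S k) \<phi>) sequentially"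
    using t by (simp add: psum_def[abs_def])
qed

end

context generated_rep
begin

lemma adj_of_coord:
  assumes b: "b \<in> A 0" and in': "\<phi> \<in> hcarrier K" "\<psi> \<in> hcarrier K"
    and eq: "\<And>x. x \<in> orb \<Longrightarrow> coord x \<psi> = hscale V (x b) (coord x \<phi>)"
  shows "adj b \<phi> \<psi>"
proof -
  have "hinner K \<psi> (ten d v) = hinner K \<phi> (ract \<pi> (star b) (ten d v))" if "v \<in> hcarrier V" for d v
  proof (rule ten_induct[OF that])
    fix x u assume x: "x \<in> orb" and u: "u \<in> hcarrier V"
    show "hinner K \<psi> (frame x u) = hinner K \<phi> (ract \<pi> (star b) (frame x u))"
      using act_frame_char[OF A0_star[OF b] x u] char_star[OF orb_pos[OF x] b] x u in' eq[OF x]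
      by (simp add: inner_C_right)
  qed (use in' in \<open>auto simp: \<pi>_zero \<pi>_hadd\<close>)
  thus ?thesis using in' by (auto simp: adj_def act_ten)
qed

text \<open>The closure of \<open>\<pi>(b)\<close> is multiplication by \<open>b\<close> in the coordinates.\<close>

definition mult_graph :: "'a \<Rightarrow> ('h \<times> 'h) set" where
  "mult_graph b = {(\<phi>, \<psi>) \<in> hcarrier K \<times> hcarrier K. \<forall>x\<in>orb. coord x \<psi> = hscale V (x b) (coord x \<phi>)}"

lemma op_closure_mult:
  assumes b: "b \<in> A 0"
  shows "op_closure K (rdom \<pi>) (ract \<pi> b) = mult_graph b"
proof (intro set_eqI iffI)
  fix p assume "p \<in> op_closure K (rdom \<pi>) (ract \<pi> b)"
  then obtain \<phi> \<psi> s where p: "p = (\<phi>, \<psi>)" "\<phi> \<in> hcarrier K" "\<psi> \<in> hcarrier K" and rs: "range s \<subseteq> rdom \<pi>"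
    and t1: "htendsto K s \<phi> sequentially" and t2: "htendsto K (\<lambda>n. ract \<pi> b (s n)) \<psi> sequentially"
    unfolding op_closure_def by auto
  have s: "s n \<in> rdom \<pi>" for n using rs by auto
  have "coord x \<psi> = hscale V (x b) (coord x \<phi>)" if x: "x \<in> orb" for x
  proof (rule coord_eqI[OF x p(3)])
    fix v assume v: "v \<in> hcarrier V"
    have "(\<lambda>n. hinner K (ract \<pi> b (s n)) (frame x v)) \<longlonglongrightarrow> hinner K \<psi> (frame x v)"
      by (rule htendsto_inner_left[OF K_ips _ p(3) _ t2]) (use s v in auto)
    moreover have "hinner K (ract \<pi> b (s n)) (frame x v) = x b * hinner K (s n) (frame x v)" for n
      using s act_frame_char[OF A0_star[OF b] x v] char_star[OF orb_pos[OF x] b] v by (simp add: \<pi>_adjoint)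
    ultimately have "(\<lambda>n. x b * hinner K (s n) (frame x v)) \<longlonglongrightarrow> hinner K \<psi> (frame x v)" by simp
    moreover have "(\<lambda>n. x b * hinner K (s n) (frame x v)) \<longlonglongrightarrow> x b * hinner K \<phi> (frame x v)"
      by (intro tendsto_mult tendsto_const htendsto_inner_left[OF K_ips _ p(2) _ t1]) (use s v in auto)
    ultimately have "hinner K \<psi> (frame x v) = x b * hinner K \<phi> (frame x v)" by (rule LIMSEQ_unique)
    thus "hinner K \<psi> (frame x v) = hinner V (hscale V (x b) (coord x \<phi>)) v"
      using x v p by (simp add: inner_C_right)
  qed (use x p in auto)
  thus "p \<in> mult_graph b" using p by (simp add: mult_graph_def)
next
  fix p assume "p \<in> mult_graph b"
  then obtain \<phi> \<psi> where p: "p = (\<phi>, \<psi>)" "\<phi> \<in> hcarrier K" "\<psi> \<in> hcarrier K"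
    and eq: "\<And>x. x \<in> orb \<Longrightarrow> coord x \<psi> = hscale V (x b) (coord x \<phi>)" by (auto simp: mult_graph_def)
  note adj = adj_of_coord[OF b p(2,3) eq]
  have "range (psum K (component_of \<phi>)) \<subseteq> rdom \<pi>" using p by auto
  moreover have "htendsto K (\<lambda>n. ract \<pi> b (psum K (component_of \<phi>) n)) \<psi> sequentially"
    using expansion[OF p(3)] act_psum[OF b p(2) adj] by simp
  ultimately show "p \<in> op_closure K (rdom \<pi>) (ract \<pi> b)"
    unfolding op_closure_def using p expansion[OF p(2)] by (auto intro!: exI[of _ "psum K (component_of \<phi>)"])
qed

lemma op_adjoint_mult:
  assumes b: "b \<in> A 0"
  shows "op_adjoint K (rdom \<pi>) (ract \<pi> b) = mult_graph (star b)"
proof (intro set_eqI iffI)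
  fix p assume "p \<in> op_adjoint K (rdom \<pi>) (ract \<pi> b)"
  then obtain \<psi> \<eta> where p: "p = (\<psi>, \<eta>)" "\<psi> \<in> hcarrier K" "\<eta> \<in> hcarrier K"
    and eq: "\<And>\<phi>. \<phi> \<in> rdom \<pi> \<Longrightarrow> hinner K (ract \<pi> b \<phi>) \<psi> = hinner K \<phi> \<eta>" unfolding op_adjoint_def by auto
  have "coord x \<eta> = hscale V (x (star b)) (coord x \<psi>)" if x: "x \<in> orb" for x
  proof (rule coord_eqI[OF x p(3)])
    fix v assume v: "v \<in> hcarrier V"
    have "hinner K (frame x v) \<eta> = x b * hinner K (frame x v) \<psi>"
      using eq[of "frame x v"] act_frame_char[OF b x v] v p by simp
    hence "cnj (hinner K (frame x v) \<eta>) = cnj (x b) * cnj (hinner K (frame x v) \<psi>)" by simp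
    hence "hinner K \<eta> (frame x v) = x (star b) * hinner K \<psi> (frame x v)"
      using hinner_sym[OF K_ips, of "frame x v" \<eta>] hinner_sym[OF K_ips, of "frame x v" \<psi>] p v x
        char_star[OF orb_pos[OF x] b] by simp
    thus "hinner K \<eta> (frame x v) = hinner V (hscale V (x (star b)) (coord x \<psi>)) v"
      using x v p by (simp add: inner_C_right)
  qed (use x p in auto)
  thus "p \<in> mult_graph (star b)" using p by (simp add: mult_graph_def)
next
  fix p assume "p \<in> mult_graph (star b)"
  then obtain \<psi> \<eta> where p: "p = (\<psi>, \<eta>)" "\<psi> \<in> hcarrier K" "\<eta> \<in> hcarrier K"
    and eq: "\<And>x. x \<in> orb \<Longrightarrow> coord x \<eta> = hscale V (x (star b)) (coord x \<psi>)" by (auto simp: mult_graph_def)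
  have "hinner K (ract \<pi> b \<phi>) \<psi> = hinner K \<phi> \<eta>" if \<phi>: "\<phi> \<in> rdom \<pi>" for \<phi>
  proof (rule inner_coordI)
    fix x assume x: "x \<in> orb"
    show "hinner V (coord x (ract \<pi> b \<phi>)) (coord x \<psi>) = hinner V (coord x \<phi>) (coord x \<eta>)"
      unfolding eq[OF x] act_coord[OF b x \<phi> \<phi>] using x p \<phi> char_star[OF orb_pos[OF x] b] by simp
  qed (use \<phi> p in auto)
  thus "p \<in> op_adjoint K (rdom \<pi>) (ract \<pi> b)" using p by (simp add: op_adjoint_def)
qed

lemma inner_proj_ten:
  assumes "\<psi> \<in> hcarrier K" "d \<in> A k" "v \<in> hcarrier V"
  shows "hinner K (proj \<Delta> \<psi>) (ten d v) =
    (if act_defined A k \<xi> \<and> char_act A k \<xi> \<in> \<Delta> then hinner K \<psi> (ten d v) else 0)"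
proof (cases "act_defined A k \<xi>")
  case True
  then show ?thesis
    using ten_frame[OF assms(2) True refl assms(3)] act_in_orb[OF True] assms
      el_star_mult_in(2)[OF True refl assms(2)]
    by (simp add: inner_C_right coord_proj)
next
  case False
  then show ?thesis using ten_undefined[OF assms(2) False assms(3)] assms by simp
qed

text \<open>Elements of degree \<open>g\<close> move the part over \<open>\<Delta>\<close> to the part over \<open>\<Delta>\<^sup>g\<close>. On tensors this
  is the equivalence of \<open>\<xi>\<^sup>k \<in> \<Delta>\<^sup>g\<close> and \<open>\<xi>\<^bsup>-g+k\<^esup> \<in> \<Delta>\<close>, for which the action must be injective.\<close>

lemma adj_proj:
  assumes a: "a \<in> A g" and \<Delta>: "\<Delta> \<subseteq> pos_characters A" and \<phi>: "\<phi> \<in> rdom \<pi>"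
  shows "adj a (proj \<Delta> \<phi>) (proj (char_act_set A g \<Delta>) (ract \<pi> a \<phi>))"
  unfolding adj_def
proof (intro conjI allI ballI)
  fix k d v assume d: "d \<in> A k" and v: "v \<in> hcarrier V"
  have ad: "star a * d \<in> A (- g + k)" by (rule A_mult[OF A_star[OF a] d])
  have in\<phi>: "hinner K (ract \<pi> a \<phi>) (ten d v) = hinner K \<phi> (ten (star a * d) v)"
    using adj_ract[OF \<phi>, of a] d v by (simp add: adj_def)
  have 1: "hinner K \<phi> (ten (star a * d) v) = 0" if "\<not> act_defined A (- g + k) \<xi> \<or> \<not> act_defined A k \<xi>"
  proof -
    have "ten (star a * d) v = hzero K" if "\<not> act_defined A k \<xi>"
      using ten_undefined[OF d that v] act_ten[OF v, of "star a" d] by (simp add: \<pi>_zero)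
    thus ?thesis using that ten_undefined[OF ad _ v] \<phi> by auto
  qed
  have 2: "char_act A k \<xi> \<in> char_act_set A g \<Delta> \<longleftrightarrow> char_act A (- g + k) \<xi> \<in> \<Delta>"
    if m: "act_defined A (- g + k) \<xi>" and k: "act_defined A k \<xi>"
  proof -
    let ?x = "char_act A (- g + k) \<xi>"
    have gk: "g + (- g + k) = k" by (simp add: add.assoc[symmetric])
    have x: "act_defined A g ?x" "char_act A g ?x = char_act A k \<xi>"
      using act_compose_defined[OF \<xi> m, of g] act_compose[OF \<xi> m, of g] k unfolding gk by auto
    show ?thesis
    proof
      assume "char_act A k \<xi> \<in> char_act_set A g \<Delta>"
      then obtain y where y: "y \<in> \<Delta>" "act_defined A g y" "char_act A g y = char_act A k \<xi>"
        unfolding char_act_set_def by auto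
      have "y = ?x" by (rule act_inject[OF _ y(2) char_act_pos[OF \<xi> m] x(1)]) (use y x \<Delta> in auto)
      thus "?x \<in> \<Delta>" using y by simp
    next
      assume "?x \<in> \<Delta>"
      thus "char_act A k \<xi> \<in> char_act_set A g \<Delta>"
        unfolding char_act_set_def mem_Collect_eq using x by (intro exI[of _ ?x]) simp
    qed
  qed
  show "hinner K (proj (char_act_set A g \<Delta>) (ract \<pi> a \<phi>)) (ten d v) = hinner K (proj \<Delta> \<phi>) (ten (star a * d) v)"
    using inner_proj_ten[OF _ d v] inner_proj_ten[OF _ ad v] in\<phi> 1 2 \<phi> by auto
qed (use \<phi> in simp)

end

context full_rep
begin

lemma integrable: "integrable_rep (A 0) \<pi>"
  unfolding integrable_rep_def
  using star_rep_mono[OF star_rep_\<pi> subset_UNIV] closed[OF order_refl]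
  by (auto simp: op_closure_mult op_adjoint_mult A0_star)

lemma proj_atomic: "atomic_spectral K (pos_characters A) (char_borel A) proj orb"
proof (intro atomic_spectral.intro spectral.intro atomic_spectral_axioms.intro countable_index.intro)
  show "hilbert_space K" by (rule K_hilbert)
  show "countable orb" by (rule countable_orb)
  show "spectral_measure K (pos_characters A) (char_borel A) proj"
    by (rule proj_spectral_measure) (use orb_pos in blast)
  show "sigma_algebra (pos_characters A) (char_borel A)" by (rule char_borel_sigma)
  show "{x} \<in> char_borel A" if "x \<in> orb" for x by (rule char_borel_singleton[OF orb_pos[OF that]])
  show "proj \<Delta> \<phi> = hzero K" if "\<Delta> \<inter> orb = {}" "\<phi> \<in> hcarrier K" for \<Delta> \<phi>
    by (rule coord_ext) (use that hlinear_zero[OF ipsK ipsV coord_linear] in \<open>auto simp: coord_proj\<close>)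
qed

text \<open>By the description of spectral integrals for atomic measures, integrating \<open>f\<^sub>b\<close> means
  multiplying the coordinate at \<open>x\<close> by \<open>x b\<close>, which is the closure of \<open>\<pi>(b)\<close>. The covariance of the
  projections, including the invariance of the domain, is \<open>adj_proj\<close> read for a largest domain.\<close>

theorem well_behaved_proj: "well_behaved_via A \<pi> proj"
proof -
  interpret sp: atomic_spectral K "pos_characters A" "char_borel A" proj orb by (rule proj_atomic)
  have point: "proj {x} \<psi> = hscale K c (proj {x} \<phi>) \<longleftrightarrow> coord x \<psi> = hscale V c (coord x \<phi>)"
    if "x \<in> orb" "\<phi> \<in> hcarrier K" "\<psi> \<in> hcarrier K" for x \<phi> \<psi> c
  proof
    assume eq: "proj {x} \<psi> = hscale K c (proj {x} \<phi>)"
    have "coord x (proj {x} \<psi>) = hscale V c (coord x (proj {x} \<phi>))"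
      unfolding eq using hlinear_scale[OF coord_linear[OF that(1)]] that by simp
    thus "coord x \<psi> = hscale V c (coord x \<phi>)" using that by (simp add: coord_proj)
  next
    assume eq: "coord x \<psi> = hscale V c (coord x \<phi>)"
    show "proj {x} \<psi> = hscale K c (proj {x} \<phi>)"
    proof (rule coord_ext)
      fix y assume y: "y \<in> orb"
      show "coord y (proj {x} \<psi>) = coord y (hscale K c (proj {x} \<phi>))"
        using that y eq hlinear_scale[OF coord_linear[OF y], of "proj {x} \<phi>" c] by (simp add: coord_proj)
    qed (use that in auto)
  qed
  have si: "op_closure K (rdom \<pi>) (ract \<pi> b) = spectral_integral K (pos_characters A) (char_borel A) proj (\<lambda>\<xi>. \<xi> b)"
    if b: "b \<in> A 0" for b
    unfolding op_closure_mult[OF b] mult_graph_def sp.spectral_integral_atomic using point by auto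
  have dom: "proj \<Delta> \<phi> \<in> rdom \<pi>" if "\<Delta> \<in> char_borel A" "\<phi> \<in> rdom \<pi>" for \<Delta> \<phi>
    using adj_proj[OF _ char_borel_sub[OF that(1)] that(2)] that by (intro domI) auto
  have act: "proj (char_act_set A g \<Delta>) (ract \<pi> a \<phi>) = ract \<pi> a (proj \<Delta> \<phi>)"
    if "a \<in> A g" "\<Delta> \<in> char_borel A" "\<phi> \<in> rdom \<pi>" for g a \<Delta> \<phi>
    using ract_eqI[OF dom adj_proj[OF that(1) char_borel_sub[OF that(2)] that(3)]] that by simp
  show ?thesis
    unfolding well_behaved_via_def using star_rep_\<pi> integrable sp.sm si dom act by blast
qed

theorem associated: "well_behaved A \<pi>" "associated_with A \<pi> orb"
proof -
  interpret sp: atomic_spectral K "pos_characters A" "char_borel A" proj orb by (rule proj_atomic)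
  show "well_behaved A \<pi>" "associated_with A \<pi> orb"
    unfolding well_behaved_def associated_with_def using well_behaved_proj sp.support by blast+
qed

end

section \<open>Equivalence, commutants and irreducibility\<close>

text \<open>By polarization. Unitary equivalences are given on domains only, so \<open>D\<close> is a subspace.\<close>

lemma norm_preserving_inner:
  assumes V: "inner_product_space V" and W: "inner_product_space W" and D: "hsubspace V D"
    and T: "\<And>x. x \<in> D \<Longrightarrow> T x \<in> hcarrier W" and lin: "hlinear V D W T"
    and n: "\<And>x. x \<in> D \<Longrightarrow> hnorm W (T x) = hnorm V x" and x: "x \<in> D" and y: "y \<in> D"
  shows "hinner W (T x) (T y) = hinner V x y"
proof -
  note c = subspace_carrier[OF D]
  have re: "Re (hinner W (T x) (T y)) = Re (hinner V x y)" if x: "x \<in> D" and y: "y \<in> D" for x y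
  proof -
    have exp: "(hnorm U (hadd U a b))\<^sup>2 = (hnorm U a)\<^sup>2 + (hnorm U b)\<^sup>2 + 2 * Re (hinner U a b)"
      if "inner_product_space U" "a \<in> hcarrier U" "b \<in> hcarrier U" for U :: "'z hspace" and a b
      using that hinner_sym[of U a b] by (simp add: hnorm_sq)
    have "hnorm W (hadd W (T x) (T y)) = hnorm V (hadd V x y)"
      using n[OF subspace_add[OF D x y]] lin x y by (simp add: hlinear_def)
    thus ?thesis
      using exp[OF W T[OF x] T[OF y]] exp[OF V c[OF x] c[OF y]] n[OF x] n[OF y] by simp
  qed
  show ?thesis
  proof (rule complex_eqI)
    show "Re (hinner W (T x) (T y)) = Re (hinner V x y)" by (rule re[OF x y])
    have "T (hscale V (-\<i>) x) = hscale W (-\<i>) (T x)" using lin x by (simp add: hlinear_def)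
    thus "Im (hinner W (T x) (T y)) = Im (hinner V x y)"
      using re[OF subspace_scale[OF D x, of "-\<i>"] y] V W T[OF x] T[OF y] c[OF x] c[OF y] by simp
  qed
qed

lemma hsubspace_carrier: "inner_product_space V \<Longrightarrow> hsubspace V (hcarrier V)"
  by (auto simp: hsubspace_def)

context generated_rep
begin

lemma J_carrier [simp]: "v \<in> hcarrier V \<Longrightarrow> J v \<in> hcarrier K"
  using J_in by simp

lemma J_norm [simp]: "v \<in> hcarrier V \<Longrightarrow> hnorm K (J v) = hnorm V v"
  by (simp add: hnorm_def J_inner)

lemma J_inject: "v \<in> hcarrier V \<Longrightarrow> w \<in> hcarrier V \<Longrightarrow> J v = J w \<Longrightarrow> v = w"
  by (rule vector_eqI[OF V_ips]) (auto simp flip: J_inner)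

lemma J_char: "b \<in> A 0 \<Longrightarrow> v \<in> hcarrier V \<Longrightarrow> ract \<pi> b (J v) = hscale K (\<xi> b) (J v)"
  using J_act[OF subgrading_homogeneous[OF _ H_zero]] \<rho>_char hlinear_scale[OF J_linear] by simp

text \<open>The space of \<open>\<rho>\<close> is recovered as the joint eigenspace of \<open>A 0\<close> for \<open>\<xi>\<close>.\<close>

lemma eigenvector_J:
  assumes \<phi>: "\<phi> \<in> rdom \<pi>" and eig: "\<And>b. b \<in> A 0 \<Longrightarrow> ract \<pi> b \<phi> = hscale K (\<xi> b) \<phi>"
  shows "\<exists>v\<in>hcarrier V. \<phi> = J v"
proof -
  let ?v = "coord \<xi> \<phi>"
  have v: "?v \<in> hcarrier V" using \<xi>_orb \<phi> by simp
  (* A degree 0 element that separates x from the eigencharacter kills the coordinate at x. *)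
  have "coord x \<phi> = hzero V" if x: "x \<in> orb" "x \<noteq> \<xi>" for x
  proof -
    obtain b where b: "b \<in> A 0" "x b \<noteq> \<xi> b"
      using x pos_char_eqI[of x \<xi>] char_extensional[OF orb_pos[OF x(1)]] char_extensional[OF \<xi>] by blast
    have c: "coord x \<phi> \<in> hcarrier V" using x \<phi> by simp
    have eq: "hscale V (x b) (coord x \<phi>) = hscale V (\<xi> b) (coord x \<phi>)"
      using act_coord[OF b(1) x(1) \<phi> \<phi>] eig[OF b(1)] hlinear_scale[OF coord_linear[OF x(1)], of \<phi> "\<xi> b"] \<phi> by simp
    have "x b * hinner V (coord x \<phi>) (coord x \<phi>) = \<xi> b * hinner V (coord x \<phi>) (coord x \<phi>)"
      using c arg_cong[OF eq, of "\<lambda>u. hinner V u (coord x \<phi>)"] by simp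
    hence "hinner V (coord x \<phi>) (coord x \<phi>) = 0" using b(2) by simp
    thus ?thesis using hinner_self_eq0[OF V_ips c] by blast
  qed
  hence "\<phi> = frame \<xi> ?v"
    by (intro coord_ext) (use v \<phi> \<xi>_orb in \<open>auto simp: coord_C\<close>)
  moreover have "el \<xi> \<in> subgrading A H" by (rule subgrading_homogeneous[OF el_in[OF \<xi>_orb] deg_\<xi>])
  ultimately have "\<phi> = J (ract \<rho> (el \<xi>) ?v)" "ract \<rho> (el \<xi>) ?v \<in> hcarrier V"
    using v by (simp_all add: frame_def ten_sub)
  thus ?thesis by blast
qed

lemma ten_linear: "hlinear V (hcarrier V) K (ten d)"
  unfolding hlinear_def ten_def
  by (auto simp: hlinear_add[OF J_linear] hlinear_scale[OF J_linear] \<pi>_hadd \<pi>_hscale J_in)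

end

text \<open>An operator acting diagonally by operators that intertwine the representations of the
  stabilizer algebra only acts on the second factor of tensors.\<close>

lemma lift_ten:
  assumes "generated_rep A \<xi> H \<rho>1 \<pi>1 J1" "generated_rep A \<xi> H \<rho>2 \<pi>2 J2"
    and D: "\<And>\<phi>. \<phi> \<in> hcarrier (hsp \<pi>1) \<Longrightarrow> D \<phi> \<in> hcarrier (hsp \<pi>2)" "hlinear (hsp \<pi>1) (hcarrier (hsp \<pi>1)) (hsp \<pi>2) D"
    and W: "\<And>v. v \<in> hcarrier (hsp \<rho>1) \<Longrightarrow> W v \<in> hcarrier (hsp \<rho>2)"
    and WI: "\<And>a v. a \<in> subgrading A H \<Longrightarrow> v \<in> hcarrier (hsp \<rho>1) \<Longrightarrow> W (ract \<rho>1 a v) = ract \<rho>2 a (W v)"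
    and DF: "\<And>x v. x \<in> char_orbit A \<xi> \<Longrightarrow> v \<in> hcarrier (hsp \<rho>1) \<Longrightarrow>
      D (generated_rep.frame A \<xi> \<pi>1 J1 x v) = generated_rep.frame A \<xi> \<pi>2 J2 x (W v)"
    and v: "v \<in> hcarrier (hsp \<rho>1)"
  shows "D (generated_rep.ten \<pi>1 J1 d v) = generated_rep.ten \<pi>2 J2 d (W v)"
proof -
  interpret one: generated_rep A \<xi> H \<rho>1 \<pi>1 J1 by fact
  interpret two: generated_rep A \<xi> H \<rho>2 \<pi>2 J2 by fact
  show ?thesis
  proof (induction d rule: one.graded_induct)
    case (homogeneous g d)
    show ?case
    proof (cases "act_defined A g \<xi>")
      case True
      have s: "star (one.el (char_act A g \<xi>)) * d \<in> subgrading A H"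
        by (rule one.el_star_mult_in(2)[OF True refl homogeneous])
      show ?thesis
        using one.ten_frame[OF homogeneous True refl v] two.ten_frame[OF homogeneous True refl W[OF v]]
          DF[OF one.act_in_orb[OF True]] WI[OF s v] one.\<rho>_in[OF s v] by simp
    next
      case False
      then show ?thesis
        using one.ten_undefined[OF homogeneous False v] two.ten_undefined[OF homogeneous False W[OF v]]
          hlinear_zero[OF one.K_ips two.K_ips D(2) D(1)] by simp
    qed
  next
    case (add a b)
    then show ?case using v W by (simp add: one.ten_add two.ten_add hlinear_add[OF D(2)])
  qed
qed

text \<open>A unitary equivalence of the representations of the stabilizer algebra lifts. The domain
  is respected since it is determined by testing against tensors.\<close>

lemma lift_unitary:
  assumes 1: "full_rep A \<xi> H \<rho>1 \<pi>1 J1" and 2: "full_rep A \<xi> H \<rho>2 \<pi>2 J2"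
    and W: "W ` hcarrier (hsp \<rho>1) = hcarrier (hsp \<rho>2)" "hlinear (hsp \<rho>1) (hcarrier (hsp \<rho>1)) (hsp \<rho>2) W"
    and Wn: "\<And>v. v \<in> hcarrier (hsp \<rho>1) \<Longrightarrow> hnorm (hsp \<rho>2) (W v) = hnorm (hsp \<rho>1) v"
    and WI: "\<And>a v. a \<in> subgrading A H \<Longrightarrow> v \<in> hcarrier (hsp \<rho>1) \<Longrightarrow> W (ract \<rho>1 a v) = ract \<rho>2 a (W v)"
  obtains D where "\<And>\<phi>. \<phi> \<in> hcarrier (hsp \<pi>1) \<Longrightarrow> D \<phi> \<in> hcarrier (hsp \<pi>2)"
    "hlinear (hsp \<pi>1) (hcarrier (hsp \<pi>1)) (hsp \<pi>2) D"
    "\<And>\<phi>. \<phi> \<in> hcarrier (hsp \<pi>1) \<Longrightarrow> hnorm (hsp \<pi>2) (D \<phi>) = hnorm (hsp \<pi>1) \<phi>"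
    "\<And>\<phi>. \<phi> \<in> rdom \<pi>1 \<Longrightarrow> D \<phi> \<in> rdom \<pi>2"
    "\<And>a \<phi>. \<phi> \<in> rdom \<pi>1 \<Longrightarrow> D (ract \<pi>1 a \<phi>) = ract \<pi>2 a (D \<phi>)"
    "\<And>x \<phi>. x \<in> char_orbit A \<xi> \<Longrightarrow> \<phi> \<in> hcarrier (hsp \<pi>1) \<Longrightarrow>
      coordinates.coord (hsp \<pi>2) (hsp \<rho>2) (generated_rep.frame A \<xi> \<pi>2 J2) x (D \<phi>) =
      W (coordinates.coord (hsp \<pi>1) (hsp \<rho>1) (generated_rep.frame A \<xi> \<pi>1 J1) x \<phi>)"
proof -
  interpret one: full_rep A \<xi> H \<rho>1 \<pi>1 J1 by fact
  interpret two: full_rep A \<xi> H \<rho>2 \<pi>2 J2 by fact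
  have Win: "W v \<in> hcarrier (hsp \<rho>2)" if "v \<in> hcarrier (hsp \<rho>1)" for v using W(1) that by blast
  obtain D where D0: "D \<in> hcarrier (hsp \<pi>1) \<rightarrow>\<^sub>E hcarrier (hsp \<pi>2)"
    and Dl: "hlinear (hsp \<pi>1) (hcarrier (hsp \<pi>1)) (hsp \<pi>2) D"
    and "\<And>\<phi>. \<phi> \<in> hcarrier (hsp \<pi>1) \<Longrightarrow> hnorm (hsp \<pi>2) (D \<phi>) \<le> 1 * hnorm (hsp \<pi>1) \<phi>"
    and Dc: "\<And>x \<phi>. x \<in> char_orbit A \<xi> \<Longrightarrow> \<phi> \<in> hcarrier (hsp \<pi>1) \<Longrightarrow> two.coord x (D \<phi>) = W (one.coord x \<phi>)"
    and Df: "\<And>x v. x \<in> char_orbit A \<xi> \<Longrightarrow> v \<in> hcarrier (hsp \<rho>1) \<Longrightarrow> D (one.frame x v) = two.frame x (W v)"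
    by (rule diagonal_operator[OF one.coordinates_axioms two.coordinates_axioms, of "\<lambda>x. W" 1])
      (use Win W(2) Wn in auto)
  have D: "D \<phi> \<in> hcarrier (hsp \<pi>2)" if "\<phi> \<in> hcarrier (hsp \<pi>1)" for \<phi> using D0 that by auto
  have Dn: "hnorm (hsp \<pi>2) (D \<phi>) = hnorm (hsp \<pi>1) \<phi>" if \<phi>: "\<phi> \<in> hcarrier (hsp \<pi>1)" for \<phi>
  proof -
    have "one.seq_of 0 (\<lambda>x. (hnorm (hsp \<rho>2) (two.coord x (D \<phi>)))\<^sup>2) k =
        one.seq_of 0 (\<lambda>x. (hnorm (hsp \<rho>1) (one.coord x \<phi>))\<^sup>2) k" for k
      by (rule one.seq_of_cases[of k]) (use \<phi> Wn Dc in auto)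
    hence "(hnorm (hsp \<pi>2) (D \<phi>))\<^sup>2 = (hnorm (hsp \<pi>1) \<phi>)\<^sup>2"
      using LIMSEQ_unique[OF two.Parseval[OF D[OF \<phi>]]] one.Parseval[OF \<phi>] by simp
    thus ?thesis using D[OF \<phi>] \<phi> by (simp add: power2_eq_iff_nonneg)
  qed
  have Di: "hinner (hsp \<pi>2) (D \<phi>) (D \<psi>) = hinner (hsp \<pi>1) \<phi> \<psi>"
    if "\<phi> \<in> hcarrier (hsp \<pi>1)" "\<psi> \<in> hcarrier (hsp \<pi>1)" for \<phi> \<psi>
    by (rule norm_preserving_inner[OF one.K_ips two.K_ips hsubspace_carrier[OF one.K_ips] D Dl Dn that])
  have Dt: "D (one.ten d v) = two.ten d (W v)" if "v \<in> hcarrier (hsp \<rho>1)" for d v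
    by (rule lift_ten[OF one.generated_rep_axioms two.generated_rep_axioms D Dl Win WI Df that])
  have adj: "two.adj a (D \<phi>) (D \<psi>)" if \<phi>: "\<phi> \<in> hcarrier (hsp \<pi>1)" and a: "one.adj a \<phi> \<psi>" for a \<phi> \<psi>
    unfolding two.adj_def
  proof (intro conjI allI ballI)
    have \<psi>: "\<psi> \<in> hcarrier (hsp \<pi>1)" using a by (simp add: one.adj_def)
    show "D \<psi> \<in> hcarrier (hsp \<pi>2)" by (rule D[OF \<psi>])
    fix g d w assume d: "d \<in> A g" and "w \<in> hcarrier (hsp \<rho>2)"
    then obtain v where v: "v \<in> hcarrier (hsp \<rho>1)" "w = W v" using W(1) by blast
    show "hinner (hsp \<pi>2) (D \<psi>) (two.ten d w) = hinner (hsp \<pi>2) (D \<phi>) (two.ten (star a * d) w)"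
      using a d v \<phi> \<psi> Di[OF \<psi> one.ten_in[OF v(1)], of d] Di[OF \<phi> one.ten_in[OF v(1)], of "star a * d"]
      by (simp add: Dt one.adj_def)
  qed
  have dom: "D \<phi> \<in> rdom \<pi>2" if "\<phi> \<in> rdom \<pi>1" for \<phi>
    by (rule two.domI) (use that D adj[OF _ one.adj_ract[OF that]] in auto)
  have act: "D (ract \<pi>1 a \<phi>) = ract \<pi>2 a (D \<phi>)" if "\<phi> \<in> rdom \<pi>1" for a \<phi>
    using two.ract_eqI[OF dom[OF that] adj[OF _ one.adj_ract[OF that]]] that by simp
  show ?thesis by (rule that[OF D Dl Dn dom act Dc])
qed

text \<open>A unitary between the representations of the stabilizer algebra lifts, and the lift of its
  inverse shows that the lift is onto. Conversely, a unitary between the full representations maps the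
  joint eigenspace for \<open>\<xi>\<close> onto the one of the other representation.\<close>

theorem full_rep_equivalence:
  assumes 1: "full_rep A \<xi> H \<rho>1 \<pi>1 J1" and 2: "full_rep A \<xi> H \<rho>2 \<pi>2 J2"
  shows "unitarily_equivalent UNIV \<pi>1 \<pi>2 \<longleftrightarrow> unitarily_equivalent (subgrading A H) \<rho>1 \<rho>2"
proof
  interpret one: full_rep A \<xi> H \<rho>1 \<pi>1 J1 by fact
  interpret two: full_rep A \<xi> H \<rho>2 \<pi>2 J2 by fact
  {
    assume "unitarily_equivalent (subgrading A H) \<rho>1 \<rho>2"
    then obtain W where W: "W ` hcarrier (hsp \<rho>1) = hcarrier (hsp \<rho>2)" "hlinear (hsp \<rho>1) (hcarrier (hsp \<rho>1)) (hsp \<rho>2) W"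
      and Wn: "\<And>v. v \<in> hcarrier (hsp \<rho>1) \<Longrightarrow> hnorm (hsp \<rho>2) (W v) = hnorm (hsp \<rho>1) v"
      and WI: "\<And>a v. a \<in> subgrading A H \<Longrightarrow> v \<in> hcarrier (hsp \<rho>1) \<Longrightarrow> W (ract \<rho>1 a v) = ract \<rho>2 a (W v)"
      unfolding unitarily_equivalent_def one.\<rho>_dom two.\<rho>_dom by auto
    have Win: "W v \<in> hcarrier (hsp \<rho>2)" if "v \<in> hcarrier (hsp \<rho>1)" for v using W(1) that by blast
    have Wi: "hinner (hsp \<rho>2) (W v) (W w) = hinner (hsp \<rho>1) v w" if "v \<in> hcarrier (hsp \<rho>1)" "w \<in> hcarrier (hsp \<rho>1)" for v w
      by (rule norm_preserving_inner[OF one.V_ips two.V_ips hsubspace_carrier[OF one.V_ips] Win W(2) Wn that])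
    have inj: "v = w" if "v \<in> hcarrier (hsp \<rho>1)" "w \<in> hcarrier (hsp \<rho>1)" "W v = W w" for v w
      by (rule vector_eqI[OF one.V_ips that(1,2)]) (use that in \<open>auto simp flip: Wi\<close>)
    define W' where "W' = inv_into (hcarrier (hsp \<rho>1)) W"
    have W'in: "W' w \<in> hcarrier (hsp \<rho>1)" and WW': "W (W' w) = w" if "w \<in> hcarrier (hsp \<rho>2)" for w
      using that W(1) by (auto simp: W'_def inv_into_into f_inv_into_f)
    have W'W: "W' (W v) = v" if "v \<in> hcarrier (hsp \<rho>1)" for v
      by (rule inj[OF W'in[OF Win[OF that]] that WW'[OF Win[OF that]]])
    have W': "W' ` hcarrier (hsp \<rho>2) = hcarrier (hsp \<rho>1)" using W'in W'W Win by force
    have W'l: "hlinear (hsp \<rho>2) (hcarrier (hsp \<rho>2)) (hsp \<rho>1) W'"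
    proof (rule isometry_linear[OF two.V_ips one.V_ips W'in])
      fix v w assume "v \<in> hcarrier (hsp \<rho>2)" "w \<in> hcarrier (hsp \<rho>2)"
      then show "hinner (hsp \<rho>1) (W' v) (W' w) = hinner (hsp \<rho>2) v w"
        using Wi[OF W'in W'in, of v w] WW' by simp
    qed
    have W'n: "hnorm (hsp \<rho>1) (W' w) = hnorm (hsp \<rho>2) w" if "w \<in> hcarrier (hsp \<rho>2)" for w
      using Wn[OF W'in[OF that]] WW'[OF that] by simp
    have W'I: "W' (ract \<rho>2 a w) = ract \<rho>1 a (W' w)" if a: "a \<in> subgrading A H" and w: "w \<in> hcarrier (hsp \<rho>2)" for a w
      by (rule inj) (use a w W'in WW' WI[OF a W'in[OF w]] in auto)
    obtain D where D: "\<And>\<phi>. \<phi> \<in> hcarrier (hsp \<pi>1) \<Longrightarrow> D \<phi> \<in> hcarrier (hsp \<pi>2)"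
      "hlinear (hsp \<pi>1) (hcarrier (hsp \<pi>1)) (hsp \<pi>2) D"
      "\<And>\<phi>. \<phi> \<in> hcarrier (hsp \<pi>1) \<Longrightarrow> hnorm (hsp \<pi>2) (D \<phi>) = hnorm (hsp \<pi>1) \<phi>"
      "\<And>\<phi>. \<phi> \<in> rdom \<pi>1 \<Longrightarrow> D \<phi> \<in> rdom \<pi>2"
      "\<And>a \<phi>. \<phi> \<in> rdom \<pi>1 \<Longrightarrow> D (ract \<pi>1 a \<phi>) = ract \<pi>2 a (D \<phi>)"
      and Dc: "\<And>x \<phi>. x \<in> char_orbit A \<xi> \<Longrightarrow> \<phi> \<in> hcarrier (hsp \<pi>1) \<Longrightarrow> two.coord x (D \<phi>) = W (one.coord x \<phi>)"
      by (rule lift_unitary[OF 1 2 W Wn WI]) (assumption+, rule that)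
    obtain D' where D': "\<And>\<phi>. \<phi> \<in> hcarrier (hsp \<pi>2) \<Longrightarrow> D' \<phi> \<in> hcarrier (hsp \<pi>1)"
      "hlinear (hsp \<pi>2) (hcarrier (hsp \<pi>2)) (hsp \<pi>1) D'"
      "\<And>\<phi>. \<phi> \<in> hcarrier (hsp \<pi>2) \<Longrightarrow> hnorm (hsp \<pi>1) (D' \<phi>) = hnorm (hsp \<pi>2) \<phi>"
      "\<And>\<phi>. \<phi> \<in> rdom \<pi>2 \<Longrightarrow> D' \<phi> \<in> rdom \<pi>1"
      "\<And>a \<phi>. \<phi> \<in> rdom \<pi>2 \<Longrightarrow> D' (ract \<pi>2 a \<phi>) = ract \<pi>1 a (D' \<phi>)"
      and D'c: "\<And>x \<phi>. x \<in> char_orbit A \<xi> \<Longrightarrow> \<phi> \<in> hcarrier (hsp \<pi>2) \<Longrightarrow> one.coord x (D' \<phi>) = W' (two.coord x \<phi>)"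
      by (rule lift_unitary[OF 2 1 W' W'l W'n W'I]) (assumption+, rule that)
    have DD': "D (D' \<psi>) = \<psi>" if "\<psi> \<in> hcarrier (hsp \<pi>2)" for \<psi>
      by (rule two.coord_ext) (use that D(1) D'(1) Dc D'c WW' in auto)
    have "D ` rdom \<pi>1 = rdom \<pi>2"
    proof (intro set_eqI iffI)
      fix \<psi> assume \<psi>: "\<psi> \<in> rdom \<pi>2"
      have "\<psi> = D (D' \<psi>)" using DD' \<psi> by simp
      thus "\<psi> \<in> D ` rdom \<pi>1" using D'(4)[OF \<psi>] by blast
    qed (use D(4) in auto)
    moreover have "hlinear (hsp \<pi>1) (rdom \<pi>1) (hsp \<pi>2) D"
      using D(2) unfolding hlinear_def by simp
    ultimately show "unitarily_equivalent UNIV \<pi>1 \<pi>2"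
      unfolding unitarily_equivalent_def using D(3,5) by (intro exI[of _ D]) auto
  next
    assume "unitarily_equivalent UNIV \<pi>1 \<pi>2"
    then obtain U where U: "U ` rdom \<pi>1 = rdom \<pi>2" and Ul: "hlinear (hsp \<pi>1) (rdom \<pi>1) (hsp \<pi>2) U"
      and Un: "\<And>\<phi>. \<phi> \<in> rdom \<pi>1 \<Longrightarrow> hnorm (hsp \<pi>2) (U \<phi>) = hnorm (hsp \<pi>1) \<phi>"
      and UI: "\<And>a \<phi>. \<phi> \<in> rdom \<pi>1 \<Longrightarrow> U (ract \<pi>1 a \<phi>) = ract \<pi>2 a (U \<phi>)"
      unfolding unitarily_equivalent_def by auto
    have Uin: "U \<phi> \<in> rdom \<pi>2" if "\<phi> \<in> rdom \<pi>1" for \<phi> using U that by blast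
    have Ui: "hinner (hsp \<pi>2) (U \<phi>) (U \<psi>) = hinner (hsp \<pi>1) \<phi> \<psi>" if "\<phi> \<in> rdom \<pi>1" "\<psi> \<in> rdom \<pi>1" for \<phi> \<psi>
      by (rule norm_preserving_inner[OF one.K_ips two.K_ips one.dom_subspace two.dom_carrier[OF Uin] Ul Un that])
    have Us: "U (hscale (hsp \<pi>1) c \<phi>) = hscale (hsp \<pi>2) c (U \<phi>)" if "\<phi> \<in> rdom \<pi>1" for c \<phi>
      using Ul that by (simp add: hlinear_def)
    have Uinj: "\<phi> = \<psi>" if "\<phi> \<in> rdom \<pi>1" "\<psi> \<in> rdom \<pi>1" "U \<phi> = U \<psi>" for \<phi> \<psi>
    proof -
      have d: "hdiff (hsp \<pi>1) \<phi> \<psi> \<in> rdom \<pi>1" by (rule subspace_diff[OF one.dom_subspace that(1,2)])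
      have "hinner (hsp \<pi>1) (hdiff (hsp \<pi>1) \<phi> \<psi>) (hdiff (hsp \<pi>1) \<phi> \<psi>) = 0"
        using that Ui[OF that(1) d] Ui[OF that(2) d] d by (simp del: hinner_diff_right)
      hence "hdiff (hsp \<pi>1) \<phi> \<psi> = hzero (hsp \<pi>1)" using hinner_self_eq0[OF one.K_ips] d by simp
      thus ?thesis using hdiff_eq_zero[OF one.K_ips] that by simp
    qed
    have "\<exists>w\<in>hcarrier (hsp \<rho>2). U (J1 v) = J2 w" if v: "v \<in> hcarrier (hsp \<rho>1)" for v
    proof (rule two.eigenvector_J)
      show "U (J1 v) \<in> rdom \<pi>2" by (rule Uin[OF one.J_in[OF v]])
      fix b assume b: "b \<in> A 0"
      have "ract \<pi>2 b (U (J1 v)) = U (ract \<pi>1 b (J1 v))" using UI[OF one.J_in[OF v]] by simp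
      also have "\<dots> = hscale (hsp \<pi>2) (\<xi> b) (U (J1 v))"
        unfolding one.J_char[OF b v] by (rule Us[OF one.J_in[OF v]])
      finally show "ract \<pi>2 b (U (J1 v)) = hscale (hsp \<pi>2) (\<xi> b) (U (J1 v))" .
    qed
    then obtain W where W: "\<And>v. v \<in> hcarrier (hsp \<rho>1) \<Longrightarrow> W v \<in> hcarrier (hsp \<rho>2)"
      and JW: "\<And>v. v \<in> hcarrier (hsp \<rho>1) \<Longrightarrow> U (J1 v) = J2 (W v)" by metis
    have Wi: "hinner (hsp \<rho>2) (W v) (W w) = hinner (hsp \<rho>1) v w" if "v \<in> hcarrier (hsp \<rho>1)" "w \<in> hcarrier (hsp \<rho>1)" for v w
      using Ui[OF one.J_in[OF that(1)] one.J_in[OF that(2)]] that JW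
        two.J_inner[OF W[OF that(1)] W[OF that(2)]] one.J_inner[OF that] by simp
    have "W ` hcarrier (hsp \<rho>1) = hcarrier (hsp \<rho>2)"
    proof (intro set_eqI iffI)
      fix w assume w: "w \<in> hcarrier (hsp \<rho>2)"
      obtain \<phi> where \<phi>: "\<phi> \<in> rdom \<pi>1" "J2 w = U \<phi>" using two.J_in[OF w] U by blast
      have "\<exists>v\<in>hcarrier (hsp \<rho>1). \<phi> = J1 v"
      proof (rule one.eigenvector_J[OF \<phi>(1)])
        fix b assume b: "b \<in> A 0"
        have "U (ract \<pi>1 b \<phi>) = U (hscale (hsp \<pi>1) (\<xi> b) \<phi>)"
          using two.J_char[OF b w] UI[OF \<phi>(1), of b] Us[OF \<phi>(1), of "\<xi> b"] \<phi>(2) by simp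
        thus "ract \<pi>1 b \<phi> = hscale (hsp \<pi>1) (\<xi> b) \<phi>"
          by (rule Uinj[rotated 2]) (use \<phi> subspace_scale[OF one.dom_subspace] in auto)
      qed
      then obtain v where v: "v \<in> hcarrier (hsp \<rho>1)" "\<phi> = J1 v" by blast
      have "w = W v" by (rule two.J_inject[OF w W[OF v(1)]]) (use \<phi>(2) v JW[OF v(1)] in simp)
      thus "w \<in> W ` hcarrier (hsp \<rho>1)" using v by blast
    qed (use W in auto)
    moreover have "hlinear (hsp \<rho>1) (hcarrier (hsp \<rho>1)) (hsp \<rho>2) W"
      by (rule isometry_linear[OF one.V_ips two.V_ips W Wi])
    moreover have "hnorm (hsp \<rho>2) (W v) = hnorm (hsp \<rho>1) v" if "v \<in> hcarrier (hsp \<rho>1)" for v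
      using Wi[OF that that] by (simp add: hnorm_def)
    moreover have "W (ract \<rho>1 a v) = ract \<rho>2 a (W v)" if a: "a \<in> subgrading A H" and v: "v \<in> hcarrier (hsp \<rho>1)" for a v
    proof (rule two.J_inject)
      have "J2 (W (ract \<rho>1 a v)) = U (ract \<pi>1 a (J1 v))"
        using JW[OF one.\<rho>_in[OF a v]] one.J_act[OF a v] by simp
      also have "\<dots> = ract \<pi>2 a (J2 (W v))" using UI[OF one.J_in[OF v]] JW[OF v] by simp
      also have "\<dots> = J2 (ract \<rho>2 a (W v))" by (rule two.J_act[OF a W[OF v]])
      finally show "J2 (W (ract \<rho>1 a v)) = J2 (ract \<rho>2 a (W v))" .
    qed (use a v W in auto)
    ultimately show "unitarily_equivalent (subgrading A H) \<rho>1 \<rho>2"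
      unfolding unitarily_equivalent_def one.\<rho>_dom two.\<rho>_dom by (intro exI[of _ W]) auto
  }
qed

subsection \<open>Bounded operators and amplifications\<close>

lemma
  assumes "T \<in> bounded_ops V"
  shows bounded_in: "x \<in> hcarrier V \<Longrightarrow> T x \<in> hcarrier V"
    and bounded_linear: "hlinear V (hcarrier V) V T"
    and bounded_ext: "T \<in> extensional (hcarrier V)"
    and bounded_norm: "\<exists>C. \<forall>x\<in>hcarrier V. hnorm V (T x) \<le> C * hnorm V x"
  using assms by (auto simp: bounded_ops_def PiE_def)

lemma bounded_norm_nonneg:
  assumes V: "inner_product_space V" and T: "T \<in> bounded_ops V"
  obtains C where "C \<ge> 0" "\<And>x. x \<in> hcarrier V \<Longrightarrow> hnorm V (T x) \<le> C * hnorm V x"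
proof -
  obtain C where C: "\<And>x. x \<in> hcarrier V \<Longrightarrow> hnorm V (T x) \<le> C * hnorm V x"
    using bounded_norm[OF T] by blast
  have "hnorm V (T x) \<le> max C 0 * hnorm V x" if "x \<in> hcarrier V" for x
    using C[OF that] mult_right_mono[of C "max C 0" "hnorm V x"] V that by fastforce
  thus ?thesis using that[of "max C 0"] by simp
qed

lemma bounded_opsI:
  assumes "\<And>x. x \<in> hcarrier V \<Longrightarrow> T x \<in> hcarrier V" "hlinear V (hcarrier V) V T"
    and "\<And>x. x \<in> hcarrier V \<Longrightarrow> hnorm V (T x) \<le> C * hnorm V x" and V: "inner_product_space V"
  shows "restrict T (hcarrier V) \<in> bounded_ops V"
  unfolding bounded_ops_def
proof (intro CollectI conjI exI[of _ C] ballI)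
  show "hlinear V (hcarrier V) V (restrict T (hcarrier V))"
    using assms(2) V by (auto simp: hlinear_def)
qed (use assms in auto)

lemma bounded_ops_eqI:
  "S \<in> bounded_ops V \<Longrightarrow> T \<in> bounded_ops V \<Longrightarrow> (\<And>x. x \<in> hcarrier V \<Longrightarrow> S x = T x) \<Longrightarrow> S = T"
  by (rule extensionalityI[OF bounded_ext bounded_ext])

lemma bounded_adjoint:
  assumes V: "hilbert_space V" and T: "T \<in> bounded_ops V"
  shows "\<exists>S\<in>bounded_ops V. adjoint_pair V T S \<and> adjoint_pair V S T"
proof -
  note ips = hilbert_ips[OF V]
  obtain C where C: "C \<ge> 0" "\<And>x. x \<in> hcarrier V \<Longrightarrow> hnorm V (T x) \<le> C * hnorm V x"
    by (rule bounded_norm_nonneg[OF ips T]) (rule that)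
  obtain S where S: "\<And>y. y \<in> hcarrier V \<Longrightarrow> S y \<in> hcarrier V"
    "\<And>x y. x \<in> hcarrier V \<Longrightarrow> y \<in> hcarrier V \<Longrightarrow> hinner V (T x) y = hinner V x (S y)"
    using adjoint_exists[OF V ips bounded_in[OF T] bounded_linear[OF T] C(2)] by blast
  have lin: "hlinear V (hcarrier V) V S"
    by (rule adjoint_linear[OF ips ips bounded_in[OF T] S])
  have bd: "hnorm V (S y) \<le> C * hnorm V y" if "y \<in> hcarrier V" for y
    by (rule adjoint_bound[OF ips ips bounded_in[OF T] that S(1)[OF that] C(2) C(1) S(2)[OF _ that]])
  have "hinner V (S x) y = hinner V x (T y)" if "x \<in> hcarrier V" "y \<in> hcarrier V" for x y
    using S(2)[OF that(2,1)] hinner_sym[OF ips bounded_in[OF T that(2)] that(1)]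
      hinner_sym[OF ips that(2) S(1)[OF that(1)]] by simp
  hence "adjoint_pair V T (restrict S (hcarrier V)) \<and> adjoint_pair V (restrict S (hcarrier V)) T"
    using S by (simp add: adjoint_pair_def)
  thus ?thesis using bounded_opsI[OF S(1) lin bd ips] by blast
qed

lemma op_commutant_bicommutant: "M \<subseteq> bounded_ops V \<Longrightarrow> M \<subseteq> op_commutant V (op_commutant V M)"
  by (auto simp: op_commutant_def)

lemma op_commutantD: "R \<in> op_commutant V M \<Longrightarrow> S \<in> M \<Longrightarrow> x \<in> hcarrier V \<Longrightarrow> R (S x) = S (R x)"
  by (auto simp: op_commutant_def)

context coordinates
begin

text \<open>The amplification \<open>1 \<otimes> T\<close>.\<close>

definition amp :: "('v \<Rightarrow> 'v) \<Rightarrow> 'h \<Rightarrow> 'h" where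
  "amp T = (SOME D. D \<in> bounded_ops K \<and> (\<forall>\<phi>\<in>hcarrier K. \<forall>x\<in>X. coord x (D \<phi>) = T (coord x \<phi>)))"

lemma
  assumes T: "T \<in> bounded_ops V"
  shows amp_bounded: "amp T \<in> bounded_ops K"
    and coord_amp: "\<phi> \<in> hcarrier K \<Longrightarrow> x \<in> X \<Longrightarrow> coord x (amp T \<phi>) = T (coord x \<phi>)"
proof -
  obtain M where M: "M \<ge> 0" "\<And>v. v \<in> hcarrier V \<Longrightarrow> hnorm V (T v) \<le> M * hnorm V v"
    by (rule bounded_norm_nonneg[OF ipsV T]) (rule that)
  obtain D where D: "D \<in> hcarrier K \<rightarrow>\<^sub>E hcarrier K" "hlinear K (hcarrier K) K D"
    "\<And>\<phi>. \<phi> \<in> hcarrier K \<Longrightarrow> hnorm K (D \<phi>) \<le> M * hnorm K \<phi>"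
    "\<And>x \<phi>. x \<in> X \<Longrightarrow> \<phi> \<in> hcarrier K \<Longrightarrow> coord x (D \<phi>) = T (coord x \<phi>)"
    by (rule diagonal_operator[OF coordinates_axioms coordinates_axioms, of "\<lambda>x. T" M])
      (use bounded_in[OF T] bounded_linear[OF T] M in auto)
  have "\<exists>D. D \<in> bounded_ops K \<and> (\<forall>\<phi>\<in>hcarrier K. \<forall>x\<in>X. coord x (D \<phi>) = T (coord x \<phi>))"
    by (rule exI[of _ D]) (use D in \<open>auto simp: bounded_ops_def\<close>)
  from someI_ex[OF this, folded amp_def]
  show "amp T \<in> bounded_ops K" "\<phi> \<in> hcarrier K \<Longrightarrow> x \<in> X \<Longrightarrow> coord x (amp T \<phi>) = T (coord x \<phi>)" by auto
qed

lemma amp_eqI: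
  assumes "T \<in> bounded_ops V" "D \<in> extensional (hcarrier K)" "\<And>\<phi>. \<phi> \<in> hcarrier K \<Longrightarrow> D \<phi> \<in> hcarrier K"
    and "\<And>\<phi> x. \<phi> \<in> hcarrier K \<Longrightarrow> x \<in> X \<Longrightarrow> coord x (D \<phi>) = T (coord x \<phi>)"
  shows "amp T = D"
  by (rule extensionalityI[OF bounded_ext[OF amp_bounded[OF assms(1)]] assms(2)], rule coord_ext)
    (use assms bounded_in[OF amp_bounded[OF assms(1)]] coord_amp[OF assms(1)] in auto)

lemma amp_C: "T \<in> bounded_ops V \<Longrightarrow> x \<in> X \<Longrightarrow> v \<in> hcarrier V \<Longrightarrow> amp T (C x v) = C x (T v)"
  using bounded_in[of T V] bounded_in[OF amp_bounded, of T] hlinear_zero[OF ipsV ipsV bounded_linear[of T V]]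
  by (intro coord_ext) (auto simp: coord_amp coord_C)

lemma amp_adjoint:
  assumes "S \<in> bounded_ops V" "T \<in> bounded_ops V" "adjoint_pair V S T"
  shows "adjoint_pair K (amp S) (amp T)"
  unfolding adjoint_pair_def
proof (intro ballI)
  fix \<phi> \<psi> assume "\<phi> \<in> hcarrier K" "\<psi> \<in> hcarrier K"
  then show "hinner K (amp S \<phi>) \<psi> = hinner K \<phi> (amp T \<psi>)"
    using assms bounded_in[OF amp_bounded[OF assms(1)]] bounded_in[OF amp_bounded[OF assms(2)]]
    by (intro inner_coordI) (auto simp: coord_amp adjoint_pair_def)
qed

text \<open>Bounded operators are determined by their values on the vectors \<open>C x v\<close>: these values
  determine the coordinates of all values of the adjoints.\<close>

lemma bounded_agree:
  assumes S: "S \<in> bounded_ops K" and T: "T \<in> bounded_ops K"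
    and eq: "\<And>x v. x \<in> X \<Longrightarrow> v \<in> hcarrier V \<Longrightarrow> S (C x v) = T (C x v)"
  shows "S = T"
proof (rule bounded_ops_eqI[OF S T])
  fix \<phi> assume \<phi>: "\<phi> \<in> hcarrier K"
  obtain S' T' where S': "S' \<in> bounded_ops K" "adjoint_pair K S S'" and T': "T' \<in> bounded_ops K" "adjoint_pair K T T'"
    using bounded_adjoint[OF K] S T by blast
  have adj: "S' \<psi> = T' \<psi>" if \<psi>: "\<psi> \<in> hcarrier K" for \<psi>
  proof (rule coord_ext)
    fix x assume x: "x \<in> X"
    show "coord x (S' \<psi>) = coord x (T' \<psi>)"
    proof (rule vector_eqI[OF ipsV])
      fix v assume v: "v \<in> hcarrier V"
      have "hinner K (C x v) (S' \<psi>) = hinner K (C x v) (T' \<psi>)"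
        using S'(2) T'(2) eq[OF x v] x v \<psi> unfolding adjoint_pair_def by (metis C_in)
      hence "hinner V v (coord x (S' \<psi>)) = hinner V v (coord x (T' \<psi>))"
        using inner_C_left[OF x bounded_in[OF S'(1) \<psi>] v] inner_C_left[OF x bounded_in[OF T'(1) \<psi>] v] by simp
      thus "hinner V (coord x (S' \<psi>)) v = hinner V (coord x (T' \<psi>)) v"
        using hinner_sym[OF ipsV v coord_in[OF x bounded_in[OF S'(1) \<psi>]]]
          hinner_sym[OF ipsV v coord_in[OF x bounded_in[OF T'(1) \<psi>]]] by simp
    qed (use x bounded_in[OF S'(1) \<psi>] bounded_in[OF T'(1) \<psi>] in auto)
  qed (use bounded_in[OF S'(1) \<psi>] bounded_in[OF T'(1) \<psi>] in auto)
  show "S \<phi> = T \<phi>"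
  proof (rule vector_eqI[OF ipsK bounded_in[OF S \<phi>] bounded_in[OF T \<phi>]])
    fix z assume z: "z \<in> hcarrier K"
    show "hinner K (S \<phi>) z = hinner K (T \<phi>) z"
      using S'(2) T'(2) adj[OF z] \<phi> z unfolding adjoint_pair_def by simp
  qed
qed

end

context stabilizer_rep
begin

abbreviation comm_\<rho> where "comm_\<rho> \<equiv> rep_commutant (subgrading A H) \<rho>"

lemma comm_\<rho>_iff: "T \<in> comm_\<rho> \<longleftrightarrow> T \<in> bounded_ops V \<and>
    (\<forall>a\<in>subgrading A H. \<forall>v\<in>hcarrier V. ract \<rho> a (T v) = T (ract \<rho> a v))"
  using bounded_in[of T V] by (auto simp: rep_commutant_def \<rho>_dom)

lemma comm_\<rho>_adjoint:
  assumes T: "T \<in> comm_\<rho>" and S: "S \<in> bounded_ops V" "adjoint_pair V T S"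
  shows "S \<in> comm_\<rho>"
  unfolding comm_\<rho>_iff
proof (intro conjI ballI)
  fix a v assume a: "a \<in> subgrading A H" and v: "v \<in> hcarrier V"
  note T' = T[unfolded comm_\<rho>_iff, THEN conjunct1]
  note in' = bounded_in[OF T'] bounded_in[OF S(1)]
  have sa: "star a \<in> subgrading A H" by (rule subgrading_star[OF a])
  have adj: "hinner V z (S w) = hinner V (T z) w" if "z \<in> hcarrier V" "w \<in> hcarrier V" for z w
    using S(2) that by (simp add: adjoint_pair_def)
  have \<rho>_adj: "hinner V z (ract \<rho> a w) = hinner V (ract \<rho> (star a) z) w" if "z \<in> hcarrier V" "w \<in> hcarrier V" for z w
    using \<rho>_adjoint[OF sa that] by (simp add: star_star)
  show "ract \<rho> a (S v) = S (ract \<rho> a v)"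
  proof (rule vector_eqI[OF V_ips])
    fix z assume z: "z \<in> hcarrier V"
    have "hinner V z (ract \<rho> a (S v)) = hinner V (T (ract \<rho> (star a) z)) v"
      using z v sa in' by (simp add: \<rho>_adj adj)
    also have "\<dots> = hinner V (ract \<rho> (star a) (T z)) v"
      using T sa z by (simp add: comm_\<rho>_iff)
    also have "\<dots> = hinner V z (S (ract \<rho> a v))"
      using z v a in' by (simp add: \<rho>_adj adj)
    finally have e: "hinner V z (ract \<rho> a (S v)) = hinner V z (S (ract \<rho> a v))" .
    show "hinner V (ract \<rho> a (S v)) z = hinner V (S (ract \<rho> a v)) z"
      using e hinner_sym[OF V_ips z, of "ract \<rho> a (S v)"] hinner_sym[OF V_ips z, of "S (ract \<rho> a v)"] a v in' by simp
  qed (use a v in' in auto)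
qed (rule S)

lemma comm_\<rho>_adjoint_ex: "T \<in> comm_\<rho> \<Longrightarrow> \<exists>S\<in>comm_\<rho>. adjoint_pair V T S \<and> adjoint_pair V S T"
  using bounded_adjoint[OF V_hilbert, of T] comm_\<rho>_adjoint by (auto simp: comm_\<rho>_iff)

text \<open>The commutant of the bounded representation \<open>\<rho>\<close> is the commutant of a set of bounded
  operators, hence equal to its bicommutant.\<close>

lemma comm_\<rho>_von_neumann: "von_neumann_algebra V comm_\<rho>"
  unfolding von_neumann_algebra_def
proof (intro conjI ballI)
  show sub: "comm_\<rho> \<subseteq> bounded_ops V" by (auto simp: comm_\<rho>_iff)
  show "\<exists>T\<in>comm_\<rho>. adjoint_pair V S T" if "S \<in> comm_\<rho>" for S using comm_\<rho>_adjoint_ex[OF that] by blast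
  show "op_commutant V (op_commutant V comm_\<rho>) = comm_\<rho>"
  proof
    show "comm_\<rho> \<subseteq> op_commutant V (op_commutant V comm_\<rho>)" by (rule op_commutant_bicommutant[OF sub])
    show "op_commutant V (op_commutant V comm_\<rho>) \<subseteq> comm_\<rho>"
    proof
      fix T assume T: "T \<in> op_commutant V (op_commutant V comm_\<rho>)"
      have TB: "T \<in> bounded_ops V" using T by (simp add: op_commutant_def)
      have "ract \<rho> a (T v) = T (ract \<rho> a v)" if a: "a \<in> subgrading A H" and v: "v \<in> hcarrier V" for a v
      proof -
        obtain C where C: "\<And>v. v \<in> hcarrier V \<Longrightarrow> hnorm V (ract \<rho> a v) \<le> C * hnorm V v"
          using \<rho>_bounded a unfolding bounded_rep_def \<rho>_dom by blast
        have "hlinear V (hcarrier V) V (ract \<rho> a)"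
          using a by (auto simp: hlinear_def \<rho>_hadd \<rho>_hscale)
        from bounded_opsI[OF \<rho>_in[OF a] this C V_ips]
        have "restrict (ract \<rho> a) (hcarrier V) \<in> op_commutant V comm_\<rho>"
          using a by (auto simp: op_commutant_def comm_\<rho>_iff bounded_in)
        from op_commutantD[OF T this v]
        have "T (restrict (ract \<rho> a) (hcarrier V) v) = restrict (ract \<rho> a) (hcarrier V) (T v)" .
        thus ?thesis using v bounded_in[OF TB] by simp
      qed
      thus "T \<in> comm_\<rho>" using TB by (simp add: comm_\<rho>_iff)
    qed
  qed
qed

end

subsection \<open>Commutants\<close>

context full_rep
begin

abbreviation comm_\<pi> where "comm_\<pi> \<equiv> rep_commutant UNIV \<pi>"

lemma amp_ten:
  assumes T: "T \<in> comm_\<rho>" and v: "v \<in> hcarrier V"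
  shows "amp T (ten d v) = ten d (T v)"
proof -
  have TB: "T \<in> bounded_ops V" using T by (simp add: comm_\<rho>_iff)
  show ?thesis
    by (rule lift_ten[OF generated_rep_axioms generated_rep_axioms bounded_in[OF amp_bounded[OF TB]]
          bounded_linear[OF amp_bounded[OF TB]] bounded_in[OF TB] _ amp_C[OF TB] v])
      (use T in \<open>auto simp: comm_\<rho>_iff\<close>)
qed

text \<open>The domain is invariant because it is defined by testing against tensors, on which the
  adjoint of the amplification again acts through the second factor.\<close>

lemma amp_in_commutant:
  assumes T: "T \<in> comm_\<rho>" shows "amp T \<in> comm_\<pi>"
proof -
  have TB: "T \<in> bounded_ops V" using T by (simp add: comm_\<rho>_iff)
  obtain S where S: "S \<in> comm_\<rho>" "adjoint_pair V T S" using comm_\<rho>_adjoint_ex[OF T] by blast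
  have SB: "S \<in> bounded_ops V" using S by (simp add: comm_\<rho>_iff)
  note aB = amp_bounded[OF TB]
  have ap: "hinner K (amp T \<phi>) \<psi> = hinner K \<phi> (amp S \<psi>)" if "\<phi> \<in> hcarrier K" "\<psi> \<in> hcarrier K" for \<phi> \<psi>
    using amp_adjoint[OF TB SB S(2)] that by (simp add: adjoint_pair_def)
  have adj: "adj a (amp T \<phi>) (amp T (ract \<pi> a \<phi>))" if \<phi>: "\<phi> \<in> rdom \<pi>" for a \<phi>
    using \<phi> bounded_in[OF aB] bounded_in[OF SB] by (simp add: adj_def ap amp_ten[OF S(1)] \<pi>_adjoint act_ten)
  have dom: "amp T \<phi> \<in> rdom \<pi>" if "\<phi> \<in> rdom \<pi>" for \<phi>
    by (rule domI) (use adj[OF that] bounded_in[OF aB] that in auto)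
  have "ract \<pi> a (amp T \<phi>) = amp T (ract \<pi> a \<phi>)" if "\<phi> \<in> rdom \<pi>" for a \<phi>
    by (rule ract_eqI[OF dom[OF that] adj[OF that]])
  thus ?thesis using aB dom by (auto simp: rep_commutant_def)
qed

text \<open>Conversely, an operator that only acts on the second factor of tensors is an
  amplification.\<close>

lemma amp_char:
  assumes R: "R \<in> bounded_ops K" and T: "\<And>w. w \<in> hcarrier V \<Longrightarrow> T w \<in> hcarrier V"
    and RT: "\<And>d w. w \<in> hcarrier V \<Longrightarrow> R (ten d w) = ten d (T w)"
  shows "restrict T (hcarrier V) \<in> comm_\<rho>" "R = amp (restrict T (hcarrier V))"
proof -
  have J: "R (J w) = J (T w)" if "w \<in> hcarrier V" for w
    using RT[OF that, of 1] that T by (simp add: ten_one)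
  note Rl = hlinear_add[OF bounded_linear[OF R]] hlinear_scale[OF bounded_linear[OF R]]
  note Jl = hlinear_add[OF J_linear] hlinear_scale[OF J_linear]
  have "hlinear V (hcarrier V) V T"
    unfolding hlinear_def
  proof (intro conjI ballI allI)
    fix x y assume xy: "x \<in> hcarrier V" "y \<in> hcarrier V"
    show "T (hadd V x y) = hadd V (T x) (T y)"
      by (rule J_inject) (use xy T in \<open>auto simp flip: J simp: Jl Rl\<close>)
  next
    fix c x assume x: "x \<in> hcarrier V"
    show "T (hscale V c x) = hscale V c (T x)"
      by (rule J_inject) (use x T in \<open>auto simp flip: J simp: Jl Rl\<close>)
  qed
  moreover obtain C where C: "\<And>\<phi>. \<phi> \<in> hcarrier K \<Longrightarrow> hnorm K (R \<phi>) \<le> C * hnorm K \<phi>"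
    using bounded_norm[OF R] by blast
  moreover have "hnorm V (T w) \<le> C * hnorm V w" if "w \<in> hcarrier V" for w
    using C[OF J_carrier[OF that]] that T J[OF that] by simp
  ultimately have TB: "restrict T (hcarrier V) \<in> bounded_ops V"
    by (intro bounded_opsI[OF T]) auto
  have "ract \<rho> a (T v) = T (ract \<rho> a v)" if a: "a \<in> subgrading A H" and v: "v \<in> hcarrier V" for a v
  proof (rule J_inject)
    have "J (ract \<rho> a (T v)) = R (ten a v)" using RT[OF v] ten_sub[OF a T[OF v]] by simp
    also have "\<dots> = J (T (ract \<rho> a v))" using ten_sub[OF a v] J[OF \<rho>_in[OF a v]] by simp
    finally show "J (ract \<rho> a (T v)) = J (T (ract \<rho> a v))" .
  qed (use a v T in auto)
  thus "restrict T (hcarrier V) \<in> comm_\<rho>" using TB T by (auto simp: comm_\<rho>_iff)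
  show "R = amp (restrict T (hcarrier V))"
  proof (rule bounded_agree[OF R amp_bounded[OF TB]])
    fix x v assume x: "x \<in> orb" and v: "v \<in> hcarrier V"
    show "R (frame x v) = amp (restrict T (hcarrier V)) (frame x v)"
      using amp_C[OF TB x v] RT[OF v] v by (simp add: frame_def)
  qed
qed

text \<open>An operator in the commutant preserves the joint eigenspace for \<open>\<xi>\<close>, which is the image
  of \<open>J\<close>, and since it commutes with the action of \<open>d\<close> it acts on \<open>d \<otimes> v\<close> as on \<open>v\<close>.\<close>

lemma commutant_amp:
  assumes R: "R \<in> comm_\<pi>"
  shows "\<exists>T\<in>comm_\<rho>. R = amp T"
proof -
  have RB: "R \<in> bounded_ops K" and Rd: "\<And>\<phi>. \<phi> \<in> rdom \<pi> \<Longrightarrow> R \<phi> \<in> rdom \<pi>"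
    and RI: "\<And>a \<phi>. \<phi> \<in> rdom \<pi> \<Longrightarrow> ract \<pi> a (R \<phi>) = R (ract \<pi> a \<phi>)"
    using R by (auto simp: rep_commutant_def)
  have "\<exists>w\<in>hcarrier V. R (J v) = J w" if v: "v \<in> hcarrier V" for v
  proof (rule eigenvector_J[OF Rd[OF J_in[OF v]]])
    fix b assume b: "b \<in> A 0"
    show "ract \<pi> b (R (J v)) = hscale K (\<xi> b) (R (J v))"
      unfolding RI[OF J_in[OF v]] J_char[OF b v] by (rule hlinear_scale[OF bounded_linear[OF RB]]) (use v in simp)
  qed
  then obtain T where T: "\<And>v. v \<in> hcarrier V \<Longrightarrow> T v \<in> hcarrier V" "\<And>v. v \<in> hcarrier V \<Longrightarrow> R (J v) = J (T v)"
    by metis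
  have "R (ten d w) = ten d (T w)" if "w \<in> hcarrier V" for d w
    using RI[OF J_in[OF that], of d] T that by (simp add: ten_def)
  from amp_char[OF RB T(1) this] show ?thesis by blast
qed

lemma amp_inj:
  assumes S: "S \<in> bounded_ops V" and T: "T \<in> bounded_ops V" and eq: "amp S = amp T"
  shows "S = T"
proof (rule bounded_ops_eqI[OF S T])
  fix v assume v: "v \<in> hcarrier V"
  have "coord \<xi> (amp S (frame \<xi> v)) = coord \<xi> (amp T (frame \<xi> v))" using eq by simp
  thus "S v = T v" using coord_amp[OF S _ \<xi>_orb] coord_amp[OF T _ \<xi>_orb] v \<xi>_orb by (simp add: coord_C)
qed

lemma commutant_isomorphic: "star_isomorphic V comm_\<rho> K comm_\<pi>"
  unfolding star_isomorphic_def
proof (intro exI[of _ amp] conjI ballI allI impI)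
  have B: "T \<in> bounded_ops V" if "T \<in> comm_\<rho>" for T using that by (simp add: comm_\<rho>_iff)
  note aB = bounded_in[OF amp_bounded]
  note cl = hlinear_add[OF coord_linear] hlinear_scale[OF coord_linear]
  show "bij_betw amp comm_\<rho> comm_\<pi>"
    unfolding bij_betw_def inj_on_def using amp_inj B amp_in_commutant commutant_amp by blast
  have bcomb: "(\<lambda>x\<in>hcarrier V. f x) \<in> bounded_ops V"
    if "\<And>x. x \<in> hcarrier V \<Longrightarrow> f x \<in> hcarrier V" "hlinear V (hcarrier V) V f"
      "\<And>x. x \<in> hcarrier V \<Longrightarrow> hnorm V (f x) \<le> M * hnorm V x" for f M
    by (rule bounded_opsI[OF that(1) that(2) that(3)]) auto
  fix S T assume S: "S \<in> comm_\<rho>" and T: "T \<in> comm_\<rho>"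
  obtain C where C: "C \<ge> 0" "\<And>x. x \<in> hcarrier V \<Longrightarrow> hnorm V (S x) \<le> C * hnorm V x"
    by (rule bounded_norm_nonneg[OF V_ips B[OF S]]) (rule that)
  obtain E where E: "E \<ge> 0" "\<And>x. x \<in> hcarrier V \<Longrightarrow> hnorm V (T x) \<le> E * hnorm V x"
    by (rule bounded_norm_nonneg[OF V_ips B[OF T]]) (rule that)
  note Sin = bounded_in[OF B[OF S]] and Tin = bounded_in[OF B[OF T]]
  note Sl = hlinear_add[OF bounded_linear[OF B[OF S]]] hlinear_scale[OF bounded_linear[OF B[OF S]]]
  note Tl = hlinear_add[OF bounded_linear[OF B[OF T]]] hlinear_scale[OF bounded_linear[OF B[OF T]]]
  have sumB: "(\<lambda>x\<in>hcarrier V. hadd V (S x) (T x)) \<in> bounded_ops V"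
  proof (rule bcomb[of _ "C + E"])
    show "hlinear V (hcarrier V) V (\<lambda>x. hadd V (S x) (T x))"
      unfolding hlinear_def
      by (auto simp: Sl Tl Sin Tin intro!: vector_eqI[OF V_ips] simp: algebra_simps)
    show "hnorm V (hadd V (S x) (T x)) \<le> (C + E) * hnorm V x" if "x \<in> hcarrier V" for x
      using hnorm_triangle[OF V_ips Sin[OF that] Tin[OF that]] C(2)[OF that] E(2)[OF that]
      by (simp add: algebra_simps)
  qed (use Sin Tin in auto)
  have prodB: "(\<lambda>x\<in>hcarrier V. S (T x)) \<in> bounded_ops V"
  proof (rule bcomb[of _ "C * E"])
    show "hlinear V (hcarrier V) V (\<lambda>x. S (T x))"
      unfolding hlinear_def by (auto simp: Sl Tl Sin Tin)
    show "hnorm V (S (T x)) \<le> C * E * hnorm V x" if "x \<in> hcarrier V" for x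
      using C(2)[OF Tin[OF that]] mult_left_mono[OF E(2)[OF that] C(1)] by (simp add: mult.assoc)
  qed (use Sin Tin in auto)
  show "amp (\<lambda>x\<in>hcarrier V. hadd V (S x) (T x)) = (\<lambda>x\<in>hcarrier K. hadd K (amp S x) (amp T x))"
    by (rule amp_eqI[OF sumB]) (use aB[OF B[OF S]] aB[OF B[OF T]] in \<open>auto simp: coord_amp[OF B[OF S]] coord_amp[OF B[OF T]] cl\<close>)
  show "amp (\<lambda>x\<in>hcarrier V. S (T x)) = (\<lambda>x\<in>hcarrier K. amp S (amp T x))"
    by (rule amp_eqI[OF prodB]) (use aB[OF B[OF S]] aB[OF B[OF T]] in \<open>auto simp: coord_amp[OF B[OF S]] coord_amp[OF B[OF T]]\<close>)
  show "adjoint_pair K (amp S) (amp T)" if "adjoint_pair V S T"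
    by (rule amp_adjoint[OF B[OF S] B[OF T] that])
  fix c
  have scB: "(\<lambda>x\<in>hcarrier V. hscale V c (S x)) \<in> bounded_ops V"
  proof (rule bcomb[of _ "cmod c * C"])
    show "hlinear V (hcarrier V) V (\<lambda>x. hscale V c (S x))"
      unfolding hlinear_def
      by (auto simp: Sl Sin intro!: vector_eqI[OF V_ips] simp: algebra_simps)
    show "hnorm V (hscale V c (S x)) \<le> cmod c * C * hnorm V x" if "x \<in> hcarrier V" for x
      using Sin[OF that] mult_left_mono[OF C(2)[OF that], of "cmod c"] by (simp add: mult.assoc)
  qed (use Sin in auto)
  show "amp (\<lambda>x\<in>hcarrier V. hscale V c (S x)) = (\<lambda>x\<in>hcarrier K. hscale K c (amp S x))"
    by (rule amp_eqI[OF scB]) (use aB[OF B[OF S]] in \<open>auto simp: coord_amp[OF B[OF S]] cl\<close>)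
qed

text \<open>The operators \<open>\<phi> \<mapsto> d \<otimes> coord \<xi> \<phi>\<close> with homogeneous \<open>d\<close> are bounded and commute with all
  amplifications. An operator commuting with them only acts on the second factor of tensors.\<close>

lemma commutant_von_neumann: "von_neumann_algebra K comm_\<pi>"
  unfolding von_neumann_algebra_def
proof (intro conjI ballI)
  show sub: "comm_\<pi> \<subseteq> bounded_ops K" by (auto simp: rep_commutant_def)
  show "\<exists>T\<in>comm_\<pi>. adjoint_pair K S T" if S: "S \<in> comm_\<pi>" for S
  proof -
    obtain S0 where S0: "S0 \<in> comm_\<rho>" "S = amp S0" using commutant_amp[OF S] by blast
    obtain T0 where T0: "T0 \<in> comm_\<rho>" "adjoint_pair V S0 T0" using comm_\<rho>_adjoint_ex[OF S0(1)] by blast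
    have "adjoint_pair K S (amp T0)"
      unfolding S0(2) using amp_adjoint[OF _ _ T0(2)] S0(1) T0(1) by (simp add: comm_\<rho>_iff)
    thus ?thesis using amp_in_commutant[OF T0(1)] by blast
  qed
  show "op_commutant K (op_commutant K comm_\<pi>) = comm_\<pi>"
  proof
    show "comm_\<pi> \<subseteq> op_commutant K (op_commutant K comm_\<pi>)" by (rule op_commutant_bicommutant[OF sub])
    show "op_commutant K (op_commutant K comm_\<pi>) \<subseteq> comm_\<pi>"
    proof
      fix R assume R: "R \<in> op_commutant K (op_commutant K comm_\<pi>)"
      have RB: "R \<in> bounded_ops K" using R by (simp add: op_commutant_def)
      define T where "T w = coord \<xi> (R (frame \<xi> w))" for w
      have T: "T w \<in> hcarrier V" if "w \<in> hcarrier V" for w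
        using that bounded_in[OF RB, of "frame \<xi> w"] \<xi>_orb by (simp add: T_def)
      have "R (ten d w) = ten d (T w)" if w: "w \<in> hcarrier V" for d w
      proof (induction d rule: graded_induct)
        case (homogeneous g d)
        let ?Q = "\<lambda>\<phi>. ten d (coord \<xi> \<phi>)"
        obtain r where r: "\<xi> (star d * d) = of_real r" "r \<ge> 0"
          using char_square[OF \<xi> homogeneous] by (auto simp: nonneg_Reals_def)
        have nd: "hnorm K (ten d v) = sqrt r * hnorm V v" if v: "v \<in> hcarrier V" for v
        proof -
          have "hinner K (ten d v) (ten d v) = of_real r * hinner V v v"
            using ten_inner[OF homogeneous homogeneous _ v v] \<rho>_char[OF A0_star_mult[OF homogeneous homogeneous] v] v r
            by simp
          thus ?thesis by (simp add: hnorm_def real_sqrt_mult)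
        qed
        have QB: "restrict ?Q (hcarrier K) \<in> bounded_ops K"
        proof (rule bounded_opsI)
          show "hlinear K (hcarrier K) K ?Q"
            unfolding hlinear_def
            using \<xi>_orb by (auto simp: hlinear_add[OF coord_linear] hlinear_scale[OF coord_linear]
                hlinear_add[OF ten_linear] hlinear_scale[OF ten_linear])
          show "hnorm K (?Q \<phi>) \<le> sqrt r * hnorm K \<phi>" if "\<phi> \<in> hcarrier K" for \<phi>
            using nd[OF coord_in[OF \<xi>_orb that]] coord_bound[OF \<xi>_orb that] r by (simp add: mult_left_mono)
        qed (use \<xi>_orb in auto)
        have "restrict ?Q (hcarrier K) \<in> op_commutant K comm_\<pi>"
          unfolding op_commutant_def
        proof (intro CollectI conjI ballI QB)
          fix S \<phi> assume S: "S \<in> comm_\<pi>" and \<phi>: "\<phi> \<in> hcarrier K"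
          obtain S0 where S0: "S0 \<in> comm_\<rho>" "S = amp S0" using commutant_amp[OF S] by blast
          have SB: "S \<in> bounded_ops K" using S sub by blast
          have S0B: "S0 \<in> bounded_ops V" using S0 by (simp add: comm_\<rho>_iff)
          show "restrict ?Q (hcarrier K) (S \<phi>) = S (restrict ?Q (hcarrier K) \<phi>)"
            using \<phi> bounded_in[OF SB \<phi>] amp_ten[OF S0(1) coord_in[OF \<xi>_orb \<phi>]] coord_amp[OF S0B \<phi> \<xi>_orb]
            by (simp add: S0(2))
        qed
        from op_commutantD[OF R this, of "frame \<xi> w"] w
        have "R (restrict ?Q (hcarrier K) (frame \<xi> w)) = restrict ?Q (hcarrier K) (R (frame \<xi> w))" by simp
        then show ?case
          using w bounded_in[OF RB, of "frame \<xi> w"] \<xi>_orb by (simp add: coord_C T_def)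
      qed (use w T in \<open>simp add: ten_add hlinear_add[OF bounded_linear[OF RB]]\<close>)
      from amp_char[OF RB T this] show "R \<in> comm_\<pi>" using amp_in_commutant by metis
    qed
  qed
qed

subsection \<open>Irreducibility\<close>

text \<open>An orthogonal decomposition of the domain of \<open>\<pi>\<close> splits the eigenvalue equations of \<open>Jv\<close>, so
  the components of \<open>Jv\<close> lie in the image of \<open>J\<close> again and \<open>\<rho>\<close> is decomposed. If one of its summands is
  trivial, then all tensors lie in one summand of the domain and the other one is orthogonal to them.\<close>

lemma irreducible_\<pi>:
  assumes irr: "irreducible_rep (subgrading A H) \<rho>"
  shows "irreducible_rep UNIV \<pi>"
  unfolding irreducible_rep_def
proof (intro allI impI, elim conjE)
  fix D1 D2
  assume D1: "hsubspace K D1" and D2: "hsubspace K D2" and orth: "\<forall>x\<in>D1. \<forall>y\<in>D2. hinner K x y = 0"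
    and dom: "rdom \<pi> = {hadd K x y |x y. x \<in> D1 \<and> y \<in> D2}"
    and inv: "\<forall>a\<in>UNIV. ract \<pi> a ` D1 \<subseteq> D1 \<and> ract \<pi> a ` D2 \<subseteq> D2"
  note c1 = subspace_carrier[OF D1] and c2 = subspace_carrier[OF D2]
  have d1: "x \<in> rdom \<pi>" if "x \<in> D1" for x
  proof -
    have "x = hadd K x (hzero K)" using c1[OF that] by simp
    thus ?thesis unfolding dom using that subspace_zero[OF D2] by blast
  qed
  have d2: "x \<in> rdom \<pi>" if "x \<in> D2" for x
  proof -
    have "x = hadd K (hzero K) x" using c2[OF that] by simp
    thus ?thesis unfolding dom using that subspace_zero[OF D1] by blast
  qed
  have orth': "hinner K y x = 0" if "x \<in> D1" "y \<in> D2" for x y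
    using orth that hinner_sym[OF K_ips c1[OF that(1)] c2[OF that(2)]] by simp
  define V1 where "V1 = {v \<in> hcarrier V. J v \<in> D1}"
  define V2 where "V2 = {v \<in> hcarrier V. J v \<in> D2}"
  have sub: "hsubspace V {v \<in> hcarrier V. J v \<in> D}" if D: "hsubspace K D" for D
    using subspace_zero[OF D] subspace_add[OF D] subspace_scale[OF D] hlinear_zero[OF V_ips K_ips J_linear]
    by (auto simp: hsubspace_def hlinear_add[OF J_linear] hlinear_scale[OF J_linear])
  have split: "\<exists>x y. x \<in> V1 \<and> y \<in> V2 \<and> v = hadd V x y" if v: "v \<in> hcarrier V" for v
  proof -
    obtain x y where xy: "x \<in> D1" "y \<in> D2" "J v = hadd K x y" using J_in[OF v] unfolding dom by blast
    have eig: "ract \<pi> b x = hscale K (\<xi> b) x \<and> ract \<pi> b y = hscale K (\<xi> b) y" if b: "b \<in> A 0" for b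
    proof -
      let ?p = "hdiff K (ract \<pi> b x) (hscale K (\<xi> b) x)" and ?q = "hdiff K (ract \<pi> b y) (hscale K (\<xi> b) y)"
      have pq: "?p \<in> D1" "?q \<in> D2"
        using inv xy subspace_scale[OF D1 xy(1)] subspace_scale[OF D2 xy(2)]
        by (auto intro!: subspace_diff[OF D1] subspace_diff[OF D2])
      have eq: "hadd K (ract \<pi> b x) (ract \<pi> b y) = hscale K (\<xi> b) (hadd K x y)"
        using J_char[OF b v] \<pi>_hadd[OF d1[OF xy(1)] d2[OF xy(2)]] by (simp add: xy(3))
      have "hinner K (hadd K ?p ?q) z = 0" if z: "z \<in> hcarrier K" for z
        using arg_cong[OF eq, of "\<lambda>u. hinner K u z"] z d1[OF xy(1)] d2[OF xy(2)] by (simp add: algebra_simps)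
      hence "hinner K ?p ?p = 0" "hinner K ?q ?q = 0"
        using hinner_add_left[OF K_ips c1[OF pq(1)] c2[OF pq(2)] c1[OF pq(1)]]
          hinner_add_left[OF K_ips c1[OF pq(1)] c2[OF pq(2)] c2[OF pq(2)]]
          orth'[OF pq] orth pq c1[OF pq(1)] c2[OF pq(2)] by (metis add.right_neutral, metis add.left_neutral)
      hence "?p = hzero K" "?q = hzero K"
        using hinner_self_eq0[OF K_ips c1[OF pq(1)]] hinner_self_eq0[OF K_ips c2[OF pq(2)]] by blast+
      thus ?thesis
        using hdiff_eq_zero[OF K_ips, of "ract \<pi> b x" "hscale K (\<xi> b) x"]
          hdiff_eq_zero[OF K_ips, of "ract \<pi> b y" "hscale K (\<xi> b) y"] d1[OF xy(1)] d2[OF xy(2)] by simp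
    qed
    obtain v1 v2 where v12: "v1 \<in> hcarrier V" "x = J v1" "v2 \<in> hcarrier V" "y = J v2"
      using eigenvector_J[OF d1[OF xy(1)]] eigenvector_J[OF d2[OF xy(2)]] eig by blast
    have "v = hadd V v1 v2"
      by (rule J_inject) (use v v12 xy(3) in \<open>auto simp: hlinear_add[OF J_linear]\<close>)
    thus ?thesis using v12 xy by (auto simp: V1_def V2_def)
  qed
  have "V1 = {hzero V} \<or> V2 = {hzero V}"
  proof (rule irr[unfolded irreducible_rep_def, rule_format], intro conjI ballI)
    show "hsubspace V V1" "hsubspace V V2" unfolding V1_def V2_def by (rule sub[OF D1], rule sub[OF D2])
    show "hinner V x y = 0" if "x \<in> V1" "y \<in> V2" for x y
      using that orth J_inner[of x y] by (simp add: V1_def V2_def)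
    show "rdom \<rho> = {hadd V x y |x y. x \<in> V1 \<and> y \<in> V2}"
    proof (intro set_eqI iffI)
      fix x assume "x \<in> rdom \<rho>"
      then show "x \<in> {hadd V x y |x y. x \<in> V1 \<and> y \<in> V2}" using split[of x] unfolding \<rho>_dom by blast
    qed (auto simp: V1_def V2_def \<rho>_dom)
    fix a assume a: "a \<in> subgrading A H"
    have "J (ract \<rho> a v) \<in> D1" if "v \<in> hcarrier V" "J v \<in> D1" for v
      unfolding J_act[OF a that(1), symmetric] using inv that(2) by blast
    moreover have "J (ract \<rho> a v) \<in> D2" if "v \<in> hcarrier V" "J v \<in> D2" for v
      unfolding J_act[OF a that(1), symmetric] using inv that(2) by blast
    ultimately show "ract \<rho> a ` V1 \<subseteq> V1" "ract \<rho> a ` V2 \<subseteq> V2"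
      using a by (auto simp: V1_def V2_def)
  qed
  thus "D1 = {hzero K} \<or> D2 = {hzero K}"
  proof (elim disjE)
    assume V1: "V1 = {hzero V}"
    have "D1 = {hzero K}"
    proof -
      have J2: "J v \<in> D2" if "v \<in> hcarrier V" for v using split[OF that] V1 by (auto simp: V2_def)
      have "x = hzero K" if x: "x \<in> D1" for x
        by (rule total[OF c1[OF x]]) (use orth x inv J2 in blast)
      thus ?thesis using subspace_zero[OF D1] by blast
    qed
    thus ?thesis ..
  next
    assume V2: "V2 = {hzero V}"
    have "D2 = {hzero K}"
    proof -
      have J1: "J v \<in> D1" if "v \<in> hcarrier V" for v using split[OF that] V2 by (auto simp: V1_def)
      have "x = hzero K" if x: "x \<in> D2" for x
        by (rule total[OF c2[OF x]]) (use orth' x inv J1 in blast)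
      thus ?thesis using subspace_zero[OF D2] by blast
    qed
    thus ?thesis ..
  qed
qed

text \<open>The projection onto a summand of \<open>\<rho>\<close> is in the commutant. Its amplification leaves the
  domain of \<open>\<pi>\<close> invariant and decomposes it.\<close>

lemma irreducible_\<rho>:
  assumes irr: "irreducible_rep UNIV \<pi>"
  shows "irreducible_rep (subgrading A H) \<rho>"
  unfolding irreducible_rep_def \<rho>_dom
proof (intro allI impI, elim conjE)
  fix V1 V2
  assume V1: "hsubspace V V1" and V2: "hsubspace V V2" and orth: "\<forall>x\<in>V1. \<forall>y\<in>V2. hinner V x y = 0"
    and dom: "hcarrier V = {hadd V x y |x y. x \<in> V1 \<and> y \<in> V2}"
    and inv: "\<forall>a\<in>subgrading A H. ract \<rho> a ` V1 \<subseteq> V1 \<and> ract \<rho> a ` V2 \<subseteq> V2"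
  note c1 = subspace_carrier[OF V1] and c2 = subspace_carrier[OF V2]
  have orth': "hinner V y x = 0" if "x \<in> V1" "y \<in> V2" for x y
    using orth that hinner_sym[OF V_ips c1[OF that(1)] c2[OF that(2)]] by simp
  have "\<exists>x. x \<in> V1 \<and> hdiff V v x \<in> V2" if v: "v \<in> hcarrier V" for v
  proof -
    obtain x y where xy: "x \<in> V1" "y \<in> V2" "v = hadd V x y" using v unfolding dom by blast
    have "hdiff V v x = y"
      by (rule vector_eqI[OF V_ips]) (use xy c1[OF xy(1)] c2[OF xy(2)] in auto)
    thus ?thesis using xy by blast
  qed
  then obtain p where p: "\<And>v. v \<in> hcarrier V \<Longrightarrow> p v \<in> V1" "\<And>v. v \<in> hcarrier V \<Longrightarrow> hdiff V v (p v) \<in> V2"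
    by metis
  have pc: "p v \<in> hcarrier V" if "v \<in> hcarrier V" for v by (rule c1[OF p(1)[OF that]])
  (* The decomposition is unique because the summands are orthogonal. *)
  have pu: "p v = x" if v: "v \<in> hcarrier V" and x: "x \<in> V1" and y: "hdiff V v x \<in> V2" for v x
  proof -
    let ?d = "hdiff V (p v) x"
    have d1: "?d \<in> V1" by (rule subspace_diff[OF V1 p(1)[OF v] x])
    have "?d = hdiff V (hdiff V v x) (hdiff V v (p v))"
      by (rule vector_eqI[OF V_ips]) (use v pc c1[OF x] in auto)
    hence d2: "?d \<in> V2" using subspace_diff[OF V2 y p(2)[OF v]] by simp
    have "?d = hzero V" using hinner_self_eq0[OF V_ips c1[OF d1]] orth d1 d2 by blast
    thus ?thesis using hdiff_eq_zero[OF V_ips pc[OF v] c1[OF x]] by blast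
  qed
  have adj: "hinner V (p v) w = hinner V v (p w)" if v: "v \<in> hcarrier V" and w: "w \<in> hcarrier V" for v w
  proof -
    have "hinner V (p v) (hdiff V w (p w)) = 0" using orth p(1)[OF v] p(2)[OF w] by blast
    moreover have "hinner V (hdiff V v (p v)) (p w) = 0" using orth' p(2)[OF v] p(1)[OF w] by blast
    ultimately show ?thesis using v w pc by simp
  qed
  have plin: "hlinear V (hcarrier V) V p" by (rule adjoint_linear[OF V_ips V_ips pc pc adj])
  have pbd: "hnorm V (p v) \<le> 1 * hnorm V v" if v: "v \<in> hcarrier V" for v
  proof -
    have "hinner V (hdiff V v (p v)) (p v) = 0" using orth' p(2)[OF v] p(1)[OF v] by blast
    hence eq: "hinner V v (p v) = hinner V (p v) (p v)" using v pc by simp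
    have eq': "hinner V (p v) v = hinner V (p v) (p v)"
      using eq adj[OF v v] by simp
    have "0 \<le> (hnorm V (hdiff V v (p v)))\<^sup>2" by simp
    also have "(hnorm V (hdiff V v (p v)))\<^sup>2 = (hnorm V v)\<^sup>2 - (hnorm V (p v))\<^sup>2"
      using v pc[OF v] eq eq' by (simp add: hnorm_sq)
    finally have "(hnorm V (p v))\<^sup>2 \<le> (hnorm V v)\<^sup>2" by simp
    thus ?thesis using power2_le_imp_le[of "hnorm V (p v)" "hnorm V v"] v by simp
  qed
  define P where "P = restrict p (hcarrier V)"
  have PB: "P \<in> bounded_ops V" unfolding P_def by (rule bounded_opsI[OF pc plin pbd V_ips])
  have "p (ract \<rho> a v) = ract \<rho> a (p v)" if a: "a \<in> subgrading A H" and v: "v \<in> hcarrier V" for a v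
  proof (rule pu)
    show "ract \<rho> a (p v) \<in> V1" using inv a p(1)[OF v] by blast
    have "hdiff V (ract \<rho> a v) (ract \<rho> a (p v)) = ract \<rho> a (hdiff V v (p v))"
      using a v pc by (simp add: hdiff_def \<rho>_hadd \<rho>_hscale)
    moreover have "ract \<rho> a (hdiff V v (p v)) \<in> V2" using inv a p(2)[OF v] by blast
    ultimately show "hdiff V (ract \<rho> a v) (ract \<rho> a (p v)) \<in> V2" by simp
  qed (use a v in simp)
  hence PM: "P \<in> comm_\<rho>" using PB pc by (simp add: comm_\<rho>_iff P_def)
  note aB = bounded_in[OF amp_bounded[OF PB]]
  have aP: "amp P \<in> comm_\<pi>" by (rule amp_in_commutant[OF PM])
  have dm: "amp P \<phi> \<in> rdom \<pi>" if "\<phi> \<in> rdom \<pi>" for \<phi> using aP that by (auto simp: rep_commutant_def)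
  have ap: "hinner K (amp P \<phi>) \<psi> = hinner K \<phi> (amp P \<psi>)" if "\<phi> \<in> hcarrier K" "\<psi> \<in> hcarrier K" for \<phi> \<psi>
    using amp_adjoint[OF PB PB] that adj by (simp add: adjoint_pair_def P_def)
  have pp: "p (p v) = p v" if "v \<in> hcarrier V" for v
  proof (rule pu[OF pc[OF that] p(1)[OF that]])
    have "hdiff V (p v) (p v) = hzero V"
      by (rule vector_eqI[OF V_ips]) (use that pc in auto)
    thus "hdiff V (p v) (p v) \<in> V2" using subspace_zero[OF V2] by simp
  qed
  have aidem: "amp P (amp P \<phi>) = amp P \<phi>" if "\<phi> \<in> hcarrier K" for \<phi>
  proof (rule coord_ext)
    have PP: "P (P v) = P v" if "v \<in> hcarrier V" for v using that pp pc by (simp add: P_def)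
    show "coord x (amp P (amp P \<phi>)) = coord x (amp P \<phi>)" if "x \<in> orb" for x
      using that \<open>\<phi> \<in> hcarrier K\<close> aB PP by (simp add: coord_amp[OF PB])
  qed (use that aB in auto)
  note al = hlinear_add[OF bounded_linear[OF amp_bounded[OF PB]]] hlinear_scale[OF bounded_linear[OF amp_bounded[OF PB]]]
    hlinear_diff[OF K_ips bounded_linear[OF amp_bounded[OF PB]]]
  have az: "amp P (hzero K) = hzero K"
    by (rule hlinear_zero[OF K_ips K_ips bounded_linear[OF amp_bounded[OF PB]] aB])
  have aI: "ract \<pi> a (amp P \<phi>) = amp P (ract \<pi> a \<phi>)" if "\<phi> \<in> rdom \<pi>" for a \<phi>
    using aP that by (auto simp: rep_commutant_def)
  let ?D1 = "{\<phi> \<in> rdom \<pi>. amp P \<phi> = \<phi>}" and ?D2 = "{\<phi> \<in> rdom \<pi>. amp P \<phi> = hzero K}"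
  have "?D1 = {hzero K} \<or> ?D2 = {hzero K}"
  proof (rule irr[unfolded irreducible_rep_def, rule_format], intro conjI ballI)
    show "hsubspace K ?D1" "hsubspace K ?D2"
      using dom_subspace az by (auto simp: hsubspace_def al subset_iff)
    show "hinner K x y = 0" if "x \<in> ?D1" "y \<in> ?D2" for x y
    proof -
      have "hinner K x y = hinner K (amp P x) y" using that by simp
      also have "\<dots> = hinner K x (amp P y)" using that by (intro ap) auto
      finally show ?thesis using that by simp
    qed
    show "rdom \<pi> = {hadd K x y |x y. x \<in> ?D1 \<and> y \<in> ?D2}"
    proof (intro set_eqI iffI)
      fix \<phi> assume \<phi>: "\<phi> \<in> rdom \<pi>"
      have \<phi>K: "\<phi> \<in> hcarrier K" using \<phi> by simp
      have s: "\<phi> = hadd K (amp P \<phi>) (hdiff K \<phi> (amp P \<phi>))"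
        by (rule vector_eqI[OF K_ips]) (use \<phi> aB in auto)
      have "amp P (hdiff K \<phi> (amp P \<phi>)) = hzero K"
      proof -
        have "amp P (hdiff K \<phi> (amp P \<phi>)) = hdiff K (amp P \<phi>) (amp P \<phi>)"
          using \<phi>K aB by (simp add: al aidem)
        also have "\<dots> = hzero K" by (rule vector_eqI[OF K_ips]) (use \<phi>K aB in auto)
        finally show ?thesis .
      qed
      hence "hdiff K \<phi> (amp P \<phi>) \<in> ?D2" using subspace_diff[OF dom_subspace \<phi> dm[OF \<phi>]] by simp
      moreover have "amp P \<phi> \<in> ?D1" using dm[OF \<phi>] aidem[OF \<phi>K] by simp
      ultimately show "\<phi> \<in> {hadd K x y |x y. x \<in> ?D1 \<and> y \<in> ?D2}" using s by blast
    qed (use subspace_add[OF dom_subspace] in auto)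
    fix a
    show "ract \<pi> a ` ?D1 \<subseteq> ?D1" "ract \<pi> a ` ?D2 \<subseteq> ?D2" using aI[of _ a] by (auto simp: \<pi>_zero) (metis aI, metis aI \<pi>_zero)
  qed
  moreover have JP: "amp P (J v) = J (p v)" if "v \<in> hcarrier V" for v
    using amp_ten[OF PM that, of 1] that pc by (simp add: ten_one P_def)
  moreover have "V1 = {hzero V}" if D1: "?D1 = {hzero K}"
  proof -
    have "v = hzero V" if v: "v \<in> V1" for v
    proof -
      have vv: "hdiff V v v \<in> V2"
        using subspace_zero[OF V2] hdiff_eq_zero[OF V_ips c1[OF v] c1[OF v]] vector_eqI[OF V_ips, of "hdiff V v v" "hzero V"] c1[OF v] by simp
      have "J v \<in> ?D1" using JP[OF c1[OF v]] pu[OF c1[OF v] v vv] J_in[OF c1[OF v]] by simp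
      hence "J v = J (hzero V)" using D1 hlinear_zero[OF V_ips K_ips J_linear] by simp
      thus ?thesis using J_inject c1[OF v] by simp
    qed
    thus ?thesis using subspace_zero[OF V1] by blast
  qed
  moreover have "V2 = {hzero V}" if D2: "?D2 = {hzero K}"
  proof -
    have "v = hzero V" if v: "v \<in> V2" for v
    proof -
      have "hdiff V v (hzero V) = v" by (rule vector_eqI[OF V_ips]) (use c2[OF v] in auto)
      hence "p v = hzero V" using pu[OF c2[OF v] subspace_zero[OF V1]] v by simp
      hence "J v \<in> ?D2" using JP[OF c2[OF v]] J_in[OF c2[OF v]] hlinear_zero[OF V_ips K_ips J_linear] by simp
      hence "J v = J (hzero V)" using D2 hlinear_zero[OF V_ips K_ips J_linear] by simp
      thus ?thesis using J_inject c2[OF v] by simp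
    qed
    thus ?thesis using subspace_zero[OF V2] by blast
  qed
  ultimately show "V1 = {hzero V} \<or> V2 = {hzero V}" by blast
qed

end

section \<open>Well-behaved representations over the orbit are generated from the stabilizer\<close>

lemma subspace_hnorm [simp]: "hnorm (K\<lparr>hcarrier := D\<rparr>) x = hnorm K x"
  by (simp add: hnorm_def)

lemma subspace_hdiff [simp]: "hdiff (K\<lparr>hcarrier := D\<rparr>) x y = hdiff K x y"
  by (simp add: hdiff_def)

lemma subspace_htendsto [simp]: "htendsto (K\<lparr>hcarrier := D\<rparr>) f l F = htendsto K f l F"
  by (simp add: htendsto_def)

lemma subspace_hCauchy [simp]: "hCauchy (K\<lparr>hcarrier := D\<rparr>) s = hCauchy K s"
  by (simp add: hCauchy_def)

lemma subspace_inner_product_space: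
  assumes K: "inner_product_space K" and D: "hsubspace K D"
  shows "inner_product_space (K\<lparr>hcarrier := D\<rparr>)"
proof -
  have D': "D \<subseteq> hcarrier K" "hzero K \<in> D" "\<forall>x\<in>D. \<forall>y\<in>D. hadd K x y \<in> D" "\<forall>c. \<forall>x\<in>D. hscale K c x \<in> D"
    using D by (auto simp: hsubspace_def)
  have c: "x \<in> hcarrier K" if "x \<in> D" for x using that D'(1) by blast
  have e: "hcarrier (K\<lparr>hcarrier := D\<rparr>) = D" "hzero (K\<lparr>hcarrier := D\<rparr>) = hzero K" "hadd (K\<lparr>hcarrier := D\<rparr>) = hadd K"
    "hscale (K\<lparr>hcarrier := D\<rparr>) = hscale K" "hinner (K\<lparr>hcarrier := D\<rparr>) = hinner K" by simp_all
  have f: "\<forall>x\<in>D. \<forall>y\<in>D. hinner K y x = cnj (hinner K x y)"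
    "\<forall>x\<in>D. \<forall>y\<in>D. hadd K x y = hadd K y x"
    "\<forall>x\<in>D. \<forall>y\<in>D. \<forall>z\<in>D. hadd K (hadd K x y) z = hadd K x (hadd K y z)"
    "\<forall>x\<in>D. hinner K x x = 0 \<longrightarrow> x = hzero K" "\<forall>x\<in>D. hinner K x x \<in> \<real>\<^sub>\<ge>\<^sub>0"
    "\<forall>x\<in>D. hadd K (hzero K) x = x" "\<forall>x\<in>D. hadd K x (hscale K (- 1) x) = hzero K" "\<forall>x\<in>D. hscale K 1 x = x"
    using hinner_sym[OF K c c] hadd_commute[OF K c c] hadd_assoc[OF K c c c] hinner_self_eq0[OF K c]
      hinner_self_nonneg[OF K c] hadd_hzero_left[OF K c] hadd_neg[OF K c] hscale_one[OF K c] by blast+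
  have g: "\<forall>c. \<forall>x\<in>D. \<forall>y\<in>D. hscale K c (hadd K x y) = hadd K (hscale K c x) (hscale K c y)"
    "\<forall>c d. \<forall>x\<in>D. hscale K (c + d) x = hadd K (hscale K c x) (hscale K d x)"
    "\<forall>c d. \<forall>x\<in>D. hscale K c (hscale K d x) = hscale K (c * d) x"
    using c K by (auto intro!: vector_eqI[OF K] simp: algebra_simps)
  have h: "\<forall>x\<in>D. \<forall>y\<in>D. \<forall>z\<in>D. hinner K (hadd K x y) z = hinner K x z + hinner K y z"
    "\<forall>c. \<forall>x\<in>D. \<forall>y\<in>D. hinner K (hscale K c x) y = c * hinner K x y"
    using c K by auto
  show ?thesis
    unfolding inner_product_space_def e by (intro conjI D' f g h)
qed

text \<open>As \<open>1\<close> belongs to \<open>S\<close>, the limit in the graph topology, which closedness provides, is the limit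
  in norm.\<close>

lemma closed_rep_limit:
  assumes \<pi>: "star_rep S \<pi>" and c: "closed_rep S \<pi>" and one: "1 \<in> S" and F: "graph_cauchy S \<pi> F"
    and t: "htendsto (hsp \<pi>) (\<lambda>x. x) \<phi> F" and \<phi>: "\<phi> \<in> hcarrier (hsp \<pi>)"
  shows "\<phi> \<in> rdom \<pi>"
proof -
  note ips = hilbert_ips[OF star_rep_hilbert[OF \<pi>]] and sub = star_rep_subspace[OF \<pi>]
  obtain \<psi> where \<psi>: "\<psi> \<in> rdom \<pi>" "((\<lambda>x. graph_norm \<pi> 1 (hdiff (hsp \<pi>) x \<psi>)) \<longlongrightarrow> 0) F"
    using c[unfolded closed_rep_def, rule_format, OF F] one by blast
  have dom: "\<forall>\<^sub>F x in F. x \<in> rdom \<pi>" and ne: "F \<noteq> bot" using F by (auto simp: graph_cauchy_def)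
  have carr: "\<forall>\<^sub>F x in F. x \<in> hcarrier (hsp \<pi>)" using dom by eventually_elim (rule subspace_carrier[OF sub])
  have \<psi>K: "\<psi> \<in> hcarrier (hsp \<pi>)" by (rule subspace_carrier[OF sub \<psi>(1)])
  have "htendsto (hsp \<pi>) (\<lambda>x. x) \<psi> F"
  proof -
    have "\<forall>\<^sub>F x in F. norm (hnorm (hsp \<pi>) (hdiff (hsp \<pi>) x \<psi>)) \<le> graph_norm \<pi> 1 (hdiff (hsp \<pi>) x \<psi>)"
      using dom
    proof eventually_elim
      case (elim x)
      have d: "hdiff (hsp \<pi>) x \<psi> \<in> rdom \<pi>" by (rule subspace_diff[OF sub elim \<psi>(1)])
      show ?case
        using hnorm_ge0[OF ips subspace_carrier[OF sub d]] hnorm_ge0[OF ips subspace_carrier[OF sub act_in[OF \<pi> one d]]]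
        by (simp add: graph_norm_def)
    qed
    from Lim_null_comparison[OF this \<psi>(2)] show ?thesis by (simp add: htendsto_def)
  qed
  from htendsto_unique[OF ips ne carr \<phi> \<psi>K t this] \<psi>(1) show ?thesis by simp
qed

context orbit
begin

text \<open>The range of \<open>E {\<xi>}\<close> consists of joint eigenvectors, so closedness puts it into the domain;
  covariance makes it invariant under the stabilizer algebra. It generates: if \<open>\<phi>\<close> is orthogonal to all
  \<open>\<pi>(d)v\<close>, then \<open>\<eta> = E {x} \<phi>\<close> is moved into this range by \<open>(el x)\<^sup>*\<close> and back by \<open>el x\<close>, altogether by the
  factor \<open>x (el x (el x)\<^sup>*) = 1\<close>, so \<open>\<eta>\<close> is orthogonal to itself. The domain is the largest one because the
  partial sums in \<open>adj_dom_approx\<close> are graph Cauchy for the closed restriction of \<open>\<pi>\<close> to degree \<open>0\<close>.\<close>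

theorem well_behaved_full:
  assumes wb: "well_behaved_via A \<pi> E"
    and supp: "\<And>\<Delta> \<phi>. \<Delta> \<in> char_borel A \<Longrightarrow> \<Delta> \<inter> orb = {} \<Longrightarrow> \<phi> \<in> hcarrier (hsp \<pi>) \<Longrightarrow> E \<Delta> \<phi> = hzero (hsp \<pi>)"
  defines "\<rho> \<equiv> \<lparr>hsp = hsp \<pi>\<lparr>hcarrier := {\<phi> \<in> hcarrier (hsp \<pi>). E {\<xi>} \<phi> = \<phi>}\<rparr>,
    rdom = {\<phi> \<in> hcarrier (hsp \<pi>). E {\<xi>} \<phi> = \<phi>}, ract = ract \<pi>\<rparr>"
  shows "full_rep A \<xi> H \<rho> \<pi> (\<lambda>v. v)"
proof -
  let ?K = "hsp \<pi>"
  have rep: "star_rep UNIV \<pi>" and int: "integrable_rep (A 0) \<pi>"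
    and sm: "spectral_measure ?K (pos_characters A) (char_borel A) E"
    and cl: "\<And>b. b \<in> A 0 \<Longrightarrow> op_closure ?K (rdom \<pi>) (ract \<pi> b) =
        spectral_integral ?K (pos_characters A) (char_borel A) E (\<lambda>\<xi>. \<xi> b)"
    and Ed: "\<And>\<Delta> \<phi>. \<Delta> \<in> char_borel A \<Longrightarrow> \<phi> \<in> rdom \<pi> \<Longrightarrow> E \<Delta> \<phi> \<in> rdom \<pi>"
    and Eg: "\<And>g a \<Delta> \<phi>. a \<in> A g \<Longrightarrow> \<Delta> \<in> char_borel A \<Longrightarrow> \<phi> \<in> rdom \<pi> \<Longrightarrow>
        E (char_act_set A g \<Delta>) (ract \<pi> a \<phi>) = ract \<pi> a (E \<Delta> \<phi>)"
    using wb A_one unfolding well_behaved_via_def by blast+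
  have rep0: "star_rep (A 0) \<pi>" and closed: "closed_rep (A 0) \<pi>" using int by (auto simp: integrable_rep_def)
  note ips [simp] = hilbert_ips[OF star_rep_hilbert[OF rep]] and sub = star_rep_subspace[OF rep]
  note dK [simp] = subspace_carrier[OF sub]
  interpret sp: atomic_spectral ?K "pos_characters A" "char_borel A" E orb
  proof (intro atomic_spectral.intro spectral.intro atomic_spectral_axioms.intro countable_index.intro)
    show "{x} \<in> char_borel A" if "x \<in> orb" for x by (rule char_borel_singleton[OF orb_pos[OF that]])
  qed (rule star_rep_hilbert[OF rep] sm char_borel_sigma countable_orb supp; assumption)+
  note pt = sp.point_in
  have eig: "ract \<pi> b \<phi> = hscale ?K (x b) \<phi>" if x: "x \<in> orb" and b: "b \<in> A 0" and \<phi>: "\<phi> \<in> rdom \<pi>" "E {x} \<phi> = \<phi>" for x b \<phi>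
  proof -
    have \<psi>: "ract \<pi> b \<phi> \<in> hcarrier ?K" using act_in[OF rep UNIV_I \<phi>(1)] by simp
    have "(\<phi>, ract \<pi> b \<phi>) \<in> op_closure ?K (rdom \<pi>) (ract \<pi> b)"
      unfolding op_closure_def using \<phi> \<psi> by (auto intro!: exI[of _ "\<lambda>_. \<phi>"])
    hence eq: "E {y} (ract \<pi> b \<phi>) = hscale ?K (y b) (E {y} \<phi>)" if "y \<in> orb" for y
      unfolding cl[OF b] sp.spectral_integral_atomic using that by auto
    show ?thesis
    proof (rule sp.points_ext[OF \<psi>])
      fix y assume y: "y \<in> orb"
      show "E {y} (ract \<pi> b \<phi>) = E {y} (hscale ?K (x b) \<phi>)"
      proof (cases "y = x")
        case False
        hence "E {y} \<phi> = hzero ?K" using sp.E_disjoint[OF pt[OF y] pt[OF x], of \<phi>] \<phi> by simp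
        then show ?thesis using eq[OF y] sp.E_scale[OF pt[OF y], of \<phi> "x b"] \<phi> by simp
      qed (use eq[OF y] sp.E_scale[OF pt[OF y], of \<phi> "x b"] \<phi> in simp)
    qed (use \<phi> in simp)
  qed
  (* On the range of E {x} the graph topology of A 0 is the norm topology, so this range lies in
     the domain. *)
  have rng: "\<phi> \<in> rdom \<pi>" if x: "x \<in> orb" and \<phi>: "\<phi> \<in> hcarrier ?K" "E {x} \<phi> = \<phi>" for x \<phi>
  proof -
    have "\<exists>s\<in>rdom \<pi>. hnorm ?K (hdiff ?K \<phi> s) < inverse (real (Suc n))" for n
      using star_rep_dense[OF rep] \<phi>(1) unfolding hdense_def by simp
    then obtain s where s: "\<And>n. s n \<in> rdom \<pi>" "\<And>n. hnorm ?K (hdiff ?K \<phi> (s n)) < inverse (real (Suc n))"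
      by metis
    have st: "htendsto ?K s \<phi> sequentially"
    proof -
      have "\<forall>\<^sub>F n in sequentially. norm (hnorm ?K (hdiff ?K (s n) \<phi>)) \<le> inverse (real (Suc n))"
        using s hnorm_diff_commute[OF ips \<phi>(1) dK[OF s(1)]] \<phi>
        by (intro always_eventually allI) (simp add: less_imp_le)
      from Lim_null_comparison[OF this LIMSEQ_inverse_real_of_nat] show ?thesis by (simp add: htendsto_def)
    qed
    define t where "t n = E {x} (s n)" for n
    have t: "t n \<in> rdom \<pi>" "E {x} (t n) = t n" for n
      using Ed[OF pt[OF x] s(1)] sp.E_idem[OF pt[OF x]] s(1) by (simp_all add: t_def)
    have tt: "htendsto ?K t \<phi> sequentially"
      using sp.E_limit[OF pt[OF x] _ \<phi>(1) st] s \<phi>(2) by (simp add: t_def[abs_def])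
    define F where "F = filtermap t sequentially"
    have "graph_cauchy (A 0) \<pi> F"
      unfolding graph_cauchy_def
    proof (intro conjI ballI allI impI)
      show "F \<noteq> bot" by (simp add: F_def filtermap_bot_iff)
      show "\<forall>\<^sub>F x in F. x \<in> rdom \<pi>" using t by (simp add: F_def eventually_filtermap)
      fix b and e :: real assume b: "b \<in> A 0" and e: "e > 0"
      define c where "c = 1 + cmod (x b)"
      have c: "c > 0" by (simp add: c_def add_pos_nonneg)
      have gn: "graph_norm \<pi> b (hdiff ?K (t m) (t n)) = c * hnorm ?K (hdiff ?K (t m) (t n))" for m n
      proof -
        have d: "hdiff ?K (t m) (t n) \<in> rdom \<pi>" by (rule subspace_diff[OF sub t(1) t(1)])
        have "E {x} (hdiff ?K (t m) (t n)) = hdiff ?K (t m) (t n)"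
          using sp.E_diff[OF pt[OF x]] t by simp
        from eig[OF x b d this] show ?thesis using d by (simp add: graph_norm_def c_def algebra_simps)
      qed
      have "hCauchy ?K t" by (rule htendsto_hCauchy[OF ips _ \<phi>(1) tt]) (use t in simp)
      moreover have "e / c > 0" using e c by simp
      ultimately obtain N where N: "\<forall>m\<ge>N. \<forall>n\<ge>N. hnorm ?K (hdiff ?K (t m) (t n)) < e / c"
        unfolding hCauchy_def by blast
      show "\<forall>\<^sub>F (x, y) in F \<times>\<^sub>F F. graph_norm \<pi> b (hdiff ?K x y) < e"
        unfolding eventually_prod_same
      proof (intro exI[of _ "\<lambda>z. \<exists>n\<ge>N. z = t n"] conjI allI impI)
        show "\<forall>\<^sub>F z in F. \<exists>n\<ge>N. z = t n"
          unfolding F_def eventually_filtermap using eventually_ge_at_top[of N] by eventually_elim auto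
        fix y z assume "\<exists>n\<ge>N. y = t n" "\<exists>n\<ge>N. z = t n"
        then obtain m n where mn: "m \<ge> N" "n \<ge> N" "y = t m" "z = t n" by blast
        show "case (y, z) of (x, y) \<Rightarrow> graph_norm \<pi> b (hdiff ?K x y) < e"
          using N mn c by (simp add: gn pos_less_divide_eq mult.commute)
      qed
    qed
    moreover have "htendsto ?K (\<lambda>x. x) \<phi> F" using tt by (simp add: htendsto_def F_def filterlim_filtermap)
    ultimately show ?thesis by (rule closed_rep_limit[OF rep0 closed A_one _ _ \<phi>(1)])
  qed
  have move: "E {char_act A g x} (ract \<pi> a \<phi>) = ract \<pi> a \<phi>"
    if "x \<in> orb" "act_defined A g x" "a \<in> A g" "\<phi> \<in> rdom \<pi>" "E {x} \<phi> = \<phi>" for g a x \<phi>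
  proof -
    have "char_act_set A g {x} = {char_act A g x}" using that(2) by (auto simp: char_act_set_def)
    thus ?thesis using Eg[OF that(3) pt[OF that(1)] that(4)] that(5) by simp
  qed
  define V0 where "V0 = {\<phi> \<in> hcarrier ?K. E {\<xi>} \<phi> = \<phi>}"
  have \<rho>: "hsp \<rho> = ?K\<lparr>hcarrier := V0\<rparr>" "rdom \<rho> = V0" "ract \<rho> = ract \<pi>"
    by (simp_all add: \<rho>_def V0_def)
  note p\<xi> = pt[OF \<xi>_orb]
  have V0: "\<phi> \<in> hcarrier ?K" "\<phi> \<in> rdom \<pi>" "E {\<xi>} \<phi> = \<phi>" if "\<phi> \<in> V0" for \<phi>
    using that rng[OF \<xi>_orb] by (auto simp: V0_def)
  have E0: "E {\<xi>} (hzero ?K) = hzero ?K"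
    using sp.E_scale[OF p\<xi> hzero_in[OF ips], of 0] sp.E_in[OF p\<xi> hzero_in[OF ips]] by (simp add: hscale_zero_eq)
  have V0sub: "hsubspace ?K V0"
    unfolding hsubspace_def V0_def using E0 p\<xi> by (auto simp: sp.E_add sp.E_scale)
  have V0act: "ract \<pi> a \<phi> \<in> V0" if "a \<in> subgrading A H" "\<phi> \<in> V0" for a \<phi>
    using that(1) H_nonempty
  proof (induction rule: subgrading_induct)
    case (homogeneous h a)
    have h: "act_defined A h \<xi>" "char_act A h \<xi> = \<xi>" using homogeneous(1) by (auto simp: H char_stab_def)
    show ?case
      using move[OF \<xi>_orb h(1) homogeneous(2) V0(2,3)[OF that(2)]] h(2) act_in[OF rep UNIV_I V0(2)[OF that(2)]]
      by (simp add: V0_def)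
  next
    case (add a b)
    then show ?case using act_add[OF rep UNIV_I UNIV_I V0(2)[OF that(2)], of a b] subspace_add[OF V0sub] by simp
  qed
  have hil: "hilbert_space (?K\<lparr>hcarrier := V0\<rparr>)"
    unfolding hilbert_space_def
  proof (intro conjI allI impI)
    show "inner_product_space (?K\<lparr>hcarrier := V0\<rparr>)" by (rule subspace_inner_product_space[OF ips V0sub])
    fix s assume "range s \<subseteq> hcarrier (?K\<lparr>hcarrier := V0\<rparr>) \<and> hCauchy (?K\<lparr>hcarrier := V0\<rparr>) s"
    hence s: "\<And>n. s n \<in> V0" and c: "hCauchy ?K s" by auto
    obtain l where l: "l \<in> hcarrier ?K" "htendsto ?K s l sequentially"
      using hilbert_complete[OF star_rep_hilbert[OF rep] _ c] V0(1)[OF s] by blast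
    have "htendsto ?K (\<lambda>n. E {\<xi>} (s n)) (E {\<xi>} l) sequentially"
      by (rule sp.E_limit[OF p\<xi> V0(1)[OF s] l])
    hence t': "htendsto ?K s (E {\<xi>} l) sequentially" using V0(3)[OF s] by simp
    have "E {\<xi>} l = l"
      by (rule htendsto_unique[OF ips sequentially_bot _ sp.E_in[OF p\<xi> l(1)] l(1) t' l(2)]) (use V0(1)[OF s] in simp)
    thus "\<exists>l\<in>hcarrier (?K\<lparr>hcarrier := V0\<rparr>). htendsto (?K\<lparr>hcarrier := V0\<rparr>) s l sequentially"
      using l by (auto simp: V0_def)
  qed
  have srep: "star_rep (subgrading A H) \<rho>"
    unfolding star_rep_def \<rho>
  proof (intro conjI ballI allI)
    show "hdense (?K\<lparr>hcarrier := V0\<rparr>) V0"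
      unfolding hdense_def
    proof (intro ballI allI impI)
      fix x and e :: real assume x: "x \<in> hcarrier (?K\<lparr>hcarrier := V0\<rparr>)" and e: "e > 0"
      have "hnorm ?K (hdiff ?K x x) = 0" using V0(1)[of x] x by (simp add: hnorm_def)
      thus "\<exists>y\<in>V0. hnorm (?K\<lparr>hcarrier := V0\<rparr>) (hdiff (?K\<lparr>hcarrier := V0\<rparr>) x y) < e" using x e by (intro bexI[of _ x]) auto
    qed
    show "hsubspace (?K\<lparr>hcarrier := V0\<rparr>) V0" using V0sub by (simp add: hsubspace_def)
    show "ract \<pi> a ` V0 \<subseteq> V0" if "a \<in> subgrading A H" for a using V0act[OF that] by blast
    show "hlinear (?K\<lparr>hcarrier := V0\<rparr>) V0 (?K\<lparr>hcarrier := V0\<rparr>) (ract \<pi> a)" for a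
      using V0(2) by (auto simp: hlinear_def act_hadd[OF rep] act_hscale[OF rep])
  qed (use V0(2) hil in \<open>auto simp: act_add[OF rep] act_scaleC[OF rep] act_mult[OF rep] act_adjoint[OF rep]\<close>)
  interpret g: generated_rep A \<xi> H \<rho> \<pi> "\<lambda>v. v"
  proof (intro generated_rep.intro stabilizer_rep.intro stabilizer_rep_axioms.intro generated_rep_axioms.intro orbit_axioms)
    show "star_rep (subgrading A H) \<rho>" by (rule srep)
    show "multiple_of_char A \<xi> \<rho>"
      unfolding multiple_of_char_def \<rho> using eig[OF \<xi>_orb _ V0(2,3)] by simp
    show "star_rep UNIV \<pi>" by (rule rep)
    show "v \<in> rdom \<pi>" if "v \<in> hcarrier (hsp \<rho>)" for v using that V0(2) by (simp add: \<rho>)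
    fix \<phi> assume \<phi>: "\<phi> \<in> hcarrier ?K"
      and 0: "\<And>d v. v \<in> hcarrier (hsp \<rho>) \<Longrightarrow> hinner ?K \<phi> (ract \<pi> d v) = 0"
    show "\<phi> = hzero ?K"
    proof (rule sp.points_ext[OF \<phi>])
      fix x assume x: "x \<in> orb"
      let ?a = "el x" and ?\<eta> = "E {x} \<phi>"
      have a: "?a \<in> A (deg x)" "star ?a \<in> A (- deg x)" using el_in[OF x] A_star by auto
      have \<eta>K: "?\<eta> \<in> hcarrier ?K" "E {x} ?\<eta> = ?\<eta>" using sp.E_in[OF pt[OF x] \<phi>] sp.E_idem[OF pt[OF x] \<phi>] by auto
      have \<eta>: "?\<eta> \<in> rdom \<pi>" by (rule rng[OF x \<eta>K])
      have inv: "act_defined A (- deg x) x" "char_act A (- deg x) x = \<xi>"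
        using act_inverse_defined[OF \<xi> deg_defined[OF x]] act_inverse[OF \<xi> deg_defined[OF x]] deg_act[OF x] by auto
      have v: "ract \<pi> (star ?a) ?\<eta> \<in> V0"
        using move[OF x inv(1) a(2) \<eta> \<eta>K(2)] inv(2) act_in[OF rep UNIV_I \<eta>] by (simp add: V0_def)
      let ?w = "ract \<pi> ?a (ract \<pi> (star ?a) ?\<eta>)"
      have w: "?w \<in> rdom \<pi>" by (rule act_in[OF rep UNIV_I V0(2)[OF v]])
      have "E {x} ?w = ?w"
        using move[OF \<xi>_orb deg_defined[OF x] a(1) V0(2,3)[OF v]] deg_act[OF x] by simp
      hence "hinner ?K ?\<eta> ?w = hinner ?K \<phi> ?w" using sp.E_sym[OF pt[OF x] \<phi>, of ?w] w by simp
      also have "\<dots> = 0" using 0[of "ract \<pi> (star ?a) ?\<eta>" ?a] v by (simp add: \<rho>)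
      finally have z: "hinner ?K ?\<eta> ?w = 0" .
      have aa: "?a * star ?a \<in> A 0" by (rule A0_mult_star[OF a(1) a(1)])
      have "?w = hscale ?K (x (?a * star ?a)) ?\<eta>"
        using act_mult[OF rep UNIV_I UNIV_I \<eta>, of ?a "star ?a"] eig[OF x aa \<eta> \<eta>K(2)] by simp
      moreover have "x (?a * star ?a) = 1" by (rule el_unit[OF x])
      ultimately have "hinner ?K ?\<eta> ?\<eta> = 0" using z \<eta>K by simp
      hence "?\<eta> = hzero ?K" by (rule hinner_self_eq0[OF ips \<eta>K(1)])
      moreover have "E {x} (hzero ?K) = hzero ?K"
        using sp.E_scale[OF pt[OF x] hzero_in[OF ips], of 0] sp.E_in[OF pt[OF x] hzero_in[OF ips]] by (simp add: hscale_zero_eq)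
      ultimately show "?\<eta> = E {x} (hzero ?K)" by simp
    qed simp
  qed (auto simp: \<rho>)
  show ?thesis
  proof (unfold_locales, rule subsetI)
    fix \<phi> assume \<phi>: "\<phi> \<in> g.adj_dom"
    show "\<phi> \<in> rdom \<pi>"
      by (rule closed_rep_limit[OF rep0 closed A_one g.adj_dom_approx(1)[OF \<phi>] g.adj_dom_approx(2)[OF \<phi>]])
        (use \<phi> in \<open>simp add: g.adj_dom_def\<close>)
  qed
qed

end

section \<open>Completions\<close>

context
  fixes P :: "'p hspace"
  assumes P: "inner_product_space P"
begin

lemma cauchy_seqs_in: "s \<in> cauchy_seqs P \<Longrightarrow> s n \<in> hcarrier P"
  and cauchy_seqs_Cauchy: "s \<in> cauchy_seqs P \<Longrightarrow> hCauchy P s"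
  by (auto simp: cauchy_seqs_def)

lemma cauchy_seqsI: "(\<And>n. s n \<in> hcarrier P) \<Longrightarrow> hCauchy P s \<Longrightarrow> s \<in> cauchy_seqs P"
  by (auto simp: cauchy_seqs_def)

lemma hCauchy_bounded:
  assumes s: "s \<in> cauchy_seqs P" shows "\<exists>M>0. \<forall>n. hnorm P (s n) \<le> M"
proof -
  note in' = cauchy_seqs_in[OF s]
  have "\<exists>N. \<forall>m\<ge>N. \<forall>n\<ge>N. hnorm P (hdiff P (s m) (s n)) < 1"
    using cauchy_seqs_Cauchy[OF s] zero_less_one unfolding hCauchy_def by blast
  then obtain N where N: "\<And>n. n \<ge> N \<Longrightarrow> hnorm P (hdiff P (s n) (s N)) < 1" by blast
  define M where "M = (\<Sum>k\<le>N. hnorm P (s k)) + 1"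
  have le: "hnorm P (s k) \<le> (\<Sum>k\<le>N. hnorm P (s k))" if "k \<le> N" for k
    by (rule member_le_sum) (use that P in' in auto)
  have "hnorm P (s n) \<le> M" for n
  proof (cases "n \<le> N")
    case True
    then show ?thesis using le[OF True] by (simp add: M_def)
  next
    case False
    then show ?thesis
      using hnorm_le_diff[OF P in' in', of n N] N[of n] le[of N] by (simp add: M_def)
  qed
  moreover have "M > 0" unfolding M_def using P in' by (intro add_nonneg_pos sum_nonneg) auto
  ultimately show ?thesis by blast
qed

text \<open>Boundedness of the two sequences makes the form Cauchy along them.\<close>

lemma inner_convergent:
  assumes s: "s \<in> cauchy_seqs P" and t: "t \<in> cauchy_seqs P"
  shows "convergent (\<lambda>n. hinner P (s n) (t n))"
proof -
  note in' = cauchy_seqs_in[OF s] cauchy_seqs_in[OF t]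
  obtain M1 where M1: "M1 > 0" "\<And>n. hnorm P (s n) \<le> M1" using hCauchy_bounded[OF s] by blast
  obtain M2 where M2: "M2 > 0" "\<And>n. hnorm P (t n) \<le> M2" using hCauchy_bounded[OF t] by blast
  have "Cauchy (\<lambda>n. hinner P (s n) (t n))"
    unfolding Cauchy_iff
  proof (intro allI impI)
    fix e :: real assume e: "e > 0"
    have e1: "e / (2 * M2) > 0" and e2: "e / (2 * M1) > 0" using e M1 M2 by auto
    obtain N1 where N1: "\<And>m n. m \<ge> N1 \<Longrightarrow> n \<ge> N1 \<Longrightarrow> hnorm P (hdiff P (s m) (s n)) < e / (2 * M2)"
      using cauchy_seqs_Cauchy[OF s] e1 unfolding hCauchy_def by blast
    obtain N2 where N2: "\<And>m n. m \<ge> N2 \<Longrightarrow> n \<ge> N2 \<Longrightarrow> hnorm P (hdiff P (t m) (t n)) < e / (2 * M1)"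
      using cauchy_seqs_Cauchy[OF t] e2 unfolding hCauchy_def by blast
    show "\<exists>N. \<forall>m\<ge>N. \<forall>n\<ge>N. norm (hinner P (s m) (t m) - hinner P (s n) (t n)) < e"
    proof (intro exI allI impI)
      fix m n assume m: "m \<ge> max N1 N2" and n: "n \<ge> max N1 N2"
      have "hinner P (s m) (t m) - hinner P (s n) (t n) =
          hinner P (hdiff P (s m) (s n)) (t m) + hinner P (s n) (hdiff P (t m) (t n))"
        using P in' by simp
      hence "norm (hinner P (s m) (t m) - hinner P (s n) (t n)) \<le>
          cmod (hinner P (hdiff P (s m) (s n)) (t m)) + cmod (hinner P (s n) (hdiff P (t m) (t n)))"
        by (simp add: norm_triangle_ineq)
      also have "\<dots> \<le> hnorm P (hdiff P (s m) (s n)) * hnorm P (t m) + hnorm P (s n) * hnorm P (hdiff P (t m) (t n))"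
        using P in' by (intro add_mono Cauchy_Schwarz) auto
      also have "\<dots> \<le> hnorm P (hdiff P (s m) (s n)) * M2 + M1 * hnorm P (hdiff P (t m) (t n))"
        using P in' M1 M2 by (intro add_mono mult_left_mono mult_right_mono) auto
      also have "\<dots> < e / (2 * M2) * M2 + M1 * (e / (2 * M1))"
        using N1[of m n] N2[of m n] m n M1 M2 by (intro add_strict_mono mult_strict_right_mono mult_strict_left_mono) auto
      also have "\<dots> = e" using M1 M2 by (simp add: field_simps)
      finally show "norm (hinner P (s m) (t m) - hinner P (s n) (t n)) < e" .
    qed
  qed
  thus ?thesis by (simp add: Cauchy_convergent_iff)
qed

definition lim_inner :: "(nat \<Rightarrow> 'p) \<Rightarrow> (nat \<Rightarrow> 'p) \<Rightarrow> complex" where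
  "lim_inner s t = lim (\<lambda>n. hinner P (s n) (t n))"

lemma lim_inner: "s \<in> cauchy_seqs P \<Longrightarrow> t \<in> cauchy_seqs P \<Longrightarrow> (\<lambda>n. hinner P (s n) (t n)) \<longlonglongrightarrow> lim_inner s t"
  unfolding lim_inner_def using inner_convergent by (simp add: convergent_LIMSEQ_iff)

lemma lim_innerI: "s \<in> cauchy_seqs P \<Longrightarrow> t \<in> cauchy_seqs P \<Longrightarrow> (\<lambda>n. hinner P (s n) (t n)) \<longlonglongrightarrow> c \<Longrightarrow> lim_inner s t = c"
  by (rule LIMSEQ_unique[OF lim_inner])

definition close :: "(nat \<Rightarrow> 'p) \<Rightarrow> (nat \<Rightarrow> 'p) \<Rightarrow> bool" where
  "close s t \<longleftrightarrow> (\<lambda>n. hnorm P (hdiff P (s n) (t n))) \<longlonglongrightarrow> 0"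

lemma cauchy_seqs_add:
  assumes s: "s \<in> cauchy_seqs P" and t: "t \<in> cauchy_seqs P"
  shows "(\<lambda>n. hadd P (s n) (t n)) \<in> cauchy_seqs P"
proof (rule cauchy_seqsI)
  note in' = cauchy_seqs_in[OF s] cauchy_seqs_in[OF t]
  show "hadd P (s n) (t n) \<in> hcarrier P" for n using P in' by simp
  show "hCauchy P (\<lambda>n. hadd P (s n) (t n))"
    unfolding hCauchy_def
  proof (intro allI impI)
    fix e :: real assume e: "e > 0"
    hence e2: "e / 2 > 0" by simp
    obtain N1 where N1: "\<And>m n. m \<ge> N1 \<Longrightarrow> n \<ge> N1 \<Longrightarrow> hnorm P (hdiff P (s m) (s n)) < e / 2"
      using cauchy_seqs_Cauchy[OF s] e2 unfolding hCauchy_def by blast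
    obtain N2 where N2: "\<And>m n. m \<ge> N2 \<Longrightarrow> n \<ge> N2 \<Longrightarrow> hnorm P (hdiff P (t m) (t n)) < e / 2"
      using cauchy_seqs_Cauchy[OF t] e2 unfolding hCauchy_def by blast
    show "\<exists>N. \<forall>m\<ge>N. \<forall>n\<ge>N. hnorm P (hdiff P (hadd P (s m) (t m)) (hadd P (s n) (t n))) < e"
    proof (intro exI allI impI)
      fix m n assume mn: "m \<ge> max N1 N2" "n \<ge> max N1 N2"
      have "hdiff P (hadd P (s m) (t m)) (hadd P (s n) (t n)) = hadd P (hdiff P (s m) (s n)) (hdiff P (t m) (t n))"
        by (rule vector_eqI[OF P]) (use P in' in \<open>auto simp: algebra_simps\<close>)
      thus "hnorm P (hdiff P (hadd P (s m) (t m)) (hadd P (s n) (t n))) < e"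
        using hnorm_triangle[OF P, of "hdiff P (s m) (s n)" "hdiff P (t m) (t n)"] P in' N1[of m n] N2[of m n] mn by simp
    qed
  qed
qed

lemma cauchy_seqs_scale:
  assumes s: "s \<in> cauchy_seqs P" shows "(\<lambda>n. hscale P c (s n)) \<in> cauchy_seqs P"
proof (rule cauchy_seqsI)
  note in' = cauchy_seqs_in[OF s]
  show "hscale P c (s n) \<in> hcarrier P" for n using P in' by simp
  show "hCauchy P (\<lambda>n. hscale P c (s n))"
    unfolding hCauchy_def
  proof (intro allI impI)
    fix e :: real assume e: "e > 0"
    have c1: "cmod c + 1 > 0" by (simp add: add_nonneg_pos)
    have "e / (cmod c + 1) > 0" using e c1 by simp
    then obtain N where N: "\<And>m n. m \<ge> N \<Longrightarrow> n \<ge> N \<Longrightarrow> hnorm P (hdiff P (s m) (s n)) < e / (cmod c + 1)"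
      using cauchy_seqs_Cauchy[OF s] unfolding hCauchy_def by blast
    show "\<exists>N. \<forall>m\<ge>N. \<forall>n\<ge>N. hnorm P (hdiff P (hscale P c (s m)) (hscale P c (s n))) < e"
    proof (intro exI allI impI)
      fix m n assume mn: "m \<ge> N" "n \<ge> N"
      have "hdiff P (hscale P c (s m)) (hscale P c (s n)) = hscale P c (hdiff P (s m) (s n))"
        by (rule vector_eqI[OF P]) (use P in' in \<open>auto simp: algebra_simps\<close>)
      hence "hnorm P (hdiff P (hscale P c (s m)) (hscale P c (s n))) = cmod c * hnorm P (hdiff P (s m) (s n))"
        using P in' by simp
      also have "\<dots> \<le> (cmod c + 1) * hnorm P (hdiff P (s m) (s n))"
        using P in' by (intro mult_right_mono) auto
      also have "\<dots> < e" using N[OF mn] c1 by (simp add: pos_less_divide_eq mult.commute)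
      finally show "hnorm P (hdiff P (hscale P c (s m)) (hscale P c (s n))) < e" .
    qed
  qed
qed

lemma cauchy_seqs_const: "x \<in> hcarrier P \<Longrightarrow> (\<lambda>_. x) \<in> cauchy_seqs P"
  by (rule cauchy_seqsI) (auto simp: hCauchy_def hnorm_def P)

lemma cauchy_seqs_diff:
  "s \<in> cauchy_seqs P \<Longrightarrow> t \<in> cauchy_seqs P \<Longrightarrow> (\<lambda>n. hdiff P (s n) (t n)) \<in> cauchy_seqs P"
  unfolding hdiff_def by (rule cauchy_seqs_add[OF _ cauchy_seqs_scale])

lemma close_refl: "s \<in> cauchy_seqs P \<Longrightarrow> close s s"
proof -
  assume s: "s \<in> cauchy_seqs P"
  have "hnorm P (hdiff P (s n) (s n)) = 0" for n
    using cauchy_seqs_in[OF s, of n] P by (simp add: hnorm_def)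
  thus ?thesis by (simp add: close_def)
qed

lemma close_sym: "s \<in> cauchy_seqs P \<Longrightarrow> t \<in> cauchy_seqs P \<Longrightarrow> close s t \<Longrightarrow> close t s"
  using hnorm_diff_commute[OF P cauchy_seqs_in cauchy_seqs_in, of s t] by (simp add: close_def)

lemma close_trans:
  assumes "s \<in> cauchy_seqs P" "t \<in> cauchy_seqs P" "u \<in> cauchy_seqs P" "close s t" "close t u"
  shows "close s u"
  unfolding close_def
proof (rule Lim_null_comparison)
  note in' = cauchy_seqs_in[OF assms(1)] cauchy_seqs_in[OF assms(2)] cauchy_seqs_in[OF assms(3)]
  show "\<forall>\<^sub>F n in sequentially. norm (hnorm P (hdiff P (s n) (u n))) \<le> hnorm P (hdiff P (s n) (t n)) + hnorm P (hdiff P (t n) (u n))"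
    using hnorm_diff_triangle[OF P in'] P in' by (intro always_eventually allI) simp
  show "(\<lambda>n. hnorm P (hdiff P (s n) (t n)) + hnorm P (hdiff P (t n) (u n))) \<longlonglongrightarrow> 0"
    using tendsto_add[OF assms(4,5)[unfolded close_def]] by simp
qed

lemma lim_inner_close:
  assumes s: "s \<in> cauchy_seqs P" "s' \<in> cauchy_seqs P" "close s s'" and t: "t \<in> cauchy_seqs P"
  shows "lim_inner s t = lim_inner s' t"
proof -
  note in' = cauchy_seqs_in[OF s(1)] cauchy_seqs_in[OF s(2)] cauchy_seqs_in[OF t]
  obtain M where M: "M > 0" "\<And>n. hnorm P (t n) \<le> M" using hCauchy_bounded[OF t] by blast
  have "(\<lambda>n. hinner P (s n) (t n) - hinner P (s' n) (t n)) \<longlonglongrightarrow> 0"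
  proof (rule Lim_null_comparison)
    show "\<forall>\<^sub>F n in sequentially. norm (hinner P (s n) (t n) - hinner P (s' n) (t n)) \<le> hnorm P (hdiff P (s n) (s' n)) * M"
    proof (intro always_eventually allI)
      fix n
      have "norm (hinner P (s n) (t n) - hinner P (s' n) (t n)) = cmod (hinner P (hdiff P (s n) (s' n)) (t n))"
        using P in' by simp
      also have "\<dots> \<le> hnorm P (hdiff P (s n) (s' n)) * hnorm P (t n)" using P in' by (intro Cauchy_Schwarz) auto
      also have "\<dots> \<le> hnorm P (hdiff P (s n) (s' n)) * M" using P in' M by (intro mult_left_mono) auto
      finally show "norm (hinner P (s n) (t n) - hinner P (s' n) (t n)) \<le> hnorm P (hdiff P (s n) (s' n)) * M" .
    qed
    show "(\<lambda>n. hnorm P (hdiff P (s n) (s' n)) * M) \<longlonglongrightarrow> 0"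
      using tendsto_mult_left_zero[OF s(3)[unfolded close_def]] by simp
  qed
  from tendsto_add[OF this lim_inner[OF s(2) t]]
  have "(\<lambda>n. hinner P (s n) (t n)) \<longlonglongrightarrow> lim_inner s' t" by simp
  thus ?thesis by (rule lim_innerI[OF s(1) t])
qed

lemma lim_inner_sym: "s \<in> cauchy_seqs P \<Longrightarrow> t \<in> cauchy_seqs P \<Longrightarrow> lim_inner t s = cnj (lim_inner s t)"
proof (rule lim_innerI)
  assume s: "s \<in> cauchy_seqs P" and t: "t \<in> cauchy_seqs P"
  have "(\<lambda>n. cnj (hinner P (s n) (t n))) \<longlonglongrightarrow> cnj (lim_inner s t)"
    by (intro tendsto_intros lim_inner s t)
  thus "(\<lambda>n. hinner P (t n) (s n)) \<longlonglongrightarrow> cnj (lim_inner s t)"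
    using hinner_sym[OF P cauchy_seqs_in[OF s] cauchy_seqs_in[OF t]] by simp
qed

lemma lim_inner_self_null:
  assumes s: "s \<in> cauchy_seqs P" and t: "t \<in> cauchy_seqs P"
  shows "close s t \<longleftrightarrow> lim_inner (\<lambda>n. hdiff P (s n) (t n)) (\<lambda>n. hdiff P (s n) (t n)) = 0"
proof -
  let ?d = "\<lambda>n. hdiff P (s n) (t n)"
  note d = cauchy_seqs_diff[OF s t]
  note l = lim_inner[OF d d]
  have eq: "hinner P (?d n) (?d n) = of_real ((hnorm P (?d n))\<^sup>2)" for n by (rule hinner_self[OF P cauchy_seqs_in[OF d]])
  show ?thesis
  proof
    assume "close s t"
    hence "(\<lambda>n. complex_of_real ((hnorm P (?d n))\<^sup>2)) \<longlonglongrightarrow> of_real (0\<^sup>2)"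
      unfolding close_def by (intro tendsto_intros)
    hence "(\<lambda>n. hinner P (?d n) (?d n)) \<longlonglongrightarrow> 0" unfolding eq by simp
    thus "lim_inner ?d ?d = 0" by (rule lim_innerI[OF d d])
  next
    assume "lim_inner ?d ?d = 0"
    with l have "(\<lambda>n. complex_of_real ((hnorm P (?d n))\<^sup>2)) \<longlonglongrightarrow> 0" unfolding eq by simp
    hence "(\<lambda>n. Re (complex_of_real ((hnorm P (?d n))\<^sup>2))) \<longlonglongrightarrow> Re 0" by (rule tendsto_Re)
    hence "(\<lambda>n. sqrt ((hnorm P (?d n))\<^sup>2)) \<longlonglongrightarrow> sqrt 0" by (intro tendsto_real_sqrt) simp
    thus "close s t" unfolding close_def using P cauchy_seqs_in[OF d] by simp
  qed
qed

abbreviation cls where "cls \<equiv> cauchy_class P"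

lemma cls_iff: "t \<in> cls s \<longleftrightarrow> t \<in> cauchy_seqs P \<and> close s t"
  by (simp add: cauchy_class_def close_def)

lemma cls_eq:
  assumes "s \<in> cauchy_seqs P" "t \<in> cauchy_seqs P"
  shows "cls s = cls t \<longleftrightarrow> close s t"
proof
  assume "cls s = cls t"
  moreover have "t \<in> cls t" using assms close_refl by (simp add: cls_iff)
  ultimately have "t \<in> cls s" by simp
  thus "close s t" by (simp add: cls_iff)
next
  assume c: "close s t"
  show "cls s = cls t"
  proof (intro set_eqI iffI)
    fix u assume "u \<in> cls s"
    then show "u \<in> cls t" using close_trans[OF assms(2,1) _ close_sym[OF assms c]] by (simp add: cls_iff)
  next
    fix u assume "u \<in> cls t"
    then show "u \<in> cls s" using close_trans[OF assms(1,2) _ c] by (simp add: cls_iff)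
  qed
qed

lemma rep_cls:
  assumes "s \<in> cauchy_seqs P"
  shows "rep_of (cls s) \<in> cauchy_seqs P" "close s (rep_of (cls s))" "close (rep_of (cls s)) s"
proof -
  have "rep_of (cls s) \<in> cls s"
    unfolding rep_of_def using close_refl[OF assms] assms by (intro someI[of "\<lambda>x. x \<in> cls s" s]) (simp add: cls_iff)
  thus 1: "rep_of (cls s) \<in> cauchy_seqs P" and 2: "close s (rep_of (cls s))" by (auto simp: cls_iff)
  show "close (rep_of (cls s)) s" by (rule close_sym[OF assms 1 2])
qed

abbreviation Q where "Q \<equiv> hcompletion P"

lemma Q_carrier: "hcarrier Q = cls ` cauchy_seqs P" and Q_zero: "hzero Q = cls (\<lambda>_. hzero P)"
  by (simp_all add: hcompletion_def)

lemma Q_inner: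
  assumes "s \<in> cauchy_seqs P" "t \<in> cauchy_seqs P"
  shows "hinner Q (cls s) (cls t) = lim_inner s t"
proof -
  note s = rep_cls[OF assms(1)] and t = rep_cls[OF assms(2)]
  have "hinner Q (cls s) (cls t) = lim_inner (rep_of (cls s)) (rep_of (cls t))"
    by (simp add: hcompletion_def lim_inner_def)
  also have "\<dots> = lim_inner s (rep_of (cls t))" by (rule lim_inner_close[OF s(1) assms(1) s(3) t(1)])
  also have "\<dots> = cnj (lim_inner (rep_of (cls t)) s)" by (rule lim_inner_sym[OF t(1) assms(1)])
  also have "\<dots> = cnj (lim_inner t s)" using lim_inner_close[OF t(1) assms(2) t(3) assms(1)] by simp
  also have "\<dots> = lim_inner s t" using lim_inner_sym[OF assms] by simp
  finally show ?thesis .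
qed

lemma Q_add:
  assumes s: "s \<in> cauchy_seqs P" and t: "t \<in> cauchy_seqs P"
  shows "hadd Q (cls s) (cls t) = cls (\<lambda>n. hadd P (s n) (t n))"
proof -
  note s' = rep_cls[OF s] and t' = rep_cls[OF t]
  note in' = cauchy_seqs_in[OF s] cauchy_seqs_in[OF t] cauchy_seqs_in[OF s'(1)] cauchy_seqs_in[OF t'(1)]
  have "close (\<lambda>n. hadd P (rep_of (cls s) n) (rep_of (cls t) n)) (\<lambda>n. hadd P (s n) (t n))"
    unfolding close_def
  proof (rule Lim_null_comparison)
    have "hdiff P (hadd P (rep_of (cls s) n) (rep_of (cls t) n)) (hadd P (s n) (t n)) =
        hadd P (hdiff P (rep_of (cls s) n) (s n)) (hdiff P (rep_of (cls t) n) (t n))" for n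
      by (rule vector_eqI[OF P]) (use P in' in \<open>auto simp: algebra_simps\<close>)
    thus "\<forall>\<^sub>F n in sequentially. norm (hnorm P (hdiff P (hadd P (rep_of (cls s) n) (rep_of (cls t) n)) (hadd P (s n) (t n))))
      \<le> hnorm P (hdiff P (rep_of (cls s) n) (s n)) + hnorm P (hdiff P (rep_of (cls t) n) (t n))"
      using hnorm_triangle[OF P] P in' by (intro always_eventually allI) simp
    show "(\<lambda>n. hnorm P (hdiff P (rep_of (cls s) n) (s n)) + hnorm P (hdiff P (rep_of (cls t) n) (t n))) \<longlonglongrightarrow> 0"
      using tendsto_add[OF s'(3)[unfolded close_def] t'(3)[unfolded close_def]] by simp
  qed
  thus ?thesis
    using cls_eq[OF cauchy_seqs_add[OF s'(1) t'(1)] cauchy_seqs_add[OF s t]] by (simp add: hcompletion_def)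
qed

lemma Q_scale:
  assumes s: "s \<in> cauchy_seqs P"
  shows "hscale Q c (cls s) = cls (\<lambda>n. hscale P c (s n))"
proof -
  note s' = rep_cls[OF s]
  note in' = cauchy_seqs_in[OF s] cauchy_seqs_in[OF s'(1)]
  have "hdiff P (hscale P c (rep_of (cls s) n)) (hscale P c (s n)) = hscale P c (hdiff P (rep_of (cls s) n) (s n))" for n
    by (rule vector_eqI[OF P]) (use P in' in \<open>auto simp: algebra_simps\<close>)
  hence "hnorm P (hdiff P (hscale P c (rep_of (cls s) n)) (hscale P c (s n))) = cmod c * hnorm P (hdiff P (rep_of (cls s) n) (s n))" for n
    using P in' by simp
  hence "close (\<lambda>n. hscale P c (rep_of (cls s) n)) (\<lambda>n. hscale P c (s n))"
    unfolding close_def using tendsto_mult_right_zero[OF s'(3)[unfolded close_def]] by simp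
  thus ?thesis
    using cls_eq[OF cauchy_seqs_scale[OF s'(1)] cauchy_seqs_scale[OF s]] by (simp add: hcompletion_def)
qed

lemma Q_eqI:
  assumes "s \<in> cauchy_seqs P" "t \<in> cauchy_seqs P" "\<And>n. s n = t n"
  shows "cls s = cls t"
proof -
  have "s = t" using assms(3) by blast
  thus ?thesis by simp
qed

lemma Q_inner_product_space: "inner_product_space Q"
  unfolding inner_product_space_def Q_carrier
proof (intro conjI ballI allI impI; (elim imageE)?; hypsubst?)
  show "hzero Q \<in> cls ` cauchy_seqs P" using cauchy_seqs_const[OF hzero_in[OF P]] by (simp add: Q_zero)
next
  fix s t assume s: "s \<in> cauchy_seqs P" and t: "t \<in> cauchy_seqs P"
  show "hadd Q (cls s) (cls t) \<in> cls ` cauchy_seqs P" using cauchy_seqs_add[OF s t] by (simp add: Q_add s t)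
  show "hadd Q (cls s) (cls t) = hadd Q (cls t) (cls s)"
    using hadd_commute[OF P cauchy_seqs_in[OF s] cauchy_seqs_in[OF t]] by (simp add: Q_add s t)
  show "hinner Q (cls t) (cls s) = cnj (hinner Q (cls s) (cls t))" using lim_inner_sym[OF s t] by (simp add: Q_inner s t)
  fix c
  show "hscale Q c (cls s) \<in> cls ` cauchy_seqs P" using cauchy_seqs_scale[OF s] by (simp add: Q_scale s)
  show "hscale Q c (hadd Q (cls s) (cls t)) = hadd Q (hscale Q c (cls s)) (hscale Q c (cls t))"
    unfolding Q_add[OF s t] Q_scale[OF s] Q_scale[OF t] Q_scale[OF cauchy_seqs_add[OF s t]] Q_add[OF cauchy_seqs_scale[OF s] cauchy_seqs_scale[OF t]]
    by (rule Q_eqI) (use s t P cauchy_seqs_in[OF s] cauchy_seqs_in[OF t] in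
        \<open>auto intro!: cauchy_seqs_add cauchy_seqs_scale vector_eqI[OF P] simp: algebra_simps\<close>)
  show "hinner Q (hscale Q c (cls s)) (cls t) = c * hinner Q (cls s) (cls t)"
    unfolding Q_scale[OF s] Q_inner[OF s t] Q_inner[OF cauchy_seqs_scale[OF s] t]
    by (rule lim_innerI[OF cauchy_seqs_scale[OF s] t])
      (use tendsto_mult_left[OF lim_inner[OF s t], of c] P cauchy_seqs_in[OF s] cauchy_seqs_in[OF t] in simp)
  fix u assume u: "u \<in> cauchy_seqs P"
  show "hadd Q (hadd Q (cls s) (cls t)) (cls u) = hadd Q (cls s) (hadd Q (cls t) (cls u))"
    using hadd_assoc[OF P cauchy_seqs_in[OF s] cauchy_seqs_in[OF t] cauchy_seqs_in[OF u]]
    by (simp add: Q_add s t u cauchy_seqs_add)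
  show "hinner Q (hadd Q (cls s) (cls t)) (cls u) = hinner Q (cls s) (cls u) + hinner Q (cls t) (cls u)"
    unfolding Q_add[OF s t] Q_inner[OF s u] Q_inner[OF t u] Q_inner[OF cauchy_seqs_add[OF s t] u]
    by (rule lim_innerI[OF cauchy_seqs_add[OF s t] u])
      (use tendsto_add[OF lim_inner[OF s u] lim_inner[OF t u]] P cauchy_seqs_in[OF s] cauchy_seqs_in[OF t] cauchy_seqs_in[OF u] in simp)
next
  fix s assume s: "s \<in> cauchy_seqs P"
  note in' = cauchy_seqs_in[OF s]
  note z = cauchy_seqs_const[OF hzero_in[OF P]]
  show "hadd Q (hzero Q) (cls s) = cls s" unfolding Q_zero Q_add[OF z s] using P in' by simp
  show "hadd Q (cls s) (hscale Q (- 1) (cls s)) = hzero Q"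
    unfolding Q_zero Q_scale[OF s] Q_add[OF s cauchy_seqs_scale[OF s]] using hadd_neg[OF P in'] by simp
  show "hscale Q 1 (cls s) = cls s" unfolding Q_scale[OF s] using hscale_one[OF P in'] by simp
  show "hscale Q (c + d) (cls s) = hadd Q (hscale Q c (cls s)) (hscale Q d (cls s))" for c d
    unfolding Q_scale[OF s] Q_add[OF cauchy_seqs_scale[OF s] cauchy_seqs_scale[OF s]]
    by (rule Q_eqI) (use s P in' in \<open>auto intro!: cauchy_seqs_add cauchy_seqs_scale vector_eqI[OF P] simp: algebra_simps\<close>)
  show "hscale Q c (hscale Q d (cls s)) = hscale Q (c * d) (cls s)" for c d
    unfolding Q_scale[OF s] Q_scale[OF cauchy_seqs_scale[OF s]]
    by (rule Q_eqI) (use s P in' in \<open>auto intro!: cauchy_seqs_scale vector_eqI[OF P] simp: algebra_simps\<close>)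
  have l: "(\<lambda>n. hinner P (s n) (s n)) \<longlonglongrightarrow> lim_inner s s" by (rule lim_inner[OF s s])
  have nn: "hinner P (s n) (s n) = of_real ((hnorm P (s n))\<^sup>2)" for n by (rule hinner_self[OF P in'])
  have "0 \<le> Re (lim_inner s s)"
    by (rule LIMSEQ_le_const[OF tendsto_Re[OF l]]) (simp add: nn)
  moreover have "Im (lim_inner s s) = 0"
  proof -
    have "(\<lambda>n. Im (hinner P (s n) (s n))) \<longlonglongrightarrow> Im (lim_inner s s)" by (rule tendsto_Im[OF l])
    thus ?thesis unfolding nn by (simp add: LIMSEQ_const_iff)
  qed
  ultimately show "hinner Q (cls s) (cls s) \<in> \<real>\<^sub>\<ge>\<^sub>0" by (simp add: Q_inner s complex_nonneg_Reals_iff)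
  assume "hinner Q (cls s) (cls s) = 0"
  hence "lim_inner s s = 0" by (simp add: Q_inner s)
  moreover have "(\<lambda>n. hdiff P (s n) (hzero P)) = s"
    by (rule ext, rule vector_eqI[OF P]) (use P in' in auto)
  ultimately have "close s (\<lambda>_. hzero P)" using lim_inner_self_null[OF s z] by simp
  thus "cls s = hzero Q" unfolding Q_zero using cls_eq[OF s z] by simp
qed

lemma hembed_in: "x \<in> hcarrier P \<Longrightarrow> hembed P x \<in> hcarrier Q"
  by (simp add: hembed_def Q_carrier cauchy_seqs_const)

lemma hembed_inner: "x \<in> hcarrier P \<Longrightarrow> y \<in> hcarrier P \<Longrightarrow> hinner Q (hembed P x) (hembed P y) = hinner P x y"
  unfolding hembed_def
  by (simp add: Q_inner cauchy_seqs_const) (rule lim_innerI, auto simp: cauchy_seqs_const)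

lemma hembed_linear: "hlinear P (hcarrier P) Q (hembed P)"
  by (rule isometry_linear[OF P Q_inner_product_space hembed_in hembed_inner])

text \<open>A Cauchy sequence approximates its own class.\<close>

lemma cls_approx:
  assumes s: "s \<in> cauchy_seqs P"
  shows "htendsto Q (\<lambda>n. hembed P (s n)) (cls s) sequentially"
  unfolding htendsto_def
proof (rule LIMSEQ_I)
  note in' = cauchy_seqs_in[OF s]
  fix e :: real assume e: "e > 0"
  hence e2: "e / 2 > 0" by simp
  obtain N where N: "\<And>m n. m \<ge> N \<Longrightarrow> n \<ge> N \<Longrightarrow> hnorm P (hdiff P (s m) (s n)) < e / 2"
    using cauchy_seqs_Cauchy[OF s] e2 unfolding hCauchy_def by blast
  have "norm (hnorm Q (hdiff Q (hembed P (s n)) (cls s)) - 0) < e" if n: "n \<ge> N" for n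
  proof -
    have c: "(\<lambda>_. s n) \<in> cauchy_seqs P" by (rule cauchy_seqs_const[OF in'])
    note d = cauchy_seqs_diff[OF c s]
    have eq: "hdiff Q (hembed P (s n)) (cls s) = cls (\<lambda>m. hdiff P (s n) (s m))"
      unfolding hdiff_def hembed_def by (simp add: Q_scale Q_add c s cauchy_seqs_scale)
    have l: "(\<lambda>m. Re (hinner P (hdiff P (s n) (s m)) (hdiff P (s n) (s m)))) \<longlonglongrightarrow>
        (hnorm Q (hdiff Q (hembed P (s n)) (cls s)))\<^sup>2"
      using tendsto_Re[OF lim_inner[OF d d]] hnorm_sq[OF Q_inner_product_space, of "cls (\<lambda>m. hdiff P (s n) (s m))"] d
      unfolding eq by (simp add: Q_inner Q_carrier)
    have "(hnorm Q (hdiff Q (hembed P (s n)) (cls s)))\<^sup>2 \<le> (e / 2)\<^sup>2"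
    proof (rule LIMSEQ_le_const2[OF l], intro exI allI impI)
      fix m assume m: "m \<ge> N"
      have "Re (hinner P (hdiff P (s n) (s m)) (hdiff P (s n) (s m))) = (hnorm P (hdiff P (s n) (s m)))\<^sup>2"
        using P in' by (intro hnorm_sq[symmetric]) auto
      also have "\<dots> \<le> (e / 2)\<^sup>2" using N[OF n m] P in' by (intro power_mono) auto
      finally show "Re (hinner P (hdiff P (s n) (s m)) (hdiff P (s n) (s m))) \<le> (e / 2)\<^sup>2" .
    qed
    hence "hnorm Q (hdiff Q (hembed P (s n)) (cls s)) \<le> e / 2"
      by (rule power2_le_imp_le) (use e in simp)
    moreover have "0 \<le> hnorm Q (hdiff Q (hembed P (s n)) (cls s))"
      using s by (intro hnorm_ge0[OF Q_inner_product_space] hdiff_in[OF Q_inner_product_space] hembed_in in') (simp add: Q_carrier)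
    ultimately show ?thesis using e by simp
  qed
  thus "\<exists>no. \<forall>n\<ge>no. norm (hnorm Q (hdiff Q (hembed P (s n)) (cls s)) - 0) < e" by blast
qed

lemma hembed_dense: "hdense Q (hembed P ` hcarrier P)"
  unfolding hdense_def
proof (intro ballI allI impI)
  fix x :: "(nat \<Rightarrow> 'p) set" and e :: real assume x: "x \<in> hcarrier Q" and e: "e > 0"
  obtain s where s: "s \<in> cauchy_seqs P" "x = cls s" using x by (auto simp: Q_carrier)
  have "\<forall>\<^sub>F n in sequentially. hnorm Q (hdiff Q (hembed P (s n)) x) < e"
    using order_tendstoD(2)[OF cls_approx[OF s(1), unfolded htendsto_def] e] by (simp add: s(2))
  then obtain n where n: "hnorm Q (hdiff Q (hembed P (s n)) x) < e"
    using eventually_happens'[OF sequentially_bot] by blast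
  have "hnorm Q (hdiff Q x (hembed P (s n))) < e"
    using n hnorm_diff_commute[OF Q_inner_product_space x hembed_in[OF cauchy_seqs_in[OF s(1)]]] by simp
  thus "\<exists>y\<in>hembed P ` hcarrier P. hnorm Q (hdiff Q x y) < e" using cauchy_seqs_in[OF s(1)] by blast
qed

theorem completion_hilbert: "hilbert_space Q"
  unfolding hilbert_space_def
proof (intro conjI allI impI)
  note ips = Q_inner_product_space
  show "inner_product_space Q" by (rule ips)
  fix S assume "range S \<subseteq> hcarrier Q \<and> hCauchy Q S"
  hence S: "\<And>n. S n \<in> hcarrier Q" and C: "hCauchy Q S" by auto
  have "\<exists>y\<in>hcarrier P. hnorm Q (hdiff Q (S n) (hembed P y)) < inverse (real (Suc n))" for n
    using hembed_dense S[of n] unfolding hdense_def by fastforce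
  then obtain y where y: "\<And>n. y n \<in> hcarrier P" and yS: "\<And>n. hnorm Q (hdiff Q (S n) (hembed P (y n))) < inverse (real (Suc n))"
    by metis
  have ey: "hembed P (y n) \<in> hcarrier Q" for n by (rule hembed_in[OF y])
  have small: "\<exists>N. \<forall>n\<ge>N. inverse (real (Suc n)) < e" if "e > 0" for e :: real
    using order_tendstoD(2)[OF LIMSEQ_inverse_real_of_nat that] by (simp add: eventually_sequentially)
  have "hCauchy P y"
    unfolding hCauchy_def
  proof (intro allI impI)
    fix e :: real assume e: "e > 0"
    hence e3: "e / 3 > 0" by simp
    obtain N1 where N1: "\<And>n. n \<ge> N1 \<Longrightarrow> inverse (real (Suc n)) < e / 3" using small[OF e3] by blast
    obtain N2 where N2: "\<And>m n. m \<ge> N2 \<Longrightarrow> n \<ge> N2 \<Longrightarrow> hnorm Q (hdiff Q (S m) (S n)) < e / 3"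
      using C e3 unfolding hCauchy_def by blast
    show "\<exists>N. \<forall>m\<ge>N. \<forall>n\<ge>N. hnorm P (hdiff P (y m) (y n)) < e"
    proof (intro exI allI impI)
      fix m n assume mn: "m \<ge> max N1 N2" "n \<ge> max N1 N2"
      have "hnorm P (hdiff P (y m) (y n)) = hnorm Q (hdiff Q (hembed P (y m)) (hembed P (y n)))"
        using P y ips ey by (simp add: hnorm_def hembed_inner)
      also have "\<dots> \<le> hnorm Q (hdiff Q (hembed P (y m)) (S m)) + hnorm Q (hdiff Q (S m) (hembed P (y n)))"
        by (rule hnorm_diff_triangle[OF ips ey S ey])
      also have "hnorm Q (hdiff Q (S m) (hembed P (y n))) \<le> hnorm Q (hdiff Q (S m) (S n)) + hnorm Q (hdiff Q (S n) (hembed P (y n)))"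
        by (rule hnorm_diff_triangle[OF ips S S ey])
      finally show "hnorm P (hdiff P (y m) (y n)) < e"
        using N1[of m] N1[of n] N2[of m n] yS[of m] yS[of n] mn hnorm_diff_commute[OF ips ey S, of m m] by simp
    qed
  qed
  hence yc: "y \<in> cauchy_seqs P" using y by (intro cauchy_seqsI)
  have cy: "cls y \<in> hcarrier Q" using yc by (simp add: Q_carrier)
  have "(\<lambda>n. hnorm Q (hdiff Q (S n) (cls y))) \<longlonglongrightarrow> 0"
  proof (rule Lim_null_comparison)
    show "\<forall>\<^sub>F n in sequentially. norm (hnorm Q (hdiff Q (S n) (cls y))) \<le> inverse (real (Suc n)) + hnorm Q (hdiff Q (hembed P (y n)) (cls y))"
    proof (intro always_eventually allI)
      fix n
      show "norm (hnorm Q (hdiff Q (S n) (cls y))) \<le> inverse (real (Suc n)) + hnorm Q (hdiff Q (hembed P (y n)) (cls y))"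
        using hnorm_diff_triangle[OF ips S ey cy, of n n] yS[of n] hnorm_ge0[OF ips hdiff_in[OF ips S cy], of n] by simp
    qed
    show "(\<lambda>n. inverse (real (Suc n)) + hnorm Q (hdiff Q (hembed P (y n)) (cls y))) \<longlonglongrightarrow> 0"
      using tendsto_add[OF LIMSEQ_inverse_real_of_nat cls_approx[OF yc, unfolded htendsto_def]] by simp
  qed
  thus "\<exists>l\<in>hcarrier Q. htendsto Q S l sequentially" using cy unfolding htendsto_def by blast
qed

end

section \<open>Induced representations\<close>

subsection \<open>Formal tensors\<close>

lemma lookup_formal_scale: "Poly_Mapping.lookup (formal_scale c f) k = c * Poly_Mapping.lookup f k"
  by (simp add: formal_scale_def Poly_Mapping.map.rep_eq when_def)

interpretation formal_vs: vector_space "formal_scale :: complex \<Rightarrow> ('a, 'v) formal_tensors \<Rightarrow> _"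
  by unfold_locales
    (auto intro!: poly_mapping_eqI simp: lookup_formal_scale Poly_Mapping.lookup_add algebra_simps)

text \<open>The linear extension of a function on the generators.\<close>

definition lin_ext :: "('p \<Rightarrow> complex) \<Rightarrow> ('p \<Rightarrow>\<^sub>0 complex) \<Rightarrow> complex" where
  "lin_ext h f = (\<Sum>p\<in>Poly_Mapping.keys f. Poly_Mapping.lookup f p * h p)"

lemma lin_ext_superset:
  "finite S \<Longrightarrow> Poly_Mapping.keys f \<subseteq> S \<Longrightarrow> lin_ext h f = (\<Sum>p\<in>S. Poly_Mapping.lookup f p * h p)"
  unfolding lin_ext_def by (rule sum.mono_neutral_left) (auto simp: in_keys_iff)

lemma lin_ext_add: "lin_ext h (f + g) = lin_ext h f + lin_ext h g"
proof -
  let ?S = "Poly_Mapping.keys f \<union> Poly_Mapping.keys g"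
  have fin: "finite ?S" by simp
  show ?thesis
    using lin_ext_superset[OF fin, of f h] lin_ext_superset[OF fin, of g h]
      lin_ext_superset[OF fin keys_add, of h]
    by (simp add: Poly_Mapping.lookup_add algebra_simps sum.distrib)
qed

lemma keys_formal_scale: "Poly_Mapping.keys (formal_scale c f) \<subseteq> Poly_Mapping.keys f"
  by (auto simp: in_keys_iff lookup_formal_scale)

lemma lin_ext_scale: "lin_ext h (formal_scale c f) = c * lin_ext h f"
  using lin_ext_superset[OF finite_keys keys_formal_scale, of h c f]
  by (simp add: lin_ext_def lookup_formal_scale sum_distrib_left mult.assoc)

lemma lin_ext_zero [simp]: "lin_ext h 0 = 0"
  by (simp add: lin_ext_def)

lemma lin_ext_diff: "lin_ext h (f - g) = lin_ext h f - lin_ext h g"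
  using lin_ext_add[of h "f - g" g] by simp

lemma lin_ext_sum: "lin_ext h (sum f I) = (\<Sum>i\<in>I. lin_ext h (f i))"
  by (induction I rule: infinite_finite_induct) (auto simp: lin_ext_add)

lemma lin_ext_formal [simp]: "lin_ext h (formal a v) = h (a, v)"
  by (simp add: lin_ext_def formal_def)

lemma keys_formal [simp]: "Poly_Mapping.keys (formal a v) = {(a, v)}"
  by (simp add: formal_def)

lemma formal_expansion:
  "f = (\<Sum>p\<in>Poly_Mapping.keys f. formal_scale (Poly_Mapping.lookup f p) (formal (fst p) (snd p)))"
proof (rule poly_mapping_eqI)
  fix k
  have "Poly_Mapping.lookup (\<Sum>p\<in>Poly_Mapping.keys f. formal_scale (Poly_Mapping.lookup f p) (formal (fst p) (snd p))) k =
      (\<Sum>p\<in>Poly_Mapping.keys f. if p = k then Poly_Mapping.lookup f p else 0)"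
    unfolding lookup_sum lookup_formal_scale
    by (intro sum.cong refl) (simp add: formal_def lookup_single when_def)
  thus "Poly_Mapping.lookup f k = Poly_Mapping.lookup (\<Sum>p\<in>Poly_Mapping.keys f. formal_scale (Poly_Mapping.lookup f p) (formal (fst p) (snd p))) k"
    by (auto simp: in_keys_iff)
qed

lemma dense_orthogonal:
  assumes V: "inner_product_space V" and D: "hdense V D" "D \<subseteq> hcarrier V"
    and \<phi>: "\<phi> \<in> hcarrier V" and 0: "\<And>y. y \<in> D \<Longrightarrow> hinner V \<phi> y = 0"
  shows "\<phi> = hzero V"
proof (rule hnorm_eq0[OF V \<phi>], rule ccontr)
  assume n: "hnorm V \<phi> \<noteq> 0"
  hence pos: "hnorm V \<phi> > 0" using hnorm_ge0[OF V \<phi>] by linarith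
  obtain y where y: "y \<in> D" "hnorm V (hdiff V \<phi> y) < hnorm V \<phi>"
    using D(1) \<phi> pos unfolding hdense_def by blast
  have yK: "y \<in> hcarrier V" using y D by blast
  have "complex_of_real ((hnorm V \<phi>)\<^sup>2) = hinner V \<phi> (hdiff V \<phi> y)"
    using V \<phi> yK 0[OF y(1)] by (simp add: hinner_self)
  hence "(hnorm V \<phi>)\<^sup>2 = cmod (hinner V \<phi> (hdiff V \<phi> y))"
    by (metis abs_of_nonneg norm_of_real zero_le_power2)
  also have "\<dots> \<le> hnorm V \<phi> * hnorm V (hdiff V \<phi> y)" using V \<phi> yK by (intro Cauchy_Schwarz) auto
  finally have "hnorm V \<phi> * hnorm V \<phi> \<le> hnorm V \<phi> * hnorm V (hdiff V \<phi> y)" by (simp add: power2_eq_square)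
  thus False using pos y(2) by simp
qed

context orbit
begin

lemma grade_proj_star: "grade_proj A H (star a) = star (grade_proj A H a)"
proof (induction a rule: graded_induct)
  case (homogeneous g a)
  have "- g \<in> H \<longleftrightarrow> g \<in> H" using H_uminus[of g] H_uminus[of "- g"] by auto
  then show ?case
    using grade_proj_homogeneous[OF homogeneous, of H] grade_proj_homogeneous[OF A_star[OF homogeneous], of H] by simp
qed (simp add: star_add grade_proj_add)

lemma grade_proj_mult:
  assumes "h \<in> subgrading A H" shows "grade_proj A H (a * h) = grade_proj A H a * h"
  using assms H_nonempty
proof (induction rule: subgrading_induct)
  case (homogeneous k h)
  show ?case
  proof (induction a rule: graded_induct)
    case (homogeneous g a)
    show ?case
      using grade_proj_homogeneous[OF homogeneous, of H] grade_proj_homogeneous[OF A_mult[OF homogeneous \<open>h \<in> A k\<close>], of H]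
        H_add_iff[OF \<open>k \<in> H\<close>, of g] by simp
  qed (simp add: distrib_right grade_proj_add)
qed (simp add: distrib_left grade_proj_add)

lemma grade_proj_one [simp]: "grade_proj A H 1 = 1"
  using grade_proj_homogeneous[OF A_one, of H] by simp

end

context stabilizer_rep
begin

abbreviation F where "F \<equiv> formal_space A H \<rho>"
abbreviation C where "C \<equiv> hcarrier F"
abbreviation form where "form \<equiv> hinner F"
abbreviation p where "p \<equiv> grade_proj A H"

lemma C_iff: "f \<in> C \<longleftrightarrow> (\<forall>q\<in>Poly_Mapping.keys f. snd q \<in> hcarrier V)"
  by (auto simp: formal_space_def \<rho>_dom)

lemma F_simps [simp]: "hadd F = (+)" "hscale F = formal_scale" "hzero F = 0"
  by (simp_all add: formal_space_def)

lemma
  shows C_zero [simp]: "0 \<in> C" and C_add [simp]: "f \<in> C \<Longrightarrow> g \<in> C \<Longrightarrow> f + g \<in> C"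
    and C_scale [simp]: "f \<in> C \<Longrightarrow> formal_scale c f \<in> C"
    and C_formal [simp]: "v \<in> hcarrier V \<Longrightarrow> formal a v \<in> C"
  using keys_add[of f g] keys_formal_scale[of c f] unfolding C_iff by auto

lemma C_diff [simp]: "f \<in> C \<Longrightarrow> g \<in> C \<Longrightarrow> f - g \<in> C"
  using C_add[of f "formal_scale (-1) g"] C_scale[of g "-1"] by simp

lemma C_sum: "(\<And>i. i \<in> I \<Longrightarrow> f i \<in> C) \<Longrightarrow> sum f I \<in> C"
  by (induction I rule: infinite_finite_induct) auto

text \<open>The value of the form at a generator \<open>b \<otimes> w\<close> in the second argument. A tensor with
  vanishing pairings is null.\<close>

definition pairing :: "('a, 'v) formal_tensors \<Rightarrow> 'a \<Rightarrow> 'v \<Rightarrow> complex" where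
  "pairing f b w = lin_ext (\<lambda>(a, v). hinner V (ract \<rho> (p (star b * a)) v) w) f"

lemma form_pairing: "form f g = cnj (lin_ext (\<lambda>(b, w). cnj (pairing f b w)) g)"
  unfolding formal_space_def pairing_def lin_ext_def
  by (simp add: case_prod_unfold sum_distrib_left mult_ac)
    (subst sum.swap, simp add: mult_ac)

lemma pairing_add: "pairing (f + g) b w = pairing f b w + pairing g b w"
  and pairing_diff: "pairing (f - g) b w = pairing f b w - pairing g b w"
  and pairing_scale: "pairing (formal_scale c f) b w = c * pairing f b w"
  and pairing_formal: "pairing (formal a v) b w = hinner V (ract \<rho> (p (star b * a)) v) w"
    and pairing_zero: "pairing 0 b w = 0"
  by (simp_all add: pairing_def lin_ext_add lin_ext_diff lin_ext_scale)

lemma form_add_left: "form (f + f') g = form f g + form f' g"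
  and form_diff_left: "form (f - f') g = form f g - form f' g"
  and form_scale_left: "form (formal_scale c f) g = c * form f g"
  and form_add_right: "form f (g + g') = form f g + form f g'"
  and form_diff_right: "form f (g - g') = form f g - form f g'"
  and form_scale_right: "form f (formal_scale c g) = cnj c * form f g"
  and form_formal_right: "form f (formal b w) = pairing f b w"
  unfolding form_pairing pairing_add pairing_diff pairing_scale
  by (simp_all add: lin_ext_add lin_ext_diff lin_ext_scale)
    (simp_all add: lin_ext_def case_prod_unfold algebra_simps sum.distrib sum_subtractf sum_distrib_left)

lemma form_eqI:
  assumes "g \<in> C" "\<And>b w. w \<in> hcarrier V \<Longrightarrow> pairing f b w = pairing f' b w"
  shows "form f g = form f' g"
  using assms unfolding form_pairing lin_ext_def C_iff by (auto simp: case_prod_unfold)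

lemma generator_sym:
  assumes "v \<in> hcarrier V" "w \<in> hcarrier V"
  shows "hinner V (ract \<rho> (p (star a * b)) w) v = cnj (hinner V (ract \<rho> (p (star b * a)) v) w)"
proof -
  have "star (p (star b * a)) = p (star a * b)" by (simp add: grade_proj_star[symmetric] star_mult star_star)
  hence "hinner V (ract \<rho> (p (star b * a)) v) w = hinner V v (ract \<rho> (p (star a * b)) w)"
    using \<rho>_adjoint[OF grade_proj_in assms, of "star b * a"] by simp
  thus ?thesis using hinner_sym[OF V_ips assms(1) \<rho>_in[OF grade_proj_in assms(2)]] by simp
qed

lemma form_sym:
  assumes "f \<in> C" "g \<in> C" shows "form g f = cnj (form f g)"
proof -
  have "form g f = (\<Sum>r\<in>Poly_Mapping.keys g. \<Sum>q\<in>Poly_Mapping.keys f. Poly_Mapping.lookup g r * cnj (Poly_Mapping.lookup f q) *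
     hinner V (ract \<rho> (p (star (fst q) * fst r)) (snd r)) (snd q))"
    by (simp add: formal_space_def case_prod_unfold)
  also have "\<dots> = (\<Sum>q\<in>Poly_Mapping.keys f. \<Sum>r\<in>Poly_Mapping.keys g. Poly_Mapping.lookup g r * cnj (Poly_Mapping.lookup f q) *
     hinner V (ract \<rho> (p (star (fst q) * fst r)) (snd r)) (snd q))"
    by (rule sum.swap)
  also have "\<dots> = (\<Sum>q\<in>Poly_Mapping.keys f. \<Sum>r\<in>Poly_Mapping.keys g. cnj (Poly_Mapping.lookup f q * cnj (Poly_Mapping.lookup g r) *
     hinner V (ract \<rho> (p (star (fst r) * fst q)) (snd q)) (snd r)))"
  proof (intro sum.cong refl)
    fix q r assume "q \<in> Poly_Mapping.keys f" "r \<in> Poly_Mapping.keys g"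
    hence "snd q \<in> hcarrier V" "snd r \<in> hcarrier V" using assms by (auto simp: C_iff)
    from generator_sym[OF this, of "fst q" "fst r"]
    show "Poly_Mapping.lookup g r * cnj (Poly_Mapping.lookup f q) * hinner V (ract \<rho> (p (star (fst q) * fst r)) (snd r)) (snd q) =
        cnj (Poly_Mapping.lookup f q * cnj (Poly_Mapping.lookup g r) * hinner V (ract \<rho> (p (star (fst r) * fst q)) (snd q)) (snd r))"
      by (simp only: complex_cnj_mult complex_cnj_cnj mult_ac)
  qed
  also have "\<dots> = cnj (form f g)"
    by (simp add: formal_space_def case_prod_unfold)
  finally show ?thesis .
qed

text \<open>If \<open>f\<close> is null, then \<open>\<langle>g - cf, g - cf\<rangle>\<close> depends affinely on \<open>c\<close>, and it is nonnegative for all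
  \<open>c\<close> only if \<open>f\<close> and \<open>g\<close> are orthogonal.\<close>

lemma form_null:
  assumes f: "f \<in> C" "form f f = 0" and g: "g \<in> C"
  shows "form f g = 0" "form g f = 0"
proof -
  define z where "z = form f g"
  have gf: "form g f = cnj z" using form_sym[OF f(1) g] by (simp add: z_def)
  have "0 \<le> Re (form g g) - 2 * s * (cmod z)\<^sup>2" for s :: real
  proof -
    let ?h = "g + formal_scale (- (of_real s * cnj z)) f"
    have "form ?h ?h = form g g - 2 * of_real s * (z * cnj z)"
      unfolding form_add_left form_add_right form_scale_left form_scale_right f(2) gf z_def[symmetric]
      by (simp add: algebra_simps)
    also have "\<dots> = form g g - of_real (2 * s * (cmod z)\<^sup>2)" by (simp flip: complex_norm_square)
    finally have "Re (form ?h ?h) = Re (form g g) - 2 * s * (cmod z)\<^sup>2" by simp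
    moreover have "form ?h ?h \<in> \<real>\<^sub>\<ge>\<^sub>0" using f g by (intro formal_form_nonneg) simp
    ultimately show ?thesis by (simp add: complex_nonneg_Reals_iff)
  qed
  (* For z \<noteq> 0 this s would make the right-hand side equal to - 1. *)
  from this[of "(Re (form g g) + 1) / (2 * (cmod z)\<^sup>2)"] have "z = 0" by (cases "z = 0") (auto simp: field_simps)
  thus "form f g = 0" "form g f = 0" using gf by (auto simp: z_def)
qed

lemma pairing_act_add:
  assumes "f \<in> C" "w \<in> hcarrier V"
  shows "pairing f (b + b') w = pairing f b w + pairing f b' w"
  unfolding pairing_def lin_ext_def sum.distrib[symmetric]
  by (rule sum.cong) (use assms in \<open>auto simp: C_iff star_add distrib_right grade_proj_add \<rho>_add grade_proj_in distrib_left\<close>)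

lemma pairing_act_scale:
  assumes "f \<in> C" "w \<in> hcarrier V"
  shows "pairing f (c *\<^sub>C b) w = cnj c * pairing f b w"
  unfolding pairing_def lin_ext_def sum_distrib_left
  by (rule sum.cong)
    (use assms in \<open>auto simp: C_iff star_scaleC mult_scaleC_left grade_proj_scale \<rho>_scaleC grade_proj_in\<close>)

lemma formal_act_C [simp]: "f \<in> C \<Longrightarrow> formal_act a f \<in> C"
  unfolding formal_act_def by (rule C_sum) (auto simp: C_iff[of f])

lemma pairing_formal_act: "pairing (formal_act a f) b w = pairing f (star a * b) w"
  unfolding pairing_def formal_act_def case_prod_unfold
  by (simp add: lin_ext_sum lin_ext_scale lin_ext_def[of _ f] star_mult star_star mult.assoc)

lemma form_formal_act:
  assumes f: "f \<in> C" and g: "g \<in> C"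
  shows "form (formal_act a f) g = form f (formal_act (star a) g)"
proof -
  have "form (formal_act a f) g = (\<Sum>r\<in>Poly_Mapping.keys g. cnj (Poly_Mapping.lookup g r) * pairing f (star a * fst r) (snd r))"
    by (simp add: form_pairing lin_ext_def case_prod_unfold pairing_formal_act)
  also have "\<dots> = (\<Sum>r\<in>Poly_Mapping.keys g. cnj (Poly_Mapping.lookup g r) * form f (formal (star a * fst r) (snd r)))"
    by (simp add: form_formal_right)
  also have "\<dots> = cnj (\<Sum>r\<in>Poly_Mapping.keys g. Poly_Mapping.lookup g r * form (formal (star a * fst r) (snd r)) f)"
    using form_sym[OF f C_formal] g by (auto simp: C_iff intro!: sum.cong)
  also have "(\<Sum>r\<in>Poly_Mapping.keys g. Poly_Mapping.lookup g r * form (formal (star a * fst r) (snd r)) f) = form (formal_act (star a) g) f"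
    unfolding formal_act_def case_prod_unfold
  proof -
    have sum: "form (sum h I) f = (\<Sum>i\<in>I. form (h i) f)" if "finite I" for h and I :: "('a \<times> 'v) set"
      using that
    proof induction
      case empty
      then show ?case using form_scale_left[of 0 0 f] by simp
    qed (simp add: form_add_left)
    show "(\<Sum>r\<in>Poly_Mapping.keys g. Poly_Mapping.lookup g r * form (formal (star a * fst r) (snd r)) f) =
      form (\<Sum>q\<in>Poly_Mapping.keys g. formal_scale (Poly_Mapping.lookup g (fst q, snd q)) (formal (star a * fst q) (snd q))) f"
      by (simp add: sum form_scale_left)
  qed
  also have "cnj (form (formal_act (star a) g) f) = form f (formal_act (star a) g)"
    using form_sym[OF formal_act_C[OF g] f, of "star a"] by simp
  finally show ?thesis .
qed

lemma formal_act_formal [simp]: "formal_act a (formal b v) = formal (a * b) v"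
  by (simp add: formal_act_def) (simp add: formal_def)

lemma formal_act_null:
  assumes "f \<in> C" "form f f = 0"
  shows "form (formal_act a f) (formal_act a f) = 0"
  using form_formal_act[OF assms(1) formal_act_C[OF assms(1)], of a a] form_null(1)[OF assms formal_act_C[OF formal_act_C[OF assms(1)]]] by simp

subsection \<open>The tensor product and its quotient\<close>

abbreviation N where "N \<equiv> tensor_relations A H \<rho>"

lemma N_subspace: "formal_vs.subspace N"
  unfolding tensor_relations_def by (rule formal_vs.subspace_span)

text \<open>The pairings annihilate the relation \<open>ah \<otimes> v = a \<otimes> \<rho>(h)v\<close> because the projection onto the
  stabilizer algebra is a right module map.\<close>

lemma N_null: "n \<in> N \<Longrightarrow> n \<in> C \<and> (\<forall>b. \<forall>w\<in>hcarrier V. pairing n b w = 0)"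
  unfolding tensor_relations_def
proof (induction rule: formal_vs.span_induct)
  case base
  show ?case
    unfolding formal_vs.subspace_def by (auto simp: pairing_add pairing_scale pairing_zero)
next
  case (step x)
  then show ?case
    unfolding \<rho>_dom
    by (auto simp: pairing_diff pairing_formal pairing_scale distrib_left grade_proj_add grade_proj_in \<rho>_add
        \<rho>_hadd \<rho>_hscale \<rho>_scaleC grade_proj_scale mult_scaleC_right \<rho>_mult grade_proj_mult simp flip: mult.assoc)
qed

lemma N_form:
  assumes "n \<in> N" "g \<in> C" shows "form n g = 0" "form g n = 0"
proof -
  show "form n g = 0"
    using form_eqI[OF assms(2), of n 0] N_null[OF assms(1)] form_scale_left[of 0 n g]
    by (simp add: pairing_def)
  thus "form g n = 0" using form_sym[of n g] assms N_null by simp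
qed

abbreviation T where "T \<equiv> tensor_space A H \<rho>"
abbreviation cs where "cs \<equiv> coset F N"

lemma cs_def: "cs f = (+) f ` N"
  by (simp add: coset_def)

lemma cs_rep:
  obtains n where "n \<in> N" "rep_of (cs f) = f + n"
proof -
  have "f + 0 \<in> cs f" unfolding cs_def using formal_vs.subspace_0[OF N_subspace] by blast
  hence "rep_of (cs f) \<in> cs f" unfolding rep_of_def by (rule someI)
  thus ?thesis using that unfolding cs_def by blast
qed

lemma cs_eq: "n \<in> N \<Longrightarrow> cs (f + n) = cs f"
proof -
  assume n: "n \<in> N"
  have "(+) (f + n) ` N \<subseteq> (+) f ` N"
    using formal_vs.subspace_add[OF N_subspace n] by (auto simp: add.assoc)
  moreover have "f + m \<in> (+) (f + n) ` N" if "m \<in> N" for m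
    using formal_vs.subspace_diff[OF N_subspace that n] by (auto simp: image_iff intro!: bexI[of _ "m - n"])
  ultimately show ?thesis unfolding cs_def by blast
qed

lemma T_carrier: "hcarrier T = cs ` C"
  by (simp add: tensor_space_def hquotient_def)

lemma T_inner: "f \<in> C \<Longrightarrow> g \<in> C \<Longrightarrow> hinner T (cs f) (cs g) = form f g"
proof -
  assume f: "f \<in> C" and g: "g \<in> C"
  obtain n where n: "n \<in> N" "rep_of (cs f) = f + n" by (rule cs_rep)
  obtain m where m: "m \<in> N" "rep_of (cs g) = g + m" by (rule cs_rep)
  have "n \<in> C" "m \<in> C" using N_null n m by auto
  thus ?thesis
    using n m f g by (simp add: tensor_space_def hquotient_def form_add_left form_add_right N_form)
qed

lemma T_add: "hadd T (cs f) (cs g) = cs (f + g)"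
proof -
  obtain n where n: "n \<in> N" "rep_of (cs f) = f + n" by (rule cs_rep)
  obtain m where m: "m \<in> N" "rep_of (cs g) = g + m" by (rule cs_rep)
  have "hadd T (cs f) (cs g) = cs ((f + g) + (n + m))"
    by (simp add: tensor_space_def hquotient_def n m algebra_simps)
  thus ?thesis using cs_eq[OF formal_vs.subspace_add[OF N_subspace n(1) m(1)]] by simp
qed

lemma T_scale: "hscale T c (cs f) = cs (formal_scale c f)"
proof -
  obtain n where n: "n \<in> N" "rep_of (cs f) = f + n" by (rule cs_rep)
  have "hscale T c (cs f) = cs (formal_scale c f + formal_scale c n)"
    by (simp add: tensor_space_def hquotient_def n formal_vs.scale_right_distrib)
  thus ?thesis using cs_eq[OF formal_vs.subspace_scale[OF N_subspace n(1)]] by simp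
qed

theorem \<rho>_inducible: "inducible A H \<rho>"
  unfolding inducible_def T_carrier using rep T_inner formal_form_nonneg by auto

abbreviation P where "P \<equiv> induced_prehilbert A H \<rho>"

text \<open>The class of a formal tensor in the quotient by the vectors of norm \<open>0\<close>.\<close>

definition qt :: "('a, 'v) formal_tensors \<Rightarrow> ('a, 'v) formal_tensors set set" where
  "qt f = coset T (null_vectors T) (cs f)"

lemma qt_alt:
  assumes "f \<in> C" shows "qt f = {cs (f + g) | g. g \<in> C \<and> form g g = 0}"
proof -
  have "qt f = hadd T (cs f) ` {x \<in> cs ` C. hinner T x x = 0}"
    unfolding qt_def coset_def[of T] null_vectors_def T_carrier ..
  also have "{x \<in> cs ` C. hinner T x x = 0} = cs ` {g \<in> C. form g g = 0}"
    using T_inner by auto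
  finally show ?thesis by (simp only: image_image T_add) blast
qed

lemma qt_rep:
  assumes f: "f \<in> C"
  obtains g where "g \<in> C" "form g g = 0" "rep_of (qt f) = cs (f + g)"
proof -
  have "cs (f + 0) \<in> qt f"
    unfolding qt_alt[OF f] using form_scale_left[of 0 0 0] by (auto intro!: exI[of _ 0])
  hence "rep_of (qt f) \<in> qt f" unfolding rep_of_def by (rule someI)
  thus ?thesis using that unfolding qt_alt[OF f] by blast
qed

lemma form_null_add:
  assumes "f \<in> C" "g \<in> C" "form f f = 0" "form g g = 0"
  shows "form (f + g) (f + g) = 0" "form (f - g) (f - g) = 0"
  using assms form_null[OF assms(1,3,2)]
  by (simp_all add: form_add_left form_add_right form_diff_left form_diff_right)

lemma qt_eqI:
  assumes f: "f \<in> C" and g: "g \<in> C" and n: "form (f - g) (f - g) = 0"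
  shows "qt f = qt g"
proof -
  have *: "qt f \<subseteq> qt g" if f: "f \<in> C" and g: "g \<in> C" and n: "form (f - g) (f - g) = 0" for f g
  proof
    fix X assume "X \<in> qt f"
    then obtain h where h: "h \<in> C" "form h h = 0" "X = cs (f + h)" unfolding qt_alt[OF f] by blast
    show "X \<in> qt g" unfolding qt_alt[OF g]
    proof (intro CollectI exI conjI)
      show "X = cs (g + ((f - g) + h))" using h by simp
      show "(f - g) + h \<in> C" using f g h by simp
      show "form ((f - g) + h) ((f - g) + h) = 0" by (rule form_null_add(1)) (use f g h n in auto)
    qed
  qed
  have "form (g - f) (g - f) = form (f - g) (f - g)"
    by (simp add: form_diff_left form_diff_right)
  thus ?thesis using *[OF f g n] *[OF g f] n by auto
qed

lemma P_carrier: "hcarrier P = qt ` C"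
  by (auto simp: induced_prehilbert_def hquotient_def T_carrier qt_def)

lemma P_inner:
  assumes f: "f \<in> C" and g: "g \<in> C" shows "hinner P (qt f) (qt g) = form f g"
proof -
  obtain m where m: "m \<in> C" "form m m = 0" "rep_of (qt f) = cs (f + m)" by (rule qt_rep[OF f])
  obtain n where n: "n \<in> C" "form n n = 0" "rep_of (qt g) = cs (g + n)" by (rule qt_rep[OF g])
  have "hinner P (qt f) (qt g) = form (f + m) (g + n)"
    using f g m n by (simp add: induced_prehilbert_def hquotient_def T_inner)
  thus ?thesis
    using form_null[OF m(1,2) g] form_null[OF m(1,2) n(1)] form_null[OF n(1,2) f]
    by (simp add: form_add_left form_add_right)
qed

lemma P_add:
  assumes f: "f \<in> C" and g: "g \<in> C" shows "hadd P (qt f) (qt g) = qt (f + g)"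
proof -
  obtain m where m: "m \<in> C" "form m m = 0" "rep_of (qt f) = cs (f + m)" by (rule qt_rep[OF f])
  obtain n where n: "n \<in> C" "form n n = 0" "rep_of (qt g) = cs (g + n)" by (rule qt_rep[OF g])
  have "hadd P (qt f) (qt g) = qt (f + m + (g + n))"
    using m n by (simp add: induced_prehilbert_def hquotient_def qt_def[of "f + m + (g + n)"] T_add)
  also have "\<dots> = qt (f + g)"
  proof (rule qt_eqI)
    have "f + m + (g + n) - (f + g) = m + n" by simp
    thus "form (f + m + (g + n) - (f + g)) (f + m + (g + n) - (f + g)) = 0"
      using form_null_add(1)[OF m(1) n(1) m(2) n(2)] by simp
  qed (use f g m n in auto)
  finally show ?thesis .
qed

lemma P_scale:
  assumes f: "f \<in> C" shows "hscale P c (qt f) = qt (formal_scale c f)"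
proof -
  obtain m where m: "m \<in> C" "form m m = 0" "rep_of (qt f) = cs (f + m)" by (rule qt_rep[OF f])
  have "hscale P c (qt f) = qt (formal_scale c (f + m))"
    using m by (simp add: induced_prehilbert_def hquotient_def qt_def[of "formal_scale c (f + m)"] T_scale)
  also have "\<dots> = qt (formal_scale c f)"
  proof (rule qt_eqI)
    have "formal_scale c (f + m) - formal_scale c f = formal_scale c m"
      by (simp add: formal_vs.scale_right_distrib)
    thus "form (formal_scale c (f + m) - formal_scale c f) (formal_scale c (f + m) - formal_scale c f) = 0"
      using m by (simp add: form_scale_left form_scale_right)
  qed (use f m in auto)
  finally show ?thesis .
qed

lemma P_zero: "hzero P = qt 0"
  by (simp add: induced_prehilbert_def hquotient_def qt_def tensor_space_def)

lemma P_inner_product_space: "inner_product_space P"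
  unfolding inner_product_space_def P_carrier
proof (intro conjI ballI allI impI; (elim imageE)?; hypsubst?)
  show "hzero P \<in> qt ` C" by (simp add: P_zero)
next
  fix f g assume f: "f \<in> C" and g: "g \<in> C"
  show "hadd P (qt f) (qt g) \<in> qt ` C" using f g by (simp add: P_add)
  show "hadd P (qt f) (qt g) = hadd P (qt g) (qt f)" using f g by (simp add: P_add add.commute)
  show "hinner P (qt g) (qt f) = cnj (hinner P (qt f) (qt g))" using f g by (simp add: P_inner form_sym[OF f g])
  fix c
  show "hscale P c (qt f) \<in> qt ` C" using f by (simp add: P_scale)
  show "hscale P c (hadd P (qt f) (qt g)) = hadd P (hscale P c (qt f)) (hscale P c (qt g))"
    using f g by (simp add: P_add P_scale formal_vs.scale_right_distrib)
  show "hinner P (hscale P c (qt f)) (qt g) = c * hinner P (qt f) (qt g)"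
    using f g by (simp add: P_scale P_inner form_scale_left)
  fix h assume h: "h \<in> C"
  show "hadd P (hadd P (qt f) (qt g)) (qt h) = hadd P (qt f) (hadd P (qt g) (qt h))"
    using f g h by (simp add: P_add add.assoc)
  show "hinner P (hadd P (qt f) (qt g)) (qt h) = hinner P (qt f) (qt h) + hinner P (qt g) (qt h)"
    using f g h by (simp add: P_add P_inner form_add_left)
next
  fix f assume f: "f \<in> C"
  show "hadd P (hzero P) (qt f) = qt f" using f by (simp add: P_zero P_add)
  show "hadd P (qt f) (hscale P (- 1) (qt f)) = hzero P" using f C_scale[OF f, of "-1"] by (simp add: P_zero P_add P_scale)
  show "hscale P (c + d) (qt f) = hadd P (hscale P c (qt f)) (hscale P d (qt f))" for c d
    using f by (simp add: P_scale P_add formal_vs.scale_left_distrib)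
  show "hscale P c (hscale P d (qt f)) = hscale P (c * d) (qt f)" for c d using f by (simp add: P_scale)
  show "hscale P 1 (qt f) = qt f" using f by (simp add: P_scale)
  show "hinner P (qt f) (qt f) \<in> \<real>\<^sub>\<ge>\<^sub>0" using f formal_form_nonneg by (simp add: P_inner)
  assume "hinner P (qt f) (qt f) = 0"
  thus "qt f = hzero P" unfolding P_zero using f by (intro qt_eqI) (auto simp: P_inner)
qed

lemma induced_act_qt:
  assumes f: "f \<in> C" shows "induced_act A H \<rho> a (qt f) = qt (formal_act a f)"
proof -
  obtain m where m: "m \<in> C" "form m m = 0" "rep_of (qt f) = cs (f + m)" by (rule qt_rep[OF f])
  obtain n where n: "n \<in> N" "rep_of (cs (f + m)) = f + m + n" by (rule cs_rep)
  have nC: "n \<in> C" using N_null[OF n(1)] by blast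
  have "induced_act A H \<rho> a (qt f) = qt (formal_act a (f + m + n))"
    by (simp add: induced_act_def quotient_map_def m n qt_def[of "formal_act a (f + m + n)"])
  also have "\<dots> = qt (formal_act a f)"
  proof (rule qt_eqI)
    have mn: "m + n \<in> C" "form (m + n) (m + n) = 0"
      using form_null_add(1)[OF m(1) nC m(2) N_form(1)[OF n(1) nC]] m nC by auto
    let ?d = "formal_act a (f + m + n) - formal_act a f"
    have eq: "pairing ?d b w = pairing (formal_act a (m + n)) b w" for b w
      by (simp add: pairing_diff pairing_formal_act pairing_add)
    have dC: "?d \<in> C" using f m nC by simp
    have "form ?d ?d = form (formal_act a (m + n)) ?d" by (rule form_eqI[OF dC eq])
    also have "\<dots> = 0" by (rule form_null(1)[OF formal_act_C[OF mn(1)] formal_act_null[OF mn] dC])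
    finally show "form ?d ?d = 0" .
  qed (use f m nC in auto)
  finally show ?thesis .
qed

subsection \<open>The induced representation is the closure of a generated one\<close>

abbreviation Q where "Q \<equiv> hcompletion P"

definition emb :: "('a, 'v) formal_tensors \<Rightarrow> (nat \<Rightarrow> ('a, 'v) formal_tensors set set) set" where
  "emb f = hembed P (qt f)"

definition pre_ind :: "('a, (nat \<Rightarrow> ('a, 'v) formal_tensors set set) set) representation" where
  "pre_ind = \<lparr>hsp = Q, rdom = hembed P ` hcarrier P,
     ract = (\<lambda>a \<phi>. hembed P (induced_act A H \<rho> a (inv_into (hcarrier P) (hembed P) \<phi>)))\<rparr>"

lemma Ind_closure: "Ind A H \<rho> = rep_closure UNIV pre_ind"
  by (simp add: Ind_def pre_ind_def Let_def)

lemma Q_hilbert: "hilbert_space Q" and Q_ips [simp]: "inner_product_space Q"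
  using completion_hilbert[OF P_inner_product_space] by simp_all

lemma emb_in [simp]: "f \<in> C \<Longrightarrow> emb f \<in> hcarrier Q"
  by (simp add: emb_def hembed_in[OF P_inner_product_space] P_carrier)

lemma emb_inner: "f \<in> C \<Longrightarrow> g \<in> C \<Longrightarrow> hinner Q (emb f) (emb g) = form f g"
  by (simp add: emb_def hembed_inner[OF P_inner_product_space] P_carrier P_inner)

lemma emb_add: "f \<in> C \<Longrightarrow> g \<in> C \<Longrightarrow> hadd Q (emb f) (emb g) = emb (f + g)"
  and emb_scale: "f \<in> C \<Longrightarrow> hscale Q c (emb f) = emb (formal_scale c f)"
  unfolding emb_def
  using hlinear_add[OF hembed_linear[OF P_inner_product_space], of "qt f" "qt g"]
    hlinear_scale[OF hembed_linear[OF P_inner_product_space], of "qt f" c]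
  by (simp_all add: P_carrier P_add P_scale)

lemma emb_eqI:
  assumes f: "f \<in> C" and g: "g \<in> C" and eq: "\<And>b w. w \<in> hcarrier V \<Longrightarrow> pairing f b w = pairing g b w"
  shows "emb f = emb g"
proof -
  have d: "f - g \<in> C" using f g by simp
  have "form f (f - g) = form g (f - g)" by (rule form_eqI[OF d eq])
  thus ?thesis unfolding emb_def using qt_eqI[OF f g] by (simp add: form_diff_left)
qed

lemma pre_ind_simps [simp]: "hsp pre_ind = Q" and pre_ind_dom: "rdom pre_ind = emb ` C"
  by (auto simp: pre_ind_def P_carrier emb_def)

lemma pre_ind_act:
  assumes f: "f \<in> C" shows "ract pre_ind a (emb f) = emb (formal_act a f)"
proof -
  have inj: "inj_on (hembed P) (hcarrier P)"
  proof (rule inj_onI)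
    fix x y assume x: "x \<in> hcarrier P" and y: "y \<in> hcarrier P" and eq: "hembed P x = hembed P y"
    show "x = y"
    proof (rule vector_eqI[OF P_inner_product_space x y])
      fix z assume z: "z \<in> hcarrier P"
      show "hinner P x z = hinner P y z"
        using hembed_inner[OF P_inner_product_space x z] hembed_inner[OF P_inner_product_space y z] eq by simp
    qed
  qed
  have "inv_into (hcarrier P) (hembed P) (emb f) = qt f"
    unfolding emb_def by (rule inv_into_f_f[OF inj]) (use f in \<open>simp add: P_carrier\<close>)
  thus ?thesis by (simp add: pre_ind_def emb_def induced_act_qt[OF f])
qed

lemma pre_ind_star_rep: "star_rep UNIV pre_ind"
  unfolding star_rep_def pre_ind_simps pre_ind_dom hlinear_def
proof (intro conjI ballI allI; (elim imageE)?; hypsubst?)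
  show "hilbert_space Q" by (rule Q_hilbert)
  have "emb 0 = hzero Q"
    using emb_scale[OF C_zero, of 0] hscale_zero_eq[OF Q_ips emb_in[OF C_zero]] by simp
  hence "hzero Q \<in> emb ` C" using C_zero by (metis image_eqI)
  thus "hsubspace Q (emb ` C)"
    unfolding hsubspace_def by (auto simp: emb_add emb_scale)
  have "emb ` C = hembed P ` hcarrier P" by (auto simp: emb_def P_carrier)
  thus "hdense Q (emb ` C)" using hembed_dense[OF P_inner_product_space] by simp
  show "ract pre_ind a ` emb ` C \<subseteq> emb ` C" for a by (auto simp: pre_ind_act)
  fix a f assume f: "f \<in> C"
  show "ract pre_ind a (hadd Q (emb f) (emb g)) = hadd Q (ract pre_ind a (emb f)) (ract pre_ind a (emb g))" if g: "g \<in> C" for g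
    using f g by (simp add: emb_add pre_ind_act) (rule emb_eqI, auto simp: pairing_formal_act pairing_add)
  show "ract pre_ind a (hscale Q c (emb f)) = hscale Q c (ract pre_ind a (emb f))" for c
    using f by (simp add: emb_scale pre_ind_act) (rule emb_eqI, auto simp: pairing_formal_act pairing_scale)
  show "ract pre_ind (a + b) (emb f) = hadd Q (ract pre_ind a (emb f)) (ract pre_ind b (emb f))" for b
    using f by (simp add: emb_add pre_ind_act)
      (rule emb_eqI, auto simp: pairing_formal_act pairing_add star_add distrib_right pairing_act_add)
  show "ract pre_ind (c *\<^sub>C a) (emb f) = hscale Q c (ract pre_ind a (emb f))" for c
    using f by (simp add: emb_scale pre_ind_act)
      (rule emb_eqI, auto simp: pairing_formal_act pairing_scale star_scaleC mult_scaleC_left pairing_act_scale)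
  show "ract pre_ind (a * b) (emb f) = ract pre_ind a (ract pre_ind b (emb f))" for b
    using f by (simp add: pre_ind_act)
      (rule emb_eqI, auto simp: pairing_formal_act star_mult mult.assoc)
  show "hinner Q (ract pre_ind a (emb f)) (emb g) = hinner Q (emb f) (ract pre_ind (star a) (emb g))" if g: "g \<in> C" for g
    using f g by (simp add: pre_ind_act emb_inner form_formal_act)
qed

definition base :: "'v \<Rightarrow> (nat \<Rightarrow> ('a, 'v) formal_tensors set set) set" where
  "base v = emb (formal 1 v)"

lemma act_base: "v \<in> hcarrier V \<Longrightarrow> ract pre_ind a (base v) = emb (formal a v)"
  by (simp add: base_def pre_ind_act)

text \<open>Totality of the tensors holds because the image of a pre-Hilbert space is dense in its
  completion and every formal tensor is a finite linear combination of generators.\<close>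

lemma pre_ind_generated: "generated_rep A \<xi> H \<rho> pre_ind base"
proof
  show "star_rep UNIV pre_ind" by (rule pre_ind_star_rep)
  show "base v \<in> rdom pre_ind" if "v \<in> hcarrier V" for v
    using that by (simp add: base_def pre_ind_dom)
  show "hinner (hsp pre_ind) (base v) (base w) = hinner V v w" if "v \<in> hcarrier V" "w \<in> hcarrier V" for v w
    using that by (simp add: base_def emb_inner form_formal_right pairing_formal)
  show "ract pre_ind a (base v) = base (ract \<rho> a v)" if a: "a \<in> subgrading A H" and v: "v \<in> hcarrier V" for a v
  proof (unfold act_base[OF v], unfold base_def, rule emb_eqI)
    fix b w assume "w \<in> hcarrier V"
    show "pairing (formal a v) b w = pairing (formal 1 (ract \<rho> a v)) b w"
      using a v grade_proj_mult[OF a, of "star b"] by (simp add: pairing_formal \<rho>_mult grade_proj_in)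
  qed (use a v in auto)
next
  fix \<phi> assume \<phi>: "\<phi> \<in> hcarrier (hsp pre_ind)"
    and 0: "\<And>d v. v \<in> hcarrier V \<Longrightarrow> hinner (hsp pre_ind) \<phi> (ract pre_ind d (base v)) = 0"
  have orth: "hinner Q \<phi> (emb (formal d v)) = 0" if "v \<in> hcarrier V" for d v
    using 0[OF that, of d] act_base[OF that] by simp
  have \<phi>Q: "\<phi> \<in> hcarrier Q" using \<phi> by simp
  have "hinner Q \<phi> (emb f) = 0" if f: "f \<in> C" for f
  proof -
    have "(\<Sum>q\<in>S. formal_scale (Poly_Mapping.lookup f q) (formal (fst q) (snd q))) \<in> C \<and>
        hinner Q \<phi> (emb (\<Sum>q\<in>S. formal_scale (Poly_Mapping.lookup f q) (formal (fst q) (snd q)))) = 0"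
      if "finite S" "S \<subseteq> Poly_Mapping.keys f" for S
      using that
    proof induction
      case empty
      have "hinner Q \<phi> (hscale Q 0 (emb 0)) = 0" using \<phi>Q by simp
      then show ?case by (simp add: emb_scale del: hinner_scale_right)
    next
      case (insert q S)
      have q: "snd q \<in> hcarrier V" using f insert by (auto simp: C_iff)
      let ?q = "formal_scale (Poly_Mapping.lookup f q) (formal (fst q) (snd q))"
      let ?s = "\<Sum>q\<in>S. formal_scale (Poly_Mapping.lookup f q) (formal (fst q) (snd q))"
      have qC: "?q \<in> C" using q by simp
      have s: "?s \<in> C" "hinner Q \<phi> (emb ?s) = 0" using insert by auto
      have "hinner Q \<phi> (emb ?q) = 0"
        using orth[OF q, of "fst q"] q \<phi>Q by (simp flip: emb_scale)
      moreover have "hinner Q \<phi> (emb (?q + ?s)) = hinner Q \<phi> (emb ?q) + hinner Q \<phi> (emb ?s)"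
        using \<phi>Q qC s by (simp flip: emb_add)
      ultimately have "hinner Q \<phi> (emb (?q + ?s)) = 0" using s by simp
      then show ?case using insert.hyps qC s by simp
    qed
    from this[OF finite_keys order_refl] show ?thesis using formal_expansion[of f] by simp
  qed
  thus "\<phi> = hzero (hsp pre_ind)"
    unfolding pre_ind_simps
    by (intro dense_orthogonal[OF Q_ips star_rep_dense[OF pre_ind_star_rep, unfolded pre_ind_simps pre_ind_dom] _ \<phi>Q]) auto
qed

theorem Ind_full: "full_rep A \<xi> H \<rho> (Ind A H \<rho>) base"
  unfolding Ind_closure
  using generated_rep.closure_full[OF pre_ind_generated]
  unfolding generated_rep.closure_def[OF pre_ind_generated] .

end

theorem theorem5:
  fixes A :: "'g::group_add \<Rightarrow> 'a::star_algebra set"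
    and \<xi> :: "'a \<Rightarrow> complex"
    and H :: "'g set"
  assumes "graded_star_algebra A"
    and "\<And>x y. x \<in> A 0 \<Longrightarrow> y \<in> A 0 \<Longrightarrow> x * y = y * x"
    and "countably_generated (A 0)"
    and "\<And>\<psi> g c d. \<psi> \<in> pos_characters A \<Longrightarrow> c \<in> A g \<Longrightarrow> d \<in> A g \<Longrightarrow>
           \<psi> (star c * d) * \<psi> (star d * c) = \<psi> (star c * c) * \<psi> (star d * d)"
    and "locally_compact_space (char_topology A)"
    and "countable (UNIV :: 'g set)"
    and "\<xi> \<in> pos_characters A"
    and "H = char_stab A \<xi>"
  shows
    \<comment> \<open>the map is defined on representatives and has values in the target\<close>
    "(\<forall>\<rho> :: ('a, 'v) representation.
        inducible A H \<rho> \<and> multiple_of_char A \<xi> \<rho> \<longrightarrow>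
        well_behaved A (Ind A H \<rho>) \<and> associated_with A (Ind A H \<rho>) (char_orbit A \<xi>)) \<and>
     \<comment> \<open>it is well-defined and injective on unitary equivalence classes\<close>
     (\<forall>(\<rho>\<^sub>1 :: ('a, 'v) representation) (\<rho>\<^sub>2 :: ('a, 'w) representation).
        inducible A H \<rho>\<^sub>1 \<and> multiple_of_char A \<xi> \<rho>\<^sub>1 \<and>
        inducible A H \<rho>\<^sub>2 \<and> multiple_of_char A \<xi> \<rho>\<^sub>2 \<longrightarrow>
        (unitarily_equivalent UNIV (Ind A H \<rho>\<^sub>1) (Ind A H \<rho>\<^sub>2) \<longleftrightarrow>
         unitarily_equivalent (subgrading A H) \<rho>\<^sub>1 \<rho>\<^sub>2)) \<and>
     \<comment> \<open>it is surjective\<close>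
     (\<forall>\<pi> :: ('a, 'u) representation.
        well_behaved A \<pi> \<and> associated_with A \<pi> (char_orbit A \<xi>) \<longrightarrow>
        (\<exists>\<rho> :: ('a, 'u) representation.
           inducible A H \<rho> \<and> multiple_of_char A \<xi> \<rho> \<and>
           unitarily_equivalent UNIV (Ind A H \<rho>) \<pi>)) \<and>
     (\<forall>\<rho> :: ('a, 'v) representation.
        star_rep (subgrading A H) \<rho> \<and> multiple_of_char A \<xi> \<rho> \<longrightarrow>
        bounded_rep (subgrading A H) \<rho> \<and> inducible A H \<rho>) \<and>
     (\<forall>\<rho> :: ('a, 'v) representation.
        inducible A H \<rho> \<and> multiple_of_char A \<xi> \<rho> \<longrightarrow>
        von_neumann_algebra (hsp \<rho>) (rep_commutant (subgrading A H) \<rho>) \<and>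
        von_neumann_algebra (hsp (Ind A H \<rho>)) (rep_commutant UNIV (Ind A H \<rho>)) \<and>
        star_isomorphic (hsp \<rho>) (rep_commutant (subgrading A H) \<rho>)
          (hsp (Ind A H \<rho>)) (rep_commutant UNIV (Ind A H \<rho>)) \<and>
        (irreducible_rep UNIV (Ind A H \<rho>) \<longleftrightarrow> irreducible_rep (subgrading A H) \<rho>))"
proof -
  interpret orbit A \<xi> H
    by unfold_locales (use assms(1,2,4,6-8) in auto)
  have rep: "stabilizer_rep A \<xi> H \<rho>"
    if "star_rep (subgrading A H) \<rho>" "multiple_of_char A \<xi> \<rho>" for \<rho> :: "('a, 'x) representation"
    by unfold_locales (use that in auto)
  have full: "full_rep A \<xi> H \<rho> (Ind A H \<rho>) (stabilizer_rep.base A H \<rho>)"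
    if "inducible A H \<rho>" "multiple_of_char A \<xi> \<rho>" for \<rho> :: "('a, 'x) representation"
    using stabilizer_rep.Ind_full[OF rep[OF _ that(2)]] that(1) by (simp add: inducible_def)
  show ?thesis
  proof (intro conjI allI impI; (elim conjE)?)
    fix \<rho> :: "('a, 'v) representation"
    assume \<rho>: "inducible A H \<rho>" "multiple_of_char A \<xi> \<rho>"
    interpret ind: full_rep A \<xi> H \<rho> "Ind A H \<rho>" "stabilizer_rep.base A H \<rho>" by (rule full[OF \<rho>])
    show "well_behaved A (Ind A H \<rho>)" "associated_with A (Ind A H \<rho>) (char_orbit A \<xi>)"
      by (rule ind.associated)+
    show "von_neumann_algebra (hsp \<rho>) (rep_commutant (subgrading A H) \<rho>)"
      by (rule ind.comm_\<rho>_von_neumann)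
    show "von_neumann_algebra (hsp (Ind A H \<rho>)) (rep_commutant UNIV (Ind A H \<rho>))"
      by (rule ind.commutant_von_neumann)
    show "star_isomorphic (hsp \<rho>) (rep_commutant (subgrading A H) \<rho>)
        (hsp (Ind A H \<rho>)) (rep_commutant UNIV (Ind A H \<rho>))"
      by (rule ind.commutant_isomorphic)
    show "irreducible_rep UNIV (Ind A H \<rho>) \<longleftrightarrow> irreducible_rep (subgrading A H) \<rho>"
      using ind.irreducible_\<pi> ind.irreducible_\<rho> by blast
  next
    fix \<rho>\<^sub>1 :: "('a, 'v) representation" and \<rho>\<^sub>2 :: "('a, 'w) representation"
    assume "inducible A H \<rho>\<^sub>1" "multiple_of_char A \<xi> \<rho>\<^sub>1" "inducible A H \<rho>\<^sub>2" "multiple_of_char A \<xi> \<rho>\<^sub>2"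
    thus "unitarily_equivalent UNIV (Ind A H \<rho>\<^sub>1) (Ind A H \<rho>\<^sub>2) \<longleftrightarrow>
        unitarily_equivalent (subgrading A H) \<rho>\<^sub>1 \<rho>\<^sub>2"
      by (intro full_rep_equivalence[OF full full])
  next
    fix \<pi> :: "('a, 'u) representation"
    assume "associated_with A \<pi> (char_orbit A \<xi>)"
    then obtain E where wb: "well_behaved_via A \<pi> E"
      and supp: "\<And>\<Delta> \<phi>. \<Delta> \<in> char_borel A \<Longrightarrow> \<Delta> \<inter> char_orbit A \<xi> = {} \<Longrightarrow> \<phi> \<in> hcarrier (hsp \<pi>) \<Longrightarrow>
        E \<Delta> \<phi> = hzero (hsp \<pi>)"
      unfolding associated_with_def by blast
    \<comment> \<open>The inverse map: \<open>\<H>\<^sub>\<rho>\<close> is the range of the spectral projection at the point \<open>\<xi>\<close>.\<close>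
    define \<rho> where "\<rho> = \<lparr>hsp = hsp \<pi>\<lparr>hcarrier := {\<phi> \<in> hcarrier (hsp \<pi>). E {\<xi>} \<phi> = \<phi>}\<rparr>,
      rdom = {\<phi> \<in> hcarrier (hsp \<pi>). E {\<xi>} \<phi> = \<phi>}, ract = ract \<pi>\<rparr>"
    interpret full_rep A \<xi> H \<rho> \<pi> "\<lambda>v. v"
      unfolding \<rho>_def by (rule well_behaved_full[OF wb supp])
    have "unitarily_equivalent (subgrading A H) \<rho> \<rho>"
      unfolding unitarily_equivalent_def hlinear_def by (intro exI[of _ "\<lambda>v. v"]) simp
    hence "unitarily_equivalent UNIV (Ind A H \<rho>) \<pi>"
      using full_rep_equivalence[OF Ind_full full_rep_axioms] by simp
    thus "\<exists>\<rho> :: ('a, 'u) representation. inducible A H \<rho> \<and> multiple_of_char A \<xi> \<rho> \<and>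
        unitarily_equivalent UNIV (Ind A H \<rho>) \<pi>"
      using \<rho>_inducible multiple by blast
  next
    fix \<rho> :: "('a, 'v) representation"
    assume \<rho>: "star_rep (subgrading A H) \<rho>" "multiple_of_char A \<xi> \<rho>"
    show "bounded_rep (subgrading A H) \<rho>" by (rule stabilizer_rep.\<rho>_bounded[OF rep[OF \<rho>]])
    show "inducible A H \<rho>" by (rule stabilizer_rep.\<rho>_inducible[OF rep[OF \<rho>]])
  qed
qed

end
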